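(* For all $F,G\in\mathcal{F}C_b^\infty(\mathcal{D},\Omega)$ and every $v\in V_0(X)$, $$\int_\Omega(\nabla_v^\Omega F)(\omega)\,G(\omega)\,d\pi_\sigma^\tau(\omega)=-\int_\Omega F(\omega)(\nabla_v^\Omega G)(\omega)\,d\pi_\sigma^\tau(\omega)-\int_\Omega F(\omega)G(\omega)B_v^{\pi_\sigma^\tau}(\omega)\,d\pi_\sigma^\tau(\omega);$$ equivalently, denoting by $\nabla_v^{\Omega *}$ the adjoint of $(\nabla_v^\Omega,\mathcal{F}C_b^\infty(\mathcal{D},\Omega))$ in $L^2(\Omega,\pi_\sigma^\tau)$, one has $\nabla_v^{\Omega *}=-\nabla_v^\Omega-B_v^{\pi_\sigma^\tau}$ as an operator equality on the domain $\mathcal{F}C_b^\infty(\mathcal{D},\Omega)$.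
   Context: **Setting.** $X$ is a connected, oriented, non-compact $C^\infty$ Riemannian manifold with volume measure $m$. $\rho>0$ $m$-a.e. with $\rho^{1/2}\in H^{1,2}_{loc}(X)$ (local Sobolev space of order 1 in $L^2_{loc}(X,m)$), and $d\sigma=\rho\,dm$. $\tau$ is a finite non-negative measure on $\mathbb{R}_+=(0,\infty)$ such that there is $C>0$ with $\int_0^\infty s^n\,d\tau(s)<C^n n!$ for all integers $n\ge 1$. $\mathcal{D}=C_0^\infty(X)$ with its usual topology, $\mathcal{D}'$ its dual, and $\varepsilon_x$ is the Dirac measure at $x$. **Compound Poisson measure.** $\Gamma_X$ is the set of locally finite subsets of $X$. The compound configuration space is $\Omega=\{\omega=\sum_{x\in\gamma_\omega}s_x\varepsilon_x\in\mathcal{D}' : \gamma_\omega\in\Gamma_X,\ s_x\in\operatorname{supp}\tau\subset\mathbb{R}_+\}$, with $\langle\omega,f\rangle=\sum_{x\in\gamma_\omega}s_xf(x)$ and $\langle\gamma_\omega,f\rangle=\sum_{x\in\gamma_\omega}f(x)$. $\pi_\sigma^\tau$ is the probability measure on $\mathcal{D}'$ with Laplace transform $\int\exp(\langle\omega,\varphi\rangle)\,d\pi_\sigma^\tau(\omega)=\exp\big(\int_X\int_0^\infty(e^{s\varphi(x)}-1)\,d\tau(s)\,d\sigma(x)\big)$, $\varphi\in\mathcal{D}$; it is known that $\pi_\sigma^\tau(\Omega)=1$, so it is regarded as a measure on $\Omega$. **Directional derivative.** $V_0(X)$ is the set of smooth compactly supported vector fields on $X$; $\phi_t^v$, $t\in\mathbb{R}$,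 is the flow of $v\in V_0(X)$. A diffeomorphism $\phi$ of $X$ equal to the identity outside a compact set acts on $\Omega$ by $\phi^*\omega=\sum_{x\in\gamma_\omega}s_x\varepsilon_{\phi(x)}$. For $F:\Omega\to\mathbb{R}$, $(\nabla_v^\Omega F)(\omega):=\frac{d}{dt}F(\phi_t^{v*}\omega)|_{t=0}$ when it exists. $\mathcal{F}C_b^\infty(\mathcal{D},\Omega)$ is the set of functions $F(\omega)=g_F(\langle\omega,\varphi_1\rangle,\dots,\langle\omega,\varphi_N\rangle)$ with $N\in\mathbb{N}$, $\varphi_i\in\mathcal{D}$, $g_F\in C_b^\infty(\mathbb{R}^N)$; it is dense in $L^2(\Omega,\pi_\sigma^\tau)$. **Logarithmic derivatives.** $\beta^\sigma:=\nabla^X\rho/\rho$ (and $0$ where $\rho=0$); $\beta_v^\sigma(x):=\langle\beta^\sigma(x),v(x)\rangle_{T_xX}+\operatorname{div}^Xv(x)$, where $\operatorname{div}^X$ is the divergence with respect to $m$; and $B_v^{\pi_\sigma^\tau}(\omega):=\langle\gamma_\omega,\beta_v^\sigma\rangle$ (defined $\pi_\sigma^\tau$-a.e.). *)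

theory Defs
  imports "HOL-Probability.Probability"
begin

section \<open>Smooth functions on open subsets of Euclidean space\<close>

definition partial :: "'n::finite \<Rightarrow> (real^'n \<Rightarrow> 'b) \<Rightarrow> real^'n \<Rightarrow> 'b::real_normed_vector" where
  "partial i f x = frechet_derivative f (at x) (axis i 1)"

fun partials :: "'n list \<Rightarrow> (real^'n \<Rightarrow> 'b) \<Rightarrow> real^'n \<Rightarrow> 'b::real_normed_vector" where
  "partials [] f = f"
| "partials (i # is) f = partial i (partials is f)"

text \<open>Class \<open>C\<^sup>\<infinity>\<close>; meant for open \<open>S\<close>, where the partial derivatives at a point of \<open>S\<close> only
  depend on the values on \<open>S\<close>. Differentiability of all iterated partial derivatives
  includes their continuity.\<close>

definition smooth_on :: "(real^'n) set \<Rightarrow> (real^'n \<Rightarrow> 'b::real_normed_vector) \<Rightarrow> bool" where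
  "smooth_on S f \<longleftrightarrow> (\<forall>is. \<forall>x\<in>S. partials is f differentiable (at x))"


section \<open>Oriented Riemannian manifolds\<close>

text \<open>The manifold is the whole type \<open>'a\<close> together with an atlas. A chart is a pair of its domain
  and its coordinate map; values of the coordinate map off the domain are irrelevant.
  The orientation is encoded by requiring all coordinate changes in the atlas to
  have positive Jacobian determinant.\<close>

type_synonym ('a, 'n) chart = "'a set \<times> ('a \<Rightarrow> real^'n)"

abbreviation chart_inv :: "('a, 'n) chart \<Rightarrow> real^'n \<Rightarrow> 'a" where
  "chart_inv c \<equiv> inv_into (fst c) (snd c)"

definition transition :: "('a, 'n) chart \<Rightarrow> ('a, 'n) chart \<Rightarrow> real^'n \<Rightarrow> real^'n" where
  "transition c d = snd d \<circ> chart_inv c"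

definition oriented_atlas :: "('a::topological_space, 'n::finite) chart set \<Rightarrow> bool" where
  "oriented_atlas A \<longleftrightarrow>
     (\<Union>c\<in>A. fst c) = UNIV \<and>
     (\<forall>c\<in>A. open (fst c) \<and> open (snd c ` fst c) \<and>
        homeomorphism (fst c) (snd c ` fst c) (snd c) (chart_inv c)) \<and>
     (\<forall>c\<in>A. \<forall>d\<in>A. smooth_on (snd c ` (fst c \<inter> fst d)) (transition c d) \<and>
        (\<forall>x\<in>fst c \<inter> fst d.
           0 < det (matrix (frechet_derivative (transition c d) (at (snd c x))))))"

text \<open>A tangent vector at \<open>x\<close> is the family of its coordinate representations in the charts around
  \<open>x\<close>, related by the Jacobians of the coordinate changes (and \<open>0\<close> in all other arguments).\<close>

type_synonym ('a, 'n) tangent = "('a, 'n) chart \<Rightarrow> real^'n"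

definition tangent_space :: "('a, 'n::finite) chart set \<Rightarrow> 'a \<Rightarrow> ('a, 'n) tangent set" where
  "tangent_space A x = {u.
     (\<forall>c\<in>A. \<forall>d\<in>A. x \<in> fst c \<inter> fst d \<longrightarrow>
        u d = frechet_derivative (transition c d) (at (snd c x)) (u c)) \<and>
     (\<forall>c. \<not> (c \<in> A \<and> x \<in> fst c) \<longrightarrow> u c = 0)}"

text \<open>The \<open>i\<close>-th coordinate vector field of the chart \<open>c\<close>.\<close>

definition coord_field :: "('a, 'n::finite) chart set \<Rightarrow> ('a, 'n) chart \<Rightarrow> 'n \<Rightarrow> 'a \<Rightarrow> ('a, 'n) tangent" where
  "coord_field A c i x =
     (\<lambda>d. if d \<in> A \<and> x \<in> fst d then partial i (transition c d) (snd c x) else 0)"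

type_synonym ('a, 'n) metric = "'a \<Rightarrow> ('a, 'n) tangent \<Rightarrow> ('a, 'n) tangent \<Rightarrow> real"

definition riemannian_metric :: "('a, 'n::finite) chart set \<Rightarrow> ('a, 'n) metric \<Rightarrow> bool" where
  "riemannian_metric A g \<longleftrightarrow>
     (\<forall>x. \<forall>u\<in>tangent_space A x. \<forall>w\<in>tangent_space A x.
        g x u w = g x w u \<and>
        (\<forall>z\<in>tangent_space A x. \<forall>a b.
           g x (\<lambda>c. a *\<^sub>R u c + b *\<^sub>R z c) w = a * g x u w + b * g x z w) \<and>
        (u \<noteq> (\<lambda>_. 0) \<longrightarrow> 0 < g x u u)) \<and>
     (\<forall>c\<in>A. \<forall>i j. smooth_on (snd c ` fst c)
        (\<lambda>y. g (chart_inv c y) (coord_field A c i (chart_inv c y)) (coord_field A c j (chart_inv c y))))"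

definition gram :: "('a, 'n::finite) chart set \<Rightarrow> ('a, 'n) metric \<Rightarrow> ('a, 'n) chart \<Rightarrow> 'a \<Rightarrow> real^'n^'n" where
  "gram A g c x = (\<chi> i j. g x (coord_field A c i x) (coord_field A c j x))"

definition vol_density :: "('a, 'n::finite) chart set \<Rightarrow> ('a, 'n) metric \<Rightarrow> ('a, 'n) chart \<Rightarrow> real^'n \<Rightarrow> real" where
  "vol_density A g c y = sqrt (det (gram A g c (chart_inv c y)))"

definition volume_measure ::
    "('a::topological_space, 'n::finite) chart set \<Rightarrow> ('a, 'n) metric \<Rightarrow> 'a measure \<Rightarrow> bool" where
  "volume_measure A g m \<longleftrightarrow> sets m = sets borel \<and>
     (\<forall>c\<in>A. \<forall>B\<in>sets borel. B \<subseteq> fst c \<longrightarrow>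
        emeasure m B = (\<integral>\<^sup>+ y\<in>snd c ` B. ennreal (vol_density A g c y) \<partial>lborel))"


section \<open>Test functions, vector fields and flows\<close>

definition test_functions :: "('a::topological_space, 'n::finite) chart set \<Rightarrow> ('a \<Rightarrow> real) set" where
  "test_functions A = {f.
     (\<forall>c\<in>A. smooth_on (snd c ` fst c) (f \<circ> chart_inv c)) \<and> compact (closure {x. f x \<noteq> 0})}"

definition compact_vector_fields ::
    "('a::topological_space, 'n::finite) chart set \<Rightarrow> ('a \<Rightarrow> ('a, 'n) tangent) set" where
  "compact_vector_fields A = {v.
     (\<forall>x. v x \<in> tangent_space A x) \<and>
     (\<forall>c\<in>A. smooth_on (snd c ` fst c) (\<lambda>y. v (chart_inv c y) c)) \<and>
     compact (closure {x. v x \<noteq> (\<lambda>_. 0)})}"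

definition flow_of ::
    "('a::topological_space, 'n::finite) chart set \<Rightarrow> ('a \<Rightarrow> ('a, 'n) tangent) \<Rightarrow> (real \<Rightarrow> 'a \<Rightarrow> 'a) \<Rightarrow> bool" where
  "flow_of A v \<phi> \<longleftrightarrow>
     (\<forall>x. \<phi> 0 x = x \<and> continuous_on UNIV (\<lambda>t. \<phi> t x) \<and>
        (\<forall>t. \<forall>c\<in>A. \<phi> t x \<in> fst c \<longrightarrow>
           ((\<lambda>s. snd c (\<phi> s x)) has_vector_derivative v (\<phi> t x) c) (at t)))"

text \<open>The divergence with respect to the Riemannian volume, by the usual coordinate formula; the
  result does not depend on the chosen chart around \<open>x\<close>.\<close>

definition divergence ::
    "('a, 'n::finite) chart set \<Rightarrow> ('a, 'n) metric \<Rightarrow> ('a \<Rightarrow> ('a, 'n) tangent) \<Rightarrow> 'a \<Rightarrow> real" where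
  "divergence A g v x =
     (let c = (SOME c. c \<in> A \<and> x \<in> fst c) in
      (\<Sum>i\<in>UNIV. partial i (\<lambda>y. vol_density A g c y * v (chart_inv c y) c $ i) (snd c x))
        / vol_density A g c (snd c x))"


section \<open>Weak gradients and local Sobolev spaces\<close>

definition locally_integrable :: "'a::topological_space measure \<Rightarrow> ('a \<Rightarrow> real) \<Rightarrow> bool" where
  "locally_integrable m f \<longleftrightarrow> (\<forall>K. compact K \<longrightarrow> set_integrable m K f)"

text \<open>\<open>Z\<close> is a Borel version of the (almost everywhere defined) gradient of \<open>f\<close>
  in the sense of distributions.\<close>

definition weak_gradient ::
    "('a::topological_space, 'n::finite) chart set \<Rightarrow> ('a, 'n) metric \<Rightarrow> 'a measure \<Rightarrow>
     ('a \<Rightarrow> real) \<Rightarrow> ('a \<Rightarrow> ('a, 'n) tangent) \<Rightarrow> bool" where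
  "weak_gradient A g m f Z \<longleftrightarrow>
     locally_integrable m f \<and>
     (\<forall>x. Z x \<in> tangent_space A x) \<and> (\<forall>c\<in>A. (\<lambda>x. Z x c) \<in> borel_measurable borel) \<and>
     locally_integrable m (\<lambda>x. sqrt (g x (Z x) (Z x))) \<and>
     (\<forall>v\<in>compact_vector_fields A.
        (LINT x|m. f x * divergence A g v x) = - (LINT x|m. g x (Z x) (v x)))"

definition local_sobolev_1_2 ::
    "('a::topological_space, 'n::finite) chart set \<Rightarrow> ('a, 'n) metric \<Rightarrow> 'a measure \<Rightarrow> ('a \<Rightarrow> real) set" where
  "local_sobolev_1_2 A g m = {f \<in> borel_measurable borel.
     locally_integrable m (\<lambda>x. (f x)\<^sup>2) \<and>
     (\<exists>Z. weak_gradient A g m f Z \<and> locally_integrable m (\<lambda>x. g x (Z x) (Z x)))}"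


section \<open>Distributions\<close>

text \<open>The absolutely convex neighbourhoods of \<open>0\<close> in \<open>test_functions A\<close> for its usual inductive limit
  topology: the trace on the functions supported in any fixed compact \<open>K\<close> is a neighbourhood of \<open>0\<close> for
  uniform convergence of all derivatives on compact subsets of the charts.\<close>

definition test_nhd :: "('a::topological_space, 'n::finite) chart set \<Rightarrow> ('a \<Rightarrow> real) set \<Rightarrow> bool" where
  "test_nhd A V \<longleftrightarrow>
     V \<subseteq> test_functions A \<and>
     (\<forall>f\<in>V. \<forall>h\<in>V. \<forall>a b. \<bar>a\<bar> + \<bar>b\<bar> \<le> 1 \<longrightarrow> (\<lambda>x. a * f x + b * h x) \<in> V) \<and>
     (\<forall>K. compact K \<longrightarrow>
        (\<exists>S e. finite S \<and> 0 < e \<and> (\<forall>(c, L, is)\<in>S. c \<in> A \<and> compact L \<and> L \<subseteq> fst c) \<and>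
          {f \<in> test_functions A. closure {x. f x \<noteq> 0} \<subseteq> K \<and>
             (\<forall>(c, L, is)\<in>S. \<forall>x\<in>L. \<bar>partials is (f \<circ> chart_inv c) (snd c x)\<bar> < e)} \<subseteq> V))"

text \<open>The dual space; distributions are extended by \<open>undefined\<close> outside of the test functions.\<close>

definition distributions :: "('a::topological_space, 'n::finite) chart set \<Rightarrow> (('a \<Rightarrow> real) \<Rightarrow> real) set" where
  "distributions A = {T \<in> extensional (test_functions A).
     (\<forall>f\<in>test_functions A. \<forall>h\<in>test_functions A. \<forall>a b.
        T (\<lambda>x. a * f x + b * h x) = a * T f + b * T h) \<and>
     (\<forall>e>0. \<exists>V. test_nhd A V \<and> (\<forall>f\<in>V. \<bar>T f\<bar> < e))}"

text \<open>The space of distributions with the \<open>\<sigma>\<close>-algebra generated by the evaluations \<open>T \<mapsto> T f\<close>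
  (only its measurable structure matters).\<close>

definition distribution_space ::
    "('a::topological_space, 'n::finite) chart set \<Rightarrow> (('a \<Rightarrow> real) \<Rightarrow> real) measure" where
  "distribution_space A =
     restrict_space (\<Pi>\<^sub>M f\<in>test_functions A. borel) (distributions A)"


section \<open>The compound configuration space and the compound Poisson measure\<close>

definition configurations :: "'a::topological_space set set" where
  "configurations = {\<gamma>. \<forall>K. compact K \<longrightarrow> finite (\<gamma> \<inter> K)}"

definition config_pairing :: "'a set \<Rightarrow> ('a \<Rightarrow> real) \<Rightarrow> real" where
  "config_pairing \<gamma> h = (\<Sum>x\<in>{x\<in>\<gamma>. h x \<noteq> 0}. h x)"

definition measure_support :: "real measure \<Rightarrow> real set" where
  "measure_support \<tau> = {s \<in> space \<tau>. \<forall>U. open U \<longrightarrow> s \<in> U \<longrightarrow> 0 < emeasure \<tau> (U \<inter> space \<tau>)}"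

text \<open>The distribution \<open>\<Sum>\<^bsub>x\<in>\<gamma>\<^esub> s\<^sub>x \<epsilon>\<^bsub>p x\<^esub>\<close>.\<close>

definition weighted_diracs ::
    "('a::topological_space, 'n::finite) chart set \<Rightarrow> 'a set \<Rightarrow> ('a \<Rightarrow> real) \<Rightarrow> ('a \<Rightarrow> 'a) \<Rightarrow> ('a \<Rightarrow> real) \<Rightarrow> real" where
  "weighted_diracs A \<gamma> s p =
     (\<lambda>f\<in>test_functions A. \<Sum>x\<in>{x\<in>\<gamma>. f (p x) \<noteq> 0}. s x * f (p x))"

definition compound_configurations ::
    "('a::topological_space, 'n::finite) chart set \<Rightarrow> real measure \<Rightarrow> (('a \<Rightarrow> real) \<Rightarrow> real) set" where
  "compound_configurations A \<tau> = {\<omega> \<in> distributions A.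
     \<exists>\<gamma>\<in>configurations. \<exists>s. (\<forall>x\<in>\<gamma>. s x \<in> measure_support \<tau>) \<and> \<omega> = weighted_diracs A \<gamma> s id}"

text \<open>The configuration \<open>\<gamma>\<^sub>\<omega>\<close> and the marks \<open>s\<^sub>x\<close> of \<open>\<omega>\<close>; they are uniquely determined since all
  marks are positive.\<close>

definition config_of ::
    "('a::topological_space, 'n::finite) chart set \<Rightarrow> real measure \<Rightarrow> (('a \<Rightarrow> real) \<Rightarrow> real) \<Rightarrow> 'a set" where
  "config_of A \<tau> \<omega> = (THE \<gamma>. \<gamma> \<in> configurations \<and>
     (\<exists>s. (\<forall>x\<in>\<gamma>. s x \<in> measure_support \<tau>) \<and> \<omega> = weighted_diracs A \<gamma> s id))"

definition marks_of ::
    "('a::topological_space, 'n::finite) chart set \<Rightarrow> real measure \<Rightarrow> (('a \<Rightarrow> real) \<Rightarrow> real) \<Rightarrow> 'a \<Rightarrow> real" where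
  "marks_of A \<tau> \<omega> = (THE s. (\<forall>x\<in>config_of A \<tau> \<omega>. s x \<in> measure_support \<tau>) \<and>
     (\<forall>x. x \<notin> config_of A \<tau> \<omega> \<longrightarrow> s x = 0) \<and> \<omega> = weighted_diracs A (config_of A \<tau> \<omega>) s id)"

text \<open>The action \<open>\<omega> \<mapsto> p\<^sup>*\<omega>\<close> of a diffeomorphism \<open>p\<close>.\<close>

definition transport ::
    "('a::topological_space, 'n::finite) chart set \<Rightarrow> real measure \<Rightarrow> ('a \<Rightarrow> 'a) \<Rightarrow>
     (('a \<Rightarrow> real) \<Rightarrow> real) \<Rightarrow> (('a \<Rightarrow> real) \<Rightarrow> real)" where
  "transport A \<tau> p \<omega> = weighted_diracs A (config_of A \<tau> \<omega>) (marks_of A \<tau> \<omega>) p"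

text \<open>The Laplace transform is prescribed as an identity in \<open>[0, \<infinity>]\<close>: for positive \<open>f\<close> of large
  supremum the double integral may be \<open>+\<infinity>\<close>, and the left-hand side is then infinite, too.
  (The negative part of the integrand is always integrable when \<open>\<tau>\<close> is finite and \<open>\<sigma>\<close> is finite on
  compact sets.)\<close>

definition compound_poisson ::
    "('a::topological_space, 'n::finite) chart set \<Rightarrow> 'a measure \<Rightarrow> real measure \<Rightarrow>
     (('a \<Rightarrow> real) \<Rightarrow> real) measure \<Rightarrow> bool" where
  "compound_poisson A \<sigma> \<tau> P \<longleftrightarrow>
     prob_space P \<and> sets P = sets (distribution_space A) \<and>
     (\<forall>f\<in>test_functions A.
        (\<integral>\<^sup>+ \<omega>. ennreal (exp (\<omega> f)) \<partial>P) =
          (if integrable (\<sigma> \<Otimes>\<^sub>M \<tau>) (\<lambda>(x, s). exp (s * f x) - 1)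
           then ennreal (exp (LINT x|\<sigma>. LINT s|\<tau>. exp (s * f x) - 1))
           else \<infinity>))"


section \<open>Cylinder functions and the directional derivative\<close>

text \<open>\<open>C\<^sub>b\<^sup>\<infinity>(\<real>\<^sup>N)\<close>: a function on \<open>\<real>\<^sup>N\<close> is represented as a function of a sequence that only depends on the
  first \<open>N\<close> entries.\<close>

definition seq_partial :: "nat \<Rightarrow> ((nat \<Rightarrow> real) \<Rightarrow> real) \<Rightarrow> (nat \<Rightarrow> real) \<Rightarrow> real" where
  "seq_partial i h y = deriv (\<lambda>t. h (y(i := t))) (y i)"

fun seq_partials :: "nat list \<Rightarrow> ((nat \<Rightarrow> real) \<Rightarrow> real) \<Rightarrow> (nat \<Rightarrow> real) \<Rightarrow> real" where
  "seq_partials [] h = h"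
| "seq_partials (i # is) h = seq_partial i (seq_partials is h)"

definition bounded_smooth :: "nat \<Rightarrow> ((nat \<Rightarrow> real) \<Rightarrow> real) set" where
  "bounded_smooth N = {h.
     (\<forall>y z. (\<forall>i<N. y i = z i) \<longrightarrow> h y = h z) \<and>
     (\<forall>is. set is \<subseteq> {..<N} \<longrightarrow>
        continuous_on UNIV (seq_partials is h) \<and> bounded (range (seq_partials is h)) \<and>
        (\<forall>i<N. \<forall>y. (\<lambda>t. seq_partials is h (y(i := t))) differentiable (at (y i))))}"

text \<open>The values of these functions outside of the compound configuration space are irrelevant.\<close>

definition cylinder_functions ::
    "('a::topological_space, 'n::finite) chart set \<Rightarrow> real measure \<Rightarrow> ((('a \<Rightarrow> real) \<Rightarrow> real) \<Rightarrow> real) set" where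
  "cylinder_functions A \<tau> = {F. \<exists>N. \<exists>f. \<exists>h\<in>bounded_smooth N.
     (\<forall>i<N. f i \<in> test_functions A) \<and>
     (\<forall>\<omega>\<in>compound_configurations A \<tau>. F \<omega> = h (\<lambda>i. \<omega> (f i)))}"

definition directional_derivative ::
    "('a::topological_space, 'n::finite) chart set \<Rightarrow> real measure \<Rightarrow> (real \<Rightarrow> 'a \<Rightarrow> 'a) \<Rightarrow>
     ((('a \<Rightarrow> real) \<Rightarrow> real) \<Rightarrow> real) \<Rightarrow> (('a \<Rightarrow> real) \<Rightarrow> real) \<Rightarrow> real" where
  "directional_derivative A \<tau> \<phi> F \<omega> = deriv (\<lambda>t. F (transport A \<tau> (\<phi> t) \<omega>)) 0"


section \<open>Logarithmic derivatives\<close>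

text \<open>\<open>R\<close> is meant to be a version of the gradient of \<open>\<rho>\<close>.\<close>

definition log_gradient ::
    "('a \<Rightarrow> real) \<Rightarrow> ('a \<Rightarrow> ('a, 'n::finite) tangent) \<Rightarrow> 'a \<Rightarrow> ('a, 'n) tangent" where
  "log_gradient \<rho> R x = (if \<rho> x = 0 then (\<lambda>_. 0) else (\<lambda>c. R x c /\<^sub>R \<rho> x))"

definition log_derivative ::
    "('a, 'n::finite) chart set \<Rightarrow> ('a, 'n) metric \<Rightarrow> ('a \<Rightarrow> real) \<Rightarrow> ('a \<Rightarrow> ('a, 'n) tangent) \<Rightarrow>
     ('a \<Rightarrow> ('a, 'n) tangent) \<Rightarrow> 'a \<Rightarrow> real" where
  "log_derivative A g \<rho> R v x = g x (log_gradient \<rho> R x) (v x) + divergence A g v x"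

definition poisson_log_derivative ::
    "('a::topological_space, 'n::finite) chart set \<Rightarrow> ('a, 'n) metric \<Rightarrow> real measure \<Rightarrow> ('a \<Rightarrow> real) \<Rightarrow>
     ('a \<Rightarrow> ('a, 'n) tangent) \<Rightarrow> ('a \<Rightarrow> ('a, 'n) tangent) \<Rightarrow> (('a \<Rightarrow> real) \<Rightarrow> real) \<Rightarrow> real" where
  "poisson_log_derivative A g \<tau> \<rho> R v \<omega> =
     config_pairing (config_of A \<tau> \<omega>) (log_derivative A g \<rho> R v)"


section \<open>Adjoints in \<open>L\<^sup>2\<close>\<close>

definition square_integrable :: "'b measure \<Rightarrow> ('b \<Rightarrow> real) \<Rightarrow> bool" where
  "square_integrable M F \<longleftrightarrow> F \<in> borel_measurable M \<and> integrable M (\<lambda>\<omega>. (F \<omega>)\<^sup>2)"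

text \<open>The graph of the adjoint of the operator \<open>T\<close> with domain \<open>Dom\<close>.\<close>

definition adjoint_graph ::
    "'b measure \<Rightarrow> (('b \<Rightarrow> real) \<Rightarrow> ('b \<Rightarrow> real)) \<Rightarrow> ('b \<Rightarrow> real) set \<Rightarrow> (('b \<Rightarrow> real) \<times> ('b \<Rightarrow> real)) set" where
  "adjoint_graph M T Dom = {(F, H). square_integrable M F \<and> square_integrable M H \<and>
     (\<forall>G\<in>Dom. (LINT \<omega>|M. T G \<omega> * F \<omega>) = (LINT \<omega>|M. G \<omega> * H \<omega>))}"

end

theory Submission
  imports Defs "HOL-Real_Asymp.Real_Asymp"
begin

text \<open>A configuration is encoded by its mark function \<open>w\<close>, so that \<open>\<omega> f = \<Sum>\<^sub>x w x * f x\<close>. The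
Laplace transform yields the Mecke formula: under the law of \<open>w\<close>, summing \<open>k x w\<close> over the points \<open>x\<close>
amounts to integrating \<open>k x (w + s \<epsilon>\<^sub>x)\<close> over \<open>\<sigma> \<Otimes> \<tau> \<Otimes> P\<close>. For fixed \<open>s\<close> and \<open>w\<close> a cylinder function of
\<open>w + s \<epsilon>\<^sub>x\<close> is smooth in \<open>x\<close>, and integration by parts with respect to \<open>\<sigma>\<close> gives the claim. Square
integrability of \<open>B\<close> rests on \<open>\<nabla>\<rho> = 2 \<rho>\<^sup>1\<^sup>/\<^sup>2 \<nabla>\<rho>\<^sup>1\<^sup>/\<^sup>2\<close>, uniqueness of the adjoint on a class of
trigonometric cylinder functions that is closed under products.\<close>

section \<open>Multiplicative classes of functions\<close>

text \<open>No realisation of the compound Poisson process is built. The only probabilistic input is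
  the Laplace functional at nonpositive arguments, where it is finite. Its derivative describes the
  Campbell measure on pairs of a point and a mark function, but only on products
  \<open>f x * exp (- pairing w g)\<close>; a monotone class argument extends this to all measurable
  integrands. Because \<open>\<sigma>\<close> has no atoms, an added point almost surely lies off
  the existing configuration and carries exactly the mark \<open>s\<close>. The analytic obstacle is
  that \<open>\<rho>\<close> has weak derivatives only and no lower bound, so the quotient of
  \<open>R\<close> by \<open>\<rho>\<close> is controlled solely through the gradient of the square
  root; the identity behind this is proved in charts by doubling the variable. The flow is known
  through its differential equation alone: a transported configuration is recognised as a compound
  one only for small times, during which the finitely many moving points stay distinct.\<close>

lemma finite_measure_eqI_multiplicative:
 fixes M N :: "'b measure" and C :: "('b => real) set"
 assumes fin: "finite_measure M" "finite_measure N" and sets: "sets N = sets M"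
  and gen: "!!S. space S = space M ==> (!!c. c \<in> C ==> c \<in> borel_measurable S) ==> (\<lambda>x. x) \<in> measurable S M"
  and one: "(\<lambda>_. 1) \<in> C"
  and meas: "!!c. c \<in> C ==> c \<in> borel_measurable M"
  and bnd: "\<forall>c\<in>C. \<forall>x\<in>space M. \<bar>c x\<bar> <= 1"
  and mult: "!!c d. c \<in> C ==> d \<in> C ==> \<exists>e\<in>C. \<forall>x\<in>space M. e x = c x * d x"
  and eq: "!!c. c \<in> C ==> (LINT x|M. c x) = (LINT x|N. c x)"
 shows "M = N"
proof -
 have L: "space L = space M" "sets L = sets M" "finite_measure L" if "L = M \<or> L = N" for L
  using that fin sets sets_eq_imp_space_eq[OF sets] by auto
 have int: "integrable L h" if "L = M \<or> L = N" "h \<in> borel_measurable M" "!!x. x \<in> space M ==> \<bar>h x\<bar> <= B" for L and h :: "'b => real" and B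
  by (rule finite_measure.integrable_const_bound[OF L(3)[OF that(1)], where B=B])
   (use that L[OF that(1)] measurable_cong_sets[OF L(2)[OF that(1)] refl] in \<open>auto intro!: AE_I2\<close>)
 \<comment> \<open>Testing against every member of \<open>C\<close>, instead of only comparing
   integrals, is what makes \<open>V\<close> stable under multiplication by superlevel
   indicators.\<close>
 define V where "V = {h \<in> borel_measurable M. (\<exists>B. \<forall>x\<in>space M. \<bar>h x\<bar> <= B) & (\<forall>c\<in>C. (LINT x|M. h x * c x) = (LINT x|N. h x * c x))}"
 have pow: "\<exists>e\<in>C. \<forall>x\<in>space M. e x = d x ^ i * c x" if "c \<in> C" "d \<in> C" for c d i
 proof (induction i)
  case (Suc i)
  then obtain e where e: "e \<in> C" "\<forall>x\<in>space M. e x = d x ^ i * c x" by blast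
  show ?case using mult[OF that(2) e(1)] e(2) by (simp add: mult.assoc)
 qed (use that in auto)
 have ind: "(\<lambda>x. h x * indicat_real {x \<in> space M. a < d x} x) \<in> V" if h: "h \<in> V" and d: "d \<in> C" for h d a
 proof -
  let ?I = "indicat_real {x \<in> space M. a < d x}"
  obtain B where B: "\<forall>x\<in>space M. \<bar>h x\<bar> <= B" using h unfolding V_def by auto
  have hm[measurable]: "h \<in> borel_measurable M" "d \<in> borel_measurable M" using h meas[OF d] unfolding V_def by auto
  \<comment> \<open>Ramps of slope k that vanish up to a and equal 1 from a + 1/k on. Evaluated at
    \<open>d x\<close> they converge to the indicator of \<open>a < d x\<close>.\<close>
  define f where "f k x = min 1 (max 0 (real k * (x - a)))" for k x
  have "\<exists>q. real_polynomial_function q & (\<forall>x\<in>{-1..1}. \<bar>f k x - q x\<bar> < 1 / real (Suc k))" for k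
   by (rule Stone_Weierstrass_real_polynomial_function[of "{-1..1}" "f k" "1 / real (Suc k)"])
    (auto simp: f_def intro!: continuous_intros)
  then obtain q where q: "!!k. real_polynomial_function (q k)" "!!k x. x \<in> {-1..1} ==> \<bar>f k x - q k x\<bar> < 1 / real (Suc k)" by metis
  have qd: "\<bar>f k (d x) - q k (d x)\<bar> < 1 / real (Suc k)" if "x \<in> space M" for k x
   by (rule q(2)) (use bnd d that in \<open>force simp: abs_le_iff\<close>)
  \<comment> \<open>The ramp lies in [0, 1] and the error is at most 1, which gives a bound uniform
    in \<open>k\<close> for dominated convergence.\<close>
  have qB: "\<bar>q k (d x)\<bar> <= 2" if "x \<in> space M" for k x
   using qd[OF that, of k] order_trans[OF less_imp_le[OF qd[OF that, of k]], of 1] unfolding f_def by (auto simp: abs_le_iff)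
  have lim: "(\<lambda>k. q k (d x)) \<longlonglongrightarrow> ?I x" if x: "x \<in> space M" for x
  proof -
   have "(\<lambda>k. f k (d x)) \<longlonglongrightarrow> ?I x"
   proof (cases "a < d x")
    case True
    then have "(\<lambda>k. min 1 (max 0 (real k * (d x - a)))) \<longlonglongrightarrow> 1" by real_asymp
    then show ?thesis using True x by (simp add: f_def)
   next
    case False
    then have "f k (d x) = 0" for k unfolding f_def by (simp add: mult_nonneg_nonpos)
    then show ?thesis using False by simp
   qed
   moreover have "(\<lambda>k. f k (d x) - q k (d x)) \<longlonglongrightarrow> 0"
    by (rule Lim_null_comparison[where g="\<lambda>k. 1 / real (Suc k)"]) (use qd[OF x] in \<open>simp add: less_imp_le\<close>, real_asymp)
   ultimately show ?thesis using tendsto_diff by fastforce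
  qed
  have qm: "(\<lambda>x. q k (d x)) \<in> borel_measurable M" for k by (rule measurable_compose[OF hm(2) borel_measurable_continuous_onI])
    (use continuous_real_polymonial_function[OF q(1)] in \<open>simp add: continuous_on_eq_continuous_at\<close>)
  have "(LINT x|M. h x * ?I x * c x) = (LINT x|N. h x * ?I x * c x)" if c: "c \<in> C" for c
  proof (rule LIMSEQ_unique)
   have conv: "(\<lambda>k. LINT x|L. h x * q k (d x) * c x) \<longlonglongrightarrow> (LINT x|L. h x * ?I x * c x)" if l: "L = M \<or> L = N" for L
   proof (rule integral_dominated_convergence[where w="\<lambda>_. B * 2 * 1"])
    note [measurable_cong] = L(2)[OF l]
    note [measurable] = qm meas[OF c]
    show "(\<lambda>x. h x * ?I x * c x) \<in> borel_measurable L" "(\<lambda>x. h x * q k (d x) * c x) \<in> borel_measurable L" for k by measurable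
    show "integrable L (\<lambda>_. B * 2 * 1)" using finite_measure.integrable_const[OF L(3)[OF l]] .
    show "AE x in L. (\<lambda>k. h x * q k (d x) * c x) \<longlonglongrightarrow> h x * ?I x * c x" by (rule AE_I2, intro tendsto_intros lim) (simp add: L(1)[OF l])
    show "AE x in L. norm (h x * q k (d x) * c x) <= B * 2 * 1" for k
    proof (rule AE_I2)
     fix x assume "x \<in> space L"
     then have x: "x \<in> space M" by (simp add: L(1)[OF l])
     show "norm (h x * q k (d x) * c x) <= B * 2 * 1" unfolding real_norm_def abs_mult
      by (intro mult_mono qB[OF x] B[rule_format, OF x] bnd[rule_format, OF c x]) (use B x in force)+
    qed
   qed
   show "(\<lambda>k. LINT x|M. h x * q k (d x) * c x) \<longlonglongrightarrow> (LINT x|M. h x * ?I x * c x)" by (rule conv) simp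
   \<comment> \<open>After expansion of the polynomial every term \<open>d x ^ i * c x\<close>
     agrees with a member of \<open>C\<close> on the space, so the assumption
     \<open>h \<in> V\<close> applies term by term.\<close>
   have "(LINT x|M. h x * q k (d x) * c x) = (LINT x|N. h x * q k (d x) * c x)" for k
   proof -
    obtain b n where b: "q k = (\<lambda>x. \<Sum>i\<le>n. b i * x ^ i)" using q(1) real_polynomial_function_iff_sum by blast
    obtain e where e: "!!i. e i \<in> C" "!!i x. x \<in> space M ==> e i x = d x ^ i * c x" using pow[OF c d] by metis
    have "(LINT x|L. h x * q k (d x) * c x) = (\<Sum>i\<le>n. b i * (LINT x|L. h x * e i x))" if l: "L = M \<or> L = N" for L
    proof -
     have "(LINT x|L. h x * q k (d x) * c x) = (LINT x|L. (\<Sum>i\<le>n. b i * (h x * e i x)))"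
      by (rule Bochner_Integration.integral_cong) (simp_all add: b e(2) L(1)[OF l] sum_distrib_left sum_distrib_right ac_simps)
     moreover have "integrable L (\<lambda>x. h x * e i x)" for i
     proof (rule int[OF l, where B="B * 1"])
      show "\<bar>h x * e i x\<bar> <= B * 1" if "x \<in> space M" for x unfolding abs_mult
       by (intro mult_mono B[rule_format, OF that] bnd[rule_format, OF e(1) that]) (use B that in force)+
     qed (use meas[OF e(1)] in measurable)
     ultimately show ?thesis by (simp add: Bochner_Integration.integral_sum)
    qed
    then show ?thesis using h e(1) unfolding V_def by simp
   qed
   then show "(\<lambda>k. LINT x|M. h x * q k (d x) * c x) \<longlonglongrightarrow> (LINT x|N. h x * ?I x * c x)" using conv[of N] by simp
  qed
  moreover have "\<bar>h x * ?I x\<bar> <= \<bar>B\<bar>" if "x \<in> space M" for x using B that by (force split: split_indicator)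
  moreover have "(\<lambda>x. h x * ?I x) \<in> borel_measurable M" by measurable
  ultimately show ?thesis unfolding V_def by blast
 qed
 \<comment> \<open>Stability under multiplication by an indicator is inherited by intersections, so
   \<open>G\<close> is a pi-system; it contains all superlevel sets of members of
   \<open>C\<close>.\<close>
 define G where "G = {E \<in> sets M. \<forall>h\<in>V. (\<lambda>x. h x * indicat_real E x) \<in> V}"
 have GD: "(\<lambda>x. h x * indicat_real E x) \<in> V" if "E \<in> G" "h \<in> V" for E h using that unfolding G_def by simp
 have V1: "(\<lambda>_. 1) \<in> V" unfolding V_def using eq by auto
 have cG: "{x \<in> space M. a < c x} \<in> G" if "c \<in> C" for c a unfolding G_def using ind[OF _ that] meas[OF that] by simp
 have GP: "G \<subseteq> Pow (space M)" using sets.sets_into_space unfolding G_def by auto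
 show ?thesis
 proof (rule measure_eqI_generator_eq[where E=G and \<Omega>="space M" and A="\<lambda>_. space M"])
  show "Int_stable G"
  proof -
   have "(\<lambda>x. h x * indicat_real (X \<inter> Y) x) \<in> V" if "X \<in> G" "Y \<in> G" "h \<in> V" for X Y h
   proof -
    have "(\<lambda>x. h x * indicat_real X x) \<in> V" by (rule GD[OF that(1,3)])
    from GD[OF that(2) this] have "(\<lambda>x. h x * indicat_real X x * indicat_real Y x) \<in> V" .
    then show ?thesis by (simp add: indicator_inter_arith mult.assoc)
   qed
   then show ?thesis unfolding Int_stable_def by (auto simp: G_def)
  qed
  show "range (\<lambda>_::nat. space M) \<subseteq> G" using cG[OF one, of 0] by simp
  show "emeasure M X = emeasure N X" if X: "X \<in> G" for X
  proof -
   have "(\<lambda>x. 1 * indicat_real X x) \<in> V" by (rule GD[OF X V1])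
   then have "(LINT x|M. indicat_real X x) = (LINT x|N. indicat_real X x)" using one unfolding V_def by force
   moreover have "X \<in> sets M" using X unfolding G_def by auto
   ultimately show ?thesis using sets fin by (simp add: sets.Int_space_eq2 finite_measure.emeasure_eq_measure)
  qed
  show "sets M = sigma_sets (space M) G"
  proof
   let ?S = "sigma (space M) G"
   \<comment> \<open>All members of \<open>C\<close> are measurable for the sigma-algebra generated
     by \<open>G\<close>. By \<open>gen\<close> the identity is then measurable, so \<open>G\<close>
     generates the sets of \<open>M\<close>.\<close>
   have id: "(\<lambda>x. x) \<in> measurable ?S M"
    by (rule gen) (use cG GP in \<open>auto simp: borel_measurable_iff_greater space_measure_of sets_measure_of intro!: sigma_sets.Basic\<close>)
   have "X \<in> sigma_sets (space M) G" if X: "X \<in> sets M" for X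
    using measurable_sets[OF id X] sets.sets_into_space[OF X] GP by (simp add: vimage_def sets_measure_of space_measure_of Int_absorb2)
   then show "sets M \<subseteq> sigma_sets (space M) G" by blast
   show "sigma_sets (space M) G \<subseteq> sets M" by (rule sets.sigma_sets_subset) (auto simp: G_def)
  qed
  then show "sets N = sigma_sets (space M) G" by (simp add: sets)
 qed (use GP fin finite_measure.emeasure_finite in auto)
qed

text \<open>The measures whose densities are the positive and the negative part of \<open>d\<close>
  are finite, and they agree on \<open>C\<close> because the difference of their integrals is the
  integral of \<open>c x * d x\<close>. They therefore coincide, and so do the two parts almost
  everywhere.\<close>

lemma AE_zero_multiplicative:
 fixes M :: "'b measure" and C :: "('b => real) set"
 assumes d: "integrable M d"
  and gen: "!!S. space S = space M ==> (!!c. c \<in> C ==> c \<in> borel_measurable S) ==> (\<lambda>x. x) \<in> measurable S M"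
  and one: "(\<lambda>_. 1) \<in> C"
  and meas: "!!c. c \<in> C ==> c \<in> borel_measurable M"
  and bnd: "\<forall>c\<in>C. \<forall>x\<in>space M. \<bar>c x\<bar> <= 1"
  and mult: "!!c d. c \<in> C ==> d \<in> C ==> \<exists>e\<in>C. \<forall>x\<in>space M. e x = c x * d x"
  and zero: "!!c. c \<in> C ==> (LINT x|M. c x * d x) = 0"
 shows "AE x in M. d x = 0"
proof -
 let ?p = "\<lambda>s x. max 0 (s * d x)"
 have p: "integrable M (?p s)" for s using d by simp
 define L where "L s = density M (\<lambda>x. ennreal (?p s x))" for s :: real
 have L: "(LINT x|L s. f x) = (LINT x|M. ?p s x * f x)" if "f \<in> borel_measurable M" for f :: "'b => real" and s
  unfolding L_def using that d by (subst integral_density) auto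
 have "L 1 = L (-1)"
 proof (rule finite_measure_eqI_multiplicative[where C=C])
  have "finite_measure (L s)" for s
  proof (rule finite_measureI)
   have "emeasure (L s) (space (L s)) = (\<integral>\<^sup>+x. ennreal (?p s x) \<partial>M)"
    unfolding L_def using borel_measurable_integrable[OF d] by (subst emeasure_density) auto
   also have "... = ennreal (LINT x|M. ?p s x)" by (rule nn_integral_eq_integral[OF p]) simp
   finally show "emeasure (L s) (space (L s)) ~= \<infinity>" by simp
  qed
  then show "finite_measure (L 1)" "finite_measure (L (-1))" by blast+
  show "(LINT x|L 1. c x) = (LINT x|L (-1). c x)" if c: "c \<in> C" for c
  proof -
   have i: "integrable M (\<lambda>x. ?p s x * c x)" for s
   proof (rule Bochner_Integration.integrable_bound[OF p])
    show "AE x in M. norm (?p s x * c x) <= norm (?p s x)" using bnd c by (intro AE_I2) (simp add: abs_mult mult_left_le)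
   qed (use p meas[OF c] in \<open>auto intro: borel_measurable_integrable\<close>)
   have "(LINT x|L 1. c x) - (LINT x|L (-1). c x) = (LINT x|M. ?p 1 x * c x - ?p (-1) x * c x)"
    unfolding L[OF meas[OF c]] by (rule Bochner_Integration.integral_diff[symmetric, OF i i])
   also have "... = (LINT x|M. c x * d x)" by (rule Bochner_Integration.integral_cong) (auto simp: max_def)
   finally show ?thesis using zero[OF c] by simp
  qed
  show "(\<lambda>x. x) \<in> measurable S (L 1)"
   if "space S = space (L 1)" "!!c. c \<in> C ==> c \<in> borel_measurable S" for S
   using gen[OF that(1)[unfolded L_def space_density] that(2)] by (simp add: L_def)
  show "c \<in> borel_measurable (L 1)" if "c \<in> C" for c using meas[OF that] by (simp add: L_def)
  show "\<forall>c\<in>C. \<forall>x\<in>space (L 1). \<bar>c x\<bar> <= 1" unfolding L_def space_density by (rule bnd)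
  show "\<exists>e\<in>C. \<forall>x\<in>space (L 1). e x = c x * k x" if "c \<in> C" "k \<in> C" for c k unfolding L_def space_density by (rule mult[OF that])
 qed (simp_all add: L_def one)
 then have *: "(LINT x|M. ?p 1 x * indicat_real A x) = (LINT x|M. ?p (-1) x * indicat_real A x)" if "A \<in> sets M" for A
  using L[OF borel_measurable_indicator[OF that], of 1] L[OF borel_measurable_indicator[OF that], of "-1"] by metis
 have "AE x in M. ?p 1 x = ?p (-1) x"
 proof (rule density_unique_real[OF p[of 1] p[of "-1"]])
  fix A assume "A \<in> sets M"
  from *[OF this] show "set_lebesgue_integral M A (?p 1) = set_lebesgue_integral M A (?p (-1))"
   unfolding set_lebesgue_integral_def by (simp add: mult.commute)
 qed
 then show ?thesis by eventually_elim (auto simp: max_def split: if_splits)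
qed

section \<open>Mark functions and the Mecke formula\<close>

text \<open>\<open>w\<close> stands for the measure with mass \<open>w x\<close> at each point
  \<open>x\<close>. One function carries the configuration, as the set where it is nonzero, and the
  marks, so that adding a point is a function update.\<close>

definition marks :: "('a::topological_space => real) set" where
 "marks = {w. (\<forall>x. 0 <= w x) & (\<forall>K. compact K --> finite ({x. w x ~= 0} \<inter> K))}"

abbreviation atoms :: "('a => real) => ('a => real) => 'a set" where
 "atoms w f \<equiv> {x. w x ~= 0 & f x ~= 0}"

definition pairing :: "('a => real) => ('a => real) => real" where
 "pairing w f = (\<Sum>x\<in>atoms w f. w x * f x)"

text \<open>Truncating at 0 keeps the result a mark function for every real \<open>s\<close>, so
  that \<open>shift\<close> is defined and measurable on the whole triple product although jumps are
  positive only almost surely. An existing mass at \<open>x\<close> is increased and not replaced,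
  which makes \<open>pairing\<close> additive.\<close>

definition shift :: "'a => real => ('a => real) => 'a => real" where
 "shift x s w = w(x := w x + max 0 s)"

text \<open>Phrased with a compact superset instead of a closure, so that it passes at once to
  smaller supports and to sums; \<open>compact_closure_iff\<close> relates the two forms.\<close>

definition csupp :: "('a::topological_space => real) => bool" where
 "csupp f \<longleftrightarrow> (\<exists>K. compact K & {x. f x ~= 0} \<subseteq> K)"

lemma csuppI: "compact K ==> {x. f x ~= 0} \<subseteq> K ==> csupp f" unfolding csupp_def by auto

lemma csupp_subset: "csupp f ==> (!!x. g x ~= 0 ==> f x ~= 0) ==> csupp g" unfolding csupp_def by blast

lemma csupp_add: "csupp f ==> csupp g ==> csupp (\<lambda>x. f x + g x)"
proof -
 assume "csupp f" "csupp g"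
 then obtain K L where "compact K" "compact L" "{x. f x ~= 0} \<subseteq> K" "{x. g x ~= 0} \<subseteq> L" unfolding csupp_def by auto
 then show ?thesis by (intro csuppI[where K="K \<union> L"]) (simp add: compact_Un, force simp: subset_iff)
qed

lemma finite_marks: "w \<in> marks ==> csupp f ==> finite (atoms w f)"
 unfolding marks_def csupp_def by clarsimp (erule allE, erule (1) impE, erule finite_subset[rotated], blast)

lemma marks_nonneg: "w \<in> marks ==> 0 <= w x" unfolding marks_def by auto

lemma pairing_eq_sum:
 assumes "finite S" "atoms w f \<subseteq> S"
 shows "pairing w f = (\<Sum>x\<in>S. w x * f x)" unfolding pairing_def by (rule sum.mono_neutral_left) (use assms in auto)

lemma pairing_lin:
 assumes "w \<in> marks" "csupp f" "csupp g"
 shows "pairing w (\<lambda>x. a * f x + b * g x) = a * pairing w f + b * pairing w g"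
proof -
 let ?S = "atoms w f \<union> atoms w g"
 have fin: "finite ?S" using finite_marks assms by auto
 show ?thesis by (subst (1 2 3) pairing_eq_sum[OF fin]) (auto simp: sum_distrib_left sum.distrib[symmetric] algebra_simps)
qed

lemma pairing_add: "w \<in> marks ==> csupp f ==> csupp g ==> pairing w (\<lambda>x. f x + g x) = pairing w f + pairing w g"
 using pairing_lin[of w f g 1 1] by simp

lemma pairing_scale: "w \<in> marks ==> csupp f ==> pairing w (\<lambda>x. a * f x) = a * pairing w f" using pairing_lin[of w f f a 0] by simp

lemma pairing_nonneg: "w \<in> marks ==> (!!x. 0 <= f x) ==> 0 <= pairing w f" unfolding pairing_def by (auto intro!: sum_nonneg simp: marks_nonneg)

lemma shift_marks: "w \<in> marks ==> shift x s w \<in> marks"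
proof -
 assume w: "w \<in> marks"
 have "{y. shift x s w y ~= 0} \<inter> K \<subseteq> insert x ({y. w y ~= 0} \<inter> K)" for K by (auto simp: shift_def split: if_splits)
 then have "finite ({y. shift x s w y ~= 0} \<inter> K)" if "compact K" for K by (rule finite_subset) (use w that in \<open>auto simp: marks_def\<close>)
 then show ?thesis using w unfolding marks_def by (auto simp: shift_def)
qed

lemma pairing_shift:
 assumes "w \<in> marks" "csupp f"
 shows "pairing (shift x s w) f = pairing w f + max 0 s * f x"
proof -
 let ?S = "insert x {y. w y ~= 0 & f y ~= 0}"
 have fin: "finite ?S" using finite_marks assms by auto
 have "pairing (shift x s w) f = (\<Sum>y\<in>?S. shift x s w y * f y)" by (rule pairing_eq_sum[OF fin]) (auto simp: shift_def split: if_splits)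
 also have "... = (\<Sum>y\<in>?S. w y * f y + (if y = x then max 0 s * f x else 0))" by (rule sum.cong) (auto simp: shift_def algebra_simps)
 also have "... = pairing w f + max 0 s * f x" unfolding sum.distrib using fin by (subst pairing_eq_sum[OF fin]) auto
 finally show ?thesis .
qed

lemma nn_integral_pairing:
 assumes "w \<in> marks" "csupp f" "!!x. 0 <= f x"
 shows "(\<integral>\<^sup>+x. ennreal (w x * f x) \<partial>count_space UNIV) = ennreal (pairing w f)"
proof -
 have "(\<integral>\<^sup>+x. ennreal (w x * f x) \<partial>count_space UNIV) = (\<Sum>x\<in>atoms w f. ennreal (w x * f x))"
  by (rule nn_integral_count_space') (use finite_marks assms in auto)
 also have "... = ennreal (pairing w f)" unfolding pairing_def by (rule sum_ennreal) (simp add: assms marks_nonneg)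
 finally show ?thesis .
qed

text \<open>What the probabilistic part requires of nonnegative test functions; nonnegativity keeps
  all Laplace transforms finite. \<open>saturate\<close> supplies functions increasing to the
  indicator of the set where \<open>f\<close> is positive, and \<open>bump\<close> makes these sets
  a base of the topology.\<close>

locale test_cone =
 fixes D :: "('a::{second_countable_topology,t2_space} => real) set"
 assumes cont: "f \<in> D ==> continuous_on UNIV f"
  and nonneg: "f \<in> D ==> 0 <= f x"
  and csupp: "f \<in> D ==> csupp f"
  and add: "f \<in> D ==> g \<in> D ==> (\<lambda>x. f x + g x) \<in> D"
  and mult: "f \<in> D ==> g \<in> D ==> (\<lambda>x. f x * g x) \<in> D"
  and scale: "f \<in> D ==> 0 <= a ==> (\<lambda>x. a * f x) \<in> D"
  and saturate: "f \<in> D ==> (!!x. f x <= 1) ==> (\<lambda>x. 1 - (1 - f x) ^ n) \<in> D"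
  and bump: "open U ==> x \<in> U ==> \<exists>f\<in>D. (\<forall>y. f y <= 1) & 0 < f x & {y. f y ~= 0} \<subseteq> U"
begin

definition mark_space :: "('a => real) measure" where
 "mark_space = vimage_algebra marks (\<lambda>w. \<lambda>f\<in>D. pairing w f) (\<Pi>\<^sub>M f\<in>D. borel)"

abbreviation "pair_space \<equiv> (borel :: 'a measure) \<Otimes>\<^sub>M mark_space"

abbreviation "triple_space \<equiv> (borel :: 'a measure) \<Otimes>\<^sub>M ((borel :: real measure) \<Otimes>\<^sub>M mark_space)"

lemma space_mark_space[simp]: "space mark_space = marks" unfolding mark_space_def by simp

lemma measurable_test[measurable]: "f \<in> D ==> f \<in> borel_measurable borel" using cont by (rule borel_measurable_continuous_onI)

lemma measurable_pairing[measurable]: "f \<in> D ==> (\<lambda>w. pairing w f) \<in> borel_measurable mark_space"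
proof -
 assume f: "f \<in> D"
 have "(\<lambda>w. \<lambda>f\<in>D. pairing w f) \<in> measurable mark_space (\<Pi>\<^sub>M f\<in>D. borel)"
  unfolding mark_space_def by (rule measurable_vimage_algebra1) (auto simp: space_PiM)
 from measurable_compose[OF this measurable_component_singleton[OF f]] show ?thesis using f by simp
qed

lemma measurable_mark_spaceI:
 assumes "!!\<omega>. \<omega> \<in> space M ==> k \<omega> \<in> marks" "!!f. f \<in> D ==> (\<lambda>\<omega>. pairing (k \<omega>) f) \<in> borel_measurable M"
 shows "k \<in> measurable M mark_space" unfolding mark_space_def
 by (rule measurable_vimage_algebra2) (use assms in \<open>auto intro!: measurable_restrict\<close>)

lemma measurable_shift[measurable]:
 "(\<lambda>(x, s, w). shift x s w) \<in> measurable triple_space mark_space"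
proof (rule measurable_mark_spaceI)
 show "(case \<omega> of (x, s, w) => shift x s w) \<in> marks"
  if "\<omega> \<in> space triple_space" for \<omega> :: "'a \<times> real \<times> ('a => real)" using that by (auto simp: space_pair_measure shift_marks)
 fix f assume f[measurable]: "f \<in> D"
 have "(\<lambda>\<omega>. pairing (snd (snd \<omega>)) f + max 0 (fst (snd \<omega>)) * f (fst \<omega>)) \<in>
   borel_measurable triple_space"
  by measurable
 then show "(\<lambda>\<omega>. pairing (case \<omega> of (x, s, w) => shift x s w) f) \<in> borel_measurable triple_space"
  by (rule measurable_cong[THEN iffD1, rotated]) (auto simp: space_pair_measure pairing_shift csupp f)
qed

section \<open>Borel sets and point masses read off from test functions\<close>

lemma zero_in: "(\<lambda>_. 0) \<in> D"
proof -
 obtain f where "f \<in> D" using bump[of UNIV] by auto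
 from scale[OF this, of 0] show ?thesis by simp
qed

definition base :: "('a => real) set" where
 "base = (SOME F. F \<subseteq> D & countable F & (\<forall>f\<in>F. \<forall>y. f y <= 1) &
  (\<forall>U x. open U --> x \<in> U --> (\<exists>f\<in>F. 0 < f x & {y. f y ~= 0} \<subseteq> U)))"

text \<open>For each member of a countable topological basis, the Lindelof property thins the bumps
  supported in it to countably many whose positivity sets still cover it. The union over the basis
  is again countable.\<close>

lemma ex_base: "\<exists>F. F \<subseteq> D & countable F & (\<forall>f\<in>F. \<forall>y. f y <= 1) &
  (\<forall>U x. open U --> x \<in> U --> (\<exists>f\<in>F. 0 < f x & {y. f y ~= 0} \<subseteq> U))"
proof -
 obtain B :: "'a set set" where B: "countable B" "topological_basis B" using ex_countable_basis by blast
 define H where "H = {f \<in> D. \<forall>y. f y <= 1}"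
 have "\<exists>F. F \<subseteq> H & countable F & (\<forall>f\<in>F. {y. f y ~= 0} \<subseteq> U) & U \<subseteq> (\<Union>f\<in>F. {y. 0 < f y})" if U: "open U" for U
 proof -
  let ?G = "{f \<in> H. {y. f y ~= 0} \<subseteq> U}"
  have o: "open {y. 0 < f y}" if "f \<in> ?G" for f using that cont unfolding H_def by (auto intro!: open_Collect_less continuous_on_const)
  have cov: "U \<subseteq> (\<Union>f\<in>?G. {y. 0 < f y})" using bump[OF U] unfolding H_def by blast
  obtain F' where F': "F' \<subseteq> (\<lambda>f. {y. 0 < f y}) ` ?G" "countable F'" "\<Union>F' = \<Union>((\<lambda>f. {y. 0 < f y}) ` ?G)"
   using Lindelof[of "(\<lambda>f. {y. 0 < f y}) ` ?G"] o by auto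
  obtain F where F: "F \<subseteq> ?G" "countable F" "F' = (\<lambda>f. {y. 0 < f y}) ` F"
   using countable_subset_image[of F' "\<lambda>f. {y. 0 < f y}" ?G] F' by auto
  show ?thesis by (rule exI[of _ F]) (use F F' cov in auto)
 qed
 then obtain F where F: "!!U. open U ==> F U \<subseteq> H & countable (F U) & (\<forall>f\<in>F U. {y. f y ~= 0} \<subseteq> U) & U \<subseteq> (\<Union>f\<in>F U. {y. 0 < f y})" by metis
 have Bo: "open b" if "b \<in> B" for b using B that by (auto simp: topological_basis_open)
 show ?thesis
 proof (intro exI[of _ "\<Union>b\<in>B. F b"] conjI)
  have FB: "F b \<subseteq> H" if "b \<in> B" for b using F[OF Bo[OF that]] by simp
  show "\<Union> (F ` B) \<subseteq> D" using FB unfolding H_def by auto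
  show "\<forall>f\<in>\<Union> (F ` B). \<forall>y. f y <= 1"
  proof
   fix f assume "f \<in> \<Union> (F ` B)"
   then obtain b where "b \<in> B" "f \<in> F b" by auto
   then have "f \<in> H" using FB by auto
   then show "\<forall>y. f y <= 1" unfolding H_def by simp
  qed
  show "countable (\<Union> (F ` B))" using B F Bo by (intro countable_UN) auto
  show "\<forall>U x. open U --> x \<in> U --> (\<exists>f\<in>\<Union> (F ` B). 0 < f x & {y. f y ~= 0} \<subseteq> U)"
  proof (intro allI impI)
   fix U x assume "open U" "(x::'a) \<in> U"
   then obtain b where b: "b \<in> B" "x \<in> b" "b \<subseteq> U" by (rule topological_basisE[OF B(2)])
   then obtain f where "f \<in> F b" "0 < f x" using F[OF Bo[OF b(1)]] by blast
   moreover have "{y. f y ~= 0} \<subseteq> U" using F[OF Bo[OF b(1)]] b \<open>f \<in> F b\<close> by blast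
   ultimately show "\<exists>f\<in>\<Union> (F ` B). 0 < f x & {y. f y ~= 0} \<subseteq> U" using b by blast
  qed
 qed
qed

lemma base_subset: "base \<subseteq> D" and countable_base: "countable base" and base_le_1: "f \<in> base ==> f y <= 1"
 and base_ex: "open U ==> x \<in> U ==> \<exists>f\<in>base. 0 < f x & {y. f y ~= 0} \<subseteq> U"
proof -
 have *: "base \<subseteq> D & countable base & (\<forall>f\<in>base. \<forall>y. f y <= 1) &
  (\<forall>U x. open U --> x \<in> U --> (\<exists>f\<in>base. 0 < f x & {y. f y ~= 0} \<subseteq> U))"
  unfolding base_def by (rule someI_ex[OF ex_base])
 then show "base \<subseteq> D" "countable base" by simp_all
 show "f y <= 1" if "f \<in> base" using * that by simp
 show "\<exists>f\<in>base. 0 < f x & {y. f y ~= 0} \<subseteq> U" if "open U" "x \<in> U" using * that by simp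
qed

text \<open>An open set is the union of the positivity sets of the countably many members of
  \<open>base\<close> supported in it. This reduces measurability of point-valued maps to that of
  real test functions.\<close>

lemma sets_borel_eq: "sets (borel :: 'a measure) = sigma_sets UNIV {{y. 0 < f y} | f. f \<in> D & (\<forall>y. f y <= 1)}" (is "_ = sigma_sets UNIV ?G")
proof
 have "?G \<subseteq> sets borel" by (auto intro!: borel_open open_Collect_less cont continuous_on_const)
 from sets.sigma_sets_subset[OF this] show "sigma_sets UNIV ?G \<subseteq> sets borel" by simp
 have "U \<in> sigma_sets UNIV ?G" if U: "open U" for U
 proof -
  let ?F = "{f \<in> base. {y. f y ~= 0} \<subseteq> U}"
  have "U = (\<Union>f\<in>?F. {y. 0 < f y})" using base_ex[OF U] by fastforce
  moreover have "(\<Union>f\<in>?F. {y. 0 < f y}) \<in> sigma_sets UNIV ?G"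
  proof (rule sigma_sets_UNION)
   show "countable ((\<lambda>f. {y. 0 < f y}) ` ?F)" using countable_base by (auto intro: countable_subset)
   show "b \<in> sigma_sets UNIV ?G" if "b \<in> (\<lambda>f. {y. 0 < f y}) ` ?F" for b
    using that base_subset base_le_1 by (auto intro!: sigma_sets.Basic)
  qed
  ultimately show ?thesis by simp
 qed
 then show "sets borel \<subseteq> sigma_sets UNIV ?G" unfolding borel_def by (subst sets_measure_of) (auto intro!: sigma_sets_mono)
qed

lemma tendsto_saturate:
 assumes "f \<in> D" "!!x. f x <= 1"
 shows "(\<lambda>n. 1 - (1 - f x) ^ n) \<longlonglongrightarrow> indicat_real {y. 0 < f y} x"
proof (cases "f x = 0")
 case False
 then have "0 < f x" using nonneg[OF assms(1), of x] by simp
 moreover have "(\<lambda>n. (1 - f x) ^ n) \<longlonglongrightarrow> 0" using \<open>0 < f x\<close> assms(2)[of x] by (intro LIMSEQ_power_zero) auto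
 from tendsto_diff[OF tendsto_const[of 1] this] show ?thesis using \<open>0 < f x\<close> by simp
qed (simp add: LIMSEQ_const_iff)

text \<open>The indicator is the limit of the saturations of \<open>f\<close>, which are test
  functions, also after multiplication by \<open>g\<close>. For fixed \<open>w\<close> all pairings
  are sums over the same finite set of atoms, so the limit passes inside.\<close>

lemma measurable_pairing_indicator:
 assumes f: "f \<in> D" "\<forall>x. f x <= 1" and g: "g \<in> D \<or> g = (\<lambda>_. 1)"
 shows "(\<lambda>w. pairing w (\<lambda>x. g x * indicat_real {y. 0 < f y} x)) \<in> borel_measurable mark_space"
proof (rule borel_measurable_LIMSEQ_real)
 let ?h = "\<lambda>n x. g x * (1 - (1 - f x) ^ n)"
 have "?h n \<in> D" for n using mult[OF _ saturate] saturate f g by auto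
 then show "(\<lambda>w. pairing w (?h n)) \<in> borel_measurable mark_space" for n by measurable
 fix w assume "w \<in> space mark_space"
 then have w: "w \<in> marks" by simp
 let ?S = "atoms w f"
 have fin: "finite ?S" using finite_marks[OF w csupp] f by auto
 have h0: "?h n x = 0" if "f x = 0" for n x using that by simp
 have 1: "pairing w (?h n) = (\<Sum>x\<in>?S. w x * ?h n x)" for n by (rule pairing_eq_sum[OF fin]) (use h0 in auto)
 have 2: "pairing w (\<lambda>x. g x * indicat_real {y. 0 < f y} x) = (\<Sum>x\<in>?S. w x * (g x * indicat_real {y. 0 < f y} x))"
  by (rule pairing_eq_sum[OF fin]) (auto simp: indicator_def split: if_splits)
 show "(\<lambda>n. pairing w (?h n)) \<longlonglongrightarrow> pairing w (\<lambda>x. g x * indicat_real {y. 0 < f y} x)"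
  unfolding 1 2 by (intro tendsto_sum tendsto_mult tendsto_const tendsto_saturate f(1) f(2)[rule_format])
qed

text \<open>Evaluation at a moving point is not among the generating pairings. It is the infimum,
  over the members of \<open>base\<close> that are positive at \<open>x\<close>, of the mass of
  their positivity sets, since small neighbourhoods contain no other atom. The value infinity
  discards the members that vanish at \<open>x\<close>.\<close>

lemma measurable_mass: "(\<lambda>(x, w). w x) \<in> borel_measurable pair_space"
proof -
 let ?h = "\<lambda>f p. if 0 < f (fst p) then ennreal (pairing (snd p) (\<lambda>x. 1 * indicat_real {y. 0 < f y} x)) else \<infinity>"
 have eq: "ennreal (w x) = (INF f\<in>base. ?h f (x, w))" if w: "w \<in> marks" for x w
 proof (rule antisym)
  show "ennreal (w x) <= (INF f\<in>base. ?h f (x, w))"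
  proof (rule INF_greatest)
   fix f assume f: "f \<in> base"
   let ?S = "atoms w f"
   have fin: "finite ?S" using finite_marks[OF w csupp] f base_subset by auto
   have 2: "pairing w (\<lambda>x. 1 * indicat_real {y. 0 < f y} x) = (\<Sum>x\<in>insert x ?S. w x * (1 * indicat_real {y. 0 < f y} x))"
    by (rule pairing_eq_sum) (use fin in \<open>auto simp: indicator_def split: if_splits\<close>)
   have "w x * (1 * indicat_real {y. 0 < f y} x) <= pairing w (\<lambda>x. 1 * indicat_real {y. 0 < f y} x)"
    unfolding 2 by (rule member_le_sum) (use fin marks_nonneg[OF w] in auto)
   then show "ennreal (w x) <= ?h f (x, w)" by (auto intro!: ennreal_leI)
  qed
  obtain f0 where f0: "f0 \<in> base" "0 < f0 x" using base_ex[of UNIV x] by auto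
  have fin: "finite (atoms w f0 - {x})" using finite_marks[OF w csupp] f0 base_subset by auto
  \<comment> \<open>Removing the finitely many other atoms seen by \<open>f0\<close> leaves a
    neighbourhood of \<open>x\<close> in which \<open>w\<close> charges at most
    \<open>x\<close>.\<close>
  let ?U = "{y. 0 < f0 y} - (atoms w f0 - {x})"
  have "open ?U" using cont f0 base_subset by (intro open_Diff finite_imp_closed[OF fin] open_Collect_less continuous_on_const) auto
  then obtain f where f: "f \<in> base" "0 < f x" "{y. f y ~= 0} \<subseteq> ?U" using base_ex[of ?U x] f0 by auto
  have "pairing w (\<lambda>x. 1 * indicat_real {y. 0 < f y} x) = (\<Sum>x\<in>{x}. w x * (1 * indicat_real {y. 0 < f y} x))"
   by (rule pairing_eq_sum) (use f(3) in \<open>force simp: indicator_def split: if_splits\<close>)+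
  then have "?h f (x, w) <= ennreal (w x)" using f by simp
  then show "(INF f\<in>base. ?h f (x, w)) <= ennreal (w x)" by (rule INF_lower2[OF f(1)])
 qed
 have m: "(\<lambda>p. INF f\<in>base. ?h f p) \<in> borel_measurable pair_space"
 proof (rule borel_measurable_INF[OF countable_base])
  fix f assume f: "f \<in> base"
  have [measurable]: "f \<in> borel_measurable borel" using f base_subset by auto
  have "(\<lambda>w. pairing w (\<lambda>x. 1 * indicat_real {y. 0 < f y} x)) \<in> borel_measurable mark_space"
   by (rule measurable_pairing_indicator) (use f base_subset base_le_1 in auto)
  from measurable_compose[OF measurable_snd this]
  have [measurable]: "(\<lambda>p. pairing (snd p) (\<lambda>x. 1 * indicat_real {y. 0 < f y} x)) \<in> borel_measurable pair_space" .
  show "?h f \<in> borel_measurable pair_space" by measurable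
 qed
 have "(\<lambda>p. enn2real (INF f\<in>base. ?h f p)) \<in> borel_measurable pair_space" by (rule borel_measurable_enn2real[OF m])
 moreover have "enn2real (INF f\<in>base. ?h f p) = (case p of (x, w) => w x)"
  if sp: "p \<in> space pair_space" for p
 proof -
  obtain x w where p: "p = (x, w)" "w \<in> marks" using sp by (cases p) (auto simp: space_pair_measure)
  have "enn2real (INF f\<in>base. ?h f p) = enn2real (ennreal (w x))" unfolding p(1) eq[OF p(2)] ..
  then show ?thesis using marks_nonneg[OF p(2), of x] unfolding p(1) by (simp only: prod.case enn2real_ennreal)
 qed
 ultimately show ?thesis by (rule measurable_cong[THEN iffD1, rotated])
qed

text \<open>The sum over the atoms weighted by \<open>w x * c x\<close>, divided by one plus its
  total mass so that it is a subprobability for every \<open>w\<close> and the bind of measures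
  applies to it; \<open>nn_integral_kernel\<close> restores the factor. The image under
  \<open>id\<close> passes from all subsets to the Borel sets.\<close>

definition kernel :: "('a => real) => ('a => real) => 'a measure" where
 "kernel c w = distr (density (count_space UNIV) (\<lambda>x. ennreal (w x * c x / (1 + pairing w c)))) borel id"

lemma nn_integral_kernel:
 assumes c: "c \<in> D" and w: "w \<in> marks" and k: "k \<in> borel_measurable borel"
 shows "(\<integral>\<^sup>+x. ennreal (w x * c x) * k x \<partial>count_space UNIV) = ennreal (1 + pairing w c) * (\<integral>\<^sup>+x. k x \<partial>kernel c w)"
proof -
 have p: "0 < 1 + pairing w c" using pairing_nonneg[OF w, of c] nonneg[OF c] by simp
 have "(\<integral>\<^sup>+x. k x \<partial>kernel c w) = (\<integral>\<^sup>+x. ennreal (w x * c x / (1 + pairing w c)) * k x \<partial>count_space UNIV)"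
  unfolding kernel_def by (subst nn_integral_distr) (auto simp: k nn_integral_density)
 then have "ennreal (1 + pairing w c) * (\<integral>\<^sup>+x. k x \<partial>kernel c w) =
   (\<integral>\<^sup>+x. ennreal (1 + pairing w c) * (ennreal (w x * c x / (1 + pairing w c)) * k x) \<partial>count_space UNIV)"
  by (simp add: nn_integral_cmult)
 also have "... = (\<integral>\<^sup>+x. ennreal (w x * c x) * k x \<partial>count_space UNIV)"
 proof (rule nn_integral_cong)
  fix x
  have "ennreal (1 + pairing w c) * ennreal (w x * c x / (1 + pairing w c)) = ennreal (w x * c x)"
   using p by (subst ennreal_mult'[symmetric]) (auto simp: marks_nonneg[OF w] nonneg[OF c])
  then show "ennreal (1 + pairing w c) * (ennreal (w x * c x / (1 + pairing w c)) * k x) = ennreal (w x * c x) * k x"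
   by (simp add: mult.assoc[symmetric])
 qed
 finally show ?thesis by simp
qed

lemma emeasure_kernel:
 assumes c: "c \<in> D" and w: "w \<in> marks" and B: "B \<in> sets borel"
 shows "emeasure (kernel c w) B = ennreal (pairing w (\<lambda>x. c x * indicat_real B x) / (1 + pairing w c))"
proof -
 have p: "0 < 1 + pairing w c" using pairing_nonneg[OF w, of c] nonneg[OF c] by simp
 have "ennreal (1 + pairing w c) * emeasure (kernel c w) B = (\<integral>\<^sup>+x. ennreal (w x * c x) * indicator B x \<partial>count_space UNIV)"
  using nn_integral_kernel[OF c w, of "indicator B"] B by (simp add: kernel_def)
 also have "... = (\<integral>\<^sup>+x. ennreal (w x * (c x * indicat_real B x)) \<partial>count_space UNIV)" by (rule nn_integral_cong) (auto simp: indicator_def)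
 also have "... = ennreal (pairing w (\<lambda>x. c x * indicat_real B x))"
  by (rule nn_integral_pairing) (use w nonneg[OF c] in \<open>auto intro: csupp_subset[OF csupp[OF c]]\<close>)
 finally have *: "ennreal (1 + pairing w c) * emeasure (kernel c w) B = ennreal (pairing w (\<lambda>x. c x * indicat_real B x))" .
 have "emeasure (kernel c w) B = ennreal (1 / (1 + pairing w c)) * (ennreal (1 + pairing w c) * emeasure (kernel c w) B)"
  using p by (simp add: mult.assoc[symmetric] ennreal_mult'[symmetric])
 then show ?thesis unfolding * using p by (simp add: ennreal_mult'[symmetric])
qed

lemma sets_kernel[simp]: "sets (kernel c w) = sets borel" and space_kernel[simp]: "space (kernel c w) = UNIV"
 unfolding kernel_def by simp_all

end

context test_cone begin

text \<open>It is enough to consider the positivity sets of test functions, which are closed under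
  intersection and generate the Borel sets; on these the kernel is a quotient of pairings.\<close>

lemma measurable_kernel[measurable]:
 assumes c: "c \<in> D" shows "kernel c \<in> measurable mark_space (subprob_algebra borel)"
proof -
 let ?G = "{{y. 0 < f y} | f. f \<in> D & (\<forall>y. f y <= 1)}"
 have 1: "Int_stable ?G"
 proof (rule Int_stableI)
  fix a b assume "a \<in> ?G" "b \<in> ?G"
  then obtain f g where f: "f \<in> D" "\<forall>y. f y <= 1" "a = {y. 0 < f y}" and g: "g \<in> D" "\<forall>y. g y <= 1" "b = {y. 0 < g y}" by auto
  have "0 < f y * g y \<longleftrightarrow> 0 < f y & 0 < g y" for y using nonneg[OF f(1), of y] nonneg[OF g(1), of y] by (simp add: zero_less_mult_iff)
  then have "a \<inter> b = {y. 0 < f y * g y}" unfolding f g by auto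
  moreover have "f y * g y <= 1" for y using nonneg[OF f(1), of y] nonneg[OF g(1), of y] f(2) g(2) by (simp add: mult_le_one)
  ultimately show "a \<inter> b \<in> ?G" using mult[OF f(1) g(1)] by (intro CollectI exI[of _ "\<lambda>y. f y * g y"] conjI allI)
 qed
 have 2: "subprob_space (kernel c w)" if "w \<in> space mark_space" for w
 proof (rule subprob_spaceI)
  have "w \<in> marks" using that by simp
  then have "0 <= pairing w c" by (rule pairing_nonneg) (rule nonneg[OF c])
  then show "emeasure (kernel c w) (space (kernel c w)) <= 1" using emeasure_kernel[OF c \<open>w \<in> marks\<close>, of UNIV] by simp
 qed simp
 have 3: "(\<lambda>w. emeasure (kernel c w) A) \<in> borel_measurable mark_space" if "A \<in> ?G" for A
 proof -
  obtain f where f: "f \<in> D" "\<forall>y. f y <= 1" "A = {y. 0 < f y}" using \<open>A \<in> ?G\<close> by auto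
  have i: "(\<lambda>w. pairing w (\<lambda>x. c x * indicat_real A x)) \<in> borel_measurable mark_space"
   unfolding f(3) by (rule measurable_pairing_indicator) (use f c in auto)
  have "open A" unfolding f(3) by (intro open_Collect_less cont[OF f(1)] continuous_on_const)
  then have [simp]: "A \<in> sets borel" by simp
  have "(\<lambda>w. ennreal (pairing w (\<lambda>x. c x * indicat_real A x) / (1 + pairing w c))) \<in> borel_measurable mark_space"
   by (intro measurable_compose[OF _ measurable_ennreal] borel_measurable_divide borel_measurable_add i
    borel_measurable_const measurable_pairing c)
  then show ?thesis by (rule measurable_cong[THEN iffD1, rotated]) (simp add: emeasure_kernel[OF c])
 qed
 have "(\<lambda>w. ennreal (pairing w c / (1 + pairing w c))) \<in> borel_measurable mark_space"
  by (intro measurable_compose[OF _ measurable_ennreal] borel_measurable_divide borel_measurable_add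
    borel_measurable_const measurable_pairing c)
 then have 4: "(\<lambda>w. emeasure (kernel c w) UNIV) \<in> borel_measurable mark_space"
  by (rule measurable_cong[THEN iffD1, rotated]) (simp add: emeasure_kernel[OF c])
 show ?thesis by (rule measurable_subprob_algebra_generated[OF sets_borel_eq 1 _ 2 _ 3 4]) simp_all
qed

lemma measurable_weighted_sum:
 assumes c[measurable]: "c \<in> D" and k: "(\<lambda>(w, x). k w x) \<in> borel_measurable (mark_space \<Otimes>\<^sub>M borel)"
 shows "(\<lambda>w. \<integral>\<^sup>+x. ennreal (w x * c x) * k w x \<partial>count_space UNIV) \<in> borel_measurable mark_space"
proof -
 have "(\<lambda>w. ennreal (1 + pairing w c) * (\<integral>\<^sup>+x. k w x \<partial>kernel c w)) \<in> borel_measurable mark_space"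
  by (intro borel_measurable_times_ennreal measurable_compose[OF _ measurable_ennreal] borel_measurable_add
    borel_measurable_const measurable_pairing c nn_integral_measurable_subprob_algebra2[OF k measurable_kernel[OF c]])
 moreover have "ennreal (1 + pairing w c) * (\<integral>\<^sup>+x. k w x \<partial>kernel c w) = (\<integral>\<^sup>+x. ennreal (w x * c x) * k w x \<partial>count_space UNIV)"
  if "w \<in> space mark_space" for w
 proof -
  have "k w \<in> borel_measurable borel" using measurable_Pair2[OF k that] by simp
  then show ?thesis using nn_integral_kernel[OF c, of w "k w"] that by simp
 qed
 ultimately show ?thesis by (rule measurable_cong[THEN iffD1, rotated])
qed

end

section \<open>Differentiating the Laplace functional\<close>

lemma exp_quotient_mono: "2 ^ n * (1 - exp (- (a / 2 ^ n))) <= 2 ^ Suc n * (1 - exp (- (a / 2 ^ Suc n :: real)))"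
proof -
 \<comment> \<open>With \<open>y\<close> the exponential at the halved step the claim reduces to 1 -
   y^2 <= 2 (1 - y), that is, to (1 - y)^2 >= 0. Dyadic steps make the difference quotients monotone
   in this simple way.\<close>
 define y where "y = exp (- (a / 2 ^ Suc n))"
 have "exp (- (a / 2 ^ n)) = y * y" unfolding y_def exp_add[symmetric] by (simp add: field_simps)
 moreover have "1 - y * y <= 2 * (1 - y)" using zero_le_power2[of "1 - y"] by (simp add: power2_eq_square algebra_simps)
 then have "2 ^ n * (1 - y * y) <= 2 ^ n * (2 * (1 - y))" by (rule mult_left_mono) simp
 ultimately show ?thesis unfolding y_def[symmetric] by simp
qed

text \<open>Here the argument itself varies with the step. The inequalities y / (1 + y) <= 1 - exp
  (- y) <= y, taken at y = d n / 2^n, squeeze the quotient.\<close>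

lemma exp_quotient_tendsto:
 fixes d :: "nat => real"
 assumes d: "d \<longlonglongrightarrow> l" and pos: "!!n. 0 <= d n"
 shows "(\<lambda>n. 2 ^ n * (1 - exp (- (d n / 2 ^ n)))) \<longlonglongrightarrow> l"
proof (rule tendsto_sandwich)
 show "\<forall>\<^sub>F n in sequentially. d n / (1 + d n / 2 ^ n) <= 2 ^ n * (1 - exp (- (d n / 2 ^ n)))"
 proof (intro always_eventually allI)
  fix n
  define y where "y = d n / 2 ^ n"
  have y: "0 <= y" using pos by (simp add: y_def)
  have "exp (- y) <= 1 / (1 + y)" using exp_ge_add_one_self[of y] y by (simp add: exp_minus inverse_eq_divide frac_le)
  then have "2 ^ n * (y / (1 + y)) <= 2 ^ n * (1 - exp (- y))" using y by (intro mult_left_mono) (auto simp: field_simps)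
  moreover have "2 ^ n * (y / (1 + y)) = d n / (1 + d n / 2 ^ n)" by (simp add: y_def)
  ultimately show "d n / (1 + d n / 2 ^ n) <= 2 ^ n * (1 - exp (- (d n / 2 ^ n)))" by (simp add: y_def)
 qed
 show "\<forall>\<^sub>F n in sequentially. 2 ^ n * (1 - exp (- (d n / 2 ^ n))) <= d n"
 proof (intro always_eventually allI)
  fix n
  have "2 ^ n * (1 - exp (- (d n / 2 ^ n))) <= 2 ^ n * (d n / 2 ^ n)"
   using exp_ge_add_one_self[of "- (d n / 2 ^ n)"] by (intro mult_left_mono) auto
  then show "2 ^ n * (1 - exp (- (d n / 2 ^ n))) <= d n" by simp
 qed
 have "(\<lambda>n. d n / (1 + d n / 2 ^ n)) \<longlonglongrightarrow> l / (1 + 0)"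
 proof (intro tendsto_intros d)
  have "(\<lambda>n. d n * (1 / 2) ^ n) \<longlonglongrightarrow> l * 0" by (intro tendsto_intros d LIMSEQ_power_zero) auto
  then show "(\<lambda>n. d n / 2 ^ n) \<longlonglongrightarrow> 0" by (simp add: power_one_over)
 qed simp
 then show "(\<lambda>n. d n / (1 + d n / 2 ^ n)) \<longlonglongrightarrow> l" by simp
qed (rule d)

lemma exp_quotient_tendsto_const: "(\<lambda>n. 2 ^ n * (1 - exp (- (a / 2 ^ n :: real)))) \<longlonglongrightarrow> a"
proof -
 consider "a = 0" | "a > 0" | "a < 0" by linarith
 then show ?thesis by cases (simp, real_asymp, real_asymp)
qed

text \<open>The Laplace functional is prescribed only at \<open>- f\<close> with \<open>f\<close> in
  the cone, where \<open>tau_moment\<close> makes the double integral finite. Jumps live on the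
  whole line and are positive almost everywhere, so that the product spaces carry the ordinary Borel
  sets in this factor.\<close>

locale compound_poisson_marks = test_cone D + P: prob_space P + tau: finite_measure \<tau>
 for D :: "('a::{second_countable_topology,t2_space} => real) set"
  and P :: "('a => real) measure" and \<tau> :: "real measure" +
 fixes \<sigma> :: "'a measure"
 assumes sets_P[measurable_cong]: "sets P = sets mark_space"
  and sets_tau[measurable_cong]: "sets \<tau> = sets borel" and sets_sigma[measurable_cong]: "sets \<sigma> = sets borel"
  and tau_pos: "AE s in \<tau>. 0 < s"
  and tau_moment: "(\<integral>\<^sup>+s. ennreal s \<partial>\<tau>) < \<infinity>"
  and sigma_fin: "compact K ==> emeasure \<sigma> K < \<infinity>"
  and sigma_nonatomic: "emeasure \<sigma> {x} = 0"
  and laplace: "f \<in> D ==> (\<integral>\<^sup>+w. ennreal (exp (- pairing w f)) \<partial>P) =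
   ennreal (exp (- enn2real (\<integral>\<^sup>+x. \<integral>\<^sup>+s. ennreal (1 - exp (- (s * f x))) \<partial>\<tau> \<partial>\<sigma>)))"
begin

abbreviation "jump_integral h \<equiv> \<integral>\<^sup>+x. \<integral>\<^sup>+s. h x s \<partial>\<tau> \<partial>\<sigma>"

lemma space_P[simp]: "space P = marks" using sets_eq_imp_space_eq[OF sets_P] by simp

lemma space_sigma[simp]: "space \<sigma> = UNIV" using sets_eq_imp_space_eq[OF sets_sigma] by simp

lemma space_tau[simp]: "space \<tau> = UNIV" using sets_eq_imp_space_eq[OF sets_tau] by simp

lemma nn_integral_sigma_finite:
 assumes "csupp f" "f \<in> borel_measurable borel" "!!x. \<bar>f x\<bar> <= b"
 shows "(\<integral>\<^sup>+x. ennreal (f x) \<partial>\<sigma>) < \<infinity>"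
proof -
 obtain K where K: "compact K" "{x. f x ~= 0} \<subseteq> K" using assms(1) unfolding csupp_def by auto
 have [measurable]: "K \<in> sets borel" using K(1) by (intro borel_closed compact_imp_closed)
 have "(\<integral>\<^sup>+x. ennreal (f x) \<partial>\<sigma>) <= (\<integral>\<^sup>+x. ennreal b * indicator K x \<partial>\<sigma>)"
 proof (intro nn_integral_mono)
  fix x show "ennreal (f x) <= ennreal b * indicator K x"
   using K(2) assms(3)[of x] by (cases "f x = 0") (auto simp: indicator_def intro!: ennreal_leI)
 qed
 also have "... = ennreal b * emeasure \<sigma> K" by (simp add: nn_integral_cmult_indicator sets_sigma)
 also have "... < \<infinity>" using sigma_fin[OF K(1)] by (simp add: ennreal_mult_less_top)
 finally show ?thesis .
qed

lemma test_bounded: "f \<in> D ==> \<exists>b\<ge>0. \<forall>x. \<bar>f x\<bar> <= b"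
proof -
 assume f: "f \<in> D"
 obtain K where K: "compact K" "{x. f x ~= 0} \<subseteq> K" using csupp[OF f] unfolding csupp_def by auto
 have "compact (f ` K)" by (rule compact_continuous_image[OF continuous_on_subset[OF cont[OF f]] K(1)]) auto
 then obtain b where b: "\<forall>y\<in>f ` K. norm y <= b" using compact_imp_bounded bounded_iff by blast
 have "\<bar>f x\<bar> <= max 0 b" for x
 proof (cases "f x = 0")
  case False
  then have "\<bar>f x\<bar> <= b" using b K(2) by auto
  then show ?thesis by simp
 qed simp
 then show ?thesis by (intro exI[of _ "max 0 b"]) auto
qed

text \<open>The positivity sets of \<open>base\<close> form a countable cover by sets that lie in
  compact ones.\<close>

sublocale sigma_finite_measure \<sigma>
proof
 have "countable ((\<lambda>f. {y. 0 < f y}) ` base)" using countable_base by auto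
 moreover have "(\<lambda>f. {y. 0 < f y}) ` base \<subseteq> sets \<sigma>"
  using base_subset by (auto simp: sets_sigma intro!: borel_open open_Collect_less cont continuous_on_const)
 moreover have "\<Union> ((\<lambda>f. {y. 0 < f y}) ` base) = space \<sigma>" using base_ex[of UNIV] by auto
 moreover have "emeasure \<sigma> {y. 0 < f y} ~= \<infinity>" if "f \<in> base" for f
 proof -
  have "csupp f" using csupp \<open>f \<in> base\<close> base_subset by auto
  then obtain K where K: "compact K" "{x. f x ~= 0} \<subseteq> K" unfolding csupp_def by auto
  have "emeasure \<sigma> {y. 0 < f y} <= emeasure \<sigma> K"
   using K by (intro emeasure_mono) (auto simp: sets_sigma intro!: borel_closed compact_imp_closed)
  then show ?thesis using sigma_fin[OF K(1)] by (auto simp: top_unique)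
 qed
 ultimately show "\<exists>A. countable A & A \<subseteq> sets \<sigma> & \<Union> A = space \<sigma> & (\<forall>a\<in>A. emeasure \<sigma> a ~= \<infinity>)"
  by (intro exI[of _ "(\<lambda>f. {y. 0 < f y}) ` base"]) auto
qed

lemma nn_integral_first_moment: "f \<in> D ==> (jump_integral (\<lambda>x s. ennreal (s * f x))) < \<infinity>"
proof -
 assume f[measurable]: "f \<in> D"
 have "(\<integral>\<^sup>+s. ennreal (s * f x) \<partial>\<tau>) = ennreal (f x) * (\<integral>\<^sup>+s. ennreal s \<partial>\<tau>)" for x
  by (subst nn_integral_cmult[symmetric]) (auto simp: nonneg[OF f] ennreal_mult'' mult.commute)
 then have "(jump_integral (\<lambda>x s. ennreal (s * f x))) = (\<integral>\<^sup>+x. ennreal (f x) \<partial>\<sigma>) * (\<integral>\<^sup>+s. ennreal s \<partial>\<tau>)" by (simp add: nn_integral_multc)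
 also have "... < \<infinity>" using tau_moment test_bounded[OF f] nn_integral_sigma_finite[OF csupp[OF f]] by (auto simp: ennreal_mult_less_top)
 finally show ?thesis .
qed

definition lap :: "('a => real) => real" where
 "lap f = enn2real (jump_integral (\<lambda>x s. ennreal (1 - exp (- (s * f x)))))"

lemma ennreal_lap: "f \<in> D ==> ennreal (lap f) = (jump_integral (\<lambda>x s. ennreal (1 - exp (- (s * f x)))))"
proof -
 assume f: "f \<in> D"
 have "1 - exp (- (s * f x)) <= s * f x" for s x using exp_ge_add_one_self[of "- (s * f x)"] by linarith
 then have "(jump_integral (\<lambda>x s. ennreal (1 - exp (- (s * f x))))) <= (jump_integral (\<lambda>x s. ennreal (s * f x)))"
  by (intro nn_integral_mono ennreal_leI)
 then show ?thesis unfolding lap_def using nn_integral_first_moment[OF f] by (auto intro!: ennreal_enn2real)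
qed

lemma nn_integral_exp_pairing: "f \<in> D ==> (\<integral>\<^sup>+w. ennreal (exp (- pairing w f)) \<partial>P) = ennreal (exp (- lap f))"
 unfolding lap_def by (rule laplace)

text \<open>Both sides are the derivative of the Laplace functional at \<open>g\<close> in the
  direction \<open>f\<close>, up to sign. The dyadic difference quotients increase, so monotone
  convergence passes to the limit in the expectation and in the jump integral.\<close>

lemma nn_integral_pairing_exp_pairing:
 assumes f[measurable]: "f \<in> D" and g[measurable]: "g \<in> D"
 shows "(\<integral>\<^sup>+w. ennreal (pairing w f * exp (- pairing w g)) \<partial>P) =
  ennreal (exp (- lap g)) * (jump_integral (\<lambda>x s. ennreal (s * f x * exp (- (s * g x)))))"
proof -
 \<comment> \<open>The difference quotient of step 2^-n at t = 0 for t -> exp (- b - t a), with the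
   sign reversed so that it is nonnegative when \<open>a\<close> is.\<close>
 define q where "q n a b = 2 ^ n * (1 - exp (- (a / 2 ^ n))) * exp (- b)" for n :: nat and a b :: real
 let ?Q = "\<lambda>n. jump_integral (\<lambda>x s. ennreal (q n (s * f x) (s * g x)))" and ?I = "jump_integral (\<lambda>x s. ennreal (s * f x * exp (- (s * g x))))"
 have q_Suc: "q n a b <= q (Suc n) a b" for n a b unfolding q_def by (intro mult_right_mono exp_quotient_mono) auto
 have q_lim: "(\<lambda>n. ennreal (q n a b)) \<longlonglongrightarrow> ennreal (a * exp (- b))" for a b
  unfolding q_def by (intro tendsto_ennrealI tendsto_mult exp_quotient_tendsto_const tendsto_const)
 have q_inc: "incseq (\<lambda>n. ennreal (q n a b))" for a b by (intro incseq_SucI ennreal_leI q_Suc)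
 have [measurable]: "(\<lambda>p. q n (fst p) (snd p)) \<in> borel_measurable borel" for n unfolding q_def borel_prod[symmetric] by measurable
 have [measurable]: "(\<lambda>x. q n (a x) (b x)) \<in> borel_measurable M" if [measurable]: "a \<in> borel_measurable M" "b \<in> borel_measurable M"
  for n and a b :: "'z => real" and M unfolding q_def by measurable
 have "(\<lambda>n. \<integral>\<^sup>+w. ennreal (q n (pairing w f) (pairing w g)) \<partial>P) \<longlonglongrightarrow> (\<integral>\<^sup>+w. ennreal (pairing w f * exp (- pairing w g)) \<partial>P)"
  by (rule nn_integral_LIMSEQ) (auto simp: q_lim incseq_def le_fun_def intro!: incseqD[OF q_inc])
 moreover
 define d where "d n = enn2real (?Q n)" for n
 have bound: "?I < \<infinity>"
 proof -
  have "s * f x * exp (- (s * g x)) <= max 0 s * f x" for s x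
  proof (cases "s \<ge> 0")
   case True
   then show ?thesis using mult_left_le[of "exp (- (s * g x))" "s * f x"] nonneg[OF f] nonneg[OF g] by (auto simp: max_def)
  qed (use nonneg[OF f] in \<open>auto simp: max_def mult_le_0_iff\<close>)
  then have "?I <= (jump_integral (\<lambda>x s. ennreal (max 0 s * f x)))" by (intro nn_integral_mono ennreal_leI)
  also have "... = (jump_integral (\<lambda>x s. ennreal (s * f x)))"
   by (rule nn_integral_cong, rule nn_integral_cong_AE, rule eventually_mono[OF tau_pos]) simp
  also have "... < \<infinity>" by (rule nn_integral_first_moment[OF f])
  finally show ?thesis .
 qed
 have dlim': "(\<lambda>n. ?Q n) \<longlonglongrightarrow>
   ?I"
 proof (rule nn_integral_LIMSEQ)
  show "incseq (\<lambda>n x. \<integral>\<^sup>+s. ennreal (q n (s * f x) (s * g x)) \<partial>\<tau>)"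
   by (auto simp: incseq_def le_fun_def intro!: nn_integral_mono incseqD[OF q_inc])
  show "(\<lambda>n. \<integral>\<^sup>+s. ennreal (q n (s * f x) (s * g x)) \<partial>\<tau>) \<longlonglongrightarrow> (\<integral>\<^sup>+s. ennreal (s * f x * exp (- (s * g x))) \<partial>\<tau>)" for x
   by (rule nn_integral_LIMSEQ) (auto simp: q_lim incseq_def le_fun_def intro!: incseqD[OF q_inc])
 qed measurable
 have dle: "?Q n <=
   ?I" for n
  by (intro nn_integral_mono incseq_le[OF q_inc q_lim])
 have dfin: "?Q n = ennreal (d n)" for n unfolding d_def using dle[of n] bound by (auto intro!: ennreal_enn2real[symmetric])
 define l where "l = enn2real ?I"
 have l: "?I = ennreal l" unfolding l_def using bound by (auto intro!: ennreal_enn2real[symmetric])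
 have d0: "0 <= d n" for n unfolding d_def by simp
 have dlim: "d \<longlonglongrightarrow> l" using dlim' unfolding l dfin by (subst (asm) tendsto_ennreal_iff) (auto simp: d0 l_def)
 have fn: "(\<lambda>x. (1 / 2 ^ n) * f x) \<in> D" for n by (rule scale[OF f]) simp
 \<comment> \<open>The exponent is not linear in the step: going from \<open>g\<close> to g + f /
   2^n adds exactly \<open>d n / 2 ^ n\<close> to \<open>lap\<close>, where \<open>d\<close>
   converges to the jump integral. This is why \<open>exp_quotient_tendsto\<close> allows a varying
   argument.\<close>
 have lapn: "lap (\<lambda>x. g x + (1 / 2 ^ n) * f x) = lap g + d n / 2 ^ n" for n
 proof -
  have "ennreal (lap (\<lambda>x. g x + (1 / 2 ^ n) * f x)) = (jump_integral (\<lambda>x s. ennreal (1 - exp (- (s * (g x + 1 / 2 ^ n * f x))))))"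
   by (rule ennreal_lap[OF add[OF g fn]])
  also have "... = (jump_integral (\<lambda>x s. ennreal (1 - exp (- (s * g x))) + ennreal (1 / 2 ^ n) * ennreal (q n (s * f x) (s * g x))))"
  proof (rule nn_integral_cong, rule nn_integral_cong_AE, rule eventually_mono[OF tau_pos])
   fix x and s :: real assume "x \<in> space \<sigma>" and s: "0 < s"
   have "1 - exp (- (s * (g x + 1 / 2 ^ n * f x))) = (1 - exp (- (s * g x))) + 1 / 2 ^ n * q n (s * f x) (s * g x)"
   proof -
    have "- (s * (g x + 1 / 2 ^ n * f x)) = - (s * g x) + - (s * f x / 2 ^ n)" by (simp add: algebra_simps)
    then have "exp (- (s * (g x + 1 / 2 ^ n * f x))) = exp (- (s * g x)) * exp (- (s * f x / 2 ^ n))" by (simp only: exp_add)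
    then show ?thesis unfolding q_def by (simp add: left_diff_distrib)
   qed
   moreover have "0 <= 1 - exp (- (s * g x))" using s nonneg[OF g, of x] by simp
   moreover have "0 <= q n (s * f x) (s * g x)" unfolding q_def using s nonneg[OF f, of x] by simp
   then have "0 <= 1 / 2 ^ n * q n (s * f x) (s * g x)" by simp
   moreover have "ennreal (1 / 2 ^ n * q n (s * f x) (s * g x)) = ennreal (1 / 2 ^ n) * ennreal (q n (s * f x) (s * g x))"
    by (rule ennreal_mult') simp
   ultimately show "ennreal (1 - exp (- (s * (g x + 1 / 2 ^ n * f x)))) =
     ennreal (1 - exp (- (s * g x))) + ennreal (1 / 2 ^ n) * ennreal (q n (s * f x) (s * g x))"
    by (simp only: ennreal_plus)
  qed
  also have "... = ennreal (lap g) + ennreal (1 / 2 ^ n) * ennreal (d n)"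
   by (simp add: nn_integral_add nn_integral_cmult ennreal_lap[OF g] dfin)
  also have "... = ennreal (lap g + d n / 2 ^ n)" by (simp add: ennreal_mult'[symmetric] d0 lap_def)
  finally show ?thesis using d0[of n] by (subst (asm) ennreal_inj) (auto simp: lap_def)
 qed
 have "(\<integral>\<^sup>+w. ennreal (q n (pairing w f) (pairing w g)) \<partial>P) = ennreal (exp (- lap g) * (2 ^ n * (1 - exp (- (d n / 2 ^ n)))))" for n
 proof -
  let ?gn = "\<lambda>x. g x + (1 / 2 ^ n) * f x"
  have i: "integrable P (\<lambda>w. exp (- pairing w h))" "(LINT w|P. exp (- pairing w h)) = exp (- lap h)" if h[measurable]: "h \<in> D" for h
  proof -
   show "integrable P (\<lambda>w. exp (- pairing w h))"
    by (rule integrableI_nn_integral_finite[where x="exp (- lap h)"]) (auto simp: nn_integral_exp_pairing[OF h])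
   then have "ennreal (LINT w|P. exp (- pairing w h)) = ennreal (exp (- lap h))"
    unfolding nn_integral_exp_pairing[OF h, symmetric] by (rule nn_integral_eq_integral[symmetric]) auto
   then show "(LINT w|P. exp (- pairing w h)) = exp (- lap h)" by simp
  qed
  have e: "q n (pairing w f) (pairing w g) = 2 ^ n * (exp (- pairing w g) - exp (- pairing w ?gn))" if "w \<in> marks" for w
   using pairing_add[OF that csupp[OF g] csupp[OF fn[of n]]] pairing_scale[OF that csupp[OF f], of "1 / 2 ^ n"]
   unfolding q_def by (simp add: algebra_simps exp_add[symmetric] exp_diff exp_minus divide_inverse)
  have q0: "0 <= q n (pairing w f) (pairing w g)" if "w \<in> marks" for w
   unfolding q_def using pairing_nonneg[OF that, of f] nonneg[OF f] by simp
  have "(\<integral>\<^sup>+w. ennreal (q n (pairing w f) (pairing w g)) \<partial>P) = (\<integral>\<^sup>+w. ennreal (2 ^ n * (exp (- pairing w g) - exp (- pairing w ?gn))) \<partial>P)"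
   by (rule nn_integral_cong) (simp add: e)
  also have "... = ennreal (LINT w|P. 2 ^ n * (exp (- pairing w g) - exp (- pairing w ?gn)))"
   by (rule nn_integral_eq_integral) (use i[OF g] i[OF add[OF g fn]] q0 e in \<open>auto intro!: AE_I2\<close>)
  also have "(LINT w|P. 2 ^ n * (exp (- pairing w g) - exp (- pairing w ?gn))) = 2 ^ n * (exp (- lap g) - exp (- lap ?gn))"
   using i[OF g] i[OF add[OF g fn]] by simp
  also have "... = exp (- lap g) * (2 ^ n * (1 - exp (- (d n / 2 ^ n))))"
   unfolding lapn by (simp add: algebra_simps exp_diff exp_minus exp_add[symmetric] divide_inverse)
  finally show ?thesis .
 qed
 moreover have "(\<lambda>n. ennreal (exp (- lap g) * (2 ^ n * (1 - exp (- (d n / 2 ^ n)))))) \<longlonglongrightarrow> ennreal (exp (- lap g) * l)"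
  by (intro tendsto_ennrealI tendsto_mult tendsto_const exp_quotient_tendsto dlim d0)
 ultimately have "(\<integral>\<^sup>+w. ennreal (pairing w f * exp (- pairing w g)) \<partial>P) = ennreal (exp (- lap g) * l)" using LIMSEQ_unique by auto
 then show ?thesis unfolding l by (simp add: ennreal_mult' l_def)
qed

end

context compound_poisson_marks begin

text \<open>Both sides integrate \<open>k\<close> against finite measures on pairs of a point and a
  mark function: \<open>M1\<close> is the Campbell measure weighted by \<open>c\<close>, and
  \<open>M2\<close> the image, under adding a point, of the triple product with density
  \<open>c x * s\<close>. By \<open>nn_integral_pairing_exp_pairing\<close> they agree on the
  functions \<open>f x * exp (- pairing w g)\<close>, which form a multiplicative generating
  class.\<close>

lemma mecke_weighted:
 assumes c[measurable]: "c \<in> D"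
  and k[measurable]: "(\<lambda>(x, w). k x w) \<in> borel_measurable pair_space"
 shows "(\<integral>\<^sup>+w. \<integral>\<^sup>+x. ennreal (w x * c x) * k x w \<partial>count_space UNIV \<partial>P) =
  (jump_integral (\<lambda>x s. \<integral>\<^sup>+w. ennreal (c x * s) * k x (shift x s w) \<partial>P))"
proof -
 let ?N = "borel \<Otimes>\<^sub>M mark_space :: ('a \<times> ('a => real)) measure"
 have spN: "space ?N = UNIV \<times> marks" by (simp add: space_pair_measure)
 define K1 where "K1 w = distr (kernel c w) ?N (\<lambda>x. (x, w))" for w
 have K1: "K1 \<in> measurable mark_space (subprob_algebra ?N)"
  unfolding K1_def by (rule measurable_distr2[OF _ measurable_kernel[OF c]]) measurable
 then have K1P: "K1 \<in> measurable P (subprob_algebra ?N)" using measurable_cong_sets[OF sets_P refl] by blast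
 \<comment> \<open>The density undoes the normalisation built into \<open>kernel\<close>.\<close>
 define M1 where "M1 = density (P \<bind> K1) (\<lambda>(x, w). ennreal (1 + pairing w c))"
 have setsB: "sets (P \<bind> K1) = sets ?N" by (rule sets_bind) (use P.not_empty in \<open>simp_all add: K1_def\<close>)
 have sets1: "sets M1 = sets ?N" unfolding M1_def by (simp add: setsB)
 have pc: "(\<lambda>(x, w). ennreal (1 + pairing w c)) \<in> borel_measurable ?N" by measurable
 have nn1: "(\<integral>\<^sup>+p. h p \<partial>M1) = (\<integral>\<^sup>+w. \<integral>\<^sup>+x. ennreal (w x * c x) * h (x, w) \<partial>count_space UNIV \<partial>P)"
  if h[measurable]: "h \<in> borel_measurable ?N" for h
 proof -
  have "(\<integral>\<^sup>+p. h p \<partial>M1) = (\<integral>\<^sup>+p. (case p of (x, w) => ennreal (1 + pairing w c)) * h p \<partial>(P \<bind> K1))"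
   unfolding M1_def by (rule nn_integral_density) (use pc h measurable_cong_sets[OF setsB refl] in blast)+
  also have "... = (\<integral>\<^sup>+w. \<integral>\<^sup>+p. (case p of (x, w) => ennreal (1 + pairing w c)) * h p \<partial>K1 w \<partial>P)"
   by (rule nn_integral_bind[OF _ K1P]) measurable
  also have "... = (\<integral>\<^sup>+w. \<integral>\<^sup>+x. ennreal (w x * c x) * h (x, w) \<partial>count_space UNIV \<partial>P)"
  proof (rule nn_integral_cong)
   fix w assume "w \<in> space P"
   then have w: "w \<in> marks" by simp
   have hw: "(\<lambda>x. h (x, w)) \<in> borel_measurable borel" using w by simp
   have pw: "(\<lambda>x. (x, w)) \<in> measurable (kernel c w) ?N" using w by (simp add: measurable_cong_sets[OF sets_kernel refl])
   have "(\<integral>\<^sup>+p. (case p of (x, w) => ennreal (1 + pairing w c)) * h p \<partial>K1 w) =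
     (\<integral>\<^sup>+x. ennreal (1 + pairing w c) * h (x, w) \<partial>kernel c w)"
    unfolding K1_def by (subst nn_integral_distr[OF pw]) (use pc h in auto)
   also have "... = ennreal (1 + pairing w c) * (\<integral>\<^sup>+x. h (x, w) \<partial>kernel c w)"
    by (rule nn_integral_cmult) (use hw in \<open>simp add: measurable_cong_sets[OF sets_kernel refl]\<close>)
   finally show "(\<integral>\<^sup>+p. (case p of (x, w) => ennreal (1 + pairing w c)) * h p \<partial>K1 w) =
     (\<integral>\<^sup>+x. ennreal (w x * c x) * h (x, w) \<partial>count_space UNIV)"
    using nn_integral_kernel[OF c w hw] by simp
  qed
  finally show ?thesis .
 qed
 let ?T = "\<sigma> \<Otimes>\<^sub>M (\<tau> \<Otimes>\<^sub>M P)"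
 have setsT: "sets ?T = sets triple_space" by (intro sets_pair_measure_cong sets_P sets_tau sets_sigma)
 define M2 where "M2 = distr (density ?T (\<lambda>(x, s, w). ennreal (c x * s))) ?N (\<lambda>(x, s, w). (x, shift x s w))"
 have sets2: "sets M2 = sets ?N" unfolding M2_def by simp
 have shm: "(\<lambda>(x, s, w). (x, shift x s w)) \<in> measurable triple_space ?N"
 proof -
  have "(\<lambda>p. (fst p, (case p of (x, s, w) => shift x s w))) \<in> measurable triple_space ?N"
   by (rule measurable_Pair) (use measurable_shift in auto)
  then show ?thesis by (simp add: case_prod_beta)
 qed
 interpret tP: pair_sigma_finite \<tau> P ..
 have nn2: "(\<integral>\<^sup>+p. h p \<partial>M2) = (jump_integral (\<lambda>x s. \<integral>\<^sup>+w. ennreal (c x * s) * h (x, shift x s w) \<partial>P))"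
  if h[measurable]: "h \<in> borel_measurable ?N" for h
 proof -
  have hs: "(\<lambda>p. h (case p of (x, s, w) => (x, shift x s w))) \<in> borel_measurable triple_space" by (rule measurable_compose[OF shm h])
  have cs: "(\<lambda>(x, s, w). ennreal (c x * s)) \<in> borel_measurable triple_space" by measurable
  let ?g = "\<lambda>p. (case p of (x, s, w) => ennreal (c x * s)) * h (case p of (x, s, w) => (x, shift x s w))"
  have g: "?g \<in> borel_measurable ?T"
   unfolding measurable_cong_sets[OF setsT refl] using hs cs by (rule borel_measurable_times_ennreal[rotated])
  have "(\<integral>\<^sup>+p. h p \<partial>M2) = (\<integral>\<^sup>+p. ?g p \<partial>?T)" unfolding M2_def
   by (subst nn_integral_distr, use shm setsT in \<open>simp add: measurable_cong_sets[OF setsT refl]\<close>, use h in simp,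
    subst nn_integral_density) (use hs cs in \<open>simp_all add: measurable_cong_sets[OF setsT refl]\<close>)
  also have "... = (\<integral>\<^sup>+x. \<integral>\<^sup>+q. ?g (x, q) \<partial>(\<tau> \<Otimes>\<^sub>M P) \<partial>\<sigma>)"
   by (rule sigma_finite_measure.nn_integral_fst[OF tP.P.sigma_finite_measure_axioms g, symmetric])
  also have "... = (jump_integral (\<lambda>x s. \<integral>\<^sup>+w. ?g (x, s, w) \<partial>P))"
   by (rule nn_integral_cong, rule P.nn_integral_fst[symmetric], rule measurable_Pair2[OF g])
  finally show ?thesis by simp
 qed
 let ?L = "\<lambda>M f g. \<integral>\<^sup>+p. ennreal (f (fst p) * exp (- pairing (snd p) g)) \<partial>M"
 have inner: "?L M1 f g = ?L M2 f g"
   "?L M1 f g < \<infinity>"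
  if g[measurable]: "g \<in> D" and f: "f = (\<lambda>_. 1) \<or> f \<in> D & (\<forall>x. f x <= 1)" for f g
 proof -
  have fm[measurable]: "f \<in> borel_measurable borel" using f by auto
  have f0: "0 <= f x" for x using f nonneg by auto
  have f1: "f x <= 1" for x using f by auto
  have cf: "(\<lambda>x. c x * f x) \<in> D" using f mult c by auto
  let ?R = "jump_integral (\<lambda>x s. ennreal (s * (c x * f x) * exp (- (s * g x))))"
  have m: "(\<lambda>p. ennreal (f (fst p) * exp (- pairing (snd p) g))) \<in> borel_measurable ?N" by measurable
  have "?L M1 f g =
    (\<integral>\<^sup>+w. \<integral>\<^sup>+x. ennreal (w x * c x) * ennreal (f x * exp (- pairing w g)) \<partial>count_space UNIV \<partial>P)"
   by (subst nn1[OF m]) simp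
  also have "... = (\<integral>\<^sup>+w. ennreal (pairing w (\<lambda>x. c x * f x) * exp (- pairing w g)) \<partial>P)"
  proof (rule nn_integral_cong)
   fix w assume "w \<in> space P"
   then have w: "w \<in> marks" by simp
   have "(\<integral>\<^sup>+x. ennreal (w x * c x) * ennreal (f x * exp (- pairing w g)) \<partial>count_space UNIV) =
     (\<integral>\<^sup>+x. ennreal (w x * (c x * f x)) * ennreal (exp (- pairing w g)) \<partial>count_space UNIV)"
    by (rule nn_integral_cong) (simp add: ennreal_mult'[symmetric] ennreal_mult''[symmetric] f0 algebra_simps)
   also have "... = ennreal (pairing w (\<lambda>x. c x * f x)) * ennreal (exp (- pairing w g))"
    by (subst nn_integral_multc) (use nn_integral_pairing[OF w csupp[OF cf]] nonneg[OF cf] in auto)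
   finally show "(\<integral>\<^sup>+x. ennreal (w x * c x) * ennreal (f x * exp (- pairing w g)) \<partial>count_space UNIV) =
     ennreal (pairing w (\<lambda>x. c x * f x) * exp (- pairing w g))"
    by (simp add: ennreal_mult'')
  qed
  also have 1: "... = ennreal (exp (- lap g)) * ?R" by (rule nn_integral_pairing_exp_pairing[OF cf g])
  finally have e1: "?L M1 f g =
   ennreal (exp (- lap g)) * ?R" .
  have "?L M2 f g =
    (jump_integral (\<lambda>x s. \<integral>\<^sup>+w. ennreal (c x * s) * ennreal (f x * exp (- pairing (shift x s w) g)) \<partial>P))"
   by (subst nn2[OF m]) simp
  also have "... = (jump_integral (\<lambda>x s. ennreal (exp (- lap g)) * ennreal (s * (c x * f x) * exp (- (s * g x)))))"
  proof (rule nn_integral_cong, rule nn_integral_cong_AE, rule eventually_mono[OF tau_pos])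
   fix x and s :: real assume "x \<in> space \<sigma>" and s: "0 < s"
   have "(\<integral>\<^sup>+w. ennreal (c x * s) * ennreal (f x * exp (- pairing (shift x s w) g)) \<partial>P) =
     (\<integral>\<^sup>+w. ennreal (s * (c x * f x) * exp (- (s * g x))) * ennreal (exp (- pairing w g)) \<partial>P)"
   proof (rule nn_integral_cong)
    fix w assume "w \<in> space P"
    then have "pairing (shift x s w) g = pairing w g + s * g x" using pairing_shift[OF _ csupp[OF g], of w x s] s by simp
    then have e: "exp (- pairing (shift x s w) g) = exp (- (s * g x)) * exp (- pairing w g)" by (simp add: exp_add[symmetric])
    show "ennreal (c x * s) * ennreal (f x * exp (- pairing (shift x s w) g)) =
      ennreal (s * (c x * f x) * exp (- (s * g x))) * ennreal (exp (- pairing w g))"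
     unfolding e by (simp add: ennreal_mult''[symmetric] ennreal_mult'[symmetric] f0 mult_ac)
   qed
   also have "... = ennreal (s * (c x * f x) * exp (- (s * g x))) * ennreal (exp (- lap g))"
    by (simp add: nn_integral_cmult nn_integral_exp_pairing[OF g])
   finally show "(\<integral>\<^sup>+w. ennreal (c x * s) * ennreal (f x * exp (- pairing (shift x s w) g)) \<partial>P) =
     ennreal (exp (- lap g)) * ennreal (s * (c x * f x) * exp (- (s * g x)))"
    by (simp add: mult.commute)
  qed
  also have "... = ennreal (exp (- lap g)) * ?R" by (simp add: nn_integral_cmult)
  finally show "?L M1 f g = ?L M2 f g" unfolding e1 by simp
  have "?R <= (jump_integral (\<lambda>x s. ennreal (s * (c x * f x))))"
  proof (rule nn_integral_mono, rule nn_integral_mono_AE, rule eventually_mono[OF tau_pos])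
   fix x and s :: real assume "x \<in> space \<sigma>" and s: "0 < s"
   show "ennreal (s * (c x * f x) * exp (- (s * g x))) <= ennreal (s * (c x * f x))"
    using s nonneg[OF cf, of x] nonneg[OF g, of x] by (intro ennreal_leI mult_left_le) auto
  qed
  also have "... < \<infinity>" by (rule nn_integral_first_moment[OF cf])
  finally show "?L M1 f g < \<infinity>" unfolding e1 by (simp add: ennreal_mult_less_top)
 qed
 have tot: "emeasure M1 (space M1) = emeasure M2 (space M2)" "emeasure M1 (space M1) < \<infinity>"
 proof -
  have "emeasure M (space M) = (\<integral>\<^sup>+p. ennreal ((\<lambda>_. 1) (fst p) * exp (- pairing (snd p) (\<lambda>_. 0))) \<partial>M)" for M :: "('a \<times> ('a => real)) measure"
   by (simp add: pairing_def)
  then show "emeasure M1 (space M1) = emeasure M2 (space M2)" "emeasure M1 (space M1) < \<infinity>" using inner[OF zero_in, of "\<lambda>_. 1"] by simp_all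
 qed
 have sp1: "space M1 = UNIV \<times> marks" using sets_eq_imp_space_eq[OF sets1] spN by simp
 have M12: "M1 = M2"
 proof (rule finite_measure_eqI_multiplicative)
  let ?P = "\<lambda>f g. g \<in> D & (f = (\<lambda>_. 1) \<or> f \<in> D & (\<forall>x. f x <= 1))"
  let ?C = "{\<lambda>p. f (fst p) * exp (- pairing (snd p) g) | f g. ?P f g}"
  have P0: "?P f g ==> 0 <= f x & f x <= 1" for f g x using nonneg by auto
  show "finite_measure M1" "finite_measure M2" using tot by (auto intro!: finite_measureI)
  show "sets M2 = sets M1" by (simp add: sets1 sets2)
  have CI: "(\<lambda>p. f (fst p) * exp (- pairing (snd p) g)) \<in> ?C" if "?P f g" for f g
   using that by (intro CollectI exI[of _ f] exI[of _ g]) simp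
  have "(\<lambda>p :: 'a \<times> ('a => real). 1 * exp (- pairing (snd p) (\<lambda>_. 0))) = (\<lambda>_. 1)" by (simp add: pairing_def)
  with CI[of "\<lambda>_. 0" "\<lambda>_. 1"] zero_in show "(\<lambda>_. 1) \<in> ?C" by (simp only: simp_thms)
  have Cm: "(\<lambda>p. f (fst p) * exp (- pairing (snd p) g)) \<in> borel_measurable ?N" if fg: "?P f g" for f g
  proof -
   have [measurable]: "g \<in> D" "f \<in> borel_measurable borel" using fg by auto
   show ?thesis by measurable
  qed
  then show "h \<in> borel_measurable M1" if "h \<in> ?C" for h using that measurable_cong_sets[OF sets1 refl] by blast
  show "\<forall>h\<in>?C. \<forall>p\<in>space M1. \<bar>h p\<bar> <= 1"
  proof (intro ballI)
   fix h p assume "h \<in> ?C" and p: "p \<in> space M1"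
   then obtain f g where fg: "?P f g" and h: "h = (\<lambda>p. f (fst p) * exp (- pairing (snd p) g))" by auto
   have "exp (- pairing (snd p) g) <= 1" using pairing_nonneg[of "snd p" g] nonneg[of g] fg p sp1 by auto
   then show "\<bar>h p\<bar> <= 1" using P0[OF fg, of "fst p"] unfolding h by (auto simp: abs_mult intro!: mult_le_one)
  qed
  show "\<exists>e\<in>?C. \<forall>p\<in>space M1. e p = h p * h' p" if hC: "h \<in> ?C" "h' \<in> ?C" for h h'
  proof -
   obtain f g where fg: "?P f g" and h: "h = (\<lambda>p. f (fst p) * exp (- pairing (snd p) g))" using hC(1) by auto
   obtain f' g' where fg': "?P f' g'" and h': "h' = (\<lambda>p. f' (fst p) * exp (- pairing (snd p) g'))" using hC(2) by auto
   have "?P (\<lambda>x. f x * f' x) (\<lambda>x. g x + g' x)" using fg fg' mult nonneg add by (auto intro!: mult_le_one)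
   from CI[OF this] show ?thesis
    by (rule bexI[rotated]) (use pairing_add[of _ g g'] csupp fg fg' in \<open>auto simp: h h' sp1 exp_add[symmetric]\<close>)
  qed
  show "(LINT p|M1. h p) = (LINT p|M2. h p)" if "h \<in> ?C" for h
  proof -
   obtain f g where fg: "?P f g" and h: "h = (\<lambda>p. f (fst p) * exp (- pairing (snd p) g))" using \<open>h \<in> ?C\<close> by auto
   have "(LINT p|M. h p) = enn2real (\<integral>\<^sup>+p. ennreal (h p) \<partial>M)" if "sets M = sets ?N" for M
    by (rule integral_eq_nn_integral) (use Cm[OF fg] measurable_cong_sets[OF that refl] h P0[OF fg] in auto)
   then show ?thesis using inner(1)[of g f] fg unfolding h by (simp add: sets1 sets2)
  qed
  fix S assume S: "space S = space M1" "!!h. h \<in> ?C ==> h \<in> borel_measurable S"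
  \<comment> \<open>With \<open>g = 0\<close> the class contains the test functions of the point,
    which determine the first coordinate. With \<open>f = 1\<close> it contains
    \<open>exp (- pairing w g)\<close>, whose logarithm recovers the pairings and hence the second
    coordinate.\<close>
  have "(\<lambda>p. fst p) \<in> measurable S borel"
  proof (rule measurable_sigma_sets[OF sets_borel_eq])
   fix A assume "A \<in> {{y. 0 < f y} |f. f \<in> D & (\<forall>y. f y <= 1)}"
   then obtain f where f: "f \<in> D" "\<forall>y. f y <= 1" "A = {y. 0 < f y}" by auto
   have "(\<lambda>p. f (fst p)) \<in> borel_measurable S" using S(2)[OF CI[of "\<lambda>_. 0" f]] f zero_in by (simp add: pairing_def)
   moreover have "fst -` A \<inter> space S = {p \<in> space S. 0 < f (fst p)}" unfolding f by auto
   ultimately show "fst -` A \<inter> space S \<in> sets S" unfolding borel_measurable_iff_greater by simp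
  qed auto
  moreover have "(\<lambda>p. snd p) \<in> measurable S mark_space"
  proof (rule measurable_mark_spaceI)
   fix g assume g: "g \<in> D"
   have [measurable]: "(\<lambda>p. 1 * exp (- pairing (snd p) g)) \<in> borel_measurable S" by (rule S(2)[OF CI[of g "\<lambda>_. 1"]]) (use g in simp)
   have "(\<lambda>p. - ln (1 * exp (- pairing (snd p) g))) \<in> borel_measurable S" by measurable
   then show "(\<lambda>p. pairing (snd p) g) \<in> borel_measurable S" by simp
  qed (use S(1) sp1 in auto)
  ultimately have "(\<lambda>p. (fst p, snd p)) \<in> measurable S ?N" by (rule measurable_Pair)
  then show "(\<lambda>p. p) \<in> measurable S M1" unfolding measurable_cong_sets[OF refl sets1] by simp
 qed
 show ?thesis using nn1[OF k] nn2[OF k] unfolding M12 by simp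
qed

end

section \<open>Unweighted sums over the atoms\<close>

context test_cone begin

text \<open>Dividing by \<open>c x * w x\<close> undoes the weight of the Campbell measure: on the
  atoms seen by \<open>c\<close> this product is positive and finite, so the factors cancel in
  \<open>ennreal\<close>.\<close>

lemma nn_integral_unweighted:
 assumes c: "c \<in> D" and w: "w \<in> marks" and k0: "!!x. c x = 0 ==> k x = 0"
 shows "(\<integral>\<^sup>+x. ennreal (w x * c x) * (k x * ennreal (1 / (c x * w x))) \<partial>count_space UNIV) =
  (\<Sum>x\<in>atoms w c. k x)"
proof -
 have fin: "finite (atoms w c)" by (rule finite_marks[OF w csupp[OF c]])
 have "(\<integral>\<^sup>+x. ennreal (w x * c x) * (k x * ennreal (1 / (c x * w x))) \<partial>count_space UNIV) =
   (\<Sum>x\<in>atoms w c. ennreal (w x * c x) * (k x * ennreal (1 / (c x * w x))))"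
  by (rule nn_integral_count_space') (use fin in auto)
 also have "... = (\<Sum>x\<in>atoms w c. k x)"
 proof (rule sum.cong[OF refl])
  fix x assume "x \<in> atoms w c"
  then have p: "0 < w x * c x" using marks_nonneg[OF w, of x] nonneg[OF c, of x] by (simp add: less_le)
  have "ennreal (w x * c x) * (k x * ennreal (1 / (c x * w x))) = k x * (ennreal (w x * c x) * ennreal (1 / (w x * c x)))"
   by (simp add: ac_simps)
  also have "ennreal (w x * c x) * ennreal (1 / (w x * c x)) = 1" using p by (subst ennreal_mult'[symmetric]) auto
  finally show "ennreal (w x * c x) * (k x * ennreal (1 / (c x * w x))) = k x" by simp
 qed
 finally show ?thesis .
qed

lemma measurable_unweighted:
 assumes c[measurable]: "c \<in> D" and k: "(\<lambda>(x, w). k x w) \<in> borel_measurable pair_space"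
 shows "(\<lambda>(x, w). k x w * ennreal (1 / (c x * w x))) \<in> borel_measurable pair_space"
proof -
 have c': "(\<lambda>p. c (fst p)) \<in> borel_measurable pair_space" by measurable
 have "(\<lambda>p. (case p of (x, w) => k x w) * ennreal (1 / (c (fst p) * (case p of (x, w) => w x)))) \<in> borel_measurable pair_space"
  by (intro borel_measurable_times_ennreal k measurable_compose[OF _ measurable_ennreal] borel_measurable_divide
   borel_measurable_times borel_measurable_const c' measurable_mass)
 then show ?thesis by (simp add: case_prod_beta)
qed

text \<open>Reinstating the weight turns a sum over random points into an integral against
  \<open>kernel\<close>. The division by \<open>w x\<close> is the reason why joint measurability of
  the mass was needed.\<close>

lemma measurable_sum_marks:
 assumes c[measurable]: "c \<in> D" and k: "(\<lambda>(x, w). k x w :: ennreal) \<in> borel_measurable pair_space"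
  and k0: "!!x w. c x = 0 ==> k x w = 0"
 shows "(\<lambda>w. \<Sum>x\<in>atoms w c. k x w) \<in> borel_measurable mark_space"
proof -
 have "(\<lambda>(w, x). k x w * ennreal (1 / (c x * w x))) \<in> borel_measurable (mark_space \<Otimes>\<^sub>M borel)"
  using measurable_compose[OF measurable_pair_swap' measurable_unweighted[OF c k]] by (simp add: case_prod_beta')
 from measurable_weighted_sum[OF c this] show ?thesis
  by (rule measurable_cong[THEN iffD1, rotated]) (use nn_integral_unweighted[OF c, of _ "\<lambda>x. k x w" for w] k0 in simp)
qed

lemma measurable_sum_marks_real:
 assumes c[measurable]: "c \<in> D" and k[measurable]: "(\<lambda>(x, w). k x w :: real) \<in> borel_measurable pair_space"
  and k0: "!!x w. c x = 0 ==> k x w = 0"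
 shows "(\<lambda>w. \<Sum>x\<in>atoms w c. k x w) \<in> borel_measurable mark_space"
proof -
 have *: "(\<lambda>w. \<Sum>x\<in>atoms w c. max 0 (u * k x w)) \<in> borel_measurable mark_space" for u
 proof -
  have "(\<lambda>p. ennreal (u * (case p of (x, w) => k x w))) \<in> borel_measurable pair_space" by measurable
  then have "(\<lambda>(x, w). ennreal (u * k x w)) \<in> borel_measurable pair_space" by (simp add: case_prod_beta)
  from measurable_sum_marks[OF c this]
  have "(\<lambda>w. enn2real (\<Sum>x\<in>atoms w c. ennreal (u * k x w))) \<in> borel_measurable mark_space"
   using k0 by (intro borel_measurable_enn2real) simp
  moreover have "enn2real (\<Sum>x\<in>S. ennreal (u * k x w)) = (\<Sum>x\<in>S. max 0 (u * k x w))" for S w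
  proof -
   have "(\<Sum>x\<in>S. ennreal (u * k x w)) = (\<Sum>x\<in>S. ennreal (max 0 (u * k x w)))" by (simp add: ennreal_max_0)
   also have "... = ennreal (\<Sum>x\<in>S. max 0 (u * k x w))" by (rule sum_ennreal) simp
   finally show ?thesis by (simp add: sum_nonneg)
  qed
  ultimately show ?thesis by simp
 qed
 have "k x w = max 0 (1 * k x w) - max 0 (-1 * k x w)" for x w by (simp add: max_def)
 then have "(\<lambda>w. \<Sum>x\<in>atoms w c. k x w) =
  (\<lambda>w. (\<Sum>x\<in>atoms w c. max 0 (1 * k x w)) - (\<Sum>x\<in>atoms w c. max 0 (-1 * k x w)))"
  by (simp only: sum_subtractf[symmetric])
 then show ?thesis using borel_measurable_diff[OF *[of 1] *[of "-1"]] by simp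
qed

end

section \<open>The Mecke formula and second moments\<close>

context compound_poisson_marks begin

lemma emeasure_P: "emeasure P marks = 1" using P.emeasure_space_1 by simp

text \<open>Exchange the order of integration: for fixed \<open>w\<close> the atoms seen by
  \<open>c\<close> are finite in number and \<open>\<sigma>\<close> has no atoms, so the exceptional
  set is null. Hence a point drawn from \<open>\<sigma>\<close> is almost surely new, and after
  \<open>shift\<close> its mark is exactly \<open>s\<close>.\<close>

lemma AE_no_mass:
 assumes c[measurable]: "c \<in> D"
 shows "AE x in \<sigma>. AE w in P. c x ~= 0 --> w x = 0"
proof -
 interpret sP: pair_sigma_finite \<sigma> P ..
 have sets: "sets (\<sigma> \<Otimes>\<^sub>M P) = sets pair_space" by (intro sets_pair_measure_cong sets_P sets_sigma)
 let ?h = "\<lambda>(x, w). indicator {p. c (fst p) ~= 0 & (case p of (x, w) => w x) ~= 0} (x, w) :: ennreal"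
 have c': "(\<lambda>p. c (fst p)) \<in> borel_measurable pair_space" by measurable
 have "{p \<in> space pair_space. c (fst p) ~= 0 & (case p of (x, w) => w x) ~= 0} \<in> sets pair_space"
 proof -
  have "(\<lambda>p. c (fst p) * (case p of (x, w) => w x)) \<in> borel_measurable pair_space" by (rule borel_measurable_times[OF c' measurable_mass])
  from borel_measurable_neq[OF this borel_measurable_const[of 0]] show ?thesis by simp
 qed
 then have "indicator {p \<in> space pair_space. c (fst p) ~= 0 & (case p of (x, w) => w x) ~= 0} \<in> borel_measurable pair_space"
  by (rule borel_measurable_indicator)
 then have h': "?h \<in> borel_measurable pair_space" by (rule measurable_cong[THEN iffD1, rotated]) (auto simp: indicator_def)
 then have h: "?h \<in> borel_measurable (\<sigma> \<Otimes>\<^sub>M P)" by (simp add: measurable_cong_sets[OF sets refl])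
 have "(\<integral>\<^sup>+x. \<integral>\<^sup>+w. ?h (x, w) \<partial>P \<partial>\<sigma>) = (\<integral>\<^sup>+w. \<integral>\<^sup>+x. ?h (x, w) \<partial>\<sigma> \<partial>P)"
  using sP.Fubini[OF h] by (simp add: P.nn_integral_fst[OF h, symmetric])
 also have "... = (\<integral>\<^sup>+w. 0 \<partial>P)"
 proof (rule nn_integral_cong)
  fix w assume "w \<in> space P"
  then have fin: "finite (atoms w c)" using finite_marks[OF _ csupp[OF c]] by simp
  have "(\<integral>\<^sup>+x. ?h (x, w) \<partial>\<sigma>) = (\<integral>\<^sup>+x. indicator (atoms w c) x \<partial>\<sigma>)" by (rule nn_integral_cong) (auto simp: indicator_def)
  also have "... = emeasure \<sigma> (atoms w c)" by (rule nn_integral_indicator) (simp add: sets_sigma fin finite_imp_closed)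
  also have "... = (\<Sum>x\<in>atoms w c. emeasure \<sigma> {x})" by (rule emeasure_eq_sum_singleton[OF fin]) (simp add: sets_sigma)
  finally show "(\<integral>\<^sup>+x. ?h (x, w) \<partial>\<sigma>) = 0" by (simp add: sigma_nonatomic)
 qed
 finally have 0: "(\<integral>\<^sup>+x. \<integral>\<^sup>+w. ?h (x, w) \<partial>P \<partial>\<sigma>) = 0" by simp
 have "(\<lambda>x. \<integral>\<^sup>+w. ?h (x, w) \<partial>P) \<in> borel_measurable \<sigma>" using P.borel_measurable_nn_integral_fst[OF h] .
 with 0 have "AE x in \<sigma>. (\<integral>\<^sup>+w. ?h (x, w) \<partial>P) = 0" using nn_integral_0_iff_AE by blast
 then show ?thesis
 proof eventually_elim
  fix x assume 0: "(\<integral>\<^sup>+w. ?h (x, w) \<partial>P) = 0"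
  have "(\<lambda>w. ?h (x, w)) \<in> borel_measurable P" by (rule measurable_Pair2[OF h]) simp
  with 0 have "AE w in P. ?h (x, w) = 0" using nn_integral_0_iff_AE by blast
  then show "AE w in P. c x ~= 0 --> w x = 0" by eventually_elim (auto simp: indicator_def)
 qed
qed

text \<open>The weighted formula is applied to \<open>k\<close> divided by \<open>c x * w x\<close>.
  After the shift the weight \<open>c x * s\<close> meets the reciprocal of
  \<open>c x * (w x + s)\<close>, and these cancel because \<open>w x\<close> is almost surely
  0.\<close>

lemma mecke:
 assumes c[measurable]: "c \<in> D"
  and k[measurable]: "(\<lambda>(x, w). k x w) \<in> borel_measurable pair_space"
  and k0: "!!x w. c x = 0 ==> k x w = 0"
 shows "(\<integral>\<^sup>+w. (\<Sum>x\<in>atoms w c. k x w) \<partial>P) =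
  (jump_integral (\<lambda>x s. \<integral>\<^sup>+w. k x (shift x s w) \<partial>P))"
proof -
 have "(\<integral>\<^sup>+w. (\<Sum>x\<in>atoms w c. k x w) \<partial>P) =
   (\<integral>\<^sup>+w. \<integral>\<^sup>+x. ennreal (w x * c x) * (k x w * ennreal (1 / (c x * w x))) \<partial>count_space UNIV \<partial>P)"
  by (rule nn_integral_cong) (use nn_integral_unweighted[OF c] k0 in simp)
 also have "... = (jump_integral (\<lambda>x s. \<integral>\<^sup>+w. ennreal (c x * s) * (k x (shift x s w) * ennreal (1 / (c x * shift x s w x))) \<partial>P))"
  by (rule mecke_weighted[OF c measurable_unweighted[OF c k]])
 also have "... = (jump_integral (\<lambda>x s. \<integral>\<^sup>+w. k x (shift x s w) \<partial>P))"
 proof (rule nn_integral_cong_AE, rule eventually_mono[OF AE_no_mass[OF c]],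
   rule nn_integral_cong_AE, rule eventually_mono[OF tau_pos], rule nn_integral_cong_AE, erule eventually_mono)
  fix x and w :: "'a => real" and s :: real assume s: "0 < s" and w: "c x ~= 0 --> w x = 0"
  show "ennreal (c x * s) * (k x (shift x s w) * ennreal (1 / (c x * shift x s w x))) = k x (shift x s w)"
  proof (cases "c x = 0")
   case False
   then have p: "0 < c x * s" using nonneg[OF c, of x] s by (simp add: less_le)
   have "ennreal (c x * s) * (k x (shift x s w) * ennreal (1 / (c x * shift x s w x))) =
     k x (shift x s w) * (ennreal (c x * s) * ennreal (1 / (c x * s)))"
    using w False s by (simp add: shift_def ac_simps)
   also have "ennreal (c x * s) * ennreal (1 / (c x * s)) = 1" using p by (subst ennreal_mult'[symmetric]) auto
   finally show ?thesis by simp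
  qed (simp add: k0)
 qed
 finally show ?thesis .
qed

abbreviation "triple \<equiv> \<sigma> \<Otimes>\<^sub>M (\<tau> \<Otimes>\<^sub>M P)"

lemma sets_triple: "sets triple = sets triple_space" by (intro sets_pair_measure_cong sets_P sets_tau sets_sigma)

lemma nn_integral_triple:
 assumes g: "g \<in> borel_measurable triple_space"
 shows "(\<integral>\<^sup>+p. g p \<partial>triple) = (jump_integral (\<lambda>x s. \<integral>\<^sup>+w. g (x, s, w) \<partial>P))"
proof -
 interpret tP: pair_sigma_finite \<tau> P ..
 have g: "g \<in> borel_measurable triple" using g by (simp add: measurable_cong_sets[OF sets_triple refl])
 have "(\<integral>\<^sup>+p. g p \<partial>triple) = (\<integral>\<^sup>+x. \<integral>\<^sup>+q. g (x, q) \<partial>(\<tau> \<Otimes>\<^sub>M P) \<partial>\<sigma>)"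
  by (rule sigma_finite_measure.nn_integral_fst[OF tP.P.sigma_finite_measure_axioms g, symmetric])
 also have "... = (jump_integral (\<lambda>x s. \<integral>\<^sup>+w. g (x, s, w) \<partial>P))"
  by (rule nn_integral_cong, rule P.nn_integral_fst[symmetric], rule measurable_Pair2[OF g])
 finally show ?thesis .
qed

lemma measurable_shifted:
 assumes k: "(\<lambda>(x, w). k x w) \<in> measurable pair_space N"
 shows "(\<lambda>(x, s, w). k x (shift x s w)) \<in> measurable triple_space N"
proof -
 have "(\<lambda>p. (fst p, (case p of (x, s, w) => shift x s w))) \<in> measurable triple_space pair_space"
  by (rule measurable_Pair) (use measurable_shift in auto)
 from measurable_compose[OF this k] show ?thesis by (simp add: case_prod_beta)
qed

text \<open>One statement with a parameter \<open>u\<close> covers the positive part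
  (\<open>u = 1\<close>) and the negative part (\<open>u = -1\<close>); both are controlled by
  integrability on the triple product.\<close>

lemma mecke_integral:
 fixes k :: "'a => ('a => real) => real"
 assumes c[measurable]: "c \<in> D"
  and k: "(\<lambda>(x, w). k x w) \<in> borel_measurable pair_space"
  and k0: "!!x w. c x = 0 ==> k x w = 0"
  and int: "integrable triple (\<lambda>(x, s, w). k x (shift x s w))"
 shows "integrable P (\<lambda>w. \<Sum>x\<in>atoms w c. k x w)"
  and "(LINT w|P. (\<Sum>x\<in>atoms w c. k x w)) = (LINT p|triple. (case p of (x, s, w) => k x (shift x s w)))"
proof -
 let ?S = "\<lambda>w. atoms w c"
 let ?k = "\<lambda>u x w. max 0 (u * k x w)"
 have *: "integrable P (\<lambda>w. \<Sum>x\<in>?S w. ?k u x w) &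
   (LINT w|P. (\<Sum>x\<in>?S w. ?k u x w)) = (LINT p|triple. (case p of (x, s, w) => ?k u x (shift x s w)))" for u
 proof -
  have "(\<lambda>p. max 0 (u * (case p of (x, w) => k x w))) \<in> borel_measurable pair_space" using k by measurable
  then have ku: "(\<lambda>(x, w). ?k u x w) \<in> borel_measurable pair_space" by (simp add: case_prod_beta)
  have kn: "(\<lambda>(x, w). ennreal (?k u x w)) \<in> borel_measurable pair_space"
   using measurable_compose[OF ku measurable_ennreal] by (simp add: case_prod_beta)
  have "(\<lambda>w. \<Sum>x\<in>?S w. ?k u x w) \<in> borel_measurable mark_space" by (rule measurable_sum_marks_real[OF c ku]) (simp add: k0)
  then have mP: "(\<lambda>w. \<Sum>x\<in>?S w. ?k u x w) \<in> borel_measurable P" by simp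
  have it: "integrable triple (\<lambda>p. max 0 (u * (case p of (x, s, w) => k x (shift x s w))))" using int by simp
  have tm: "(\<lambda>(x, s, w). ennreal (?k u x (shift x s w))) \<in> borel_measurable triple_space" using measurable_shifted[OF kn] .
  have "(\<integral>\<^sup>+w. ennreal (\<Sum>x\<in>?S w. ?k u x w) \<partial>P) = (\<integral>\<^sup>+w. (\<Sum>x\<in>?S w. ennreal (?k u x w)) \<partial>P)"
   by (rule nn_integral_cong, rule sum_ennreal[symmetric]) simp
  also have "... = (jump_integral (\<lambda>x s. \<integral>\<^sup>+w. ennreal (?k u x (shift x s w)) \<partial>P))" by (rule mecke[OF c kn]) (simp add: k0)
  also have "... = (\<integral>\<^sup>+p. (case p of (x, s, w) => ennreal (?k u x (shift x s w))) \<partial>triple)" using nn_integral_triple[OF tm] by simp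
  also have "... = (\<integral>\<^sup>+p. ennreal (max 0 (u * (case p of (x, s, w) => k x (shift x s w)))) \<partial>triple)"
   by (rule nn_integral_cong) (auto split: prod.split)
  also have "... = ennreal (LINT p|triple. max 0 (u * (case p of (x, s, w) => k x (shift x s w))))"
   by (rule nn_integral_eq_integral[OF it]) simp
  finally have e: "(\<integral>\<^sup>+w. ennreal (\<Sum>x\<in>?S w. ?k u x w) \<partial>P) =
   ennreal (LINT p|triple. max 0 (u * (case p of (x, s, w) => k x (shift x s w))))" .
  have i: "integrable P (\<lambda>w. \<Sum>x\<in>?S w. ?k u x w)" by (rule integrableI_nn_integral_finite[OF mP _ e]) (auto intro!: sum_nonneg)
  moreover have "(LINT w|P. (\<Sum>x\<in>?S w. ?k u x w)) = (LINT p|triple. max 0 (u * (case p of (x, s, w) => k x (shift x s w))))"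
   using integral_eq_nn_integral[OF mP] e by (simp add: sum_nonneg)
  ultimately show ?thesis by (simp add: case_prod_beta)
 qed
 have s: "k x w = max 0 (1 * k x w) - max 0 (-1 * k x w)" for x w by (simp add: max_def)
 have sS: "(\<Sum>x\<in>?S w. k x w) = (\<Sum>x\<in>?S w. ?k 1 x w) - (\<Sum>x\<in>?S w. ?k (-1) x w)" for w unfolding sum_subtractf[symmetric] using s by simp
 show "integrable P (\<lambda>w. \<Sum>x\<in>?S w. k x w)" unfolding sS using *[of 1] *[of "-1"] by (intro Bochner_Integration.integrable_diff) auto
 have i: "integrable triple (\<lambda>p. case p of (x, s, w) => ?k u x (shift x s w))" for u
 proof -
  have "integrable triple (\<lambda>p. max 0 (u * (case p of (x, s, w) => k x (shift x s w))))" using int by simp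
  then show ?thesis by (simp add: case_prod_beta)
 qed
 have "(LINT w|P. (\<Sum>x\<in>?S w. k x w)) =
   (LINT p|triple. (case p of (x, s, w) => ?k 1 x (shift x s w))) - (LINT p|triple. (case p of (x, s, w) => ?k (-1) x (shift x s w)))"
  unfolding sS using *[of 1] *[of "-1"] by (subst Bochner_Integration.integral_diff) auto
 also have "... = (LINT p|triple. (case p of (x, s, w) => ?k 1 x (shift x s w)) - (case p of (x, s, w) => ?k (-1) x (shift x s w)))"
  by (rule Bochner_Integration.integral_diff[OF i i, symmetric])
 also have "... = (LINT p|triple. (case p of (x, s, w) => k x (shift x s w)))"
  by (rule Bochner_Integration.integral_cong[OF refl]) (auto split: prod.split simp: max_def)
 finally show "(LINT w|P. (\<Sum>x\<in>?S w. k x w)) = (LINT p|triple. (case p of (x, s, w) => k x (shift x s w)))" .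
qed

text \<open>One factor of the square is expanded over the atoms, and the other is kept in the
  integrand of the Mecke formula. Adding a point turns \<open>A\<close> into
  \<open>A + a x s\<close>, so the result is the square of the first moment plus the integral of
  a^2.\<close>

lemma second_moment_finite:
 fixes a :: "'a => real => real"
 assumes c[measurable]: "c \<in> D"
  and a[measurable]: "(\<lambda>(x, s). a x s) \<in> borel_measurable (borel \<Otimes>\<^sub>M borel)"
  and a_nonneg: "!!x s. 0 <= a x s" and a0: "!!x s. c x = 0 ==> a x s = 0"
  and fin1: "(jump_integral (\<lambda>x s. ennreal (a x s))) < \<infinity>"
  and fin2: "(jump_integral (\<lambda>x s. ennreal ((a x s)\<^sup>2))) < \<infinity>"
 shows "(\<integral>\<^sup>+w. ennreal ((\<Sum>x\<in>atoms w c. a x (w x))\<^sup>2) \<partial>P) < \<infinity>"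
proof -
 let ?S = "\<lambda>w. atoms w c"
 define A where "A w = (\<Sum>x\<in>?S w. a x (w x))" for w
 have A0: "0 <= A w" for w unfolding A_def by (intro sum_nonneg a_nonneg)
 have am: "(\<lambda>(x, w). a x (w x)) \<in> borel_measurable pair_space"
 proof -
  have "(\<lambda>p. (fst p, (case p of (x, w) => w x))) \<in> measurable pair_space (borel \<Otimes>\<^sub>M borel)"
   by (rule measurable_Pair) (use measurable_mass in auto)
  from measurable_compose[OF this a] show ?thesis by (simp add: case_prod_beta)
 qed
 have amn: "(\<lambda>(x, w). ennreal (a x (w x))) \<in> borel_measurable pair_space"
  using measurable_compose[OF am measurable_ennreal] by (simp add: case_prod_beta)
 have Am: "A \<in> borel_measurable mark_space" unfolding A_def by (rule measurable_sum_marks_real[OF c am]) (simp add: a0)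
 have A2: "(\<lambda>p. A (snd p)) \<in> borel_measurable pair_space" by (rule measurable_compose[OF measurable_snd Am])
 let ?I = "jump_integral (\<lambda>x s. ennreal (a x s))"
 have first: "(\<integral>\<^sup>+w. ennreal (A w) \<partial>P) = ?I"
 proof -
  have "(\<integral>\<^sup>+w. ennreal (A w) \<partial>P) = (\<integral>\<^sup>+w. (\<Sum>x\<in>?S w. ennreal (a x (w x))) \<partial>P)"
   unfolding A_def by (rule nn_integral_cong) (simp add: sum_ennreal a_nonneg)
  also have "... = (jump_integral (\<lambda>x s. \<integral>\<^sup>+w. ennreal (a x (shift x s w x)) \<partial>P))" by (rule mecke[OF c amn]) (simp add: a0)
  also have "... = (jump_integral (\<lambda>x s. \<integral>\<^sup>+w. ennreal (a x s) \<partial>P))"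
  proof (rule nn_integral_cong_AE, rule eventually_mono[OF AE_no_mass[OF c]],
    rule nn_integral_cong_AE, rule eventually_mono[OF tau_pos], rule nn_integral_cong_AE, erule eventually_mono)
   fix x and w :: "'a => real" and s :: real assume "0 < s" and "c x ~= 0 --> w x = 0"
   then show "ennreal (a x (shift x s w x)) = ennreal (a x s)" by (cases "c x = 0") (auto simp: a0 shift_def)
  qed
  finally show ?thesis by (simp add: emeasure_P)
 qed
 have km: "(\<lambda>(x, w). ennreal (a x (w x)) * ennreal (A w)) \<in> borel_measurable pair_space"
  using borel_measurable_times_ennreal[OF amn measurable_compose[OF A2 measurable_ennreal]] by (simp add: case_prod_beta)
 have "(\<integral>\<^sup>+w. ennreal ((A w)\<^sup>2) \<partial>P) = (\<integral>\<^sup>+w. (\<Sum>x\<in>?S w. ennreal (a x (w x)) * ennreal (A w)) \<partial>P)"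
 proof (rule nn_integral_cong)
  fix w
  have "(\<Sum>x\<in>?S w. ennreal (a x (w x)) * ennreal (A w)) = (\<Sum>x\<in>?S w. ennreal (a x (w x))) * ennreal (A w)"
   by (rule sum_distrib_right[symmetric])
  also have "(\<Sum>x\<in>?S w. ennreal (a x (w x))) = ennreal (A w)" unfolding A_def by (simp add: sum_ennreal a_nonneg)
  finally show "ennreal ((A w)\<^sup>2) = (\<Sum>x\<in>?S w. ennreal (a x (w x)) * ennreal (A w))" by (simp add: power2_eq_square ennreal_mult' A0)
 qed
 also have "... = (jump_integral (\<lambda>x s. \<integral>\<^sup>+w. ennreal (a x (shift x s w x)) * ennreal (A (shift x s w)) \<partial>P))"
  by (rule mecke[OF c km]) (simp add: a0)
 \<comment> \<open>The new point contributes its own term once and leaves the marks of the others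
   unchanged, because it is not an old atom.\<close>
 also have "... = (jump_integral (\<lambda>x s. \<integral>\<^sup>+w. ennreal (a x s) * ennreal (A w) + ennreal ((a x s)\<^sup>2) \<partial>P))"
 proof (rule nn_integral_cong_AE, rule eventually_mono[OF AE_no_mass[OF c]],
   rule nn_integral_cong_AE, rule eventually_mono[OF tau_pos], rule nn_integral_cong_AE,
   erule eventually_elim2[OF AE_space])
  fix x and w :: "'a => real" and s :: real assume s: "0 < s" and w: "c x ~= 0 --> w x = 0" and "w \<in> space P"
  then have wm: "w \<in> marks" by simp
  show "ennreal (a x (shift x s w x)) * ennreal (A (shift x s w)) = ennreal (a x s) * ennreal (A w) + ennreal ((a x s)\<^sup>2)"
  proof (cases "c x = 0")
   case False
   then have S: "?S (shift x s w) = insert x (?S w)" "x \<notin> ?S w" "w x = 0" using w s by (auto simp: shift_def)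
   have "A (shift x s w) = a x s + A w"
   proof -
    have "(\<Sum>y\<in>?S w. a y (shift x s w y)) = (\<Sum>y\<in>?S w. a y (w y))" by (rule sum.cong) (use S(3) in \<open>auto simp: shift_def\<close>)
    then show ?thesis unfolding A_def S(1) using S(2,3) s finite_marks[OF wm csupp[OF c]] by (simp add: shift_def)
   qed
   then show ?thesis using S(3) s A0[of w] a_nonneg[of x s]
    by (simp add: shift_def power2_eq_square ennreal_mult'[symmetric] distrib_left add.commute ennreal_plus[symmetric] del: ennreal_plus)
  qed (simp add: a0)
 qed
 also have "... = (jump_integral (\<lambda>x s. ennreal (a x s) * ?I + ennreal ((a x s)\<^sup>2)))"
 proof -
  have "A \<in> borel_measurable P" using Am by simp
  then have "(\<lambda>w. ennreal (A w)) \<in> borel_measurable P" by (rule measurable_compose[OF _ measurable_ennreal])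
  then show ?thesis by (simp add: nn_integral_add nn_integral_cmult first emeasure_P)
 qed
 also have "... = ?I * ?I + (jump_integral (\<lambda>x s. ennreal ((a x s)\<^sup>2)))" by (simp add: nn_integral_add nn_integral_multc)
 also have "... < \<infinity>" using fin1 fin2 by (simp add: ennreal_mult_less_top)
 finally show ?thesis unfolding A_def .
qed

end

section \<open>Smooth functions in coordinates\<close>

text \<open>\<open>partials\<close> adds new derivatives on the outside, where nothing is known
  about the function to be differentiated. Here the derivative of \<open>f\<close> itself is split
  off first, so product and chain rules apply to it and the induction hypothesis to the resulting
  terms.\<close>

fun diff_upto :: "nat => (real^'n) set => (real^'n::finite => 'b::real_normed_vector) => bool" where
 "diff_upto 0 S f \<longleftrightarrow> (\<forall>x\<in>S. f differentiable (at x))"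
| "diff_upto (Suc k) S f \<longleftrightarrow> (\<forall>x\<in>S. f differentiable (at x)) & (\<forall>i. diff_upto k S (partial i f))"

lemma partials_append: "partials (is @ js) f = partials is (partials js f)" by (induction "is") auto

lemma diff_upto_iff: "diff_upto k S f \<longleftrightarrow> (\<forall>is. length is <= k --> (\<forall>x\<in>S. partials is f differentiable (at x)))"
proof (induction k arbitrary: f)
 case (Suc k)
 show ?case
 proof
  assume l: "diff_upto (Suc k) S f"
  show "\<forall>is. length is <= Suc k --> (\<forall>x\<in>S. partials is f differentiable (at x))"
  proof (intro allI impI)
   fix "is" :: "'a list" assume "length is <= Suc k"
   then show "\<forall>x\<in>S. partials is f differentiable (at x)"
   proof (cases "is" rule: rev_cases)
    case (snoc js i)
    then show ?thesis using l Suc.IH[of "partial i f"] \<open>length is <= Suc k\<close> by (simp add: partials_append)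
   qed (use l in simp)
  qed
 next
  assume r: "\<forall>is. length is <= Suc k --> (\<forall>x\<in>S. partials is f differentiable (at x))"
  have "diff_upto k S (partial i f)" for i unfolding Suc.IH
  proof (intro allI impI)
   fix js :: "'a list" assume "length js <= k"
   then show "\<forall>x\<in>S. partials js (partial i f) differentiable (at x)" using r[rule_format, of "js @ [i]"] by (simp add: partials_append)
  qed
  then show "diff_upto (Suc k) S f" using r[rule_format, of "[]"] by simp
 qed
qed simp

lemma smooth_on_iff: "smooth_on S f \<longleftrightarrow> (\<forall>k. diff_upto k S f)" unfolding smooth_on_def diff_upto_iff by (meson le_refl)

lemma smooth_on_differentiable: "smooth_on S f ==> x \<in> S ==> f differentiable (at x)" unfolding smooth_on_iff by (metis diff_upto.simps(1))

lemma smooth_on_partial: "smooth_on S f ==> smooth_on S (partial i f)" unfolding smooth_on_iff by (metis diff_upto.simps(2))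

lemma smooth_on_subset: "smooth_on S f ==> T \<subseteq> S ==> smooth_on T f" unfolding smooth_on_def by blast

lemma smooth_on_continuous_on: "smooth_on S f ==> continuous_on S f"
 by (meson continuous_at_imp_continuous_on differentiable_imp_continuous_within smooth_on_differentiable)

lemma partial_eq: "(f has_derivative f') (at x) ==> partial i f x = f' (axis i 1)" unfolding partial_def using frechet_derivative_at by metis

lemma partial_cong:
 assumes "f differentiable (at x)" "open S" "x \<in> S" "!!y. y \<in> S ==> f y = g y"
 shows "partial i g x = partial i f x" unfolding partial_def using frechet_derivative_transform_within_open[OF assms] by simp

lemma differentiable_cong_open:
 assumes "f differentiable (at x)" "open S" "x \<in> S" "!!y. y \<in> S ==> f y = g y"
 shows "g differentiable (at x)"
proof -
 obtain f' where "(f has_derivative f') (at x)" using assms(1) unfolding differentiable_def by blast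
 then have "(g has_derivative f') (at x)" by (rule has_derivative_transform_within_open) (use assms in auto)
 then show ?thesis unfolding differentiable_def by blast
qed

lemma diff_upto_cong:
 assumes "open S" "diff_upto k S f" "!!y. y \<in> S ==> f y = g y"
 shows "diff_upto k S g" using assms(2,3)
proof (induction k arbitrary: f g)
 case 0
 then show ?case by (auto intro: differentiable_cong_open[OF _ assms(1)])
next
 case (Suc k)
 have "diff_upto k S (partial i g)" for i
 proof (rule Suc.IH)
  show "diff_upto k S (partial i f)" using Suc.prems by simp
  show "partial i f y = partial i g y" if "y \<in> S" for y by (rule partial_cong[OF _ assms(1), symmetric]) (use that Suc.prems in auto)
 qed
 moreover have "\<forall>x\<in>S. g differentiable (at x)" using Suc.prems by (auto intro: differentiable_cong_open[OF _ assms(1)])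
 ultimately show ?case by simp
qed

lemma smooth_on_cong: "open S ==> smooth_on S f ==> (!!y. y \<in> S ==> f y = g y) ==> smooth_on S g"
 unfolding smooth_on_iff using diff_upto_cong by blast

lemma diff_upto_Suc: "diff_upto (Suc k) S f ==> diff_upto k S f" unfolding diff_upto_iff by simp

lemma differentiable_has_derivative: "f differentiable (at x) ==> (f has_derivative frechet_derivative f (at x)) (at x)"
 using frechet_derivative_works by blast

lemma diff_upto_const: "diff_upto k S (\<lambda>_. c)"
proof (induction k arbitrary: c)
 case (Suc k)
 have "partial i (\<lambda>_. c) = (\<lambda>_. 0)" for i :: 'a by (rule ext, subst partial_eq[OF has_derivative_const]) simp
 then show ?case using Suc by simp
qed simp

lemma diff_upto_add:
 assumes "open S" "diff_upto k S f" "diff_upto k S g"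
 shows "diff_upto k S (\<lambda>x. f x + g x)" using assms(2,3)
proof (induction k arbitrary: f g)
 case (Suc k)
 have "diff_upto k S (partial i (\<lambda>x. f x + g x))" for i
 proof (rule diff_upto_cong[OF assms(1)])
  show "diff_upto k S (\<lambda>x. partial i f x + partial i g x)" by (rule Suc.IH) (use Suc.prems in auto)
  show "partial i f y + partial i g y = partial i (\<lambda>x. f x + g x) y" if "y \<in> S" for y
   by (subst partial_eq[OF has_derivative_add[OF differentiable_has_derivative differentiable_has_derivative]])
    (use that Suc.prems in \<open>auto simp: partial_def\<close>)
 qed
 then show ?case using Suc.prems by auto
qed auto

lemma diff_upto_linear:
 assumes "open S" "bounded_linear L" "diff_upto k S f"
 shows "diff_upto k S (\<lambda>x. L (f x))" using assms(3)
proof (induction k arbitrary: f)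
 case 0
 then show ?case using bounded_linear.has_derivative[OF assms(2) differentiable_has_derivative]
  unfolding diff_upto.simps differentiable_def by blast
next
 case (Suc k)
 have "diff_upto k S (partial i (\<lambda>x. L (f x)))" for i
 proof (rule diff_upto_cong[OF assms(1)])
  show "diff_upto k S (\<lambda>x. L (partial i f x))" by (rule Suc.IH) (use Suc.prems in auto)
  show "L (partial i f y) = partial i (\<lambda>x. L (f x)) y" if "y \<in> S" for y
   by (subst partial_eq[OF bounded_linear.has_derivative[OF assms(2) differentiable_has_derivative]])
    (use that Suc.prems in \<open>auto simp: partial_def\<close>)
 qed
 moreover have "(\<lambda>x. L (f x)) differentiable (at y)" if "y \<in> S" for y
 proof -
  have df: "f differentiable (at y)" using Suc.prems that by simp
  show ?thesis using bounded_linear.has_derivative[OF assms(2) differentiable_has_derivative[OF df]] unfolding differentiable_def by blast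
 qed
 ultimately show ?case by simp
qed

text \<open>The derivative is a sum of two products of the same kind with one factor differentiated,
  so the induction on the order closes. Real products and scalar multiples are instances.\<close>

lemma diff_upto_bilinear:
 assumes "open S" "bounded_bilinear B" "diff_upto k S f" "diff_upto k S g"
 shows "diff_upto k S (\<lambda>x. B (f x) (g x))" using assms(3,4)
proof (induction k arbitrary: f g)
 case 0
 have "((\<lambda>x. B (f x) (g x)) has_derivative (\<lambda>h. B (f y) (frechet_derivative g (at y) h) + B (frechet_derivative f (at y) h) (g y))) (at y)"
  if "y \<in> S" for y by (rule bounded_bilinear.FDERIV[OF assms(2)]) (use that 0 in \<open>auto intro: differentiable_has_derivative\<close>)
 then show ?case unfolding diff_upto.simps differentiable_def by blast
next
 case (Suc k)
 have d: "((\<lambda>x. B (f x) (g x)) has_derivative (\<lambda>h. B (f y) (frechet_derivative g (at y) h) + B (frechet_derivative f (at y) h) (g y))) (at y)"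
  if "y \<in> S" for y by (rule bounded_bilinear.FDERIV[OF assms(2)]) (use that Suc.prems in \<open>auto intro: differentiable_has_derivative\<close>)
 have "diff_upto k S (partial i (\<lambda>x. B (f x) (g x)))" for i
 proof (rule diff_upto_cong[OF assms(1)])
  show "diff_upto k S (\<lambda>x. B (f x) (partial i g x) + B (partial i f x) (g x))"
   using Suc.prems by (intro diff_upto_add[OF assms(1)] Suc.IH) (auto intro: diff_upto_Suc)
  show "B (f y) (partial i g y) + B (partial i f y) (g y) = partial i (\<lambda>x. B (f x) (g x)) y" if "y \<in> S" for y
   by (subst partial_eq[OF d[OF that]]) (simp add: partial_def)
 qed
 then show ?case using d unfolding diff_upto.simps differentiable_def by blast
qed

lemma smooth_on_const: "smooth_on S (\<lambda>_. c)" unfolding smooth_on_iff by (simp add: diff_upto_const)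

lemma smooth_on_add: "open S ==> smooth_on S f ==> smooth_on S g ==> smooth_on S (\<lambda>x. f x + g x)"
 unfolding smooth_on_iff by (simp add: diff_upto_add)

lemma smooth_on_linear: "open S ==> bounded_linear L ==> smooth_on S f ==> smooth_on S (\<lambda>x. L (f x))"
 unfolding smooth_on_iff by (simp add: diff_upto_linear)

lemma smooth_on_mult:
 fixes f g :: "real^'n::finite => real"
 shows "open S ==> smooth_on S f ==> smooth_on S g ==> smooth_on S (\<lambda>x. f x * g x)"
 unfolding smooth_on_iff by (simp add: diff_upto_bilinear[OF _ bounded_bilinear_mult])

lemma smooth_on_scaleR: "open S ==> smooth_on S f ==> smooth_on S g ==> smooth_on S (\<lambda>x. f x *\<^sub>R g x)"
 unfolding smooth_on_iff by (simp add: diff_upto_bilinear[OF _ bounded_bilinear_scaleR])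

lemma smooth_on_cmult:
 fixes f :: "real^'n::finite => real"
 shows "open S ==> smooth_on S f ==> smooth_on S (\<lambda>x. a * f x)" by (rule smooth_on_mult[OF _ smooth_on_const])

lemma smooth_on_diff:
 fixes f g :: "real^'n::finite => real"
 shows "open S ==> smooth_on S f ==> smooth_on S g ==> smooth_on S (\<lambda>x. f x - g x)"
 using smooth_on_add[OF _ _ smooth_on_cmult[of S g "-1"], of f] by simp

lemma smooth_on_power:
 fixes f :: "real^'n::finite => real"
 assumes "open S" "smooth_on S f" shows "smooth_on S (\<lambda>x. f x ^ n)" by (induction n) (use assms smooth_on_const smooth_on_mult in auto)

lemma diff_upto_sum:
 assumes "open S" "finite I" "!!i. i \<in> I ==> diff_upto k S (f i)"
 shows "diff_upto k S (\<lambda>x. \<Sum>i\<in>I. f i x)" using assms(2,3) by (induction I) (simp_all add: diff_upto_const diff_upto_add[OF assms(1)])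

lemma smooth_on_sum:
 assumes "open S" "finite I" "!!i. i \<in> I ==> smooth_on S (f i)"
 shows "smooth_on S (\<lambda>x. \<Sum>i\<in>I. f i x)" using assms diff_upto_sum[of S I] unfolding smooth_on_iff by blast

lemma smooth_on_prod:
 fixes f :: "'i => real^'n::finite => real"
 assumes "open S" "finite I" "!!i. i \<in> I ==> smooth_on S (f i)"
 shows "smooth_on S (\<lambda>x. \<Prod>i\<in>I. f i x)" using assms(2,3) by (induction I) (simp_all add: smooth_on_const smooth_on_mult[OF assms(1)])

lemma smooth_on_nth: "open S ==> smooth_on S f ==> smooth_on S (\<lambda>x. f x $ i)" by (rule smooth_on_linear[OF _ bounded_linear_vec_nth])

lemma vec_eq_sum_axis: "(v :: real^'n::finite) = (\<Sum>j\<in>UNIV. v $ j *\<^sub>R axis j 1)"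
 using basis_expansion[of v] by (simp add: scalar_mult_eq_scaleR)

lemma frechet_derivative_eq_sum:
 assumes "f differentiable (at x)"
 shows "frechet_derivative f (at x) v = (\<Sum>j\<in>UNIV. v $ j *\<^sub>R partial j f x)"
proof -
 interpret linear "frechet_derivative f (at x)" using assms by (rule linear_frechet_derivative)
 show ?thesis by (subst vec_eq_sum_axis[of v]) (simp add: sum scale partial_def)
qed

lemma smooth_on_id: "open S ==> smooth_on S (\<lambda>x. x)"
proof -
 assume S: "open S"
 have "diff_upto k S (\<lambda>x. x)" for k
 proof (cases k)
  case (Suc k')
  have "partial i (\<lambda>x :: real^'a. x) = (\<lambda>_. axis i 1)" for i by (rule ext, subst partial_eq[OF has_derivative_ident]) simp
  then show ?thesis using Suc by (simp add: diff_upto_const)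
 qed simp
 then show ?thesis unfolding smooth_on_iff by simp
qed

text \<open>The induction differentiates the outer function, which therefore ranges over a family
  closed under differentiation on \<open>I\<close>. Powers and the functions behind
  \<open>exp_bump\<close> form such families.\<close>

lemma diff_upto_compose_real:
 fixes \<Theta> :: "(real => real) set"
 assumes S: "open S" and \<Theta>: "!!\<theta>. \<theta> \<in> \<Theta> ==> \<exists>\<theta>'\<in>\<Theta>. \<forall>t\<in>I. (\<theta> has_real_derivative \<theta>' t) (at t)"
  and I: "f ` S \<subseteq> I" and "diff_upto k S f" "\<theta> \<in> \<Theta>"
 shows "diff_upto k S (\<lambda>x. \<theta> (f x))" using assms(4,5)
proof (induction k arbitrary: \<theta>)
 case 0
 obtain \<theta>' where "\<forall>t\<in>I. (\<theta> has_real_derivative \<theta>' t) (at t)" using \<Theta>[OF 0(2)] by auto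
 then have "\<theta> differentiable (at (f x))" if "x \<in> S" for x using I that unfolding differentiable_def has_field_derivative_def by blast
 then show ?case using 0(1) differentiable_compose[of \<theta> f] by simp
next
 case (Suc k)
 obtain \<theta>' where \<theta>': "\<theta>' \<in> \<Theta>" "\<forall>t\<in>I. (\<theta> has_real_derivative \<theta>' t) (at t)" using \<Theta>[OF Suc.prems(2)] by auto
 have d: "((\<lambda>x. \<theta> (f x)) has_derivative (\<lambda>h. \<theta>' (f y) * frechet_derivative f (at y) h)) (at y)" if "y \<in> S" for y
  by (rule has_derivative_compose[OF differentiable_has_derivative]) (use Suc.prems \<theta>'(2) I that in \<open>auto simp: has_field_derivative_def\<close>)
 have "diff_upto k S (partial i (\<lambda>x. \<theta> (f x)))" for i
 proof (rule diff_upto_cong[OF S])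
  show "diff_upto k S (\<lambda>x. \<theta>' (f x) * partial i f x)"
  proof (rule diff_upto_bilinear[OF S bounded_bilinear_mult])
   show "diff_upto k S (\<lambda>x. \<theta>' (f x))" by (rule Suc.IH[OF diff_upto_Suc[OF Suc.prems(1)] \<theta>'(1)])
   show "diff_upto k S (partial i f)" using Suc.prems(1) by simp
  qed
  show "\<theta>' (f y) * partial i f y = partial i (\<lambda>x. \<theta> (f x)) y" if "y \<in> S" for y
   by (subst partial_eq[OF d[OF that]]) (simp add: partial_def)
 qed
 then show ?case using d unfolding diff_upto.simps differentiable_def by blast
qed

lemma smooth_on_compose_real:
 fixes \<Theta> :: "(real => real) set"
 assumes "open S" "!!\<theta>. \<theta> \<in> \<Theta> ==> \<exists>\<theta>'\<in>\<Theta>. \<forall>t\<in>I. (\<theta> has_real_derivative \<theta>' t) (at t)"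
  and "f ` S \<subseteq> I" "smooth_on S f" "\<theta> \<in> \<Theta>"
 shows "smooth_on S (\<lambda>x. \<theta> (f x))" using assms diff_upto_compose_real[of S \<Theta> I f] unfolding smooth_on_iff by blast

lemma smooth_on_powr:
 fixes f :: "real^'n::finite => real"
 assumes "open S" "smooth_on S f" "!!x. x \<in> S ==> 0 < f x"
 shows "smooth_on S (\<lambda>x. f x powr b)"
proof -
 let ?\<Theta> = "{\<lambda>t. a * t powr b | a b. True} :: (real => real) set"
 have "smooth_on S (\<lambda>x. (\<lambda>t. 1 * t powr b) (f x))"
 proof (rule smooth_on_compose_real[of S ?\<Theta> "{0<..}" f "\<lambda>t. 1 * t powr b"])
  fix \<theta> assume "\<theta> \<in> ?\<Theta>"
  then obtain a d where \<theta>: "\<theta> = (\<lambda>t. a * t powr d)" by auto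
  have "\<forall>t\<in>{0<..}. (\<theta> has_real_derivative (a * d) * t powr (d - 1)) (at t)" unfolding \<theta> by (auto intro!: derivative_eq_intros)
  then show "\<exists>\<theta>'\<in>?\<Theta>. \<forall>t\<in>{0<..}. (\<theta> has_real_derivative \<theta>' t) (at t)" by (intro bexI[of _ "\<lambda>t. (a * d) * t powr (d - 1)"]) auto
 next
  show "(\<lambda>t. 1 * t powr b) \<in> ?\<Theta>" by blast
 qed (use assms in auto)
 then show ?thesis by simp
qed

lemma has_derivative_compose_vec:
 fixes T :: "real^'m::finite => real^'n::finite"
 assumes "T differentiable (at x)" "f differentiable (at (T x))"
 shows "((\<lambda>x. f (T x)) has_derivative (\<lambda>h. \<Sum>j\<in>UNIV. frechet_derivative (\<lambda>x. T x $ j) (at x) h *\<^sub>R partial j f (T x))) (at x)"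
proof -
 have n: "frechet_derivative (\<lambda>x. T x $ j) (at x) h = frechet_derivative T (at x) h $ j" for j h
  using frechet_derivative_at[OF bounded_linear.has_derivative[OF bounded_linear_vec_nth differentiable_has_derivative[OF assms(1)]], of j]
  by metis
 show ?thesis using has_derivative_compose[OF differentiable_has_derivative[OF assms(1)] differentiable_has_derivative[OF assms(2)]]
  unfolding n frechet_derivative_eq_sum[OF assms(2)] .
qed

text \<open>By the chain rule a partial derivative of the composition is a sum of products of a
  partial derivative of \<open>T\<close> with \<open>partial j f\<close> composed with
  \<open>T\<close>. The induction thus runs over \<open>f\<close> while \<open>T\<close> stays
  fixed.\<close>

lemma diff_upto_compose:
 fixes T :: "real^'m::finite => real^'n::finite"
 assumes S: "open S" and T: "T ` S \<subseteq> O'" and "smooth_on S T" "smooth_on O' f"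
 shows "diff_upto k S (\<lambda>x. f (T x))" using assms(4)
proof (induction k arbitrary: f)
 case 0
 have "(\<lambda>x. f (T x)) differentiable (at x)" if "x \<in> S" for x by (rule differentiable_compose)
   (use that T smooth_on_differentiable[OF assms(3)] smooth_on_differentiable[OF 0] in auto)
 then show ?case by simp
next
 case (Suc k)
 note dT = smooth_on_differentiable[OF assms(3)] and df = smooth_on_differentiable[OF Suc.prems]
 have d: "((\<lambda>x. f (T x)) has_derivative (\<lambda>h. \<Sum>j\<in>UNIV. frechet_derivative (\<lambda>x. T x $ j) (at x) h *\<^sub>R partial j f (T x))) (at x)"
  if "x \<in> S" for x by (rule has_derivative_compose_vec) (use that dT df T in auto)
 have "diff_upto k S (partial i (\<lambda>x. f (T x)))" for i
 proof (rule diff_upto_cong[OF S])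
  have "smooth_on S (partial i (\<lambda>x. T x $ j))" for j by (intro smooth_on_partial smooth_on_nth S assms(3))
  then show "diff_upto k S (\<lambda>x. \<Sum>j\<in>UNIV. partial i (\<lambda>x. T x $ j) x *\<^sub>R partial j f (T x))"
   by (intro diff_upto_sum[OF S] finite diff_upto_bilinear[OF S bounded_bilinear_scaleR] Suc.IH smooth_on_partial[OF Suc.prems])
    (auto simp: smooth_on_iff)
  show "(\<Sum>j\<in>UNIV. partial i (\<lambda>x. T x $ j) y *\<^sub>R partial j f (T y)) = partial i (\<lambda>x. f (T x)) y" if "y \<in> S" for y
   by (subst partial_eq[OF d[OF that]]) (simp add: partial_def)
 qed
 then show ?case using d unfolding diff_upto.simps differentiable_def by blast
qed

lemma smooth_on_compose:
 fixes T :: "real^'m::finite => real^'n::finite"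
 assumes "open S" "T ` S \<subseteq> O'" "smooth_on S T" "smooth_on O' f"
 shows "smooth_on S (\<lambda>x. f (T x))" using diff_upto_compose[OF assms] unfolding smooth_on_iff by simp

section \<open>Smooth bump functions\<close>

definition exp_bump :: "real => real" where
 "exp_bump t = (if t > 0 then exp (- (1 / t)) else 0)"

lemma poly_exp_tendsto_0: "((\<lambda>x. poly p x * exp (- x)) \<longlongrightarrow> 0) at_top" for p :: "real poly"
proof -
 have "((\<lambda>x. \<Sum>i\<le>degree p. coeff p i * (x ^ i / exp x)) \<longlongrightarrow> (\<Sum>i\<le>degree p. coeff p i * 0)) at_top"
  by (intro tendsto_intros tendsto_power_div_exp_0)
 then show ?thesis by (simp add: poly_altdef sum_distrib_right exp_minus divide_inverse mult.assoc)
qed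

text \<open>The functions p (1/t) exp (-1/t), extended by zero, are closed under differentiation.
  The delicate point is 0, where the difference quotient from the right is again of this form and
  exponential decay in 1/t beats the polynomial.\<close>

lemma exp_bump_family:
 fixes p :: "real poly"
 defines "\<theta> \<equiv> \<lambda>p t. if t > 0 then poly p (1 / t) * exp (- (1 / t)) else (0::real)"
 shows "\<exists>q. \<forall>t. (\<theta> p has_real_derivative \<theta> q t) (at t)"
proof -
 \<comment> \<open>For t > 0 the derivative of p (1/t) is - p' (1/t) / t^2 and that of exp (-1/t) is
   exp (-1/t) / t^2. The factor \<open>[:0, 0, 1:]\<close> is the common 1/t^2, as a polynomial in
   1/t.\<close>
 define q where "q = (p - pderiv p) * [:0, 0, 1:]"
 have "(\<theta> p has_real_derivative \<theta> q t) (at t)" for t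
 proof -
  consider "t > 0" | "t < 0" | "t = 0" by linarith
  then show ?thesis
  proof cases
   case 1
   have "((\<lambda>t. poly p (1 / t) * exp (- (1 / t))) has_real_derivative \<theta> q t) (at t)" unfolding \<theta>_def q_def using 1
    by (auto intro!: derivative_eq_intros DERIV_chain2[OF poly_DERIV] simp: field_simps power2_eq_square)
   then show ?thesis by (rule has_field_derivative_transform_within_open[where S="{0<..}"]) (use 1 in \<open>auto simp: \<theta>_def\<close>)
  next
   case 2
   have "((\<lambda>t. 0) has_real_derivative \<theta> q t) (at t)" unfolding \<theta>_def using 2 by simp
   then show ?thesis by (rule has_field_derivative_transform_within_open[where S="{..<0}"]) (use 2 in \<open>auto simp: \<theta>_def\<close>)
  next
   case 3
   have r: "((\<lambda>h. \<theta> p h / h) \<longlongrightarrow> 0) (at_right 0)"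
   proof -
    have "((\<lambda>h. poly (pCons 0 p) (inverse h) * exp (- inverse h)) \<longlongrightarrow> 0) (at_right (0::real))"
     by (rule filterlim_compose[OF poly_exp_tendsto_0 filterlim_inverse_at_top_right])
    then show ?thesis by (rule Lim_transform_eventually) (auto simp: eventually_at_right_less eventually_at_filter \<theta>_def divide_inverse)
   qed
   have l: "((\<lambda>h. \<theta> p h / h) \<longlongrightarrow> 0) (at_left 0)" by (rule tendsto_eventually) (auto simp: eventually_at_filter \<theta>_def)
   have "((\<lambda>h. \<theta> p h / h) \<longlongrightarrow> 0) (at 0)" using l r by (simp add: filterlim_at_split)
   then show ?thesis unfolding 3 DERIV_def by (simp add: \<theta>_def)
  qed
 qed
 then show ?thesis by blast
qed

lemma smooth_on_exp_bump:
 fixes f :: "real^'n::finite => real"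
 assumes "open S" "smooth_on S f"
 shows "smooth_on S (\<lambda>x. exp_bump (f x))"
proof -
 let ?\<theta> = "\<lambda>p t. if t > 0 then poly p (1 / t) * exp (- (1 / t)) else (0::real)"
 have "smooth_on S (\<lambda>x. ?\<theta> [:1:] (f x))"
 proof (rule smooth_on_compose_real[of S "range ?\<theta>" UNIV f "?\<theta> [:1:]"])
  fix \<theta> assume "\<theta> \<in> range ?\<theta>"
  then obtain p where p: "\<theta> = ?\<theta> p" by auto
  obtain q where "\<forall>t. (?\<theta> p has_real_derivative ?\<theta> q t) (at t)" using exp_bump_family[of p] by blast
  then show "\<exists>\<theta>'\<in>range ?\<theta>. \<forall>t\<in>UNIV. (\<theta> has_real_derivative \<theta>' t) (at t)" unfolding p by (intro bexI[of _ "?\<theta> q"] rangeI) simp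
 next
  show "?\<theta> [:1:] \<in> range ?\<theta>" by (rule rangeI)
 qed (use assms in auto)
 then show ?thesis unfolding exp_bump_def by (simp cong: if_cong)
qed

definition ball_bump :: "real^'n::finite => real => real^'n => real" where
 "ball_bump a r y = exp_bump (r\<^sup>2 - (\<Sum>i\<in>UNIV. (y $ i - a $ i)\<^sup>2))"

lemma smooth_on_ball_bump: "open S ==> smooth_on S (ball_bump a r)" unfolding ball_bump_def[abs_def]
 by (intro smooth_on_exp_bump smooth_on_diff smooth_on_const smooth_on_sum smooth_on_power smooth_on_nth smooth_on_id finite)

lemma ball_bump_pos_iff: "0 < r ==> 0 < ball_bump a r y \<longleftrightarrow> dist y a < r"
proof -
 assume r: "0 < r"
 have "(\<Sum>i\<in>UNIV. (y $ i - a $ i)\<^sup>2) = (dist y a)\<^sup>2" by (simp add: dist_norm norm_vec_def L2_set_def sum_nonneg)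
 then show ?thesis using r unfolding ball_bump_def exp_bump_def
  using power2_less_imp_less[of "dist y a" r] power_strict_mono[of "dist y a" r 2] by auto
qed

lemma ball_bump_bounds: "0 <= ball_bump a r y" "ball_bump a r y <= 1" unfolding ball_bump_def exp_bump_def by auto

lemma ball_bump_zero_iff: "0 < r ==> ball_bump a r y = 0 \<longleftrightarrow> r <= dist y a"
 using ball_bump_pos_iff[of r a y] ball_bump_bounds(1)[of a r y] by (metis less_eq_real_def linorder_not_less)

section \<open>Differentiating functions of finitely many entries of a sequence\<close>

lemma tendsto_fun_componentwise:
 fixes f :: "'c => 'i => 'b::topological_space"
 assumes "!!i. ((\<lambda>c. f c i) \<longlongrightarrow> l i) F"
 shows "(f \<longlongrightarrow> l) F"
proof -
 have "limitin (product_topology (\<lambda>i. euclidean) UNIV) f l F" by (subst limitin_componentwise) (simp add: assms limitin_canonical_iff)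
 then show ?thesis by (simp add: euclidean_product_topology limitin_canonical_iff)
qed

text \<open>As \<open>u\<close> vanishes at \<open>x\<close>, the other factor only has to converge.
  This admits mean value points inside the coefficients, about which nothing but convergence is
  known.\<close>

lemma has_derivative_mult_tendsto:
 fixes q u :: "'x::real_normed_vector => real"
 assumes q: "(q \<longlongrightarrow> L) (at x)" and u: "(u has_derivative u') (at x)" "u x = 0"
 shows "((\<lambda>y. q y * u y) has_derivative (\<lambda>v. L * u' v)) (at x)"
proof -
 have lin: "bounded_linear u'" and lim: "((\<lambda>h. norm (u (x + h) - u x - u' h) / norm h) \<longlongrightarrow> 0) (at 0)"
  using u(1) unfolding has_derivative_at by auto
 obtain K where K: "!!h. norm (u' h) <= norm h * K" "0 <= K" using bounded_linear.nonneg_bounded[OF lin] by blast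
 have q0: "((\<lambda>h. q (x + h)) \<longlongrightarrow> L) (at 0)" using q by (simp add: LIM_offset_zero_iff)
 have "((\<lambda>h. norm (q (x + h) * u (x + h) - q x * u x - L * u' h) / norm h) \<longlongrightarrow> 0) (at 0)"
 proof (rule Lim_null_comparison)
  show "((\<lambda>h. \<bar>q (x + h)\<bar> * (norm (u (x + h) - u x - u' h) / norm h) + \<bar>q (x + h) - L\<bar> * K) \<longlongrightarrow> 0) (at 0)"
  proof -
   have "((\<lambda>h. \<bar>q (x + h)\<bar> * (norm (u (x + h) - u x - u' h) / norm h) + \<bar>q (x + h) - L\<bar> * K) \<longlongrightarrow> \<bar>L\<bar> * 0 + \<bar>L - L\<bar> * K) (at 0)"
    by (intro tendsto_intros q0 lim)
   then show ?thesis by simp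
  qed
  show "\<forall>\<^sub>F h in at 0. norm (norm (q (x + h) * u (x + h) - q x * u x - L * u' h) / norm h) <=
    \<bar>q (x + h)\<bar> * (norm (u (x + h) - u x - u' h) / norm h) + \<bar>q (x + h) - L\<bar> * K"
  proof (rule always_eventually, rule allI)
   fix h
   show "norm (norm (q (x + h) * u (x + h) - q x * u x - L * u' h) / norm h) <=
    \<bar>q (x + h)\<bar> * (norm (u (x + h) - u x - u' h) / norm h) + \<bar>q (x + h) - L\<bar> * K"
   proof (cases "h = 0")
    case False
    have e: "q (x + h) * u (x + h) - q x * u x - L * u' h =
      q (x + h) * (u (x + h) - u x - u' h) + (q (x + h) - L) * u' h"
     by (simp add: u(2) algebra_simps)
    have "norm (q (x + h) * u (x + h) - q x * u x - L * u' h) <=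
      \<bar>q (x + h)\<bar> * norm (u (x + h) - u x - u' h) + \<bar>q (x + h) - L\<bar> * norm (u' h)"
     unfolding e by (rule order_trans[OF norm_triangle_ineq]) (simp add: abs_mult)
    also have "... <= \<bar>q (x + h)\<bar> * norm (u (x + h) - u x - u' h) + \<bar>q (x + h) - L\<bar> * (norm h * K)"
     by (intro add_left_mono mult_left_mono K) auto
    finally show ?thesis using False by (simp add: field_simps)
   qed (use K(2) in simp)
  qed
 qed
 then show ?thesis unfolding has_derivative_at using bounded_linear_mult_right[THEN bounded_linear_compose, OF lin] by auto
qed

text \<open>Differentiability from continuous partial derivatives: the entries are replaced one at a
  time, the mean value theorem is applied to each increment, and the intermediate points converge.
  The type of sequences carries no norm, so the derivative is taken in the normed space on which the
  functions \<open>a i\<close> live.\<close>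

lemma has_derivative_seq:
 fixes a :: "nat => 'x::real_normed_vector => real"
 assumes dep: "!!y z. (!!i. i < N ==> y i = z i) ==> h y = h z"
  and diff: "!!i y. i < N ==> (\<lambda>t. h (y(i := t))) differentiable (at (y i))"
  and cont: "!!i. i < N ==> continuous_on UNIV (seq_partial i h)"
  and a: "!!i. i < N ==> (a i has_derivative a' i) (at x0)"
 shows "((\<lambda>x. h (\<lambda>i. a i x)) has_derivative (\<lambda>v. \<Sum>i<N. seq_partial i h (\<lambda>i. a i x0) * a' i v)) (at x0)"
proof -
 \<comment> \<open>The first \<open>j\<close> entries are taken at \<open>x\<close> and the others
   still at \<open>x0\<close>, so that passing from \<open>j\<close> to \<open>Suc j\<close> changes
   entry \<open>j\<close> only.\<close>
 define y where "y j x i = (if i < j then a i x else a i x0)" for j x i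
 have "\<exists>t. \<bar>t - a j x0\<bar> <= \<bar>a j x - a j x0\<bar> &
   h (y (Suc j) x) - h (y j x) = seq_partial j h ((y j x)(j := t)) * (a j x - a j x0)" if j: "j < N" for j x
 proof -
  define k where "k t = h ((y j x)(j := t))" for t
  have k: "(k has_real_derivative seq_partial j h ((y j x)(j := t))) (at t)" for t
  proof -
   have "k differentiable (at t)" using diff[OF j, of "(y j x)(j := t)"] unfolding k_def by simp
   then show ?thesis unfolding seq_partial_def k_def by (auto simp: DERIV_deriv_iff_real_differentiable)
  qed
  have e: "h (y (Suc j) x) = k (a j x)" "h (y j x) = k (a j x0)"
   unfolding k_def by (auto intro!: arg_cong[of _ _ h] simp: y_def fun_eq_iff less_Suc_eq)
  consider "a j x0 < a j x" | "a j x < a j x0" | "a j x = a j x0" by linarith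
  then show ?thesis
  proof cases
   case 1
   then obtain t where "a j x0 < t" "t < a j x" "k (a j x) - k (a j x0) = (a j x - a j x0) * seq_partial j h ((y j x)(j := t))"
    using MVT2[of "a j x0" "a j x" k "\<lambda>t. seq_partial j h ((y j x)(j := t))"] k by blast
   then show ?thesis unfolding e by (intro exI[of _ t]) (auto simp: mult.commute)
  next
   case 2
   then obtain t where "a j x < t" "t < a j x0" "k (a j x0) - k (a j x) = (a j x0 - a j x) * seq_partial j h ((y j x)(j := t))"
    using MVT2[of "a j x" "a j x0" k "\<lambda>t. seq_partial j h ((y j x)(j := t))"] k by blast
   then show ?thesis unfolding e by (intro exI[of _ t]) (auto simp: algebra_simps)
  next
   case 3
   then show ?thesis unfolding e by (intro exI[of _ "a j x0"]) auto
  qed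
 qed
 then obtain t where t: "!!j x. j < N ==> \<bar>t j x - a j x0\<bar> <= \<bar>a j x - a j x0\<bar>"
  and ht: "!!j x. j < N ==> h (y (Suc j) x) - h (y j x) = seq_partial j h ((y j x)(j := t j x)) * (a j x - a j x0)" by metis
 have eq: "h (\<lambda>i. a i x) = h (\<lambda>i. a i x0) + (\<Sum>j<N. seq_partial j h ((y j x)(j := t j x)) * (a j x - a j x0))" for x
 proof -
  have "h (\<lambda>i. a i x) = h (y N x)" by (rule dep) (simp add: y_def)
  moreover have "h (\<lambda>i. a i x0) = h (y 0 x)" by (rule dep) (simp add: y_def)
  moreover have "(\<Sum>j<N. seq_partial j h ((y j x)(j := t j x)) * (a j x - a j x0)) = h (y N x) - h (y 0 x)"
  proof -
   have "(\<Sum>j<N. seq_partial j h ((y j x)(j := t j x)) * (a j x - a j x0)) = (\<Sum>j<N. h (y (Suc j) x) - h (y j x))"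
    by (rule sum.cong) (use ht in auto)
   also have "... = h (y N x) - h (y 0 x)" by (rule sum_lessThan_telescope)
   finally show ?thesis .
  qed
  ultimately show ?thesis by simp
 qed
 have d: "((\<lambda>x. seq_partial j h ((y j x)(j := t j x)) * (a j x - a j x0)) has_derivative
   (\<lambda>v. seq_partial j h (\<lambda>i. a i x0) * a' j v)) (at x0)" if j: "j < N" for j
 proof (rule has_derivative_mult_tendsto)
  have lim: "(a i \<longlongrightarrow> a i x0) (at x0)" if "i < N" for i using has_derivative_continuous[OF a[OF that]] by (simp add: continuous_within)
  have "((\<lambda>x. (y j x)(j := t j x)) \<longlongrightarrow> (\<lambda>i. a i x0)) (at x0)"
  proof (rule tendsto_fun_componentwise)
   fix i
   consider "i < j" | "i = j" | "j < i" by linarith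
   then show "((\<lambda>x. ((y j x)(j := t j x)) i) \<longlongrightarrow> a i x0) (at x0)"
   proof cases
    case 2
    have "((\<lambda>x. t j x - a j x0) \<longlongrightarrow> 0) (at x0)"
    proof (rule Lim_null_comparison[OF always_eventually])
     show "\<forall>x. norm (t j x - a j x0) <= \<bar>a j x - a j x0\<bar>" using t[OF j] by simp
     have "((\<lambda>x. \<bar>a j x - a j x0\<bar>) \<longlongrightarrow> \<bar>a j x0 - a j x0\<bar>) (at x0)" by (intro tendsto_intros lim j)
     then show "((\<lambda>x. \<bar>a j x - a j x0\<bar>) \<longlongrightarrow> 0) (at x0)" by simp
    qed
    then show ?thesis using 2 by (simp add: LIM_zero_iff)
   qed (use lim j in \<open>auto simp: y_def\<close>)
  qed
  moreover have "isCont (seq_partial j h) (\<lambda>i. a i x0)" using cont[OF j] by (simp add: continuous_on_eq_continuous_at)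
  ultimately show "((\<lambda>x. seq_partial j h ((y j x)(j := t j x))) \<longlongrightarrow> seq_partial j h (\<lambda>i. a i x0)) (at x0)"
   by (rule isCont_tendsto_compose[rotated])
  show "((\<lambda>x. a j x - a j x0) has_derivative a' j) (at x0)" using has_derivative_diff[OF a[OF j] has_derivative_const] by simp
 qed simp
 have "((\<lambda>x. h (\<lambda>i. a i x0) + (\<Sum>j<N. seq_partial j h ((y j x)(j := t j x)) * (a j x - a j x0))) has_derivative
   (\<lambda>v. 0 + (\<Sum>j<N. seq_partial j h (\<lambda>i. a i x0) * a' j v))) (at x0)"
  by (intro has_derivative_add has_derivative_const has_derivative_sum d) auto
 then show ?thesis unfolding eq[symmetric] by simp
qed

lemma seq_partials_append: "seq_partials (is @ js) h = seq_partials is (seq_partials js h)" by (induction "is") auto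

lemma bounded_smoothD:
 assumes "h \<in> bounded_smooth N"
 shows "(!!i. i < N ==> y i = z i) ==> h y = h z"
  and "i < N ==> (\<lambda>t. h (y(i := t))) differentiable (at (y i))"
  and "continuous_on UNIV h" and "\<exists>B. \<forall>y. \<bar>h y\<bar> <= B"
proof -
 show "(!!i. i < N ==> y i = z i) ==> h y = h z" using assms unfolding bounded_smooth_def by simp
 have "\<forall>is. set is \<subseteq> {..<N} --> continuous_on UNIV (seq_partials is h) & bounded (range (seq_partials is h)) &
   (\<forall>i<N. \<forall>y. (\<lambda>t. seq_partials is h (y(i := t))) differentiable (at (y i)))"
  using assms unfolding bounded_smooth_def by simp
 from this[rule_format, of "[]"]
 have *: "continuous_on UNIV (seq_partials [] h)" "bounded (range (seq_partials [] h))"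
   "\<forall>i<N. \<forall>y. (\<lambda>t. seq_partials [] h (y(i := t))) differentiable (at (y i))" by simp_all
 then show "i < N ==> (\<lambda>t. h (y(i := t))) differentiable (at (y i))" "continuous_on UNIV h" by auto
 show "\<exists>B. \<forall>y. \<bar>h y\<bar> <= B" using *(2) unfolding bounded_iff by auto
qed

lemma bounded_smooth_partial:
 assumes h: "h \<in> bounded_smooth N" and i: "i < N"
 shows "seq_partial i h \<in> bounded_smooth N"
proof -
 have "seq_partial i h y = seq_partial i h z" if "\<forall>j<N. y j = z j" for y z
 proof -
  have "h (y(i := t)) = h (z(i := t))" for t by (rule bounded_smoothD(1)[OF h]) (use that in auto)
  then show ?thesis unfolding seq_partial_def using that i by simp
 qed
 moreover have "seq_partials is (seq_partial i h) = seq_partials (is @ [i]) h" for "is" by (simp add: seq_partials_append)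
 moreover have "set (is @ [i]) \<subseteq> {..<N}" if "set is \<subseteq> {..<N}" for "is" using that i by auto
 ultimately show ?thesis using h unfolding bounded_smooth_def by simp
qed

lemma bounded_smooth_mono:
 assumes h: "h \<in> bounded_smooth N" and i: "i < N" shows "continuous_on UNIV (seq_partial i h)"
 by (rule bounded_smoothD(3)[OF bounded_smooth_partial[OF assms]])

lemma has_derivative_bounded_smooth:
 fixes a :: "nat => 'x::real_normed_vector => real"
 assumes h: "h \<in> bounded_smooth N" and a: "!!i. i < N ==> (a i has_derivative a' i) (at x0)"
 shows "((\<lambda>x. h (\<lambda>i. a i x)) has_derivative (\<lambda>v. \<Sum>i<N. seq_partial i h (\<lambda>i. a i x0) * a' i v)) (at x0)"
 by (rule has_derivative_seq[where N=N]) (use bounded_smoothD(1,2)[OF h] bounded_smooth_mono[OF h] a in blast)+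

lemma diff_upto_bounded_smooth:
 assumes S: "open S" and "h \<in> bounded_smooth N" and a: "!!i. i < N ==> smooth_on S (a i)"
 shows "diff_upto k S (\<lambda>x. h (\<lambda>i. a i x))" using assms(2)
proof (induction k arbitrary: h)
 case 0
 have "((\<lambda>x. h (\<lambda>i. a i x)) has_derivative
   (\<lambda>v. \<Sum>i<N. seq_partial i h (\<lambda>i. a i y) * frechet_derivative (a i) (at y) v)) (at y)" if "y \<in> S" for y
  by (rule has_derivative_bounded_smooth[OF 0]) (use a that in \<open>auto intro: differentiable_has_derivative smooth_on_differentiable\<close>)
 then show ?case unfolding diff_upto.simps differentiable_def by blast
next
 case (Suc k)
 have d: "((\<lambda>x. h (\<lambda>i. a i x)) has_derivative
   (\<lambda>v. \<Sum>i<N. seq_partial i h (\<lambda>i. a i y) * frechet_derivative (a i) (at y) v)) (at y)" if "y \<in> S" for y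
  by (rule has_derivative_bounded_smooth[OF Suc.prems])
   (use a that in \<open>auto intro: differentiable_has_derivative smooth_on_differentiable\<close>)
 have "diff_upto k S (partial j (\<lambda>x. h (\<lambda>i. a i x)))" for j
 proof (rule diff_upto_cong[OF S])
  show "diff_upto k S (\<lambda>x. \<Sum>i<N. seq_partial i h (\<lambda>i. a i x) * partial j (a i) x)"
  proof (intro diff_upto_sum[OF S] diff_upto_bilinear[OF S bounded_bilinear_mult])
   fix i assume "i \<in> {..<N}"
   then show "diff_upto k S (\<lambda>x. seq_partial i h (\<lambda>i. a i x))" using Suc.IH[OF bounded_smooth_partial[OF Suc.prems]] by simp
   show "diff_upto k S (partial j (a i))" using a \<open>i \<in> {..<N}\<close> smooth_on_partial unfolding smooth_on_iff by blast
  qed simp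
  show "(\<Sum>i<N. seq_partial i h (\<lambda>i. a i y) * partial j (a i) y) = partial j (\<lambda>x. h (\<lambda>i. a i x)) y" if "y \<in> S" for y
   by (subst partial_eq[OF d[OF that]]) (simp add: partial_def)
 qed
 then show ?case using d unfolding diff_upto.simps differentiable_def by blast
qed

lemma smooth_on_bounded_smooth:
 assumes "open S" "h \<in> bounded_smooth N" "!!i. i < N ==> smooth_on S (a i)"
 shows "smooth_on S (\<lambda>x. h (\<lambda>i. a i x))" using diff_upto_bounded_smooth[OF assms] unfolding smooth_on_iff by simp

text \<open>The phase absorbs cosines, so a partial derivative only changes parameters: the constant
  becomes 0 and the phase grows by pi/2. Products concatenate the factors, and coefficients whose
  absolute values add up to at most 1 keep the product in [-1, 1].\<close>

definition trig_prod :: "nat => (nat => real) => (nat => real) => (nat => real) => (nat => real) => real" where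
 "trig_prod N \<alpha> \<beta> \<gamma> y = (\<Prod>i<N. \<alpha> i + \<beta> i * sin (y i + \<gamma> i))"

lemma trig_prod_upd:
 assumes "i < N"
 shows "trig_prod N \<alpha> \<beta> \<gamma> (y(i := t)) = (\<alpha> i + \<beta> i * sin (t + \<gamma> i)) * (\<Prod>j\<in>{..<N} - {i}. \<alpha> j + \<beta> j * sin (y j + \<gamma> j))"
 unfolding trig_prod_def using assms by (subst prod.remove[of _ i]) (auto intro!: prod.cong)

lemma DERIV_trig_prod:
 assumes "i < N"
 shows "((\<lambda>t. trig_prod N \<alpha> \<beta> \<gamma> (y(i := t))) has_real_derivative
  trig_prod N (\<alpha>(i := 0)) \<beta> (\<gamma>(i := \<gamma> i + pi / 2)) (y(i := t))) (at t)"
proof -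
 have s: "sin (t + (\<gamma> i + pi / 2)) = cos (t + \<gamma> i)" using sin_add[of "t + \<gamma> i" "pi / 2"] by (simp add: add.assoc)
 have p: "(\<Prod>j\<in>{..<N} - {i}. (\<alpha>(i := 0)) j + \<beta> j * sin (y j + (\<gamma>(i := \<gamma> i + pi / 2)) j)) =
   (\<Prod>j\<in>{..<N} - {i}. \<alpha> j + \<beta> j * sin (y j + \<gamma> j))"
  by (rule prod.cong) auto
 show ?thesis unfolding trig_prod_upd[OF assms] p by (auto intro!: derivative_eq_intros simp: s)
qed

lemma seq_partial_trig_prod:
 assumes "i < N"
 shows "seq_partial i (trig_prod N \<alpha> \<beta> \<gamma>) = trig_prod N (\<alpha>(i := 0)) \<beta> (\<gamma>(i := \<gamma> i + pi / 2))"
 unfolding seq_partial_def using DERIV_imp_deriv[OF DERIV_trig_prod[OF assms]] by auto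

lemma seq_partials_trig_prod:
 assumes "set is \<subseteq> {..<N}"
 shows "\<exists>\<alpha>' \<gamma>'. seq_partials is (trig_prod N \<alpha> \<beta> \<gamma>) = trig_prod N \<alpha>' \<beta> \<gamma>'" using assms
proof (induction "is")
 case (Cons i "is")
 then obtain \<alpha>' \<gamma>' where "seq_partials is (trig_prod N \<alpha> \<beta> \<gamma>) = trig_prod N \<alpha>' \<beta> \<gamma>'" by auto
 then have "seq_partials (i # is) (trig_prod N \<alpha> \<beta> \<gamma>) = trig_prod N (\<alpha>'(i := 0)) \<beta> (\<gamma>'(i := \<gamma>' i + pi / 2))"
  using seq_partial_trig_prod[of i N] Cons.prems by simp
 then show ?case by blast
qed auto

lemma trig_prod_bounded_smooth: "trig_prod N \<alpha> \<beta> \<gamma> \<in> bounded_smooth N"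
proof -
 have c: "continuous_on UNIV (trig_prod N \<alpha> \<beta> \<gamma>)" for \<alpha> \<gamma>
  unfolding trig_prod_def[abs_def] by (intro continuous_intros continuous_on_product_coordinates)
 have b: "bounded (range (trig_prod N \<alpha> \<beta> \<gamma>))" for \<alpha> \<gamma>
 proof -
  have "\<bar>trig_prod N \<alpha> \<beta> \<gamma> y\<bar> <= (\<Prod>i<N. \<bar>\<alpha> i\<bar> + \<bar>\<beta> i\<bar>)" for y unfolding trig_prod_def abs_prod
  proof (intro prod_mono conjI)
   fix i
   have "\<bar>\<alpha> i + \<beta> i * sin (y i + \<gamma> i)\<bar> <= \<bar>\<alpha> i\<bar> + \<bar>\<beta> i\<bar> * \<bar>sin (y i + \<gamma> i)\<bar>" by (metis abs_mult abs_triangle_ineq)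
   also have "... <= \<bar>\<alpha> i\<bar> + \<bar>\<beta> i\<bar> * 1" by (intro add_left_mono mult_left_mono) auto
   finally show "\<bar>\<alpha> i + \<beta> i * sin (y i + \<gamma> i)\<bar> <= \<bar>\<alpha> i\<bar> + \<bar>\<beta> i\<bar>" by simp
  qed auto
  then show ?thesis unfolding bounded_iff by auto
 qed
 have d: "(\<lambda>t. trig_prod N \<alpha> \<beta> \<gamma> (y(i := t))) differentiable (at (y i))" if "i < N" for \<alpha> \<gamma> y i
  using DERIV_trig_prod[OF that] unfolding differentiable_def has_field_derivative_def by blast
 have sq: "continuous_on UNIV (seq_partials is (trig_prod N \<alpha> \<beta> \<gamma>)) & bounded (range (seq_partials is (trig_prod N \<alpha> \<beta> \<gamma>))) &
   (\<forall>i<N. \<forall>y. (\<lambda>t. seq_partials is (trig_prod N \<alpha> \<beta> \<gamma>) (y(i := t))) differentiable (at (y i)))"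
  if is_set: "set is \<subseteq> {..<N}" for "is"
 proof -
  obtain \<alpha>' \<gamma>' where "seq_partials is (trig_prod N \<alpha> \<beta> \<gamma>) = trig_prod N \<alpha>' \<beta> \<gamma>'" using seq_partials_trig_prod[OF is_set] by blast
  then show ?thesis using c b d by simp
 qed
 moreover have "trig_prod N \<alpha> \<beta> \<gamma> y = trig_prod N \<alpha> \<beta> \<gamma> z" if "\<forall>i<N. y i = z i" for y z
  unfolding trig_prod_def using that by (auto intro!: prod.cong)
 ultimately show ?thesis unfolding bounded_smooth_def by blast
qed

section \<open>Products of weakly differentiable functions\<close>

lemma integral_lborel_translate:
 fixes f :: "'a::euclidean_space => real"
 shows "f \<in> borel_measurable borel ==> (LINT x|lborel. f (c + x)) = (LINT x|lborel. f x)"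
  and "f \<in> borel_measurable borel ==> integrable lborel (\<lambda>x. f (c + x)) \<longleftrightarrow> integrable lborel f"
 using integral_distr[of "(+) c" lborel borel f] integrable_distr_eq[of "(+) c" lborel borel f] by (simp_all add: lborel_distr_plus)

lemma partial_along:
 assumes "f differentiable (at (x + t *\<^sub>R axis i 1))"
 shows "((\<lambda>t. f (x + t *\<^sub>R axis i 1)) has_real_derivative partial i f (x + t *\<^sub>R axis i 1)) (at t)"
proof -
 have "((\<lambda>t. x + t *\<^sub>R axis i (1::real)) has_derivative (\<lambda>h. h *\<^sub>R axis i 1)) (at t)" by (auto intro!: derivative_eq_intros)
 from has_derivative_compose[OF this differentiable_has_derivative[OF assms]]
 have d: "((\<lambda>t. f (x + t *\<^sub>R axis i 1)) has_derivative (\<lambda>h. frechet_derivative f (at (x + t *\<^sub>R axis i 1)) (h *\<^sub>R axis i 1))) (at t)" .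
 have "frechet_derivative f (at (x + t *\<^sub>R axis i 1)) (h *\<^sub>R axis i 1) = partial i f (x + t *\<^sub>R axis i 1) * h" for h
  using linear_frechet_derivative[OF assms] by (simp add: linear_scale partial_def)
 then show ?thesis using d unfolding has_field_derivative_def by simp
qed

lemma differential_quotient_bound:
 fixes f :: "real^'n::finite => real"
 assumes d: "!!x. f differentiable (at x)" and B: "!!x. \<bar>partial i f x\<bar> <= B" and h: "0 < h"
 shows "\<bar>f (x + h *\<^sub>R axis i 1) - f x\<bar> <= h * B"
proof -
 obtain t where "0 < t" "t < h" "f (x + h *\<^sub>R axis i 1) - f (x + 0 *\<^sub>R axis i 1) = (h - 0) * partial i f (x + t *\<^sub>R axis i 1)"
  using MVT2[of 0 h "\<lambda>t. f (x + t *\<^sub>R axis i 1)" "\<lambda>t. partial i f (x + t *\<^sub>R axis i 1)"] h partial_along[OF d] by blast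
 then show ?thesis using B[of "x + t *\<^sub>R axis i 1"] h by (simp add: abs_mult mult_left_mono)
qed

lemma partial_zero_outside:
 fixes f :: "real^'n::finite => 'b::real_normed_vector"
 assumes "closed K" "{x. f x ~= 0} \<subseteq> K" "x \<notin> K"
 shows "partial i f x = 0"
proof -
 have "partial i f x = partial i (\<lambda>_. 0) x" by (rule partial_cong[of "\<lambda>_. 0" x "- K"]) (use assms in auto)
 also have "... = 0" by (subst partial_eq[OF has_derivative_const]) simp
 finally show ?thesis .
qed

lemma bounded_of_compact_support:
 fixes f :: "'x::topological_space => real"
 assumes "compact K" "{x. f x ~= 0} \<subseteq> K" "continuous_on UNIV f"
 shows "\<exists>B\<ge>0. \<forall>x. \<bar>f x\<bar> <= B"
proof -
 have "compact (f ` K)" by (rule compact_continuous_image[OF continuous_on_subset[OF assms(3)] assms(1)]) auto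
 then obtain b where b: "\<forall>y\<in>f ` K. norm y <= b" using compact_imp_bounded bounded_iff by blast
 have "\<bar>f x\<bar> <= max 0 b" for x
 proof (cases "f x = 0")
  case False
  then have "\<bar>f x\<bar> <= b" using b assms(2) by auto
  then show ?thesis by simp
 qed simp
 then show ?thesis by (intro exI[of _ "max 0 b"]) auto
qed

lemma integrable_indicator_compact:
 fixes K :: "'a::euclidean_space set"
 assumes "compact K" shows "integrable lborel (indicat_real K)" using assms emeasure_compact_finite[OF assms]
 by (intro integrable_real_indicator) (auto simp: compact_imp_closed)

lemma integrable_compact_support:
 fixes f :: "'a::euclidean_space => real"
 assumes K: "compact K" "{x. f x ~= 0} \<subseteq> K" and f: "f \<in> borel_measurable borel" "!!x. \<bar>f x\<bar> <= B"
 shows "integrable lborel f"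
proof (rule Bochner_Integration.integrable_bound[where f="\<lambda>x. B * indicat_real K x"])
 have "integrable lborel (indicat_real K)" by (rule integrable_indicator_compact[OF K(1)])
 then show "integrable lborel (\<lambda>x. B * indicat_real K x)" by (rule integrable_mult_right)
 show "AE x in lborel. norm (f x) <= norm (B * indicat_real K x)"
 proof (rule AE_I2)
  fix x show "norm (f x) <= norm (B * indicat_real K x)"
  proof (cases "x \<in> K")
   case True then show ?thesis using f(2)[of x] by simp
  next
   case False then have "f x = 0" using K(2) by auto
   then show ?thesis by simp
  qed
 qed
qed (use f in simp)

text \<open>Lebesgue measure is translation invariant, so every difference quotient of
  \<open>f\<close> integrates to 0, and dominated convergence carries this over to the
  derivative.\<close>

lemma integral_partial_eq_0:
 fixes f :: "real^'n::finite => real"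
 assumes K: "compact K" "{x. f x ~= 0} \<subseteq> K"
  and d: "!!x. f differentiable (at x)" and c: "continuous_on UNIV (partial i f)"
 shows "(LINT x|lborel. partial i f x) = 0"
proof -
 have z: "{x. partial i f x ~= 0} \<subseteq> K" using partial_zero_outside[OF compact_imp_closed[OF K(1)] K(2)] by blast
 obtain B where B: "!!x. \<bar>partial i f x\<bar> <= B" "0 <= B" using bounded_of_compact_support[OF K(1) z c] by blast
 have cf: "continuous_on UNIV f" using d by (simp add: continuous_at_imp_continuous_on differentiable_imp_continuous_within)
 have fm: "f \<in> borel_measurable borel" using cf by (rule borel_measurable_continuous_onI)
 obtain B' where B': "!!x. \<bar>f x\<bar> <= B'" using bounded_of_compact_support[OF K cf] by blast
 have fi: "integrable lborel f" by (rule integrable_compact_support[OF K fm B'])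
 obtain r where "\<forall>x\<in>K. norm x <= r" using compact_imp_bounded[OF K(1)] unfolding bounded_iff by blast
 then have r: "K \<subseteq> cball 0 r" by auto
 define h where "h n = 1 / real (Suc n)" for n
 have h: "0 < h n" "h n <= 1" for n by (auto simp: h_def)
 have h0: "h \<longlonglongrightarrow> 0" unfolding h_def by real_asymp
 let ?q = "\<lambda>n x. (f (x + h n *\<^sub>R axis i 1) - f x) / h n"
 \<comment> \<open>Steps are at most 1, so all quotients vanish outside the ball of radius
   \<open>r + 1\<close>; the mean value theorem bounds them by \<open>B\<close>.\<close>
 let ?w = "\<lambda>x. B * indicat_real (cball 0 (r + 1)) x"
 have w: "integrable lborel ?w" by (intro integrable_mult_right integrable_indicator_compact compact_cball)
 have lim: "(\<lambda>n. LINT x|lborel. ?q n x) \<longlonglongrightarrow> (LINT x|lborel. partial i f x)"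
 proof (rule integral_dominated_convergence[where w="?w"])
  show "AE x in lborel. (\<lambda>n. ?q n x) \<longlonglongrightarrow> partial i f x"
  proof (rule AE_I2)
   fix x
   have "((\<lambda>t. f (x + t *\<^sub>R axis i 1)) has_real_derivative partial i f (x + 0 *\<^sub>R axis i 1)) (at 0)"
    by (rule partial_along) (use d in simp)
   then have "((\<lambda>t. (f (x + t *\<^sub>R axis i 1) - f x) / t) \<longlongrightarrow> partial i f x) (at 0)" by (simp add: DERIV_def)
   moreover have "filterlim h (at 0) sequentially"
   proof -
    have "h n ~= 0" for n using h(1)[of n] by simp
    then show ?thesis using h0 by (simp add: filterlim_at)
   qed
   ultimately show "(\<lambda>n. ?q n x) \<longlonglongrightarrow> partial i f x" by (rule filterlim_compose)
  qed
  show "AE x in lborel. norm (?q n x) <= ?w x" for n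
  proof (rule AE_I2)
   fix x
   show "norm (?q n x) <= ?w x"
   proof (cases "x \<in> cball 0 (r + 1)")
    case True
    then show ?thesis using differential_quotient_bound[OF d B(1) h(1), where x=x] h(1)[of n]
     by (simp add: abs_divide divide_le_eq mult.commute)
   next
    case False
    have "x \<notin> K" using False r by auto
    moreover have "x + h n *\<^sub>R axis i 1 \<notin> K"
    proof
     assume "x + h n *\<^sub>R axis i 1 \<in> K"
     then have "norm (x + h n *\<^sub>R axis i 1) <= r" using r by auto
     moreover have "norm (h n *\<^sub>R axis i (1::real)) <= 1" using h[of n] by (simp add: norm_axis_1)
     ultimately have "norm x <= r + 1" using norm_triangle_ineq4[of "x + h n *\<^sub>R axis i 1" "h n *\<^sub>R axis i 1"] by simp
     then show False using False by simp
    qed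
    ultimately have "f x = 0" "f (x + h n *\<^sub>R axis i 1) = 0" using K(2) by auto
    then show ?thesis using B by simp
   qed
  qed
  show "partial i f \<in> borel_measurable lborel" using borel_measurable_continuous_onI[OF c] by simp
  show "?q n \<in> borel_measurable lborel" for n using fm by measurable
 qed (rule w)
 have zero: "(LINT x|lborel. ?q n x) = 0" for n
 proof -
  have t: "(LINT x|lborel. f (x + h n *\<^sub>R axis i 1)) = (LINT x|lborel. f x)"
   "integrable lborel (\<lambda>x. f (x + h n *\<^sub>R axis i 1))"
   using integral_lborel_translate[OF fm, of "h n *\<^sub>R axis i 1"] fi by (simp_all add: add.commute)
  have "(LINT x|lborel. ?q n x) = ((LINT x|lborel. f (x + h n *\<^sub>R axis i 1)) - (LINT x|lborel. f x)) / h n" using t(2) fi by simp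
  then show ?thesis using t(1) by simp
 qed
 show ?thesis using LIMSEQ_unique[OF lim] unfolding zero by simp
qed

section \<open>Square integrable functions and their correlations\<close>

lemma square_le_dominated: "(a - b)\<^sup>2 <= a\<^sup>2" if "0 <= b & b <= a \<or> a <= b & b <= (0::real)"
proof -
 have "\<bar>a - b\<bar> <= \<bar>a\<bar>" using that by auto
 then show ?thesis by (simp add: abs_le_square_iff)
qed

text \<open>Truncation of the values at level \<open>n\<close> and of the domain at radius about
  \<open>n\<close> makes the error small. Both truncations preserve continuity, so they can also be
  applied to continuous functions that converge to \<open>a\<close> almost everywhere, and then the
  convergence is dominated.\<close>

lemma square_integrable_approx_continuous:
 fixes a :: "'a::euclidean_space => real"
 assumes a[measurable]: "a \<in> borel_measurable borel" and a2: "integrable lborel (\<lambda>x. (a x)\<^sup>2)" and e: "0 < e"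
 shows "\<exists>c r. continuous_on UNIV c & {x. c x ~= 0} \<subseteq> cball 0 r & integrable lborel (\<lambda>x. (a x - c x)\<^sup>2) &
  (LINT x|lborel. (a x - c x)\<^sup>2) < e"
proof -
 define cl where "cl M t = max (- M) (min M t)" for M t :: real
 define cut where "cut M x = max 0 (min 1 (M + 1 - norm x))" for M and x :: 'a
 have cutb: "0 <= cut M x" "cut M x <= 1" for M x unfolding cut_def by auto
 have clc: "continuous_on UNIV (cl M)" for M unfolding cl_def by (intro continuous_intros)
 have cutc: "continuous_on UNIV (cut M)" for M unfolding cut_def by (intro continuous_intros)
 have [measurable]: "cl M \<in> borel_measurable borel" "cut M \<in> borel_measurable borel" for M
  using clc cutc by (auto intro: borel_measurable_continuous_onI)
 have clb: "\<bar>cl M t\<bar> <= M" if "0 <= M" for M t using that unfolding cl_def by auto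
 define aM where "aM n x = cl (real n) (a x) * cut (real n) x" for n x
 have [measurable]: "aM n \<in> borel_measurable borel" for n unfolding aM_def by measurable
 have aM_le: "(a x - aM n x)\<^sup>2 <= (a x)\<^sup>2" for n x
 proof (rule square_le_dominated)
  have "0 <= a x ==> 0 <= cl (real n) (a x) & cl (real n) (a x) <= a x"
   "a x <= 0 ==> cl (real n) (a x) <= 0 & a x <= cl (real n) (a x)" unfolding cl_def by auto
  then show "0 <= aM n x & aM n x <= a x \<or> a x <= aM n x & aM n x <= 0" unfolding aM_def using cutb[of "real n" x]
   by (smt (verit) mult_left_le mult_nonneg_nonneg mult_nonpos_nonneg mult_minus_left)
 qed
 have "(\<lambda>n. LINT x|lborel. (a x - aM n x)\<^sup>2) \<longlonglongrightarrow> (LINT x|lborel. (0::real) * (a x)\<^sup>2)"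
 proof (rule integral_dominated_convergence[OF _ _ a2])
  show "AE x in lborel. (\<lambda>n. (a x - aM n x)\<^sup>2) \<longlonglongrightarrow> 0 * (a x)\<^sup>2"
  proof (rule AE_I2)
   fix x
   have "\<forall>\<^sub>F n in sequentially. \<bar>a x\<bar> + norm x <= real n" by (rule eventually_at_top_linorderI[of "nat \<lceil>\<bar>a x\<bar> + norm x\<rceil>"]) linarith
   then have "\<forall>\<^sub>F n in sequentially. (a x - aM n x)\<^sup>2 = 0"
   proof eventually_elim
    fix n assume "\<bar>a x\<bar> + norm x <= real n"
    then have "norm x <= real n" "\<bar>a x\<bar> <= real n" using norm_ge_zero[of x] by linarith+
    then have "cl (real n) (a x) = a x" "cut (real n) x = 1" unfolding cl_def cut_def by (auto simp: min_def max_def)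
    then show "(a x - aM n x)\<^sup>2 = 0" by (simp add: aM_def)
   qed
   then show "(\<lambda>n. (a x - aM n x)\<^sup>2) \<longlonglongrightarrow> 0 * (a x)\<^sup>2" by (simp add: tendsto_eventually)
  qed
  show "AE x in lborel. norm ((a x - aM n x)\<^sup>2) <= (a x)\<^sup>2" for n using aM_le by simp
 qed measurable
 then have "\<forall>\<^sub>F n in sequentially. (LINT x|lborel. (a x - aM n x)\<^sup>2) < e / 4" using e by (intro order_tendstoD) auto
 then obtain n where n: "(LINT x|lborel. (a x - aM n x)\<^sup>2) < e / 4" by (auto dest: eventually_happens)
 have ni: "integrable lborel (\<lambda>x. (a x - aM n x)\<^sup>2)"
  by (rule Bochner_Integration.integrable_bound[OF a2]) (use aM_le in \<open>auto simp: power2_eq_square[symmetric]\<close>)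
 have "a \<in> borel_measurable lebesgue" using a by (simp add: measurable_completion)
 then have "a measurable_on UNIV" by (rule lebesgue_measurable_imp_measurable_on) simp
 then obtain N g where N: "negligible N" and gc: "!!k. continuous_on UNIV (g k)"
  and lim: "!!x. x \<notin> N ==> (\<lambda>k. g k x) \<longlonglongrightarrow> a x" unfolding measurable_on_def by auto
 have [measurable]: "g k \<in> borel_measurable borel" for k using gc by (rule borel_measurable_continuous_onI)
 have "N \<in> null_sets lebesgue" using N negligible_iff_null_sets by blast
 then have "AE x in lebesgue. x \<notin> N" by (rule AE_not_in)
 then have AEN: "AE x in lborel. x \<notin> N" by (simp add: AE_completion_iff)
 define c where "c k x = cl (real n) (g k x) * cut (real n) x" for k x
 have [measurable]: "c k \<in> borel_measurable borel" for k unfolding c_def by measurable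
 have cc: "continuous_on UNIV (c k)" for k unfolding c_def by (intro continuous_on_mult cutc continuous_on_compose2[OF clc gc]) auto
 have supp: "{x. c k x ~= 0} \<subseteq> cball 0 (real n + 1)" for k unfolding c_def cut_def by (auto simp: max_def min_def split: if_splits)
 have dom: "(aM n x - c k x)\<^sup>2 <= (2 * real n)\<^sup>2 * indicat_real (cball 0 (real n + 1)) x" for k x
 proof (cases "x \<in> cball 0 (real n + 1)")
  case True
  have "\<bar>aM n x\<bar> <= real n" "\<bar>c k x\<bar> <= real n" unfolding aM_def c_def abs_mult using clb[of "real n"] cutb[of "real n" x]
   by (auto intro!: order_trans[OF mult_left_le])
  then have "\<bar>aM n x - c k x\<bar> <= \<bar>2 * real n\<bar>" by linarith
  then have "(aM n x - c k x)\<^sup>2 <= (2 * real n)\<^sup>2" by (rule abs_le_square_iff[THEN iffD1])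
  then show ?thesis using True by simp
 next
  case False
  then have "cut (real n) x = 0" unfolding cut_def by auto
  then show ?thesis by (simp add: aM_def c_def)
 qed
 have wi: "integrable lborel (\<lambda>x. (2 * real n)\<^sup>2 * indicat_real (cball (0::'a) (real n + 1)) x)"
  by (intro integrable_mult_right integrable_indicator_compact compact_cball)
 have "(\<lambda>k. LINT x|lborel. (aM n x - c k x)\<^sup>2) \<longlonglongrightarrow> (LINT x|lborel. (aM n x - aM n x)\<^sup>2)"
 proof (rule integral_dominated_convergence[OF _ _ wi])
  show "AE x in lborel. (\<lambda>k. (aM n x - c k x)\<^sup>2) \<longlonglongrightarrow> (aM n x - aM n x)\<^sup>2" using AEN
  proof eventually_elim
   fix x assume "x \<notin> N"
   from lim[OF this] show "(\<lambda>k. (aM n x - c k x)\<^sup>2) \<longlonglongrightarrow> (aM n x - aM n x)\<^sup>2" unfolding aM_def c_def cl_def by (intro tendsto_intros)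
  qed
  show "AE x in lborel. norm ((aM n x - c k x)\<^sup>2) <= (2 * real n)\<^sup>2 * indicat_real (cball 0 (real n + 1)) x" for k using dom by simp
 qed measurable
 then have "\<forall>\<^sub>F k in sequentially. (LINT x|lborel. (aM n x - c k x)\<^sup>2) < e / 4" using e by (intro order_tendstoD) auto
 then obtain k where k: "(LINT x|lborel. (aM n x - c k x)\<^sup>2) < e / 4" by (auto dest: eventually_happens)
 have ki: "integrable lborel (\<lambda>x. (aM n x - c k x)\<^sup>2)" by (rule Bochner_Integration.integrable_bound[OF wi]) (use dom in auto)
 \<comment> \<open>The factors 2 explain why both approximations were made with accuracy
   \<open>e / 4\<close>.\<close>
 have le: "(a x - c k x)\<^sup>2 <= 2 * (a x - aM n x)\<^sup>2 + 2 * (aM n x - c k x)\<^sup>2" for x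
  using zero_le_power2[of "(a x - aM n x) - (aM n x - c k x)"] by (simp add: power2_eq_square algebra_simps)
 have bi: "integrable lborel (\<lambda>x. 2 * (a x - aM n x)\<^sup>2 + 2 * (aM n x - c k x)\<^sup>2)" using ni ki by simp
 have ci: "integrable lborel (\<lambda>x. (a x - c k x)\<^sup>2)" by (rule Bochner_Integration.integrable_bound[OF bi]) (use le in auto)
 have "(LINT x|lborel. (a x - c k x)\<^sup>2) <= (LINT x|lborel. 2 * (a x - aM n x)\<^sup>2 + 2 * (aM n x - c k x)\<^sup>2)"
  by (rule integral_mono[OF ci bi le])
 also have "... = 2 * (LINT x|lborel. (a x - aM n x)\<^sup>2) + 2 * (LINT x|lborel. (aM n x - c k x)\<^sup>2)" using ni ki by simp
 also have "... < e" using n k by simp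
 finally show ?thesis using cc supp ci by blast
qed

lemma integrable_mult_squares:
 fixes a b :: "'x => real"
 assumes [measurable]: "a \<in> borel_measurable M" "b \<in> borel_measurable M"
  and "integrable M (\<lambda>x. (a x)\<^sup>2)" "integrable M (\<lambda>x. (b x)\<^sup>2)"
 shows "integrable M (\<lambda>x. a x * b x)"
proof (rule Bochner_Integration.integrable_bound)
 show "integrable M (\<lambda>x. (a x)\<^sup>2 + (b x)\<^sup>2)" using assms by simp
 have "\<bar>a x * b x\<bar> <= (a x)\<^sup>2 + (b x)\<^sup>2" for x
  using zero_le_power2[of "a x - b x"] zero_le_power2[of "a x + b x"] zero_le_power2[of "a x"] zero_le_power2[of "b x"]
  by (simp add: power2_eq_square algebra_simps abs_if)
 then show "AE x in M. norm (a x * b x) <= norm ((a x)\<^sup>2 + (b x)\<^sup>2)" by simp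
qed measurable

text \<open>Young's inequality with a free weight, in place of Cauchy-Schwarz: a small
  \<open>e\<close> makes the term with \<open>b\<close> small, after which the term with
  \<open>a\<close> is made small by approximation.\<close>

lemma abs_integral_mult_le:
 fixes a b :: "'x => real"
 assumes [measurable]: "a \<in> borel_measurable M" "b \<in> borel_measurable M"
  and i: "integrable M (\<lambda>x. (a x)\<^sup>2)" "integrable M (\<lambda>x. (b x)\<^sup>2)" and e: "0 < e"
 shows "\<bar>LINT x|M. a x * b x\<bar> <= (LINT x|M. (a x)\<^sup>2) / e + e * (LINT x|M. (b x)\<^sup>2)"
proof -
 have "\<bar>a x * b x\<bar> <= (a x)\<^sup>2 / e + e * (b x)\<^sup>2" for x
 proof -
  have "0 <= (\<bar>a x\<bar> - e * \<bar>b x\<bar>)\<^sup>2" by simp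
  then have "2 * e * (\<bar>a x\<bar> * \<bar>b x\<bar>) <= (a x)\<^sup>2 + (e * b x)\<^sup>2" by (simp add: power2_eq_square algebra_simps)
  then have "2 * (\<bar>a x\<bar> * \<bar>b x\<bar>) <= (a x)\<^sup>2 / e + e * (b x)\<^sup>2" using e by (simp add: power2_eq_square field_simps)
  moreover have "0 <= \<bar>a x\<bar> * \<bar>b x\<bar>" by simp
  ultimately show ?thesis unfolding abs_mult by linarith
 qed
 moreover have "integrable M (\<lambda>x. (a x)\<^sup>2 / e + e * (b x)\<^sup>2)" using i by simp
 ultimately have "(LINT x|M. \<bar>a x * b x\<bar>) <= (LINT x|M. (a x)\<^sup>2 / e + e * (b x)\<^sup>2)"
  by (intro integral_mono integrable_abs integrable_mult_squares i) auto
 also have "... = (LINT x|M. (a x)\<^sup>2) / e + e * (LINT x|M. (b x)\<^sup>2)" using i by simp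
 finally show ?thesis using integral_abs_bound[of M "\<lambda>x. a x * b x"] by linarith
qed

text \<open>Replacing \<open>a\<close> by a continuous \<open>c\<close> of compact support costs
  little, uniformly in the shift, because translations preserve the norm of \<open>b\<close>. For
  \<open>c\<close> the translation is moved from \<open>b\<close> to \<open>c\<close>, where it
  converges pointwise.\<close>

lemma correlation_tendsto:
 fixes a b :: "'a::euclidean_space => real"
 assumes a[measurable]: "a \<in> borel_measurable borel" and b[measurable]: "b \<in> borel_measurable borel"
  and a2: "integrable lborel (\<lambda>x. (a x)\<^sup>2)" and b2: "integrable lborel (\<lambda>x. (b x)\<^sup>2)"
  and h: "h \<longlonglongrightarrow> 0"
 shows "(\<lambda>n. LINT x|lborel. a x * b (h n + x)) \<longlonglongrightarrow> (LINT x|lborel. a x * b x)"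
proof -
 have b2m: "(\<lambda>x. (b x)\<^sup>2) \<in> borel_measurable borel" by measurable
 have bt: "integrable lborel (\<lambda>x. (b (t + x))\<^sup>2)" "(LINT x|lborel. (b (t + x))\<^sup>2) = (LINT x|lborel. (b x)\<^sup>2)" for t
  using integral_lborel_translate[OF b2m, of t] b2 by auto
 define S where "S = (LINT x|lborel. (b x)\<^sup>2)"
 have S: "0 <= S" unfolding S_def by simp
 show ?thesis
 proof (rule LIMSEQ_I)
  fix r :: real assume r: "0 < r"
  \<comment> \<open>With this weight the term containing the norm of \<open>b\<close> stays below
    r/8; the 1 added to \<open>S\<close> avoids a division by zero. Approximating \<open>a\<close>
    with accuracy \<open>e * (r / 8)\<close> makes the other term smaller than r/8 as well.\<close>
  define e where "e = r / (8 * (S + 1))"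
  have e: "0 < e" unfolding e_def using r S by simp
  have eS: "e * S < r / 8" unfolding e_def using r S by (simp add: field_simps)
  obtain c R where c: "continuous_on UNIV c" "{x. c x ~= 0} \<subseteq> cball 0 R"
   "integrable lborel (\<lambda>x. (a x - c x)\<^sup>2)" "(LINT x|lborel. (a x - c x)\<^sup>2) < e * (r / 8)"
   using square_integrable_approx_continuous[OF a a2, of "e * (r / 8)"] e r by auto
  have cm[measurable]: "c \<in> borel_measurable borel" using c(1) by (rule borel_measurable_continuous_onI)
  obtain B where B: "!!x. \<bar>c x\<bar> <= B" "0 <= B" using bounded_of_compact_support[OF compact_cball c(2) c(1)] by blast
  have c2: "integrable lborel (\<lambda>x. (c x)\<^sup>2)" by (rule integrable_compact_support[of "cball 0 R" _ "B\<^sup>2"])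
    (use c(2) B in \<open>auto simp: abs_le_square_iff[symmetric]\<close>)
  have close: "\<bar>(LINT x|lborel. a x * b (t + x)) - (LINT x|lborel. c x * b (t + x))\<bar> < r / 4" for t
  proof -
   have "(LINT x|lborel. a x * b (t + x)) - (LINT x|lborel. c x * b (t + x)) = (LINT x|lborel. (a x - c x) * b (t + x))"
    by (subst Bochner_Integration.integral_diff[symmetric]) (auto intro!: integrable_mult_squares a2 c2 bt simp: left_diff_distrib)
   also have "\<bar>...\<bar> <= (LINT x|lborel. (a x - c x)\<^sup>2) / e + e * (LINT x|lborel. (b (t + x))\<^sup>2)"
    by (rule abs_integral_mult_le) (use c(3) bt e in auto)
   also have "... < r / 8 + r / 8"
   proof (rule add_strict_mono)
    show "(LINT x|lborel. (a x - c x)\<^sup>2) / e < r / 8" using c(4) e by (simp add: divide_less_eq mult.commute)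
    show "e * (LINT x|lborel. (b (t + x))\<^sup>2) < r / 8" using eS bt(2)[of t] by (simp add: S_def)
   qed
   finally show ?thesis by simp
  qed
  have tr: "(LINT x|lborel. c x * b (t + x)) = (LINT x|lborel. c (x - t) * b x)" for t
  proof -
   have "(\<lambda>x. c (x - t) * b x) \<in> borel_measurable borel" by measurable
   from integral_lborel_translate(1)[OF this, of t] show ?thesis by simp
  qed
  have hb: "\<forall>\<^sub>F n in sequentially. norm (h n) < 1" using tendsto_norm[OF h] by (rule order_tendstoD) simp
  then obtain n0 where n0: "!!n. n \<ge> n0 ==> norm (h n) < 1" unfolding eventually_sequentially by blast
  have bi: "integrable lborel (\<lambda>x. B * (indicat_real (cball 0 (R + 1)) x * b x))"
  proof (intro integrable_mult_right integrable_mult_squares b2)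
   have "integrable lborel (indicat_real (cball (0::'a) (R + 1)))" by (rule integrable_indicator_compact[OF compact_cball])
   then show "integrable lborel (\<lambda>x. (indicat_real (cball (0::'a) (R + 1)) x)\<^sup>2)"
    by (simp add: power2_eq_square indicator_inter_arith[symmetric])
  qed (auto intro!: borel_measurable_indicator b)
  have "(\<lambda>n. LINT x|lborel. c (x - h (n + n0)) * b x) \<longlonglongrightarrow> (LINT x|lborel. c x * b x)"
  proof (rule integral_dominated_convergence[where w="\<lambda>x. \<bar>B * (indicat_real (cball 0 (R + 1)) x * b x)\<bar>"])
   show "integrable lborel (\<lambda>x. \<bar>B * (indicat_real (cball 0 (R + 1)) x * b x)\<bar>)" by (rule integrable_abs[OF bi])
   show "AE x in lborel. (\<lambda>n. c (x - h (n + n0)) * b x) \<longlonglongrightarrow> c x * b x"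
   proof (rule AE_I2)
    fix x
    have "(\<lambda>n. x - h (n + n0)) \<longlonglongrightarrow> x - 0" by (intro tendsto_intros LIMSEQ_ignore_initial_segment h)
    then have "(\<lambda>n. c (x - h (n + n0))) \<longlonglongrightarrow> c x"
     using c(1) by (intro isCont_tendsto_compose[of x c]) (auto simp: continuous_on_eq_continuous_at)
    then show "(\<lambda>n. c (x - h (n + n0)) * b x) \<longlonglongrightarrow> c x * b x" by (intro tendsto_intros)
   qed
   show "AE x in lborel. norm (c (x - h (n + n0)) * b x) <= \<bar>B * (indicat_real (cball 0 (R + 1)) x * b x)\<bar>" for n
   proof (rule AE_I2)
    fix x
    show "norm (c (x - h (n + n0)) * b x) <= \<bar>B * (indicat_real (cball 0 (R + 1)) x * b x)\<bar>"
    proof (cases "x \<in> cball 0 (R + 1)")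
     case True
     then show ?thesis using B by (auto simp: abs_mult intro!: mult_right_mono order_trans[OF B(1)])
    next
     case False
     have "norm x <= norm (x - h (n + n0)) + norm (h (n + n0))" using norm_triangle_ineq[of "x - h (n + n0)" "h (n + n0)"] by simp
     then have "x - h (n + n0) \<notin> cball 0 R" using False n0[of "n + n0"] by auto
     then have "c (x - h (n + n0)) = 0" using c(2) by blast
     then show ?thesis by simp
    qed
   qed
  qed measurable
  then have "(\<lambda>n. LINT x|lborel. c (x - h n) * b x) \<longlonglongrightarrow> (LINT x|lborel. c x * b x)" by (rule LIMSEQ_offset)
  from LIMSEQ_D[OF this, of "r / 4"] r obtain n1 where
   n1: "!!n. n \<ge> n1 ==> \<bar>(LINT x|lborel. c (x - h n) * b x) - (LINT x|lborel. c x * b x)\<bar> < r / 4" by auto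
  show "\<exists>no. \<forall>n\<ge>no. norm ((LINT x|lborel. a x * b (h n + x)) - (LINT x|lborel. a x * b x)) < r"
  proof (intro exI allI impI)
   fix n assume "n1 <= n"
   then show "norm ((LINT x|lborel. a x * b (h n + x)) - (LINT x|lborel. a x * b x)) < r"
   proof -
    have "\<bar>A - A0\<bar> < r" if "\<bar>A - C\<bar> < r / 4" "\<bar>C - C0\<bar> < r / 4" "\<bar>A0 - C0\<bar> < r / 4" for A A0 C C0 :: real using that r by linarith
    from this[OF close[of "h n", unfolded tr] n1[OF \<open>n1 <= n\<close>]] close[of 0] show ?thesis by simp
   qed
  qed
 qed
qed

section \<open>The product rule for weak derivatives\<close>

lemma integral_shift_swap:
 fixes f :: "'a::euclidean_space \<times> 'a => real"
 assumes f: "integrable (lborel \<Otimes>\<^sub>M lborel) f"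
 shows "(LINT x|lborel. LINT y|lborel. f (x, y)) = (LINT h|lborel. LINT x|lborel. f (x, h + x))"
  and "integrable lborel (\<lambda>h. LINT x|lborel. f (x, h + x))"
proof -
 have fm[measurable]: "f \<in> borel_measurable (borel \<Otimes>\<^sub>M borel)" using borel_measurable_integrable[OF f] by simp
 have tr: "(LINT h|lborel. k (h + x)) = (LINT y|lborel. k y)" "integrable lborel (\<lambda>h. k (h + x)) \<longleftrightarrow> integrable lborel k"
  if "k \<in> borel_measurable borel" for k :: "'a => real" and x using integral_lborel_translate[OF that, of x] by (simp_all add: add.commute)
 have g: "integrable (lborel \<Otimes>\<^sub>M lborel) (\<lambda>p. f (fst p, snd p + fst p))"
 proof (rule lborel_pair.Fubini_integrable)
  show "(\<lambda>p. f (fst p, snd p + fst p)) \<in> borel_measurable (lborel \<Otimes>\<^sub>M lborel)" by measurable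
  have "(LINT y|lborel. norm (f (x, y + x))) = (LINT y|lborel. norm (f (x, y)))" for x
   by (rule tr(1)[of "\<lambda>y. norm (f (x, y))"]) measurable
  then show "integrable lborel (\<lambda>x. LINT y|lborel. norm (f (fst (x, y), snd (x, y) + fst (x, y))))"
   using lborel_pair.integrable_fst'[OF integrable_norm[OF f]] by simp
  have "AE x in lborel. integrable lborel (\<lambda>y. f (x, y))" by (rule lborel_pair.AE_integrable_fst'[OF f])
  then show "AE x in lborel. integrable lborel (\<lambda>y. f (fst (x, y), snd (x, y) + fst (x, y)))"
   by eventually_elim (simp add: tr(2)[of "\<lambda>y. f (x, y)" for x])
 qed
 have g': "integrable (lborel \<Otimes>\<^sub>M lborel) (\<lambda>(x, h). f (x, h + x))" unfolding case_prod_beta' by (rule g)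
 have "(LINT x|lborel. LINT y|lborel. f (x, y)) = (LINT x|lborel. LINT h|lborel. f (x, h + x))"
  by (rule Bochner_Integration.integral_cong[OF refl], rule tr(1)[of "\<lambda>y. f (x, y)" for x, symmetric]) measurable
 also have "... = (LINT h|lborel. LINT x|lborel. f (x, h + x))" by (rule lborel_pair.Fubini_integral[OF g', symmetric])
 finally show "(LINT x|lborel. LINT y|lborel. f (x, y)) = (LINT h|lborel. LINT x|lborel. f (x, h + x))" .
 show "integrable lborel (\<lambda>h. LINT x|lborel. f (x, h + x))" by (rule lborel_pair.integrable_snd[OF g'])
qed

lemma integrable_product_bounded:
 fixes p q G :: "'a::euclidean_space => real"
 assumes p: "integrable lborel p" and q: "integrable lborel q"
  and G[measurable]: "G \<in> borel_measurable borel" "!!x. \<bar>G x\<bar> <= B"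
 shows "integrable (lborel \<Otimes>\<^sub>M lborel) (\<lambda>(x, y). p x * q y * G (y - x))"
proof (rule Bochner_Integration.integrable_bound)
 have [measurable]: "p \<in> borel_measurable borel" "q \<in> borel_measurable borel"
  using borel_measurable_integrable[OF p] borel_measurable_integrable[OF q] by simp_all
 show "integrable (lborel \<Otimes>\<^sub>M lborel) (\<lambda>(x, y). B * (p x * q y))"
 proof (rule lborel_pair.Fubini_integrable)
  have "(LINT y|lborel. norm (case (x, y) of (x, y) => B * (p x * q y))) = \<bar>B\<bar> * (\<bar>p x\<bar> * (LINT y|lborel. \<bar>q y\<bar>))" for x
   by (simp add: abs_mult)
  then show "integrable lborel (\<lambda>x. LINT y|lborel. norm (case (x, y) of (x, y) => B * (p x * q y)))" using p by simp
  show "AE x in lborel. integrable lborel (\<lambda>y. case (x, y) of (x, y) => B * (p x * q y))" using q by simp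
 qed measurable
 show "(\<lambda>(x, y). p x * q y * G (y - x)) \<in> borel_measurable (lborel \<Otimes>\<^sub>M lborel)" by measurable
 show "AE x in lborel \<Otimes>\<^sub>M lborel. norm (case x of (x, y) => p x * q y * G (y - x)) <= norm (case x of (x, y) => B * (p x * q y))"
 proof (rule AE_I2, clarify)
  fix x y
  have "\<bar>p x * q y\<bar> * \<bar>G (y - x)\<bar> <= \<bar>p x * q y\<bar> * \<bar>B\<bar>" by (rule mult_left_mono) (use G(2)[of "y - x"] in auto)
  then show "norm (p x * q y * G (y - x)) <= norm (B * (p x * q y))" by (simp add: abs_mult ac_simps)
 qed
qed

lemma integral_ball_bump_pos: "0 < r ==> integrable lborel (ball_bump a r) & 0 < (LINT x|lborel. ball_bump a r x)"
proof -
 assume r: "0 < r"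
 have m: "ball_bump a r \<in> borel_measurable borel"
  by (rule borel_measurable_continuous_onI[OF smooth_on_continuous_on[OF smooth_on_ball_bump[OF open_UNIV]]])
 have i: "integrable lborel (ball_bump a r)" by (rule integrable_compact_support[OF compact_cball[of a r] _ m, of 1])
   (use ball_bump_zero_iff[OF r, of a] ball_bump_bounds[of a r] in \<open>auto simp: dist_commute abs_le_iff not_le intro: less_imp_le order_trans[of _ 0]\<close>)
 have "(LINT x|lborel. ball_bump a r x) ~= 0"
 proof
  assume "(LINT x|lborel. ball_bump a r x) = 0"
  then have "AE x in lborel. ball_bump a r x = 0" using integral_nonneg_eq_0_iff_AE[OF i] ball_bump_bounds by auto
  then have "AE x in lborel. x \<notin> ball a r" by eventually_elim (use ball_bump_zero_iff[OF r, of a] in \<open>auto simp: dist_commute\<close>)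
  then have "ball a r \<in> null_sets lborel" by (subst AE_iff_null_sets) auto
  then have "negligible (ball a r)" by (simp add: negligible_iff_null_sets null_sets_completionI)
  then show False using open_not_negligible[OF open_ball, of a r] r by simp
 qed
 moreover have "0 <= (LINT x|lborel. ball_bump a r x)" by (simp add: ball_bump_bounds)
 ultimately show ?thesis using i by simp
qed

text \<open>Doubling of variables. In the double integral of u(x) u(y) against psi(x) J(y - x) the
  hypothesis is used in x, with test function psi(x) J(y - x), and in y, with test function J(y -
  x); the terms containing a derivative of \<open>J\<close> cancel. What is left says that a
  function \<open>C\<close> of the shift integrates to 0 against every bump near 0. It is continuous
  at 0, so it vanishes there, which is the claim.\<close>

lemma weak_product_rule:
 fixes u z :: "real^'n::finite => real"
 assumes U: "open U" and u[measurable]: "u \<in> borel_measurable borel" and z[measurable]: "z \<in> borel_measurable borel"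
  and sq: "!!K. compact K ==> K \<subseteq> U ==> integrable lborel (\<lambda>x. indicat_real K x * (u x)\<^sup>2) & integrable lborel (\<lambda>x. indicat_real K x * (z x)\<^sup>2)"
  and weak: "!!\<psi> K. smooth_on UNIV \<psi> ==> compact K ==> K \<subseteq> U ==> {x. \<psi> x ~= 0} \<subseteq> K ==>
   (LINT x|lborel. u x * partial i \<psi> x) = - (LINT x|lborel. z x * \<psi> x)"
  and \<psi>: "smooth_on UNIV \<psi>" "compact K" "K \<subseteq> U" "{x. \<psi> x ~= 0} \<subseteq> K"
 shows "(LINT x|lborel. (u x)\<^sup>2 * partial i \<psi> x) = - (LINT x|lborel. 2 * (u x * z x) * \<psi> x)"
proof -
 obtain r where r: "0 < r" "(\<Union>x\<in>K. cball x r) \<subseteq> U" using compact_subset_open_imp_cball_epsilon_subset[OF \<psi>(2) U \<psi>(3)] by blast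
 \<comment> \<open>Room for the shifts: \<open>K'\<close> contains all points within
   \<open>r\<close> of \<open>K\<close> and still lies in \<open>U\<close>. Cutting \<open>u\<close>
   and \<open>z\<close> off outside \<open>K'\<close> changes none of the integrals below and makes
   both functions globally integrable.\<close>
 define K' where "K' = {x + y |x y. x \<in> K & y \<in> cball 0 r}"
 have K'c: "compact K'" unfolding K'_def by (rule compact_sums[OF \<psi>(2) compact_cball])
 have K'U: "K' \<subseteq> U" unfolding K'_def using r(2) by (force simp: dist_norm)
 have K'r: "y \<in> K'" if "x \<in> K" "norm (y - x) <= r" for x y
  unfolding K'_def using that by (intro CollectI exI[of _ x] exI[of _ "y - x"]) auto
 have KK': "K \<subseteq> K'" using K'r r(1) by force
 have K'm[measurable]: "K' \<in> sets borel" using K'c by (simp add: compact_imp_closed)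
 define u' where "u' x = indicat_real K' x * u x" for x
 define z' where "z' x = indicat_real K' x * z x" for x
 have [measurable]: "u' \<in> borel_measurable borel" "z' \<in> borel_measurable borel" unfolding u'_def z'_def by measurable
 have sq': "(u' x)\<^sup>2 = indicat_real K' x * (u x)\<^sup>2" "(z' x)\<^sup>2 = indicat_real K' x * (z x)\<^sup>2" for x
  unfolding u'_def z'_def by (auto simp: indicator_def)
 have u'2: "integrable lborel (\<lambda>x. (u' x)\<^sup>2)" and z'2: "integrable lborel (\<lambda>x. (z' x)\<^sup>2)" unfolding sq' using sq[OF K'c K'U] by auto
 have ind2: "integrable lborel (\<lambda>x. (indicat_real K' x)\<^sup>2)"
  using integrable_indicator_compact[OF K'c] by (simp add: power2_eq_square indicator_inter_arith[symmetric])
 have u'1: "integrable lborel u'"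
 proof -
  have "integrable lborel (\<lambda>x. indicat_real K' x * u' x)" by (rule integrable_mult_squares[OF _ _ ind2 u'2]) measurable
  moreover have "(\<lambda>x. indicat_real K' x * u' x) = u'" unfolding u'_def by (auto simp: indicator_def)
  ultimately show ?thesis by simp
 qed
 have z'1: "integrable lborel z'"
 proof -
  have "integrable lborel (\<lambda>x. indicat_real K' x * z' x)" by (rule integrable_mult_squares[OF _ _ ind2 z'2]) measurable
  moreover have "(\<lambda>x. indicat_real K' x * z' x) = z'" unfolding z'_def by (auto simp: indicator_def)
  ultimately show ?thesis by simp
 qed
 have \<psi>d: "\<psi> differentiable (at x)" for x using smooth_on_differentiable[OF \<psi>(1)] by simp
 have \<psi>c: "continuous_on UNIV \<psi>" "continuous_on UNIV (partial i \<psi>)"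
  using smooth_on_continuous_on[OF \<psi>(1)] smooth_on_continuous_on[OF smooth_on_partial[OF \<psi>(1)]] by auto
 have [measurable]: "\<psi> \<in> borel_measurable borel" "partial i \<psi> \<in> borel_measurable borel"
  using \<psi>c by (auto intro: borel_measurable_continuous_onI)
 have d\<psi>K: "{x. partial i \<psi> x ~= 0} \<subseteq> K" using partial_zero_outside[OF compact_imp_closed[OF \<psi>(2)] \<psi>(4)] by blast
 obtain B1 where B1: "!!x. \<bar>\<psi> x\<bar> <= B1" using bounded_of_compact_support[OF \<psi>(2,4) \<psi>c(1)] by blast
 obtain B2 where B2: "!!x. \<bar>partial i \<psi> x\<bar> <= B2" using bounded_of_compact_support[OF \<psi>(2) d\<psi>K \<psi>c(2)] by blast
 have mult_bdd: "integrable lborel (\<lambda>x. a x * b x)" "integrable lborel (\<lambda>x. (a x)\<^sup>2) ==> integrable lborel (\<lambda>x. (a x * b x)\<^sup>2)"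
  if a: "integrable lborel a" and b: "b \<in> borel_measurable borel" "!!x. \<bar>b x\<bar> <= B" for a b :: "real^'n => real" and B
 proof -
  have [measurable]: "a \<in> borel_measurable borel" using borel_measurable_integrable[OF a] by simp
  note [measurable] = b(1)
  have B0: "0 <= B" using b(2)[of 0] by linarith
  show "integrable lborel (\<lambda>x. a x * b x)" by (rule Bochner_Integration.integrable_bound[OF integrable_mult_left[of B, OF a]])
    (use b(2) B0 in \<open>auto simp: abs_mult intro!: mult_left_mono\<close>)
  show "integrable lborel (\<lambda>x. (a x * b x)\<^sup>2)" if a2: "integrable lborel (\<lambda>x. (a x)\<^sup>2)"
  proof (rule Bochner_Integration.integrable_bound[OF integrable_mult_left[of "B\<^sup>2", OF a2]])
   have "(b x)\<^sup>2 <= B\<^sup>2" for x using b(2)[of x] B0 by (simp add: abs_le_square_iff[symmetric])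
   then show "AE x in lborel. norm ((a x * b x)\<^sup>2) <= norm ((a x)\<^sup>2 * B\<^sup>2)" by (auto simp: power_mult_distrib intro!: mult_left_mono)
  qed measurable
 qed
 define p1 p2 p3 where "p1 x = u' x * partial i \<psi> x" and "p2 x = u' x * \<psi> x" and "p3 x = z' x * \<psi> x" for x
 have p1: "integrable lborel p1" "integrable lborel (\<lambda>x. (p1 x)\<^sup>2)"
  unfolding p1_def using mult_bdd[OF u'1, of "partial i \<psi>" B2] u'2 B2 by auto
 have p2: "integrable lborel p2" "integrable lborel (\<lambda>x. (p2 x)\<^sup>2)" unfolding p2_def using mult_bdd[OF u'1, of \<psi> B1] u'2 B1 by auto
 have p3: "integrable lborel p3" "integrable lborel (\<lambda>x. (p3 x)\<^sup>2)" unfolding p3_def using mult_bdd[OF z'1, of \<psi> B1] z'2 B1 by auto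
 have [measurable]: "p1 \<in> borel_measurable borel" "p2 \<in> borel_measurable borel" "p3 \<in> borel_measurable borel"
  unfolding p1_def p2_def p3_def by measurable
 let ?co = "\<lambda>p q h. LINT x|lborel. p x * q (h + x)" and ?ad = "\<lambda>p G y. LINT x|lborel. p x * G (y - x)"
 let ?cv = "\<lambda>p q G. LINT x|lborel. LINT y|lborel. p x * q y * G (y - x)"
 \<comment> \<open>At shift 0 the first term is the integral of u^2 times the derivative of
   \<open>\<psi>\<close>, and the other two add up to the integral of
   \<open>2 * (u x * z x) * \<psi> x\<close>.\<close>
 define C where "C h = ?co p1 u' h + ?co p3 u' h + ?co p2 z' h" for h
 have C_cont: "isCont C 0" unfolding continuous_at_sequentially
 proof (intro allI impI)
  fix h :: "nat => real^'n" assume h: "h \<longlonglongrightarrow> 0"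
  show "(C \<circ> h) \<longlonglongrightarrow> C 0" unfolding C_def comp_def add_0 by (intro tendsto_add correlation_tendsto h p1 p2 p3 u'2 z'2) measurable
 qed
 have JC: "integrable lborel (\<lambda>h. ball_bump 0 e h * C h) & (LINT h|lborel. ball_bump 0 e h * C h) = 0" if e: "0 < e" "e <= r" for e
 proof -
  define J where "J = ball_bump (0::real^'n) e"
  define J' where "J' = partial i J"
  have Js: "smooth_on UNIV J" unfolding J_def by (rule smooth_on_ball_bump[OF open_UNIV])
  have Jd: "J differentiable (at x)" for x using smooth_on_differentiable[OF Js] by simp
  have Jc: "continuous_on UNIV J" "continuous_on UNIV J'"
   unfolding J'_def using smooth_on_continuous_on[OF Js] smooth_on_continuous_on[OF smooth_on_partial[OF Js]] by auto
  have [measurable]: "J \<in> borel_measurable borel" "J' \<in> borel_measurable borel" using Jc by (auto intro: borel_measurable_continuous_onI)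
  have Jz: "{x. J x ~= 0} \<subseteq> cball 0 e"
  proof
   fix x assume "x \<in> {x. J x ~= 0}"
   then have "~ e <= dist x 0" using ball_bump_zero_iff[OF e(1), of 0 x] by (simp add: J_def)
   then show "x \<in> cball 0 e" by simp
  qed
  have J'z: "{x. J' x ~= 0} \<subseteq> cball 0 e" unfolding J'_def using partial_zero_outside[OF closed_cball Jz] by blast
  obtain b where b: "!!x. \<bar>J x\<bar> <= b" using bounded_of_compact_support[OF compact_cball Jz Jc(1)] by blast
  obtain b' where b': "!!x. \<bar>J' x\<bar> <= b'" using bounded_of_compact_support[OF compact_cball J'z Jc(2)] by blast
  have Jm: "J \<in> borel_measurable borel" "J' \<in> borel_measurable borel" by measurable
  note I = integrable_product_bounded[OF p1(1) u'1 Jm(1) b] integrable_product_bounded[OF p2(1) u'1 Jm(2) b']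
   integrable_product_bounded[OF p3(1) u'1 Jm(1) b] integrable_product_bounded[OF p2(1) z'1 Jm(1) b]
  let ?I1 = "?cv p1 u' J"
  let ?I2 = "?cv p2 u' J'"
  let ?I3 = "?cv p3 u' J"
  let ?I4 = "?cv p2 z' J"
  have dm: "((\<lambda>x. J (y - x)) has_derivative (\<lambda>h. - frechet_derivative J (at (y - x)) h)) (at x)" for x y
  proof -
   have "((\<lambda>x. y - x) has_derivative (\<lambda>h. - h)) (at x)" by (auto intro!: derivative_eq_intros)
   from has_derivative_compose[OF this differentiable_has_derivative[OF Jd]]
   show ?thesis using linear_frechet_derivative[OF Jd, of "y - x"] by (simp add: linear_neg)
  qed
  have dp: "((\<lambda>y. J (y - x)) has_derivative frechet_derivative J (at (y - x))) (at y)" for x y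
  proof -
   have "((\<lambda>y. y - x) has_derivative (\<lambda>h. h)) (at y)" by (auto intro!: derivative_eq_intros)
   from has_derivative_compose[OF this differentiable_has_derivative[OF Jd]] show ?thesis by simp
  qed
  have sm: "smooth_on UNIV (\<lambda>x. J (y - x))" for y
  proof (rule smooth_on_compose[OF open_UNIV _ _ Js])
   have "smooth_on UNIV (\<lambda>x :: real^'n. y + (- x))"
    by (intro smooth_on_add smooth_on_const smooth_on_linear[OF _ bounded_linear_minus[OF bounded_linear_ident]] smooth_on_id open_UNIV)
   then show "smooth_on UNIV (\<lambda>x :: real^'n. y - x)" by simp
  qed simp
  have sp: "smooth_on UNIV (\<lambda>y. J (y - x))" for x
  proof (rule smooth_on_compose[OF open_UNIV _ _ Js])
   have "smooth_on UNIV (\<lambda>y :: real^'n. y + (- x))" by (intro smooth_on_add smooth_on_const smooth_on_id open_UNIV)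
   then show "smooth_on UNIV (\<lambda>y :: real^'n. y - x)" by simp
  qed simp
  \<comment> \<open>The hypothesis in the first variable, for fixed \<open>y\<close>.\<close>
  have A: "?ad p1 J y - ?ad p2 J' y = - ?ad p3 J y" for y
  proof -
   have d: "partial i (\<lambda>x. \<psi> x * J (y - x)) x = \<psi> x * - J' (y - x) + partial i \<psi> x * J (y - x)" for x
    by (subst partial_eq[OF has_derivative_mult[OF differentiable_has_derivative[OF \<psi>d] dm]]) (simp add: J'_def partial_def)
   have s: "smooth_on UNIV (\<lambda>x. \<psi> x * J (y - x))" by (intro smooth_on_mult open_UNIV \<psi>(1) sm)
   have "(LINT x|lborel. u x * partial i (\<lambda>x. \<psi> x * J (y - x)) x) = - (LINT x|lborel. z x * (\<psi> x * J (y - x)))"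
    by (rule weak[OF s \<psi>(2,3)]) (use \<psi>(4) in auto)
   moreover have "u x * partial i (\<lambda>x. \<psi> x * J (y - x)) x = p1 x * J (y - x) - p2 x * J' (y - x)" for x
   proof (cases "x \<in> K'")
    case True then show ?thesis unfolding d p1_def p2_def u'_def by (simp add: algebra_simps)
   next
    case False
    then have "\<psi> x = 0" "partial i \<psi> x = 0" using KK' \<psi>(4) d\<psi>K by auto
    then show ?thesis unfolding d p1_def p2_def by simp
   qed
   moreover have "z x * (\<psi> x * J (y - x)) = p3 x * J (y - x)" for x
   proof (cases "x \<in> K'")
    case True then show ?thesis unfolding p3_def z'_def by (simp add: algebra_simps)
   next
    case False
    then have "\<psi> x = 0" using KK' \<psi>(4) by auto
    then show ?thesis unfolding p3_def by simp
   qed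
   moreover have "(LINT x|lborel. p1 x * J (y - x) - p2 x * J' (y - x)) = ?ad p1 J y - ?ad p2 J' y"
    by (intro Bochner_Integration.integral_diff mult_bdd(1)[OF p1(1), of "\<lambda>x. J (y - x)" b]
     mult_bdd(1)[OF p2(1), of "\<lambda>x. J' (y - x)" b'] b b') measurable
   ultimately show ?thesis by simp
  qed
  \<comment> \<open>The hypothesis in the second variable, for fixed \<open>x\<close>. Off
    \<open>K\<close> the factor \<open>p2 x\<close> is 0; on \<open>K\<close> the support of the
    translated bump lies in \<open>K'\<close>.\<close>
  have Bx: "p2 x * (LINT y|lborel. u' y * J' (y - x)) = - (p2 x * (LINT y|lborel. z' y * J (y - x)))" for x
  proof (cases "x \<in> K")
   case True
   have c: "cball x e \<subseteq> K'" using K'r[OF True] e by (auto simp: dist_norm norm_minus_commute)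
   have d: "partial i (\<lambda>y. J (y - x)) y = J' (y - x)" for y by (subst partial_eq[OF dp]) (simp add: J'_def partial_def)
   have J0: "J (y - x) = 0" "J' (y - x) = 0" if "y \<notin> K'" for y
    using that c Jz J'z by (auto simp: subset_iff dist_norm norm_minus_commute)
   have "(LINT y|lborel. u y * partial i (\<lambda>y. J (y - x)) y) = - (LINT y|lborel. z y * J (y - x))"
    by (rule weak[OF sp compact_cball[of x e]]) (use c K'U Jz in \<open>auto simp: subset_iff dist_norm norm_minus_commute\<close>)
   moreover have "u y * partial i (\<lambda>y. J (y - x)) y = u' y * J' (y - x)" "z y * J (y - x) = z' y * J (y - x)" for y
    unfolding d u'_def z'_def using J0[of y] by (cases "y \<in> K'"; simp)+
   ultimately show ?thesis by simp
  next
   case False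
   then have "\<psi> x = 0" using \<psi>(4) by auto
   then show ?thesis by (simp add: p2_def)
  qed
  have "?I2 = - ?I4"
  proof -
   have "?I2 = (LINT x|lborel. p2 x * (LINT y|lborel. u' y * J' (y - x)))" by (simp add: mult.assoc)
   also have "... = (LINT x|lborel. - (p2 x * (LINT y|lborel. z' y * J (y - x))))" unfolding Bx ..
   also have "... = - ?I4" by (simp add: mult.assoc)
   finally show ?thesis .
  qed
  moreover have "?I1 - ?I2 = - ?I3"
  proof -
   have sw: "?cv p u' G = (LINT y|lborel. u' y * ?ad p G y)"
    "integrable lborel (\<lambda>y. u' y * ?ad p G y)"
    if i: "integrable (lborel \<Otimes>\<^sub>M lborel) (\<lambda>(x, y). p x * u' y * G (y - x))" for p G
   proof -
    have e: "(LINT x|lborel. p x * u' y * G (y - x)) = u' y * ?ad p G y" for y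
     by (subst integral_mult_right_zero[symmetric]) (simp add: ac_simps)
    show "?cv p u' G = (LINT y|lborel. u' y * ?ad p G y)" unfolding e[symmetric] by (rule lborel_pair.Fubini_integral[OF i, symmetric])
    show "integrable lborel (\<lambda>y. u' y * ?ad p G y)" unfolding e[symmetric] by (rule lborel_pair.integrable_snd[OF i])
   qed
   have "?I1 - ?I2 = (LINT y|lborel. u' y * ?ad p1 J y - u' y * ?ad p2 J' y)" unfolding sw(1)[OF I(1)] sw(1)[OF I(2)]
    by (rule Bochner_Integration.integral_diff[OF sw(2)[OF I(1)] sw(2)[OF I(2)], symmetric])
   also have "... = (LINT y|lborel. - (u' y * ?ad p3 J y))" unfolding right_diff_distrib[symmetric] A by simp
   also have "... = - ?I3" unfolding sw(1)[OF I(3)] by simp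
   finally show ?thesis .
  qed
  ultimately have sum0: "?I1 + ?I3 + ?I4 = 0" by simp
  have tr: "?cv p q J = (LINT h|lborel. J h * ?co p q h)"
   "integrable lborel (\<lambda>h. J h * ?co p q h)"
   if i: "integrable (lborel \<Otimes>\<^sub>M lborel) (\<lambda>(x, y). p x * q y * J (y - x))" for p q
  proof -
   have e: "(LINT x|lborel. p x * q (h + x) * J h) = J h * ?co p q h" for h by simp
   show "?cv p q J = (LINT h|lborel. J h * ?co p q h)"
    "integrable lborel (\<lambda>h. J h * ?co p q h)" using integral_shift_swap[OF i] by (simp_all add: mult.commute)
  qed
  have JC: "J h * C h = J h * ?co p1 u' h + J h * ?co p3 u' h + J h * ?co p2 z' h" for h unfolding C_def by (simp add: algebra_simps)
  have ad: "integrable lborel (\<lambda>h. J h * ?co p1 u' h + J h * ?co p3 u' h)" by (intro Bochner_Integration.integrable_add tr(2) I)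
  have "integrable lborel (\<lambda>h. J h * C h)" unfolding JC by (intro Bochner_Integration.integrable_add tr(2) I)
  moreover have "(LINT h|lborel. J h * C h) = ?I1 + ?I3 + ?I4" unfolding JC Bochner_Integration.integral_add[OF ad tr(2)[OF I(4)]]
    Bochner_Integration.integral_add[OF tr(2)[OF I(1)] tr(2)[OF I(3)]] tr(1)[OF I(1)] tr(1)[OF I(3)] tr(1)[OF I(4)] ..
  ultimately show ?thesis using sum0 unfolding J_def by simp
 qed
 \<comment> \<open>On a bump of small radius \<open>C\<close> deviates from \<open>C 0\<close> by at
   most half of its absolute value, so the integral of \<open>C\<close> against the bump could not
   be 0 if \<open>C 0\<close> were nonzero.\<close>
 have C0: "C 0 = 0"
 proof (rule ccontr)
  assume n: "C 0 ~= 0"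
  then obtain d where d: "0 < d" "!!h. dist h 0 < d ==> dist (C h) (C 0) < \<bar>C 0\<bar> / 2"
   using C_cont unfolding continuous_at_eps_delta by (metis half_gt_zero zero_less_abs_iff)
  define e where "e = min d r"
  have e: "0 < e" "e <= r" "e <= d" unfolding e_def using d(1) r(1) by auto
  let ?J = "ball_bump (0::real^'n) e"
  have J: "integrable lborel ?J" "0 < (LINT h|lborel. ?J h)" using integral_ball_bump_pos[OF e(1)] by auto
  have b: "\<bar>?J h * C h - ?J h * C 0\<bar> <= ?J h * (\<bar>C 0\<bar> / 2)" for h
  proof (cases "dist h 0 < e")
   case True
   then have "\<bar>C h - C 0\<bar> <= \<bar>C 0\<bar> / 2" using d(2)[of h] e(3) by (simp add: dist_real_def)
   then show ?thesis using ball_bump_bounds(1)[of 0 e h]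
    by (simp add: right_diff_distrib[symmetric] abs_mult mult_left_mono del: times_divide_eq_right)
  next
   case False
   then have "?J h = 0" using ball_bump_zero_iff[OF e(1), of 0 h] by simp
   then show ?thesis by simp
  qed
  have "(LINT h|lborel. ?J h * C h - ?J h * C 0) = - ((LINT h|lborel. ?J h) * C 0)" using JC[OF e(1,2)] J(1) by simp
  moreover have "\<bar>LINT h|lborel. ?J h * C h - ?J h * C 0\<bar> <= (LINT h|lborel. ?J h * (\<bar>C 0\<bar> / 2))"
  proof -
   have i: "integrable lborel (\<lambda>h. ?J h * C h - ?J h * C 0)" using JC[OF e(1,2)] J(1) by simp
   have "\<bar>LINT h|lborel. ?J h * C h - ?J h * C 0\<bar> <= (LINT h|lborel. \<bar>?J h * C h - ?J h * C 0\<bar>)" by (rule integral_abs_bound)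
   also have "... <= (LINT h|lborel. ?J h * (\<bar>C 0\<bar> / 2))" by (rule integral_mono[OF integrable_abs[OF i] _ b]) (use J(1) in simp)
   finally show ?thesis .
  qed
  ultimately have "(LINT h|lborel. ?J h) * \<bar>C 0\<bar> <= (LINT h|lborel. ?J h) * (\<bar>C 0\<bar> / 2)" using J by (simp add: abs_mult)
  then have "\<bar>C 0\<bar> <= \<bar>C 0\<bar> / 2" using J(2) by simp
  then show False using n by simp
 qed
 have "p1 x * u' x = (u x)\<^sup>2 * partial i \<psi> x" for x
 proof (cases "x \<in> K'")
  case False
  then have "partial i \<psi> x = 0" using KK' d\<psi>K by auto
  then show ?thesis by (simp add: p1_def)
 qed (simp add: p1_def u'_def power2_eq_square)
 moreover have m: "p3 x * u' x + p2 x * z' x = 2 * (u x * z x) * \<psi> x" for x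
 proof (cases "x \<in> K'")
  case False
  then have "\<psi> x = 0" using KK' \<psi>(4) by auto
  then show ?thesis by (simp add: p2_def p3_def)
 qed (simp add: p2_def p3_def u'_def z'_def)
 moreover have "(LINT x|lborel. p3 x * u' x + p2 x * z' x) = (LINT x|lborel. p3 x * u' x) + (LINT x|lborel. p2 x * z' x)"
  by (intro Bochner_Integration.integral_add integrable_mult_squares p2 p3 u'2 z'2) measurable
 ultimately show ?thesis using C0 unfolding C_def by simp
qed

section \<open>Riemannian volume, vector fields and weak gradients\<close>

lemma smooth_on_Un: "smooth_on S f ==> smooth_on T f ==> smooth_on (S \<union> T) f" unfolding smooth_on_def by blast

lemma smooth_on_extend_zero:
 assumes O: "open O'" and f: "smooth_on O' f" and K: "closed K" "K \<subseteq> O'" "!!y. y \<in> O' ==> y \<notin> K ==> f y = 0"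
 shows "smooth_on UNIV (\<lambda>y. if y \<in> O' then f y else 0)"
proof -
 have "smooth_on O' (\<lambda>y. if y \<in> O' then f y else 0)" by (rule smooth_on_cong[OF O f]) simp
 moreover have "smooth_on (- K) (\<lambda>y. if y \<in> O' then f y else 0)" by (rule smooth_on_cong[OF _ smooth_on_const[of _ 0]]) (use K in auto)
 ultimately have "smooth_on (O' \<union> - K) (\<lambda>y. if y \<in> O' then f y else 0)" by (rule smooth_on_Un)
 moreover have "O' \<union> - K = UNIV" using K by auto
 ultimately show ?thesis by simp
qed

text \<open>On the segment from the identity to \<open>M\<close> the quadratic form stays positive,
  so no matrix on it is singular. The determinant is 1 at the start and hence, by the intermediate
  value theorem, positive at the end.\<close>

lemma det_pos_of_positive_definite:
 fixes M :: "real^'n::finite^'n"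
 assumes pos: "!!v. v ~= 0 ==> 0 < v \<bullet> (M *v v)"
 shows "0 < det M"
proof (rule ccontr)
 assume "~ 0 < det M"
 define P where "P t = (1 - t) *\<^sub>R mat 1 + t *\<^sub>R M" for t :: real
 have Pn: "P t $ i $ j = (1 - t) * (if i = j then 1 else 0) + t * M $ i $ j" for t i j by (simp add: P_def mat_def)
 have c: "continuous_on {0..1} (\<lambda>t. det (P t))" unfolding det_def Pn by (intro continuous_intros)
 have "det (P 0) = 1" "det (P 1) = det M" unfolding P_def by simp_all
 then have "\<exists>t\<ge>0. t <= 1 & det (P t) = 0" using IVT2'[of "\<lambda>t. det (P t)" 1 0 0] c \<open>~ 0 < det M\<close> by auto
 then obtain t where t: "0 <= t" "t <= 1" "det (P t) = 0" by blast
 have "~ invertible (P t)" using t(3) by (simp add: invertible_det_nz)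
 then obtain v where v: "P t *v v = 0" "v ~= 0" using matrix_left_invertible_ker[of "P t"] invertible_left_inverse[of "P t"] by auto
 have "P t *v v = (1 - t) *\<^sub>R v + t *\<^sub>R (M *v v)"
  unfolding P_def by (simp add: matrix_vector_mult_add_rdistrib scaleR_matrix_vector_assoc[symmetric])
 then have "0 = (1 - t) * (v \<bullet> v) + t * (v \<bullet> (M *v v))" using v(1) by (metis inner_add_right inner_scaleR_right inner_zero_right)
 moreover have "0 < v \<bullet> v" "0 < v \<bullet> (M *v v)" using v(2) pos by auto
 ultimately show False using t(1,2) by (smt (verit) mult_nonneg_nonneg mult_pos_pos)
qed

locale riemannian_atlas =
 fixes A :: "('a::{second_countable_topology,t2_space}, 'n::finite) chart set" and g :: "('a, 'n) metric"
 assumes atlas: "oriented_atlas A" and metric: "riemannian_metric A g"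
begin

lemma chart_homeo: "c \<in> A ==> homeomorphism (fst c) (snd c ` fst c) (snd c) (chart_inv c)"
 and open_dom: "c \<in> A ==> open (fst c)" and open_img: "c \<in> A ==> open (snd c ` fst c)" using atlas unfolding oriented_atlas_def by auto

lemma ex_chart: "\<exists>c\<in>A. x \<in> fst c" using atlas unfolding oriented_atlas_def by auto

lemma inv_chart[simp]: "c \<in> A ==> x \<in> fst c ==> chart_inv c (snd c x) = x" using chart_homeo[of c] by (simp add: homeomorphism_def)

lemma chart_inv_in: "c \<in> A ==> y \<in> snd c ` fst c ==> chart_inv c y \<in> fst c" using chart_homeo[of c] by (auto simp: homeomorphism_def)

lemma chart_inv[simp]: "c \<in> A ==> y \<in> snd c ` fst c ==> snd c (chart_inv c y) = y" using chart_homeo[of c] by (auto simp: homeomorphism_def)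

lemma cont_chart: "c \<in> A ==> continuous_on (fst c) (snd c)"
 and cont_inv: "c \<in> A ==> continuous_on (snd c ` fst c) (chart_inv c)" using chart_homeo[of c] by (simp_all add: homeomorphism_def)

lemma chart_image_eq: "c \<in> A ==> snd c ` (fst c \<inter> U) = snd c ` fst c \<inter> chart_inv c -` U"
proof -
 assume c: "c \<in> A"
 show ?thesis
 proof (intro equalityI subsetI)
  fix y assume "y \<in> snd c ` (fst c \<inter> U)"
  then show "y \<in> snd c ` fst c \<inter> chart_inv c -` U" using c by auto
 next
  fix y assume y: "y \<in> snd c ` fst c \<inter> chart_inv c -` U"
  then have "y = snd c (chart_inv c y)" "chart_inv c y \<in> fst c \<inter> U" using c chart_inv_in by auto
  then show "y \<in> snd c ` (fst c \<inter> U)" by blast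
 qed
qed

lemma open_chart_image: "c \<in> A ==> open U ==> open (snd c ` (fst c \<inter> U))"
 unfolding chart_image_eq by (intro continuous_open_preimage cont_inv open_img)

lemma compact_inv_image: "c \<in> A ==> compact L ==> L \<subseteq> snd c ` fst c ==> compact (chart_inv c ` L)"
 by (rule compact_continuous_image[OF continuous_on_subset[OF cont_inv]])

lemma compact_chart_image: "c \<in> A ==> compact K ==> K \<subseteq> fst c ==> compact (snd c ` K)"
 by (rule compact_continuous_image[OF continuous_on_subset[OF cont_chart]])

lemma smooth_transition: "c \<in> A ==> d \<in> A ==> smooth_on (snd c ` (fst c \<inter> fst d)) (transition c d)"
 using atlas unfolding oriented_atlas_def by blast

lemma transition_chart[simp]: "c \<in> A ==> x \<in> fst c ==> transition c d (snd c x) = snd d x" unfolding transition_def by simp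

lemma transition_differentiable:
 "c \<in> A ==> d \<in> A ==> x \<in> fst c ==> x \<in> fst d ==> transition c d differentiable (at (snd c x))"
 by (rule smooth_on_differentiable[OF smooth_transition]) auto

text \<open>The chain rule for coordinate changes; it is what makes the coordinate fields compatible
  families in the sense of \<open>tangent_space\<close>.\<close>

lemma transition_cocycle:
 assumes A: "c \<in> A" "d \<in> A" "e \<in> A" and x: "x \<in> fst c" "x \<in> fst d" "x \<in> fst e"
 shows "frechet_derivative (transition c e) (at (snd c x)) w =
  frechet_derivative (transition d e) (at (snd d x)) (frechet_derivative (transition c d) (at (snd c x)) w)"
proof -
 have "((\<lambda>y. transition d e (transition c d y)) has_derivative
  (\<lambda>w. frechet_derivative (transition d e) (at (snd d x)) (frechet_derivative (transition c d) (at (snd c x)) w))) (at (snd c x))"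
  using has_derivative_compose[OF differentiable_has_derivative[OF transition_differentiable[OF A(1,2) x(1,2)]],
   of "transition d e"] differentiable_has_derivative[OF transition_differentiable[OF A(2,3) x(2,3)]] A x by simp
 then have "(transition c e has_derivative
  (\<lambda>w. frechet_derivative (transition d e) (at (snd d x)) (frechet_derivative (transition c d) (at (snd c x)) w))) (at (snd c x))"
  by (rule has_derivative_transform_within_open[OF _ open_chart_image[OF A(1) open_dom[OF A(2)]]]) (use A x in auto)
 from frechet_derivative_at[OF this] show ?thesis by metis
qed

lemma transition_self:
 assumes "c \<in> A" "x \<in> fst c"
 shows "frechet_derivative (transition c c) (at (snd c x)) w = w"
proof -
 have "(transition c c has_derivative (\<lambda>w. w)) (at (snd c x))"
  by (rule has_derivative_transform_within_open[OF has_derivative_ident open_img[OF assms(1)]]) (use assms in auto)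
 from frechet_derivative_at[OF this] show ?thesis by metis
qed

lemma partial_transition_self: "c \<in> A ==> x \<in> fst c ==> partial i (transition c c) (snd c x) = axis i 1"
 unfolding partial_def by (rule transition_self)

lemma coord_field_in: "c \<in> A ==> x \<in> fst c ==> coord_field A c i x \<in> tangent_space A x" unfolding tangent_space_def coord_field_def
 by (auto simp: partial_def intro: transition_cocycle)

lemma coord_field_self: "c \<in> A ==> x \<in> fst c ==> coord_field A c i x c = axis i 1"
 unfolding coord_field_def by (simp add: partial_transition_self)

lemma tangent_transition:
 "u \<in> tangent_space A x ==> c \<in> A ==> d \<in> A ==> x \<in> fst c ==> x \<in> fst d ==>
  u d = frechet_derivative (transition c d) (at (snd c x)) (u c)"
 unfolding tangent_space_def by blast

lemma tangent_zero: "u \<in> tangent_space A x ==> ~ (c \<in> A & x \<in> fst c) ==> u c = 0" unfolding tangent_space_def by blast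

text \<open>A tangent vector is determined by its representation in one chart, the others being its
  images under the linear Jacobians. The equality is one of families over all charts, including
  those away from \<open>x\<close>, where both sides are 0.\<close>

lemma tangent_expand:
 assumes u: "u \<in> tangent_space A x" and c: "c \<in> A" "x \<in> fst c"
 shows "u = (\<lambda>d. \<Sum>i\<in>UNIV. u c $ i *\<^sub>R coord_field A c i x d)"
proof
 fix d
 show "u d = (\<Sum>i\<in>UNIV. u c $ i *\<^sub>R coord_field A c i x d)"
 proof (cases "d \<in> A & x \<in> fst d")
  case True
  then show ?thesis using tangent_transition[OF u c(1) _ c(2)] frechet_derivative_eq_sum[OF transition_differentiable[OF c(1) _ c(2)]]
   by (simp add: coord_field_def)
 next
  case False
  then show ?thesis using tangent_zero[OF u False] by (auto simp: coord_field_def)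
 qed
qed

lemma tangent_lin:
 assumes u: "u \<in> tangent_space A x" and w: "w \<in> tangent_space A x"
 shows "(\<lambda>c. a *\<^sub>R u c + b *\<^sub>R w c) \<in> tangent_space A x"
proof -
 have "a *\<^sub>R u d + b *\<^sub>R w d = frechet_derivative (transition c d) (at (snd c x)) (a *\<^sub>R u c + b *\<^sub>R w c)"
  if "c \<in> A" "d \<in> A" "x \<in> fst c \<inter> fst d" for c d
 proof -
  have "linear (frechet_derivative (transition c d) (at (snd c x)))"
   using that by (intro linear_frechet_derivative transition_differentiable) auto
  then show ?thesis using tangent_transition[OF u that(1,2)] tangent_transition[OF w that(1,2)] that(3)
   by (simp add: linear_add linear_scale)
 qed
 moreover have "a *\<^sub>R u c + b *\<^sub>R w c = 0" if "~ (c \<in> A & x \<in> fst c)" for c using tangent_zero[OF u that] tangent_zero[OF w that] by simp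
 ultimately show ?thesis unfolding tangent_space_def mem_Collect_eq by (intro conjI ballI allI impI)
qed

lemma tangent_0: "(\<lambda>_. 0) \<in> tangent_space A x"
proof -
 obtain c where "c \<in> A" "x \<in> fst c" using ex_chart by blast
 from tangent_lin[OF coord_field_in[OF this] coord_field_in[OF this], of 0 undefined 0 undefined]
 show ?thesis by (simp only: scaleR_zero_left add_0)
qed

lemma tangent_scale: "u \<in> tangent_space A x ==> (\<lambda>c. a *\<^sub>R u c) \<in> tangent_space A x" using tangent_lin[of u x u a 0] by simp

lemma tangent_sum: "finite I ==> (!!i. i \<in> I ==> X i \<in> tangent_space A x) ==> (\<lambda>d. \<Sum>i\<in>I. a i *\<^sub>R X i d) \<in> tangent_space A x"
proof (induction I rule: finite_induct)
 case (insert i I)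
 then show ?case using tangent_lin[of "X i" x "\<lambda>d. \<Sum>i\<in>I. a i *\<^sub>R X i d" "a i" 1] by simp
qed (simp add: tangent_0)

lemma g_sym: "u \<in> tangent_space A x ==> w \<in> tangent_space A x ==> g x u w = g x w u"
 and g_lin: "u \<in> tangent_space A x ==> w \<in> tangent_space A x ==> z \<in> tangent_space A x ==>
  g x (\<lambda>c. a *\<^sub>R u c + b *\<^sub>R z c) w = a * g x u w + b * g x z w"
 and g_pos: "u \<in> tangent_space A x ==> u ~= (\<lambda>_. 0) ==> 0 < g x u u" using metric unfolding riemannian_metric_def by blast+

lemma g_scale: "u \<in> tangent_space A x ==> w \<in> tangent_space A x ==> g x (\<lambda>c. a *\<^sub>R u c) w = a * g x u w" using g_lin[of u x w u a 0] by simp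

lemma g_zero: "w \<in> tangent_space A x ==> g x (\<lambda>_. 0) w = 0" using g_scale[of w x w 0] by simp

lemma g_nonneg: "u \<in> tangent_space A x ==> 0 <= g x u u" using g_pos[of u x] g_zero[of u x] by (cases "u = (\<lambda>_. 0)") (auto intro: less_imp_le)

lemma g_scale_right: "u \<in> tangent_space A x ==> w \<in> tangent_space A x ==> g x u (\<lambda>c. a *\<^sub>R w c) = a * g x u w"
 using g_sym[OF _ tangent_scale, of u x w a] g_scale[of w x u a] g_sym[of u x w] by simp

lemma g_sum: "finite I ==> (!!i. i \<in> I ==> X i \<in> tangent_space A x) ==> w \<in> tangent_space A x ==>
 g x (\<lambda>d. \<Sum>i\<in>I. a i *\<^sub>R X i d) w = (\<Sum>i\<in>I. a i * g x (X i) w)"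
proof (induction I rule: finite_induct)
 case (insert i I)
 have "g x (\<lambda>d. a i *\<^sub>R X i d + 1 *\<^sub>R (\<Sum>i\<in>I. a i *\<^sub>R X i d)) w = a i * g x (X i) w + 1 * g x (\<lambda>d. \<Sum>i\<in>I. a i *\<^sub>R X i d) w"
 proof (rule g_lin)
  show "(\<lambda>d. \<Sum>i\<in>I. a i *\<^sub>R X i d) \<in> tangent_space A x" by (rule tangent_sum) (use insert in auto)
 qed (use insert in auto)
 then show ?case using insert by simp
qed (simp add: g_zero)

lemma g_expand_right:
 assumes u: "u \<in> tangent_space A x" and w: "w \<in> tangent_space A x" and c: "c \<in> A" "x \<in> fst c"
 shows "g x u w = (\<Sum>i\<in>UNIV. w c $ i * g x u (coord_field A c i x))"
proof -
 have "g x u w = g x w u" by (rule g_sym[OF u w])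
 also have "... = g x (\<lambda>d. \<Sum>i\<in>UNIV. w c $ i *\<^sub>R coord_field A c i x d) u" using tangent_expand[OF w c] by simp
 also have "... = (\<Sum>i\<in>UNIV. w c $ i * g x (coord_field A c i x) u)" by (rule g_sum) (use u coord_field_in[OF c] in auto)
 finally show ?thesis using g_sym[OF u coord_field_in[OF c]] by simp
qed

lemma g_coord_expand:
 assumes u: "u \<in> tangent_space A x" and c: "c \<in> A" "x \<in> fst c"
 shows "g x u (coord_field A c i x) = (\<Sum>j\<in>UNIV. u c $ j * gram A g c x $ i $ j)"
 using g_expand_right[OF coord_field_in[OF c] u c, of i] g_sym[OF u coord_field_in[OF c], of i] by (simp add: gram_def)

lemma g_expand:
 assumes u: "u \<in> tangent_space A x" and w: "w \<in> tangent_space A x" and c: "c \<in> A" "x \<in> fst c"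
 shows "g x u w = (\<Sum>i\<in>UNIV. \<Sum>j\<in>UNIV. w c $ i * (u c $ j * gram A g c x $ i $ j))"
 unfolding g_expand_right[OF assms] g_coord_expand[OF u c] by (simp add: sum_distrib_left)

text \<open>With a = g(w, w) and b = g(u, w) the vector a u - b w is orthogonal to w. Its square is
  a times the difference of the two sides of the claim, and a is positive.\<close>

lemma g_Cauchy_Schwarz:
 assumes u: "u \<in> tangent_space A x" and w: "w \<in> tangent_space A x"
 shows "(g x u w)\<^sup>2 <= g x u u * g x w w"
proof (cases "w = (\<lambda>_. 0)")
 case True
 then show ?thesis using g_sym[OF u w] g_zero[OF u] g_zero[OF w] by simp
next
 case False
 let ?a = "g x w w" and ?b = "g x u w"
 have a: "0 < ?a" by (rule g_pos[OF w False])
 let ?z = "\<lambda>c. ?a *\<^sub>R u c + (- ?b) *\<^sub>R w c"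
 have z: "?z \<in> tangent_space A x" by (rule tangent_lin[OF u w])
 have zw: "g x ?z w = 0" using g_lin[OF u w w, of ?a "- ?b"] by simp
 have zu: "g x ?z u = ?a * g x u u - ?b * ?b" using g_lin[OF u u w, of ?a "- ?b"] g_sym[OF u w] by simp
 have "g x ?z ?z = ?a * g x u ?z + (- ?b) * g x w ?z" by (rule g_lin[OF u z w])
 also have "... = ?a * (?a * g x u u - ?b * ?b)" using zu zw g_sym[OF u z] g_sym[OF w z] by simp
 finally have "0 <= ?a * (?a * g x u u - ?b * ?b)" using g_nonneg[OF z] by simp
 then show ?thesis using a by (simp add: zero_le_mult_iff power2_eq_square mult.commute)
qed

lemma det_gram_pos: "c \<in> A ==> x \<in> fst c ==> 0 < det (gram A g c x)"
proof (rule det_pos_of_positive_definite)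
 fix v :: "real^'n" assume c: "c \<in> A" "x \<in> fst c" and v: "v ~= 0"
 define u where "u = (\<lambda>d. \<Sum>i\<in>UNIV. v $ i *\<^sub>R coord_field A c i x d)"
 have u: "u \<in> tangent_space A x" unfolding u_def by (rule tangent_sum) (use coord_field_in[OF c] in auto)
 have uc: "u c = v" unfolding u_def coord_field_self[OF c] by (rule vec_eq_sum_axis[symmetric])
 then have "u ~= (\<lambda>_. 0)" using v by auto
 then have "0 < g x u u" by (rule g_pos[OF u])
 also have "g x u u = v \<bullet> (gram A g c x *v v)" unfolding g_expand[OF u u c] uc
  by (simp add: inner_vec_def matrix_vector_mult_def sum_distrib_left mult_ac)
 finally show "0 < v \<bullet> (gram A g c x *v v)" .
qed

lemma smooth_gram: "c \<in> A ==> smooth_on (snd c ` fst c) (\<lambda>y. gram A g c (chart_inv c y) $ i $ j)"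
 using metric unfolding riemannian_metric_def gram_def by simp

lemma smooth_det_gram: "c \<in> A ==> smooth_on (snd c ` fst c) (\<lambda>y. det (gram A g c (chart_inv c y)))" unfolding det_def
 by (intro smooth_on_sum smooth_on_cmult smooth_on_prod smooth_gram open_img finite_permutations finite)

lemma vol_pos: "c \<in> A ==> y \<in> snd c ` fst c ==> 0 < vol_density A g c y"
 unfolding vol_density_def using det_gram_pos[of c "chart_inv c y"] chart_inv_in by simp

lemma vol_nonneg: "0 <= vol_density A g c y" if "c \<in> A" "y \<in> snd c ` fst c" using vol_pos[OF that] by simp

lemma smooth_vol: "c \<in> A ==> smooth_on (snd c ` fst c) (vol_density A g c)"
 and smooth_inverse_vol: "c \<in> A ==> smooth_on (snd c ` fst c) (\<lambda>y. 1 / vol_density A g c y)"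
proof -
 assume c: "c \<in> A"
 have p: "0 < det (gram A g c (chart_inv c y))" if "y \<in> snd c ` fst c" for y using det_gram_pos[OF c chart_inv_in[OF c that]] .
 note s = smooth_on_powr[OF open_img[OF c] smooth_det_gram[OF c] p]
 show "smooth_on (snd c ` fst c) (vol_density A g c)" by (rule smooth_on_cong[OF open_img[OF c] s[of "1/2"]])
   (auto simp: vol_density_def powr_half_sqrt less_imp_le[OF p] simp del: inv_chart)
 show "smooth_on (snd c ` fst c) (\<lambda>y. 1 / vol_density A g c y)" by (rule smooth_on_cong[OF open_img[OF c] s[of "- (1/2)"]])
   (auto simp: vol_density_def powr_minus powr_half_sqrt inverse_eq_divide less_imp_le[OF p] simp del: inv_chart)
qed

lemma continuous_on_charts:
 fixes f :: "'a => 'b::topological_space"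
 assumes "!!c. c \<in> A ==> continuous_on (snd c ` fst c) (\<lambda>y. f (chart_inv c y))"
 shows "continuous_on UNIV f"
proof (rule continuous_at_imp_continuous_on, rule ballI)
 fix x
 obtain c where c: "c \<in> A" "x \<in> fst c" using ex_chart by blast
 have "continuous_on (fst c) (\<lambda>x. f (chart_inv c (snd c x)))" by (rule continuous_on_compose2[OF assms[OF c(1)] cont_chart[OF c(1)]]) simp
 then have "continuous_on (fst c) f" by (rule continuous_on_eq) (use c in simp)
 then show "isCont f x" using open_dom[OF c(1)] c(2) by (simp add: continuous_on_eq_continuous_at)
qed

lemma continuous_on_chart_compose:
 "c \<in> A ==> continuous_on (snd c ` fst c) b ==> continuous_on (fst c) (\<lambda>x. b (snd c x))" by (rule continuous_on_compose2[OF _ cont_chart]) auto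

text \<open>Measurability can be glued only along countably many chart domains; second countability
  provides such a subatlas.\<close>

definition atlas_cover :: "('a, 'n) chart set" where
 "atlas_cover = (SOME C. C \<subseteq> A & countable C & (\<Union>c\<in>C. fst c) = UNIV)"

lemma atlas_cover: "atlas_cover \<subseteq> A" "countable atlas_cover" "(\<Union>c\<in>atlas_cover. fst c) = UNIV"
proof -
 obtain F where F: "F \<subseteq> fst ` A" "countable F" "\<Union>F = \<Union>(fst ` A)" using Lindelof[of "fst ` A"] open_dom by blast
 then obtain C where C: "C \<subseteq> A" "countable C" "F = fst ` C" using countable_subset_image[of F fst A] by blast
 have "(\<Union>c\<in>C. fst c) = UNIV" using F(3) C(3) ex_chart by auto
 then have "\<exists>C. C \<subseteq> A & countable C & (\<Union>c\<in>C. fst c) = UNIV" using C by blast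
 from someI_ex[OF this] show "atlas_cover \<subseteq> A" "countable atlas_cover" "(\<Union>c\<in>atlas_cover. fst c) = UNIV" unfolding atlas_cover_def by blast+
qed

lemma borel_measurable_charts:
 fixes f :: "'a => real"
 assumes "!!c. c \<in> A ==> f \<in> borel_measurable (restrict_space borel (fst c))"
 shows "f \<in> borel_measurable borel"
proof (rule measurable_piecewise_restrict[of "fst ` atlas_cover"])
 show "countable (fst ` atlas_cover)" using atlas_cover by simp
 show "\<Omega> \<inter> space borel \<in> sets borel" if "\<Omega> \<in> fst ` atlas_cover" for \<Omega> using that atlas_cover open_dom by auto
 show "space borel \<subseteq> \<Union> (fst ` atlas_cover)" using atlas_cover by simp
 show "f \<in> borel_measurable (restrict_space borel \<Omega>)" if "\<Omega> \<in> fst ` atlas_cover" for \<Omega> using that atlas_cover assms by auto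
qed

lemma measurable_g:
 assumes u: "!!x. u x \<in> tangent_space A x" "!!c. c \<in> A ==> (\<lambda>x. u x c) \<in> borel_measurable (restrict_space borel (fst c))"
  and w: "!!x. w x \<in> tangent_space A x" "!!c. c \<in> A ==> (\<lambda>x. w x c) \<in> borel_measurable (restrict_space borel (fst c))"
 shows "(\<lambda>x. g x (u x) (w x)) \<in> borel_measurable borel"
proof (rule borel_measurable_charts)
 fix c assume c: "c \<in> A"
 have G: "(\<lambda>x. gram A g c x $ i $ j) \<in> borel_measurable (restrict_space borel (fst c))" for i j
 proof (rule borel_measurable_continuous_on_restrict)
  have "continuous_on (fst c) (\<lambda>x. gram A g c (chart_inv c (snd c x)) $ i $ j)"
   by (rule continuous_on_chart_compose[OF c smooth_on_continuous_on[OF smooth_gram[OF c]]])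
  then show "continuous_on (fst c) (\<lambda>x. gram A g c x $ i $ j)" by (rule continuous_on_eq) (use c in simp)
 qed
 have comp: "(\<lambda>x. u x c $ i) \<in> borel_measurable (restrict_space borel (fst c))"
  "(\<lambda>x. w x c $ i) \<in> borel_measurable (restrict_space borel (fst c))" for i
 proof -
  have v: "(\<lambda>z :: real^'n. z $ i) \<in> borel_measurable borel" by (intro borel_measurable_continuous_onI continuous_intros)
  show "(\<lambda>x. u x c $ i) \<in> borel_measurable (restrict_space borel (fst c))"
   "(\<lambda>x. w x c $ i) \<in> borel_measurable (restrict_space borel (fst c))" by (rule measurable_compose[OF _ v], rule u(2) w(2), rule c)+
 qed
 have "(\<lambda>x. \<Sum>i\<in>UNIV. \<Sum>j\<in>UNIV. w x c $ i * (u x c $ j * gram A g c x $ i $ j)) \<in> borel_measurable (restrict_space borel (fst c))"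
  by (intro borel_measurable_sum borel_measurable_times comp G)
 then show "(\<lambda>x. g x (u x) (w x)) \<in> borel_measurable (restrict_space borel (fst c))"
  by (rule measurable_cong[THEN iffD1, rotated]) (use g_expand[OF u(1) w(1) c] in \<open>simp add: space_restrict_space\<close>)
qed

end

section \<open>The volume measure in charts\<close>

locale riemannian_volume = riemannian_atlas A g
 for A :: "('a::{second_countable_topology,t2_space}, 'n::finite) chart set" and g :: "('a, 'n) metric" +
 fixes m :: "'a measure"
 assumes volume: "volume_measure A g m"
begin

lemma sets_m[measurable_cong]: "sets m = sets borel" using volume unfolding volume_measure_def by simp

lemma space_m[simp]: "space m = UNIV" using sets_eq_imp_space_eq[OF sets_m] by simp

lemma measurable_vol: "c \<in> A ==> vol_density A g c \<in> borel_measurable (restrict_space borel (snd c ` fst c))"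
 by (rule borel_measurable_continuous_on_restrict[OF smooth_on_continuous_on[OF smooth_vol]])

lemma measurable_chart_inv: "c \<in> A ==> chart_inv c \<in> measurable (restrict_space borel (snd c ` fst c)) borel"
 by (rule borel_measurable_continuous_on_restrict[OF cont_inv])

text \<open>\<open>volume_measure\<close> prescribes only the masses of Borel sets inside a chart.
  Read as an equality of measures, it allows integrals of functions to be pulled back to
  coordinates.\<close>

lemma density_chart:
 assumes c: "c \<in> A"
 shows "density m (indicator (fst c)) =
  distr (density (restrict_space lborel (snd c ` fst c)) (\<lambda>y. ennreal (vol_density A g c y))) borel (chart_inv c)"
proof (rule measure_eqI)
 let ?O = "snd c ` fst c"
 have O: "?O \<in> sets borel" using open_img[OF c] by simp
 have D: "fst c \<in> sets borel" using open_dom[OF c] by simp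
 have r: "sets (restrict_space lborel ?O) = sets (restrict_space borel ?O)" by (intro sets_restrict_space_cong) simp
 have mv: "(\<lambda>y. ennreal (vol_density A g c y)) \<in> borel_measurable (restrict_space lborel ?O)"
  unfolding measurable_cong_sets[OF r refl] by (rule measurable_compose[OF measurable_vol[OF c] measurable_ennreal])
 have mi: "chart_inv c \<in> measurable (density (restrict_space lborel ?O) (\<lambda>y. ennreal (vol_density A g c y))) borel"
  using measurable_chart_inv[OF c] by (simp add: measurable_cong_sets[OF r refl])
 show "sets (density m (indicator (fst c))) =
   sets (distr (density (restrict_space lborel ?O) (\<lambda>y. ennreal (vol_density A g c y))) borel (chart_inv c))"
  by (simp add: sets_m)
 fix B assume "B \<in> sets (density m (indicator (fst c)))"
 then have B: "B \<in> sets borel" by (simp add: sets_m)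
 have BO: "chart_inv c -` B \<inter> ?O \<in> sets (restrict_space lborel ?O)"
  using measurable_sets[OF measurable_chart_inv[OF c] B] r by (simp add: space_restrict_space)
 have "emeasure (density m (indicator (fst c))) B = (\<integral>\<^sup>+x. indicator (fst c) x * indicator B x \<partial>m)"
  using D B by (intro emeasure_density) (auto simp: sets_m measurable_cong_sets[OF sets_m refl])
 also have "... = emeasure m (fst c \<inter> B)" using D B by (simp add: indicator_inter_arith[symmetric] sets_m)
 also have "... = (\<integral>\<^sup>+ y\<in>snd c ` (fst c \<inter> B). ennreal (vol_density A g c y) \<partial>lborel)" using volume c D B unfolding volume_measure_def by auto
 also have "... = (\<integral>\<^sup>+ y. ennreal (vol_density A g c y) * indicator (chart_inv c -` B \<inter> ?O) y * indicator ?O y \<partial>lborel)"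
  by (rule nn_integral_cong) (auto simp: indicator_def chart_image_eq[OF c])
 also have "... = (\<integral>\<^sup>+ y. ennreal (vol_density A g c y) * indicator (chart_inv c -` B \<inter> ?O) y \<partial>restrict_space lborel ?O)"
  by (subst nn_integral_restrict_space) (use O in auto)
 also have "... = emeasure (density (restrict_space lborel ?O) (\<lambda>y. ennreal (vol_density A g c y))) (chart_inv c -` B \<inter> ?O)"
  by (rule emeasure_density[symmetric, OF mv BO])
 also have "... = emeasure (distr (density (restrict_space lborel ?O) (\<lambda>y. ennreal (vol_density A g c y))) borel (chart_inv c)) B"
  by (subst emeasure_distr[OF mi B]) (simp add: space_restrict_space)
 finally show "emeasure (density m (indicator (fst c))) B =
  emeasure (distr (density (restrict_space lborel ?O) (\<lambda>y. ennreal (vol_density A g c y))) borel (chart_inv c)) B" .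
qed

lemma chart_integral:
 fixes k :: "'a => real"
 assumes c: "c \<in> A" and k: "k \<in> borel_measurable borel" and supp: "!!x. x \<notin> fst c ==> k x = 0"
 shows "integrable m k \<longleftrightarrow> integrable lborel (\<lambda>y. indicat_real (snd c ` fst c) y * (vol_density A g c y * k (chart_inv c y)))"
  and "(LINT x|m. k x) = (LINT y|lborel. indicat_real (snd c ` fst c) y * (vol_density A g c y * k (chart_inv c y)))"
proof -
 let ?O = "snd c ` fst c"
 let ?v = "vol_density A g c"
 have O: "?O \<in> sets borel" using open_img[OF c] by simp
 have D: "fst c \<in> sets borel" using open_dom[OF c] by simp
 have r: "sets (restrict_space lborel ?O) = sets (restrict_space borel ?O)" by (intro sets_restrict_space_cong) simp
 have mv: "?v \<in> borel_measurable (restrict_space lborel ?O)" unfolding measurable_cong_sets[OF r refl] by (rule measurable_vol[OF c])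
 have mi: "chart_inv c \<in> measurable (density (restrict_space lborel ?O) (\<lambda>y. ennreal (?v y))) borel"
  using measurable_chart_inv[OF c] by (simp add: measurable_cong_sets[OF r refl])
 have mki: "(\<lambda>y. k (chart_inv c y)) \<in> borel_measurable (restrict_space lborel ?O)"
  unfolding measurable_cong_sets[OF r refl] by (rule measurable_compose[OF measurable_chart_inv[OF c] k])
 have v0: "AE y in restrict_space lborel ?O. 0 <= ?v y" by (rule AE_I2) (use vol_nonneg[OF c] in \<open>auto simp: space_restrict_space\<close>)
 have ki: "(\<lambda>x. indicat_real (fst c) x *\<^sub>R k x) = k"
 proof
  fix x show "indicat_real (fst c) x *\<^sub>R k x = k x" by (cases "x \<in> fst c") (simp_all add: supp)
 qed
 have ind: "indicator (fst c) = (\<lambda>x. ennreal (indicat_real (fst c) x))" by (auto simp: indicator_def)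
 have km: "k \<in> borel_measurable m" "indicat_real (fst c) \<in> borel_measurable m"
  using k D by (auto simp: measurable_cong_sets[OF sets_m refl])
 have "integrable m k \<longleftrightarrow> integrable (density m (indicator (fst c))) k"
  unfolding ind using integrable_density[OF km(1) km(2)] by (simp only: ki) simp
 also have "... \<longleftrightarrow> integrable (density (restrict_space lborel ?O) (\<lambda>y. ennreal (?v y))) (\<lambda>y. k (chart_inv c y))"
  unfolding density_chart[OF c] by (rule integrable_distr_eq[OF mi k])
 also have "... \<longleftrightarrow> integrable (restrict_space lborel ?O) (\<lambda>y. ?v y *\<^sub>R k (chart_inv c y))" by (rule integrable_density[OF mki mv v0])
 also have "... \<longleftrightarrow> integrable lborel (\<lambda>y. indicat_real ?O y *\<^sub>R (?v y *\<^sub>R k (chart_inv c y)))"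
  by (rule integrable_restrict_space) (use O in simp)
 finally show "integrable m k \<longleftrightarrow> integrable lborel (\<lambda>y. indicat_real ?O y * (?v y * k (chart_inv c y)))" by simp
 have "(LINT x|m. k x) = (LINT x|density m (indicator (fst c)). k x)"
  unfolding ind using integral_density[OF km(1) km(2)] by (simp only: ki) simp
 also have "... = (LINT y|density (restrict_space lborel ?O) (\<lambda>y. ennreal (?v y)). k (chart_inv c y))"
  unfolding density_chart[OF c] by (rule integral_distr[OF mi k])
 also have "... = (LINT y|restrict_space lborel ?O. ?v y *\<^sub>R k (chart_inv c y))" by (rule integral_density[OF mki mv v0])
 also have "... = (LINT y|lborel. indicat_real ?O y *\<^sub>R (?v y *\<^sub>R k (chart_inv c y)))" by (rule integral_restrict_space) (use O in simp)
 finally show "(LINT x|m. k x) = (LINT y|lborel. indicat_real ?O y * (?v y * k (chart_inv c y)))" by simp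
qed

lemma nonatomic: "emeasure m {x} = 0"
proof -
 obtain c where c: "c \<in> A" "x \<in> fst c" using ex_chart by blast
 have "emeasure m {x} = (\<integral>\<^sup>+ y\<in>snd c ` {x}. ennreal (vol_density A g c y) \<partial>lborel)" using volume c unfolding volume_measure_def by auto
 also have "... = 0" using nn_integral_null_set[of "{snd c x}" lborel] by simp
 finally show ?thesis .
qed

end

section \<open>Smooth functions and vector fields on the manifold\<close>

lemma compact_closure_iff: "compact (closure S) \<longleftrightarrow> (\<exists>K. compact K & S \<subseteq> K)" for S :: "'a::t2_space set"
proof
 assume "\<exists>K. compact K & S \<subseteq> K"
 then obtain K where K: "compact K" "S \<subseteq> K" by blast
 then have "closure S \<subseteq> K" by (simp add: closure_minimal compact_imp_closed)
 then have "K \<inter> closure S = closure S" by blast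
 then show "compact (closure S)" using compact_Int_closed[OF K(1) closed_closure[of S]] by simp
qed (use closure_subset in blast)

context riemannian_atlas begin

definition smooth_fun :: "('a => real) => bool" where
 "smooth_fun u \<longleftrightarrow> (\<forall>c\<in>A. smooth_on (snd c ` fst c) (\<lambda>y. u (chart_inv c y)))"

definition smooth_field :: "('a => ('a, 'n) tangent) => bool" where
 "smooth_field X \<longleftrightarrow> (\<forall>x. X x \<in> tangent_space A x) & (\<forall>c\<in>A. smooth_on (snd c ` fst c) (\<lambda>y. X (chart_inv c y) c))"

lemma smooth_funD: "smooth_fun u ==> c \<in> A ==> smooth_on (snd c ` fst c) (\<lambda>y. u (chart_inv c y))" unfolding smooth_fun_def by blast

lemma smooth_fieldD: "smooth_field X ==> X x \<in> tangent_space A x"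
 "smooth_field X ==> c \<in> A ==> smooth_on (snd c ` fst c) (\<lambda>y. X (chart_inv c y) c)" unfolding smooth_field_def by blast+

lemma smooth_fieldD_nth: "smooth_field X ==> c \<in> A ==> smooth_on (snd c ` fst c) (\<lambda>y. X (chart_inv c y) c $ i)"
 by (intro smooth_on_nth open_img smooth_fieldD)

lemma test_iff: "f \<in> test_functions A \<longleftrightarrow> smooth_fun f & csupp f"
 unfolding test_functions_def smooth_fun_def csupp_def comp_def compact_closure_iff by simp

lemma field_iff: "v \<in> compact_vector_fields A \<longleftrightarrow> smooth_field v & (\<exists>K. compact K & {x. v x ~= (\<lambda>_. 0)} \<subseteq> K)"
 unfolding compact_vector_fields_def smooth_field_def compact_closure_iff by simp

lemma smooth_fun_const: "smooth_fun (\<lambda>_. a)" unfolding smooth_fun_def by (simp add: smooth_on_const)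

lemma smooth_fun_add: "smooth_fun u ==> smooth_fun w ==> smooth_fun (\<lambda>x. u x + w x)"
 unfolding smooth_fun_def by (auto intro!: smooth_on_add open_img)

lemma smooth_fun_mult: "smooth_fun u ==> smooth_fun w ==> smooth_fun (\<lambda>x. u x * w x)"
 unfolding smooth_fun_def by (auto intro!: smooth_on_mult open_img)

lemma smooth_fun_cmult: "smooth_fun u ==> smooth_fun (\<lambda>x. a * u x)" by (rule smooth_fun_mult[OF smooth_fun_const])

lemma smooth_fun_diff: "smooth_fun u ==> smooth_fun w ==> smooth_fun (\<lambda>x. u x - w x)"
 unfolding smooth_fun_def by (auto intro!: smooth_on_diff open_img)

lemma smooth_fun_power: "smooth_fun u ==> smooth_fun (\<lambda>x. u x ^ k)" unfolding smooth_fun_def by (auto intro!: smooth_on_power open_img)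

lemma smooth_fun_bounded_smooth:
 "h \<in> bounded_smooth N ==> (!!i. i < N ==> smooth_fun (a i)) ==> smooth_fun (\<lambda>x. h (\<lambda>i. a i x))"
 unfolding smooth_fun_def by (rule ballI, rule smooth_on_bounded_smooth[OF open_img, where h=h and N=N]) simp_all

lemma smooth_fun_continuous: "smooth_fun u ==> continuous_on UNIV u"
 by (rule continuous_on_charts) (auto intro: smooth_on_continuous_on smooth_funD)

lemma smooth_fun_measurable: "smooth_fun u ==> u \<in> borel_measurable borel" by (rule borel_measurable_continuous_onI[OF smooth_fun_continuous])

lemma smooth_field_scale: "smooth_fun u ==> smooth_field X ==> smooth_field (\<lambda>x c. u x *\<^sub>R X x c)"
proof -
 assume u: "smooth_fun u" and X: "smooth_field X"
 have "smooth_on (snd c ` fst c) (\<lambda>y. u (chart_inv c y) *\<^sub>R X (chart_inv c y) c)" if "c \<in> A" for c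
  by (rule smooth_on_scaleR[OF open_img[OF that] smooth_funD[OF u that] smooth_fieldD(2)[OF X that]])
 then show ?thesis using tangent_scale[OF smooth_fieldD(1)[OF X]] unfolding smooth_field_def by simp
qed

text \<open>The image of the second chart is covered by its overlap with the first and by the part
  off \<open>K\<close>, where the function is 0. Both parts are open and smoothness is a condition
  at each point, so it holds on the union.\<close>

lemma chart_split:
 assumes c: "c \<in> A" "d \<in> A" and K: "closed K" "K \<subseteq> fst c"
  and 1: "smooth_on (snd d ` (fst d \<inter> fst c)) f" and 2: "!!x. x \<in> fst d ==> x \<notin> K ==> f (snd d x) = 0"
 shows "smooth_on (snd d ` fst d) f"
proof -
 have "smooth_on (snd d ` (fst d \<inter> - K)) f" by (rule smooth_on_cong[OF _ smooth_on_const[of _ 0]])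
   (use 2 open_chart_image[OF c(2), of "- K"] K in auto)
 with 1 have "smooth_on (snd d ` (fst d \<inter> fst c) \<union> snd d ` (fst d \<inter> - K)) f" by (rule smooth_on_Un)
 moreover have "snd d ` (fst d \<inter> fst c) \<union> snd d ` (fst d \<inter> - K) = snd d ` fst d" using K by blast
 ultimately show ?thesis by simp
qed

lemma transition_image: "c \<in> A ==> d \<in> A ==> transition d c ` (snd d ` (fst d \<inter> fst c)) \<subseteq> snd c ` (fst c \<inter> fst d)" by (auto simp: image_iff)

text \<open>Seen in another chart, the extension by zero is a composition with the coordinate change
  on the overlap and vanishes off a compact set; \<open>chart_split\<close> joins the two
  descriptions.\<close>

lemma chart_lift_smooth:
 assumes c: "c \<in> A" and \<psi>: "smooth_on (snd c ` fst c) \<psi>" and L: "compact L" "L \<subseteq> snd c ` fst c"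
  and z: "!!y. y \<in> snd c ` fst c ==> y \<notin> L ==> \<psi> y = 0"
 shows "smooth_fun (\<lambda>x. if x \<in> fst c then \<psi> (snd c x) else 0)"
  and "{x. (if x \<in> fst c then \<psi> (snd c x) else 0) ~= 0} \<subseteq> chart_inv c ` L"
proof -
 let ?K = "chart_inv c ` L"
 have K: "compact ?K" "?K \<subseteq> fst c" using compact_inv_image[OF c L] chart_inv_in[OF c] L by auto
 have zK: "(if x \<in> fst c then \<psi> (snd c x) else 0) = 0" if "x \<notin> ?K" for x
 proof (cases "x \<in> fst c")
  case True
  have "snd c x \<notin> L" using that True c by (metis image_eqI inv_chart)
  then show ?thesis using z True by simp
 qed simp
 then show "{x. (if x \<in> fst c then \<psi> (snd c x) else 0) ~= 0} \<subseteq> ?K" by blast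
 show "smooth_fun (\<lambda>x. if x \<in> fst c then \<psi> (snd c x) else 0)" unfolding smooth_fun_def
 proof
  fix d assume d: "d \<in> A"
  show "smooth_on (snd d ` fst d) (\<lambda>y. if chart_inv d y \<in> fst c then \<psi> (snd c (chart_inv d y)) else 0)"
  proof (rule chart_split[OF c d compact_imp_closed[OF K(1)] K(2)])
   have "smooth_on (snd d ` (fst d \<inter> fst c)) (\<lambda>y. \<psi> (transition d c y))"
    by (rule smooth_on_compose[OF open_chart_image[OF d open_dom[OF c]] _ smooth_transition[OF d c] \<psi>])
     (use transition_image[OF c d] in auto)
   then show "smooth_on (snd d ` (fst d \<inter> fst c)) (\<lambda>y. if chart_inv d y \<in> fst c then \<psi> (snd c (chart_inv d y)) else 0)"
    by (rule smooth_on_cong[OF open_chart_image[OF d open_dom[OF c]]]) (use d in auto)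
  next
   fix x assume x: "x \<in> fst d" "x \<notin> ?K"
   show "(if chart_inv d (snd d x) \<in> fst c then \<psi> (snd c (chart_inv d (snd d x))) else 0) = 0"
    using zK[OF x(2)] d x(1) by (simp only: inv_chart)
  qed
 qed
qed

text \<open>As for functions. In another chart the coordinate field has the columns of the Jacobian
  as its values, and these become smooth functions of the new coordinates after composition with the
  inverse coordinate change.\<close>

lemma field_lift_smooth:
 assumes c: "c \<in> A" and a: "smooth_on (snd c ` fst c) a" and L: "compact L" "L \<subseteq> snd c ` fst c"
  and z: "!!y. y \<in> snd c ` fst c ==> y \<notin> L ==> a y = 0"
 shows "smooth_field (\<lambda>x d. if x \<in> fst c then a (snd c x) *\<^sub>R coord_field A c i x d else 0)"
  and "{x. (\<lambda>d. if x \<in> fst c then a (snd c x) *\<^sub>R coord_field A c i x d else 0) ~= (\<lambda>_. 0)} \<subseteq> chart_inv c ` L"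
proof -
 let ?K = "chart_inv c ` L"
 have K: "compact ?K" "?K \<subseteq> fst c" using compact_inv_image[OF c L] chart_inv_in[OF c] L by auto
 have zK: "(if x \<in> fst c then a (snd c x) *\<^sub>R coord_field A c i x d else 0) = 0" if "x \<notin> ?K" for x d
 proof (cases "x \<in> fst c")
  case True
  have "snd c x \<notin> L" using that True c by (metis image_eqI inv_chart)
  then show ?thesis using z True by simp
 qed simp
 then show "{x. (\<lambda>d. if x \<in> fst c then a (snd c x) *\<^sub>R coord_field A c i x d else 0) ~= (\<lambda>_. 0)} \<subseteq> ?K" by blast
 have "(\<lambda>d. if x \<in> fst c then a (snd c x) *\<^sub>R coord_field A c i x d else 0) \<in> tangent_space A x" for x
  using tangent_scale[OF coord_field_in[OF c]] tangent_0 by (cases "x \<in> fst c") simp_all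
 moreover have "smooth_on (snd d ` fst d) (\<lambda>y. if chart_inv d y \<in> fst c then a (snd c (chart_inv d y)) *\<^sub>R coord_field A c i (chart_inv d y) d else 0)"
  if d: "d \<in> A" for d
 proof (rule chart_split[OF c d compact_imp_closed[OF K(1)] K(2)])
  let ?W = "snd d ` (fst d \<inter> fst c)"
  have W: "open ?W" by (rule open_chart_image[OF d open_dom[OF c]])
  have "smooth_on ?W (\<lambda>y. a (transition d c y) *\<^sub>R partial i (transition c d) (transition d c y))"
  proof (rule smooth_on_scaleR[OF W])
   show "smooth_on ?W (\<lambda>y. a (transition d c y))"
    by (rule smooth_on_compose[OF W _ smooth_transition[OF d c] a]) (use transition_image[OF c d] in auto)
   show "smooth_on ?W (\<lambda>y. partial i (transition c d) (transition d c y))"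
    by (rule smooth_on_compose[OF W transition_image[OF c d] smooth_transition[OF d c] smooth_on_partial[OF smooth_transition[OF c d]]])
  qed
  then show "smooth_on ?W (\<lambda>y. if chart_inv d y \<in> fst c then a (snd c (chart_inv d y)) *\<^sub>R coord_field A c i (chart_inv d y) d else 0)"
   by (rule smooth_on_cong[OF W]) (use d in \<open>auto simp: coord_field_def\<close>)
 next
  fix x assume x: "x \<in> fst d" "x \<notin> ?K"
  show "(if chart_inv d (snd d x) \<in> fst c then a (snd c (chart_inv d (snd d x))) *\<^sub>R coord_field A c i (chart_inv d (snd d x)) d else 0) = 0"
   using zK[OF x(2), of d] d x(1) by (simp only: inv_chart)
 qed
 ultimately show "smooth_field (\<lambda>x d. if x \<in> fst c then a (snd c x) *\<^sub>R coord_field A c i x d else 0)" unfolding smooth_field_def by blast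
qed

lemma ex_cball_in_chart:
 assumes "c \<in> A" "open U" "x \<in> fst c \<inter> U"
 shows "\<exists>r>0. cball (snd c x) r \<subseteq> snd c ` (fst c \<inter> U)" using open_chart_image[OF assms(1,2)] assms(3) open_contains_cball by blast

lemma bump_exists:
 assumes U: "open U" "x \<in> U"
 shows "\<exists>f K. smooth_fun f & (\<forall>y. 0 <= f y & f y <= 1) & 0 < f x & compact K & K \<subseteq> U & {y. f y ~= 0} \<subseteq> K"
proof -
 obtain c where c: "c \<in> A" "x \<in> fst c" using ex_chart by blast
 obtain r where r: "0 < r" "cball (snd c x) r \<subseteq> snd c ` (fst c \<inter> U)" using ex_cball_in_chart[OF c(1) U(1)] c U by blast
 let ?L = "cball (snd c x) r"
 have L: "compact ?L" "?L \<subseteq> snd c ` fst c" using r(2) by auto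
 let ?f = "\<lambda>z. if z \<in> fst c then ball_bump (snd c x) r (snd c z) else 0"
 have z: "ball_bump (snd c x) r y = 0" if "y \<notin> ?L" for y
  using that ball_bump_zero_iff[OF r(1), of "snd c x" y] by (auto simp: dist_commute)
 note * = chart_lift_smooth[OF c(1) smooth_on_ball_bump[OF open_img[OF c(1)]] L z]
 have "compact (chart_inv c ` ?L)" by (rule compact_inv_image[OF c(1) L])
 moreover have "chart_inv c ` ?L \<subseteq> U" using r(2) chart_image_eq[OF c(1), of U] by auto
 moreover have "0 < ?f x" using c ball_bump_pos_iff[OF r(1), of "snd c x" "snd c x"] r(1) by simp
 moreover have "\<forall>y. 0 <= ?f y & ?f y <= 1" using ball_bump_bounds by auto
 ultimately show ?thesis using * by (intro exI[of _ ?f] exI[of _ "chart_inv c ` ?L"]) blast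
qed

definition pos_tests :: "('a => real) set" where
 "pos_tests = {f \<in> test_functions A. \<forall>x. 0 <= f x}"

lemma pos_tests_iff: "f \<in> pos_tests \<longleftrightarrow> smooth_fun f & csupp f & (\<forall>x. 0 <= f x)" unfolding pos_tests_def by (auto simp: test_iff)

lemma test_cone_pos_tests: "test_cone pos_tests"
proof
 show "continuous_on UNIV f" if "f \<in> pos_tests" for f using that smooth_fun_continuous pos_tests_iff by blast
 show "0 <= f x" if "f \<in> pos_tests" for f x using that pos_tests_iff by blast
 show "csupp f" if "f \<in> pos_tests" for f using that pos_tests_iff by blast
 show "(\<lambda>x. f x + h x) \<in> pos_tests" if "f \<in> pos_tests" "h \<in> pos_tests" for f h
  using that unfolding pos_tests_iff by (auto intro: smooth_fun_add csupp_add)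
 show "(\<lambda>x. f x * h x) \<in> pos_tests" if "f \<in> pos_tests" "h \<in> pos_tests" for f h
  using that unfolding pos_tests_iff by (auto intro: smooth_fun_mult csupp_subset)
 show "(\<lambda>x. a * f x) \<in> pos_tests" if "f \<in> pos_tests" "0 <= a" for f a
  using that unfolding pos_tests_iff by (auto intro: smooth_fun_cmult csupp_subset)
 show "(\<lambda>x. 1 - (1 - f x) ^ n) \<in> pos_tests" if f: "f \<in> pos_tests" "!!x. f x <= 1" for f n
 proof -
  have "smooth_fun (\<lambda>x. 1 - (1 - f x) ^ n)"
   using f by (intro smooth_fun_diff smooth_fun_power smooth_fun_const) (auto simp: pos_tests_iff)
  moreover have "csupp (\<lambda>x. 1 - (1 - f x) ^ n)" by (rule csupp_subset[of f]) (use f in \<open>auto simp: pos_tests_iff\<close>)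
  moreover have "0 <= 1 - (1 - f x) ^ n" for x using f power_le_one[of "1 - f x" n] by (auto simp: pos_tests_iff)
  ultimately show ?thesis unfolding pos_tests_iff by blast
 qed
 show "\<exists>f\<in>pos_tests. (\<forall>y. f y <= 1) & 0 < f x & {y. f y ~= 0} \<subseteq> U" if U: "open U" "x \<in> U" for U x
 proof -
  obtain f K where f: "smooth_fun f" "\<forall>y. 0 <= f y & f y <= 1" "0 < f x" "compact K" "K \<subseteq> U" "{y. f y ~= 0} \<subseteq> K"
   using bump_exists[OF U] by blast
  have "f \<in> pos_tests" using f unfolding pos_tests_iff csupp_def by blast
  then show ?thesis using f by (intro bexI[of _ f]) auto
 qed
qed

text \<open>Compactness leaves finitely many bumps that are positive at single points, and their sum
  is positive on all of \<open>K\<close>.\<close>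

lemma ex_cutoff:
 assumes K: "compact K"
 shows "\<exists>f\<in>pos_tests. \<forall>x\<in>K. 0 < f x"
proof -
 interpret test_cone pos_tests by (rule test_cone_pos_tests)
 have "\<exists>f\<in>pos_tests. 0 < f x" for x using bump[of UNIV x] by auto
 then obtain f where f: "!!x. f x \<in> pos_tests & 0 < f x x" by metis
 have o: "open {y. 0 < f x y}" for x by (intro open_Collect_less cont continuous_on_const) (use f in blast)
 obtain T where T: "T \<subseteq> K" "finite T" "K \<subseteq> (\<Union>x\<in>T. {y. 0 < f x y})" using compactE_image[OF K, of K "\<lambda>x. {y. 0 < f x y}"] o f by blast
 have s: "(\<lambda>y. \<Sum>x\<in>T. f x y) \<in> pos_tests" using T(2)
 proof (induction T rule: finite_induct)
  case (insert x T)
  show ?case using add[OF conjunct1[OF f[of x]] insert.IH] insert.hyps by simp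
 qed (simp add: zero_in)
 have "0 < (\<Sum>x\<in>T. f x y)" if yK: "y \<in> K" for y
 proof -
  obtain x where x: "x \<in> T" "0 < f x y" using T(3) yK by blast
  have "0 <= f x' y" for x' using f[of x'] nonneg by simp
  then show ?thesis using sum_pos2[OF T(2) x(1), of "\<lambda>x. f x y"] x(2) by simp
 qed
 then show ?thesis by (intro bexI[OF _ s] ballI)
qed

text \<open>The Lie derivative of \<open>f\<close> along \<open>v\<close>, computed in an
  arbitrarily chosen chart; \<open>vderiv_frechet\<close> shows by the chain rule that every chart
  around the point gives the same value.\<close>

definition vderiv :: "('a => real) => ('a => ('a, 'n) tangent) => 'a => real" where
 "vderiv f v x = (let c = (SOME c. c \<in> A & x \<in> fst c) in
  frechet_derivative (\<lambda>y. f (chart_inv c y)) (at (snd c x)) (v x c))"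

lemma vderiv_frechet:
 assumes f: "smooth_fun f" and v: "smooth_field v" and c: "c \<in> A" "x \<in> fst c"
 shows "vderiv f v x = frechet_derivative (\<lambda>y. f (chart_inv c y)) (at (snd c x)) (v x c)"
proof -
 define d where "d = (SOME d. d \<in> A & x \<in> fst d)"
 have d: "d \<in> A" "x \<in> fst d" using someI_ex[of "\<lambda>d. d \<in> A & x \<in> fst d"] ex_chart[of x] unfolding d_def by blast+
 have df: "(\<lambda>y. f (chart_inv e y)) differentiable (at (snd e x))" if "e \<in> A" "x \<in> fst e" for e
  by (rule smooth_on_differentiable[OF smooth_funD[OF f that(1)]]) (use that in auto)
 have "((\<lambda>y. f (chart_inv d (transition c d y))) has_derivative
  (\<lambda>w. frechet_derivative (\<lambda>y. f (chart_inv d y)) (at (snd d x)) (frechet_derivative (transition c d) (at (snd c x)) w))) (at (snd c x))"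
  using has_derivative_compose[OF differentiable_has_derivative[OF transition_differentiable[OF c(1) d(1) c(2) d(2)]],
   of "\<lambda>y. f (chart_inv d y)"] differentiable_has_derivative[OF df[OF d]] c by simp
 then have "((\<lambda>y. f (chart_inv c y)) has_derivative
  (\<lambda>w. frechet_derivative (\<lambda>y. f (chart_inv d y)) (at (snd d x)) (frechet_derivative (transition c d) (at (snd c x)) w))) (at (snd c x))"
  by (rule has_derivative_transform_within_open[OF _ open_chart_image[OF c(1) open_dom[OF d(1)]]]) (use c d in auto)
 from frechet_derivative_at[OF this]
 have "frechet_derivative (\<lambda>y. f (chart_inv c y)) (at (snd c x)) (v x c) =
  frechet_derivative (\<lambda>y. f (chart_inv d y)) (at (snd d x)) (v x d)"
  using tangent_transition[OF smooth_fieldD(1)[OF v] c(1) d(1) c(2) d(2)] by metis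
 then show ?thesis unfolding vderiv_def d_def[symmetric] by simp
qed

lemma vderiv_eq:
 assumes f: "smooth_fun f" and v: "smooth_field v" and c: "c \<in> A" "x \<in> fst c"
 shows "vderiv f v x = (\<Sum>i\<in>UNIV. v x c $ i * partial i (\<lambda>y. f (chart_inv c y)) (snd c x))"
proof -
 have "(\<lambda>y. f (chart_inv c y)) differentiable (at (snd c x))" by (rule smooth_on_differentiable[OF smooth_funD[OF f c(1)]]) (use c in auto)
 then show ?thesis unfolding vderiv_frechet[OF assms] by (simp add: frechet_derivative_eq_sum)
qed

lemma vderiv_smooth: "smooth_fun f ==> smooth_field v ==> smooth_fun (vderiv f v)" unfolding smooth_fun_def[of "vderiv f v"]
proof
 fix c assume f: "smooth_fun f" and v: "smooth_field v" and c: "c \<in> A"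
 have "smooth_on (snd c ` fst c) (\<lambda>y. \<Sum>i\<in>UNIV. v (chart_inv c y) c $ i * partial i (\<lambda>y. f (chart_inv c y)) y)"
  by (intro smooth_on_sum smooth_on_mult smooth_on_partial smooth_funD[OF f c] smooth_fieldD_nth[OF v c] open_img[OF c] finite)
 then show "smooth_on (snd c ` fst c) (\<lambda>y. vderiv f v (chart_inv c y))" by (rule smooth_on_cong[OF open_img[OF c]])
   (use vderiv_eq[OF f v c chart_inv_in[OF c]] c in \<open>auto simp del: inv_chart\<close>)
qed

lemma vderiv_zero: "smooth_fun f ==> smooth_field v ==> v x = (\<lambda>_. 0) ==> vderiv f v x = 0" using vderiv_eq[of f v _ x] ex_chart[of x] by auto

text \<open>\<open>divergence\<close> chooses a chart at each point separately, whereas smoothness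
  can be seen only in a fixed chart. Independence of the chart therefore has to precede all
  regularity of \<open>divergence\<close>.\<close>

definition chart_div :: "('a, 'n) chart => ('a => ('a, 'n) tangent) => 'a => real" where
 "chart_div c v x = (\<Sum>i\<in>UNIV. partial i (\<lambda>y. vol_density A g c y * v (chart_inv c y) c $ i) (snd c x)) / vol_density A g c (snd c x)"

lemma chart_div_smooth: "smooth_field v ==> c \<in> A ==> smooth_on (snd c ` fst c) (\<lambda>y. chart_div c v (chart_inv c y))"
proof -
 assume v: "smooth_field v" and c: "c \<in> A"
 have "smooth_on (snd c ` fst c) (\<lambda>y. (\<Sum>i\<in>UNIV. partial i (\<lambda>y. vol_density A g c y * v (chart_inv c y) c $ i) y) * (1 / vol_density A g c y))"
  by (intro smooth_on_mult smooth_on_sum smooth_on_partial smooth_vol smooth_inverse_vol smooth_fieldD_nth[OF v c] open_img c finite)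
 then show ?thesis by (rule smooth_on_cong[OF open_img[OF c]]) (use c in \<open>auto simp: chart_div_def\<close>)
qed

lemma chart_div_continuous: "smooth_field v ==> c \<in> A ==> continuous_on (fst c) (chart_div c v)"
proof -
 assume v: "smooth_field v" and c: "c \<in> A"
 have "continuous_on (fst c) (\<lambda>x. chart_div c v (chart_inv c (snd c x)))"
  by (rule continuous_on_chart_compose[OF c smooth_on_continuous_on[OF chart_div_smooth[OF v c]]])
 then show ?thesis by (rule continuous_on_eq) (use c in simp)
qed

lemma chart_div_mult:
 assumes u: "smooth_fun u" and v: "smooth_field v" and c: "c \<in> A" "x \<in> fst c"
 shows "chart_div c (\<lambda>x d. u x *\<^sub>R v x d) x = u x * chart_div c v x + vderiv u v x"
proof -
 let ?y = "snd c x"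
 have y: "?y \<in> snd c ` fst c" using c by auto
 have du: "(\<lambda>y. u (chart_inv c y)) differentiable (at ?y)" by (rule smooth_on_differentiable[OF smooth_funD[OF u c(1)] y])
 have dv: "(\<lambda>y. vol_density A g c y * v (chart_inv c y) c $ i) differentiable (at ?y)" for i
  by (rule smooth_on_differentiable[OF smooth_on_mult[OF open_img[OF c(1)] smooth_vol[OF c(1)] smooth_fieldD_nth[OF v c(1)]] y])
 have "partial i (\<lambda>y. vol_density A g c y * (u (chart_inv c y) *\<^sub>R v (chart_inv c y) c) $ i) ?y =
   u x * partial i (\<lambda>y. vol_density A g c y * v (chart_inv c y) c $ i) ?y +
   partial i (\<lambda>y. u (chart_inv c y)) ?y * (vol_density A g c ?y * v x c $ i)" for i
 proof -
  have "partial i (\<lambda>y. u (chart_inv c y) * (vol_density A g c y * v (chart_inv c y) c $ i)) ?y =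
   u (chart_inv c ?y) * partial i (\<lambda>y. vol_density A g c y * v (chart_inv c y) c $ i) ?y +
   partial i (\<lambda>y. u (chart_inv c y)) ?y * (vol_density A g c ?y * v (chart_inv c ?y) c $ i)"
   by (subst partial_eq[OF has_derivative_mult[OF differentiable_has_derivative[OF du] differentiable_has_derivative[OF dv]]])
    (simp add: partial_def)
  then show ?thesis using c by (simp add: mult.left_commute)
 qed
 moreover have "(\<Sum>i\<in>UNIV. partial i (\<lambda>y. u (chart_inv c y)) ?y * (vol_density A g c ?y * v x c $ i)) =
   vol_density A g c ?y * (\<Sum>i\<in>UNIV. v x c $ i * partial i (\<lambda>y. u (chart_inv c y)) ?y)"
  by (simp add: sum_distrib_left mult_ac)
 ultimately show ?thesis unfolding chart_div_def vderiv_eq[OF u v c] using vol_pos[OF c(1) y]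
  by (simp add: sum.distrib sum_distrib_left[symmetric] add_divide_distrib)
qed

end

section \<open>The divergence\<close>

context riemannian_volume begin

text \<open>Small coordinate balls have finite volume, because the density is bounded on their
  closures; finitely many of them cover \<open>K\<close>.\<close>

lemma compact_finite: "compact K ==> emeasure m K < \<infinity>"
proof -
 assume K: "compact K"
 have "\<exists>U. open U & x \<in> U & emeasure m U < \<infinity>" for x
 proof -
  obtain c where c: "c \<in> A" "x \<in> fst c" using ex_chart by blast
  obtain r where r: "0 < r" "cball (snd c x) r \<subseteq> snd c ` (fst c \<inter> UNIV)" using ex_cball_in_chart[OF c(1) open_UNIV] c by blast
  let ?L = "cball (snd c x) r" let ?U = "fst c \<inter> snd c -` ball (snd c x) r"
  have U: "open ?U" using cont_chart[OF c(1)] open_dom[OF c(1)] by (intro continuous_open_preimage) auto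
  have "compact (vol_density A g c ` ?L)"
   by (rule compact_continuous_image[OF continuous_on_subset[OF smooth_on_continuous_on[OF smooth_vol[OF c(1)]]]]) (use r in auto)
  then obtain B where B: "\<forall>t\<in>vol_density A g c ` ?L. norm t <= B" using compact_imp_bounded bounded_iff by blast
  have "emeasure m ?U = (\<integral>\<^sup>+ y\<in>snd c ` ?U. ennreal (vol_density A g c y) \<partial>lborel)"
   using volume c(1) U unfolding volume_measure_def by auto
  also have "... <= (\<integral>\<^sup>+ y. ennreal B * indicator ?L y \<partial>lborel)"
  proof (rule nn_integral_mono)
   fix y
   show "ennreal (vol_density A g c y) * indicator (snd c ` ?U) y <= ennreal B * indicator ?L y"
   proof (cases "y \<in> snd c ` ?U")
    case True
    then have "y \<in> ?L" by (auto simp: less_imp_le)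
    then have "vol_density A g c y <= B" using B by force
    then show ?thesis using \<open>y \<in> ?L\<close> by (simp add: indicator_def ennreal_leI)
   qed simp
  qed
  also have "... = ennreal B * emeasure lborel ?L" by (rule nn_integral_cmult_indicator) simp
  also have "... < \<infinity>" using emeasure_compact_finite[OF compact_cball, of "snd c x" r] by (simp add: ennreal_mult_less_top)
  finally show ?thesis using U c r(1) by (intro exI[of _ ?U]) auto
 qed
 then obtain U where U: "!!x. open (U x) & x \<in> U x & emeasure m (U x) < \<infinity>" by metis
 obtain T where T: "T \<subseteq> K" "finite T" "K \<subseteq> (\<Union>x\<in>T. U x)" using compactE_image[OF K, of K U] U by blast
 have "emeasure m K <= emeasure m (\<Union>x\<in>T. U x)" using T U by (intro emeasure_mono) (auto simp: sets_m)
 also have "... <= (\<Sum>x\<in>T. emeasure m (U x))" using T U by (intro emeasure_subadditive_finite) (auto simp: sets_m)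
 also have "... < \<infinity>" using U by (simp add: T(2))
 finally show ?thesis .
qed

lemma integrable_compact_continuous:
 assumes K: "compact K" "{x. h x ~= 0} \<subseteq> K" and h: "continuous_on UNIV h"
 shows "integrable m (h :: 'a => real)"
proof -
 obtain B where B: "!!x. \<bar>h x\<bar> <= B" using bounded_of_compact_support[OF K h] by blast
 have "integrable m (\<lambda>x. B * indicat_real K x)" using compact_finite[OF K(1)] K(1)
  by (intro integrable_mult_right integrable_real_indicator) (auto simp: sets_m compact_imp_closed)
 then show ?thesis
 proof (rule Bochner_Integration.integrable_bound)
  show "h \<in> borel_measurable m" using borel_measurable_continuous_onI[OF h] by (simp add: measurable_cong_sets[OF sets_m refl])
  show "AE x in m. norm (h x) <= norm (B * indicat_real K x)"
  proof (rule AE_I2)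
   fix x show "norm (h x) <= norm (B * indicat_real K x)" using K(2) B[of x] by (cases "h x = 0") (auto simp: indicator_def)
  qed
 qed
qed

text \<open>The volume density is strictly positive, so a null neighbourhood would give a nonempty
  open Lebesgue null set in a chart. This is what turns weak identities between continuous functions
  into pointwise ones.\<close>

lemma open_positive: "open U ==> x \<in> U ==> emeasure m U ~= 0"
proof
 assume U: "open U" "x \<in> U" and 0: "emeasure m U = 0"
 obtain c where c: "c \<in> A" "x \<in> fst c" using ex_chart by blast
 let ?S = "snd c ` (fst c \<inter> U)"
 have S: "open ?S" "?S ~= {}" using open_chart_image[OF c(1) U(1)] c U by auto
 have "emeasure m (fst c \<inter> U) = 0" using 0 emeasure_mono[of "fst c \<inter> U" U m] U(1) by (simp add: sets_m)
 moreover have "emeasure m (fst c \<inter> U) = (\<integral>\<^sup>+ y\<in>?S. ennreal (vol_density A g c y) \<partial>lborel)"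
  using volume c(1) U open_dom[OF c(1)] unfolding volume_measure_def by auto
 ultimately have 1: "(\<integral>\<^sup>+ y. ennreal (indicat_real ?S y * vol_density A g c y) \<partial>lborel) = 0"
  by (simp add: ennreal_mult'' ennreal_indicator mult.commute ennreal_mult')
 have "(\<lambda>y. indicat_real ?S y *\<^sub>R vol_density A g c y) \<in> borel_measurable borel" by (rule borel_measurable_continuous_on_indicator)
   (use S in \<open>auto intro!: continuous_on_subset[OF smooth_on_continuous_on[OF smooth_vol[OF c(1)]]]\<close>)
 then have "(\<lambda>y. ennreal (indicat_real ?S y * vol_density A g c y)) \<in> borel_measurable lborel"
  by (intro measurable_compose[OF _ measurable_ennreal]) simp
 with 1 have "AE y in lborel. ennreal (indicat_real ?S y * vol_density A g c y) = 0" using nn_integral_0_iff_AE by blast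
 then have "AE y in lborel. y \<notin> ?S"
 proof eventually_elim
  fix y assume "ennreal (indicat_real ?S y * vol_density A g c y) = 0"
  then show "y \<notin> ?S" using vol_pos[OF c(1), of y] by (auto simp: indicator_def ennreal_eq_0_iff)
 qed
 then have "?S \<in> null_sets lborel" using S(1) by (subst AE_iff_null_sets) auto
 then have "negligible ?S" by (simp add: negligible_iff_null_sets null_sets_completionI)
 then show False using open_not_negligible S by blast
qed

lemma continuous_on_supported:
 fixes h :: "'a => real"
 assumes W: "open W" and h: "continuous_on W h" and K: "compact K" "K \<subseteq> W" "{x. h x ~= 0} \<subseteq> K"
 shows "continuous_on UNIV h"
proof -
 have "continuous_on (- K) h" by (rule continuous_on_eq[of _ "\<lambda>_. 0"]) (use K in auto)
 then have "continuous_on (W \<union> - K) h" using h W K by (intro continuous_on_open_Un) (auto simp: compact_imp_closed)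
 moreover have "W \<union> - K = UNIV" using K by auto
 ultimately show ?thesis by simp
qed

text \<open>In coordinates, \<open>f\<close> times the volume density times the components of
  \<open>v\<close> is a smooth field of compact support, so its Euclidean divergence integrates to
  0. Expanding the products gives the two integrands, each multiplied by the volume density.\<close>

lemma chart_div_weak:
 assumes c: "c \<in> A" and f: "smooth_fun f" and K: "compact K" "K \<subseteq> fst c" "{x. f x ~= 0} \<subseteq> K" and v: "smooth_field v"
 shows "(LINT x|m. f x * chart_div c v x) = - (LINT x|m. vderiv f v x)"
proof -
 let ?O = "snd c ` fst c" and ?V = "vol_density A g c"
 have fc: "continuous_on UNIV f" by (rule smooth_fun_continuous[OF f])
 have c1: "continuous_on UNIV (\<lambda>x. f x * chart_div c v x)" by (rule continuous_on_supported[OF open_dom[OF c] _ K(1,2)])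
   (use K(3) in \<open>auto intro!: continuous_on_mult chart_div_continuous v c continuous_on_subset[OF fc]\<close>)
 have i1: "integrable m (\<lambda>x. f x * chart_div c v x)" by (rule integrable_compact_continuous[OF K(1) _ c1]) (use K(3) in auto)
 have z2: "vderiv f v x = 0" if "x \<notin> K" for x
 proof -
  obtain d where d: "d \<in> A" "x \<in> fst d" using ex_chart by blast
  have "partial i (\<lambda>y. f (chart_inv d y)) (snd d x) = partial i (\<lambda>_. 0) (snd d x)" for i
   by (rule partial_cong[OF _ open_chart_image[OF d(1), of "- K"]]) (use K d \<open>x \<notin> K\<close> in \<open>auto simp: compact_imp_closed\<close>)
  then have "partial i (\<lambda>y. f (chart_inv d y)) (snd d x) = 0" for i using partial_eq[OF has_derivative_const[of 0 "at (snd d x)"]] by simp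
  then show ?thesis unfolding vderiv_eq[OF f v d] by simp
 qed
 have c2: "continuous_on UNIV (vderiv f v)" by (rule smooth_fun_continuous[OF vderiv_smooth[OF f v]])
 have i2: "integrable m (vderiv f v)" by (rule integrable_compact_continuous[OF K(1) _ c2]) (use z2 in auto)
 \<comment> \<open>The extension by 0 is smooth on the whole coordinate space, so that
   \<open>integral_partial_eq_0\<close> applies.\<close>
 define W where "W i y = (if y \<in> ?O then f (chart_inv c y) * (?V y * v (chart_inv c y) c $ i) else 0)" for i y
 have cK: "compact (snd c ` K)" "snd c ` K \<subseteq> ?O" using compact_chart_image[OF c K(1,2)] K(2) by auto
 have fz: "f (chart_inv c y) = 0" if "y \<in> ?O" "y \<notin> snd c ` K" for y using that K(3) c by auto
 have Ws: "smooth_on UNIV (W i)" for i unfolding W_def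
  by (rule smooth_on_extend_zero[OF open_img[OF c] _ compact_imp_closed[OF cK(1)] cK(2)])
   (use fz in \<open>auto intro!: smooth_on_mult open_img c smooth_funD[OF f c] smooth_vol smooth_fieldD_nth[OF v c] simp del: inv_chart\<close>)
 have Wz: "{y. W i y ~= 0} \<subseteq> snd c ` K" for i using fz unfolding W_def by (auto split: if_splits)
 have dz: "partial i (W i) y = 0" if "y \<notin> snd c ` K" for i y by (rule partial_zero_outside[OF compact_imp_closed[OF cK(1)] Wz that])
 have Wi: "integrable lborel (partial i (W i))" for i
 proof -
  have ct: "continuous_on UNIV (partial i (W i))" by (rule smooth_on_continuous_on[OF smooth_on_partial[OF Ws]])
  have s: "{y. partial i (W i) y ~= 0} \<subseteq> snd c ` K" using dz by blast
  obtain B where "!!y. \<bar>partial i (W i) y\<bar> <= B" using bounded_of_compact_support[OF cK(1) s ct] by blast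
  then show ?thesis by (rule integrable_compact_support[OF cK(1) s borel_measurable_continuous_onI[OF ct]])
 qed
 have dW: "partial i (W i) y = f (chart_inv c y) * partial i (\<lambda>y. ?V y * v (chart_inv c y) c $ i) y +
   partial i (\<lambda>y. f (chart_inv c y)) y * (?V y * v (chart_inv c y) c $ i)" if y: "y \<in> ?O" for i y
 proof -
  have df: "(\<lambda>y. f (chart_inv c y)) differentiable (at y)" by (rule smooth_on_differentiable[OF smooth_funD[OF f c] y])
  have dv: "(\<lambda>y. ?V y * v (chart_inv c y) c $ i) differentiable (at y)"
   by (rule smooth_on_differentiable[OF smooth_on_mult[OF open_img[OF c] smooth_vol[OF c] smooth_fieldD_nth[OF v c]] y])
  have d: "((\<lambda>y. f (chart_inv c y) * (?V y * v (chart_inv c y) c $ i)) has_derivative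
   (\<lambda>h. f (chart_inv c y) * frechet_derivative (\<lambda>y. ?V y * v (chart_inv c y) c $ i) (at y) h +
    frechet_derivative (\<lambda>y. f (chart_inv c y)) (at y) h * (?V y * v (chart_inv c y) c $ i))) (at y)"
   by (rule has_derivative_mult[OF differentiable_has_derivative[OF df] differentiable_has_derivative[OF dv]])
  have "partial i (W i) y = partial i (\<lambda>y. f (chart_inv c y) * (?V y * v (chart_inv c y) c $ i)) y"
   by (rule partial_cong[OF _ open_img[OF c] y]) (use d in \<open>auto simp: W_def differentiable_def\<close>)
  then show ?thesis unfolding partial_eq[OF d] by (simp add: partial_def)
 qed
 have "(LINT x|m. f x * chart_div c v x) + (LINT x|m. vderiv f v x) = (LINT x|m. f x * chart_div c v x + vderiv f v x)"
  by (rule Bochner_Integration.integral_add[OF i1 i2, symmetric])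
 also have "... = (LINT y|lborel. indicat_real ?O y * (?V y * (f (chart_inv c y) * chart_div c v (chart_inv c y) + vderiv f v (chart_inv c y))))"
 proof (rule chart_integral(2)[OF c borel_measurable_continuous_onI[OF continuous_on_add[OF c1 c2]]])
  fix x assume "x \<notin> fst c"
  then have "x \<notin> K" "f x = 0" using K(2,3) by auto
  then show "f x * chart_div c v x + vderiv f v x = 0" by (simp add: z2)
 qed
 also have "... = (LINT y|lborel. (\<Sum>i\<in>UNIV. partial i (W i) y))"
 proof (rule Bochner_Integration.integral_cong[OF refl])
  fix y
  show "indicat_real ?O y * (?V y * (f (chart_inv c y) * chart_div c v (chart_inv c y) + vderiv f v (chart_inv c y))) = (\<Sum>i\<in>UNIV. partial i (W i) y)"
  proof (cases "y \<in> ?O")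
   case True
   have x: "chart_inv c y \<in> fst c" by (rule chart_inv_in[OF c True])
   show ?thesis using True vol_pos[OF c True] c unfolding chart_div_def vderiv_eq[OF f v c x] dW[OF True]
    by (simp add: sum.distrib sum_distrib_left sum_divide_distrib distrib_left mult_ac del: inv_chart)
  next
   case False
   then have "y \<notin> snd c ` K" using cK(2) by blast
   then show ?thesis using False by (simp add: dz)
  qed
 qed
 also have "... = (\<Sum>i\<in>UNIV. LINT y|lborel. partial i (W i) y)" by (rule Bochner_Integration.integral_sum[OF Wi])
 also have "... = 0"
  using integral_partial_eq_0[OF cK(1) Wz] smooth_on_differentiable[OF Ws] smooth_on_continuous_on[OF smooth_on_partial[OF Ws]] by simp
 finally show ?thesis by simp
qed

text \<open>Both coordinate expressions represent the adjoint of \<open>f \<mapsto> vderiv f v\<close>, so they agree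
 weakly on the overlap, and hence pointwise by continuity. This avoids transforming the
 derivative of the volume density.\<close>

lemma chart_div_unique:
 assumes v: "smooth_field v" and c: "c \<in> A" "d \<in> A" and x: "x \<in> fst c" "x \<in> fst d"
 shows "chart_div c v x = chart_div d v x"
proof (rule ccontr)
 assume n: "chart_div c v x ~= chart_div d v x"
 \<comment> \<open>The sign makes the difference of the two expressions positive at
   \<open>x\<close>, hence near \<open>x\<close>; a bump supported there detects it.\<close>
 define q where "q z = sgn (chart_div c v x - chart_div d v x) * (chart_div c v z - chart_div d v z)" for z
 let ?W = "fst c \<inter> fst d"
 have W: "open ?W" by (intro open_Int open_dom c)
 have qc: "continuous_on ?W q" unfolding q_def
  by (intro continuous_intros continuous_on_subset[OF chart_div_continuous[OF v c(1)]] continuous_on_subset[OF chart_div_continuous[OF v c(2)]]) auto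
 have qx: "0 < q x" unfolding q_def using n by (auto simp: sgn_if)
 let ?N = "?W \<inter> q -` {0<..}"
 have N: "open ?N" by (rule continuous_open_preimage[OF qc W]) simp
 obtain f K where f: "smooth_fun f" "\<forall>y. 0 <= f y & f y <= 1" "0 < f x" "compact K" "K \<subseteq> ?N" "{y. f y ~= 0} \<subseteq> K"
  using bump_exists[OF N, of x] x qx by auto
 have e: "(LINT z|m. f z * chart_div c v z) = (LINT z|m. f z * chart_div d v z)"
  using chart_div_weak[OF c(1) f(1,4) _ f(6) v] chart_div_weak[OF c(2) f(1,4) _ f(6) v] f(5) by auto
 have cc: "continuous_on UNIV (\<lambda>z. f z * chart_div e v z)" if "e \<in> A" "K \<subseteq> fst e" for e
  by (rule continuous_on_supported[OF open_dom[OF that(1)] _ f(4) that(2)])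
   (use f(6) in \<open>auto intro!: continuous_on_mult chart_div_continuous v that continuous_on_subset[OF smooth_fun_continuous[OF f(1)]]\<close>)
 have ii: "integrable m (\<lambda>z. f z * chart_div e v z)" if "e \<in> A" "K \<subseteq> fst e" for e
  by (rule integrable_compact_continuous[OF f(4) _ cc[OF that]]) (use f(6) in auto)
 have Kc: "K \<subseteq> fst c" "K \<subseteq> fst d" using f(5) by auto
 have fq: "f z * q z = sgn (chart_div c v x - chart_div d v x) * (f z * chart_div c v z - f z * chart_div d v z)" for z
  unfolding q_def by (simp add: algebra_simps)
 have fqc: "continuous_on UNIV (\<lambda>z. f z * q z)" unfolding fq by (intro continuous_intros cc c Kc)
 have fqi: "integrable m (\<lambda>z. f z * q z)" unfolding fq using ii[OF c(1) Kc(1)] ii[OF c(2) Kc(2)] by simp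
 have "(LINT z|m. f z * q z) = 0" unfolding fq using e ii[OF c(1) Kc(1)] ii[OF c(2) Kc(2)] by simp
 moreover have "0 <= f z * q z" for z
 proof (cases "f z = 0")
  case False
  then have "z \<in> ?N" using f(5,6) by blast
  then show ?thesis using f(2) by auto
 qed simp
 ultimately have "AE z in m. f z * q z = 0" using integral_nonneg_eq_0_iff_AE[OF fqi] by simp
 then have ae: "AE z in m. z \<notin> {z. 0 < f z * q z}" by eventually_elim auto
 have o: "open {z. 0 < f z * q z}" by (intro open_Collect_less fqc continuous_on_const)
 then have "{z. 0 < f z * q z} \<in> null_sets m" using ae by (subst AE_iff_null_sets) (auto simp: sets_m)
 then show False using open_positive[OF o, of x] f(3) qx by auto
qed

lemma divergence_eq:
 assumes v: "smooth_field v" and c: "c \<in> A" "x \<in> fst c"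
 shows "divergence A g v x = chart_div c v x"
proof -
 define d where "d = (SOME d. d \<in> A & x \<in> fst d)"
 have d: "d \<in> A" "x \<in> fst d" using someI_ex[of "\<lambda>d. d \<in> A & x \<in> fst d"] ex_chart[of x] unfolding d_def by blast+
 have "divergence A g v x = chart_div d v x" unfolding divergence_def chart_div_def Let_def d_def[symmetric] ..
 also have "... = chart_div c v x" by (rule chart_div_unique[OF v d(1) c(1) d(2) c(2)])
 finally show ?thesis .
qed

lemma divergence_smooth: "smooth_field v ==> smooth_fun (divergence A g v)" unfolding smooth_fun_def
proof
 fix c assume v: "smooth_field v" and c: "c \<in> A"
 show "smooth_on (snd c ` fst c) (\<lambda>y. divergence A g v (chart_inv c y))"
  by (rule smooth_on_cong[OF open_img[OF c] chart_div_smooth[OF v c]])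
   (use divergence_eq[OF v c chart_inv_in[OF c]] in \<open>auto simp del: inv_chart\<close>)
qed

lemma divergence_mult:
 assumes "smooth_fun u" "smooth_field v"
 shows "divergence A g (\<lambda>x d. u x *\<^sub>R v x d) x = u x * divergence A g v x + vderiv u v x"
proof -
 obtain c where c: "c \<in> A" "x \<in> fst c" using ex_chart by blast
 show ?thesis using divergence_eq[OF smooth_field_scale[OF assms] c] divergence_eq[OF assms(2) c] chart_div_mult[OF assms c] by simp
qed

lemma divergence_zero:
 assumes v: "smooth_field v" and K: "closed K" "{x. v x ~= (\<lambda>_. 0)} \<subseteq> K" "x \<notin> K"
 shows "divergence A g v x = 0"
proof -
 obtain c where c: "c \<in> A" "x \<in> fst c" using ex_chart by blast
 have "partial i (\<lambda>y. vol_density A g c y * v (chart_inv c y) c $ i) (snd c x) = partial i (\<lambda>_. 0) (snd c x)" for i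
 proof (rule partial_cong[OF _ open_chart_image[OF c(1), of "- K"]])
  show "0 = vol_density A g c y * v (chart_inv c y) c $ i" if y: "y \<in> snd c ` (fst c \<inter> - K)" for y
  proof -
   have "v (chart_inv c y) = (\<lambda>_. 0)" using y K c by auto
   then show ?thesis by simp
  qed
 qed (use K c in auto)
 then have "partial i (\<lambda>y. vol_density A g c y * v (chart_inv c y) c $ i) (snd c x) = 0" for i
  using partial_eq[OF has_derivative_const[of 0 "at (snd c x)"]] by simp
 then show ?thesis unfolding divergence_eq[OF v c] chart_div_def by simp
qed

end

section \<open>Weak gradients in coordinates\<close>

context riemannian_volume begin

text \<open>The covariant component, with the index lowered by the metric, and not the coordinate
  \<open>Y x c $ i\<close>. For a gradient these are the plain partial derivatives in the
  chart.\<close>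

definition comp :: "('a, 'n) chart => ('a => ('a, 'n) tangent) => 'n => real^'n => real" where
 "comp c Y i y = indicat_real (snd c ` fst c) y * g (chart_inv c y) (Y (chart_inv c y)) (coord_field A c i (chart_inv c y))"

lemma measurable_in_chart:
 assumes c: "c \<in> A" and h: "h \<in> borel_measurable (restrict_space borel (fst c))"
 shows "(\<lambda>y. indicat_real (snd c ` fst c) y * h (chart_inv c y)) \<in> borel_measurable borel"
proof -
 have "chart_inv c \<in> measurable (restrict_space borel (snd c ` fst c)) (restrict_space borel (fst c))"
  by (rule measurable_restrict_space2[OF _ measurable_chart_inv[OF c]]) (use chart_inv_in[OF c] in \<open>auto simp: space_restrict_space\<close>)
 from measurable_compose[OF this h]
 have "(\<lambda>y. h (chart_inv c y)) \<in> borel_measurable (restrict_space borel (snd c ` fst c))" .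
 then show ?thesis by (subst (asm) borel_measurable_restrict_space_iff) (use open_img[OF c] in auto)
qed

lemma continuous_gram: "c \<in> A ==> continuous_on (fst c) (\<lambda>x. gram A g c x $ i $ j)"
proof -
 assume c: "c \<in> A"
 have "continuous_on (fst c) (\<lambda>x. gram A g c (chart_inv c (snd c x)) $ i $ j)"
  by (rule continuous_on_chart_compose[OF c smooth_on_continuous_on[OF smooth_gram[OF c]]])
 then show ?thesis by (rule continuous_on_eq) (use c in simp)
qed

lemma measurable_coord_pairing:
 assumes Y: "!!x. Y x \<in> tangent_space A x" "(\<lambda>x. Y x c) \<in> borel_measurable borel" and c: "c \<in> A"
 shows "(\<lambda>x. g x (Y x) (coord_field A c i x)) \<in> borel_measurable (restrict_space borel (fst c))"
proof -
 have v: "(\<lambda>z :: real^'n. z $ j) \<in> borel_measurable borel" for j by (intro borel_measurable_continuous_onI continuous_intros)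
 have "(\<lambda>x. Y x c $ j) \<in> borel_measurable (restrict_space borel (fst c))" for j
  by (rule measurable_restrict_space1[OF measurable_compose[OF Y(2) v]])
 moreover have "(\<lambda>x. gram A g c x $ i $ j) \<in> borel_measurable (restrict_space borel (fst c))" for j
  by (rule borel_measurable_continuous_on_restrict[OF continuous_gram[OF c]])
 ultimately have "(\<lambda>x. \<Sum>j\<in>UNIV. Y x c $ j * gram A g c x $ i $ j) \<in> borel_measurable (restrict_space borel (fst c))"
  by (intro borel_measurable_sum borel_measurable_times)
 then show ?thesis by (rule measurable_cong[THEN iffD1, rotated]) (use g_coord_expand[OF Y(1) c] in \<open>simp add: space_restrict_space\<close>)
qed

lemma measurable_comp:
 assumes "!!x. Y x \<in> tangent_space A x" "(\<lambda>x. Y x c) \<in> borel_measurable borel" "c \<in> A"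
 shows "comp c Y i \<in> borel_measurable borel"
 unfolding comp_def by (rule measurable_in_chart[OF assms(3) measurable_coord_pairing[OF assms]])

lemma weak_gradientD:
 assumes "weak_gradient A g m f Z"
 shows "locally_integrable m f" "Z x \<in> tangent_space A x" "c \<in> A ==> (\<lambda>x. Z x c) \<in> borel_measurable borel"
  "locally_integrable m (\<lambda>x. sqrt (g x (Z x) (Z x)))"
  "v \<in> compact_vector_fields A ==> (LINT x|m. f x * divergence A g v x) = - (LINT x|m. g x (Z x) (v x))"
 using assms unfolding weak_gradient_def by blast+

lemma measurable_gradient_pairing:
 assumes Z: "weak_gradient A g m f Z" and v: "smooth_field v"
 shows "(\<lambda>x. g x (Z x) (v x)) \<in> borel_measurable borel"
proof (rule measurable_g)
 show "Z x \<in> tangent_space A x" "v x \<in> tangent_space A x" for x using weak_gradientD(2)[OF Z] smooth_fieldD(1)[OF v] .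
 show "(\<lambda>x. Z x c) \<in> borel_measurable (restrict_space borel (fst c))" if "c \<in> A" for c
  by (rule measurable_restrict_space1[OF weak_gradientD(3)[OF Z that]])
 show "(\<lambda>x. v x c) \<in> borel_measurable (restrict_space borel (fst c))" if c: "c \<in> A" for c
 proof (rule borel_measurable_continuous_on_restrict)
  have "continuous_on (fst c) (\<lambda>x. v (chart_inv c (snd c x)) c)"
   by (rule continuous_on_chart_compose[OF c smooth_on_continuous_on[OF smooth_fieldD(2)[OF v c]]])
  then show "continuous_on (fst c) (\<lambda>x. v x c)" by (rule continuous_on_eq) (use c in simp)
 qed
qed

text \<open>Test with the i-th coordinate field multiplied by \<open>\<psi>\<close> and divided by
  the volume density. Its divergence is \<open>partial i \<psi>\<close> divided by the density, so
  the density cancels on both sides and the Euclidean weak derivative remains.\<close>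

lemma weak_gradient_chart:
 assumes Z: "weak_gradient A g m f Z" and f: "f \<in> borel_measurable borel" and c: "c \<in> A"
  and \<psi>: "smooth_on UNIV \<psi>" and L: "compact L" "L \<subseteq> snd c ` fst c" "{y. \<psi> y ~= 0} \<subseteq> L"
 shows "(LINT y|lborel. (indicat_real (snd c ` fst c) y * f (chart_inv c y)) * partial i \<psi> y) =
  - (LINT y|lborel. comp c Z i y * \<psi> y)"
proof -
 let ?O = "snd c ` fst c" and ?V = "vol_density A g c"
 let ?a = "\<lambda>y. \<psi> y * (1 / ?V y)"
 have a: "smooth_on ?O ?a" by (intro smooth_on_mult smooth_on_subset[OF \<psi>] smooth_inverse_vol open_img c subset_UNIV)
 have z: "?a y = 0" if "y \<notin> L" for y using L(3) that by auto
 define X where "X = (\<lambda>x d. if x \<in> fst c then ?a (snd c x) *\<^sub>R coord_field A c i x d else 0)"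
 have X: "smooth_field X" and X0: "{x. X x ~= (\<lambda>_. 0)} \<subseteq> chart_inv c ` L" unfolding X_def using field_lift_smooth[OF c a L(1,2) z] by blast+
 have K: "compact (chart_inv c ` L)" by (rule compact_inv_image[OF c L(1,2)])
 have Xv: "X \<in> compact_vector_fields A" unfolding field_iff using X X0 K by blast
 have K0: "x \<notin> chart_inv c ` L" if "x \<notin> fst c" for x using that L(2) chart_inv_in[OF c] by auto
 have div: "divergence A g X x = partial i \<psi> (snd c x) / ?V (snd c x)" if x: "x \<in> fst c" for x
 proof -
  have y: "snd c x \<in> ?O" using x by simp
  have "partial j (\<lambda>y. ?V y * X (chart_inv c y) c $ j) (snd c x) = (if j = i then partial i \<psi> (snd c x) else 0)" for j
  proof -
   have e: "?V y * X (chart_inv c y) c $ j = (if j = i then \<psi> y else 0)" if "y \<in> ?O" for y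
    using vol_pos[OF c that] chart_inv_in[OF c that] c that by (simp add: X_def coord_field_self axis_def)
   have "partial j (\<lambda>y. ?V y * X (chart_inv c y) c $ j) (snd c x) = partial j (\<lambda>y. if j = i then \<psi> y else 0) (snd c x)"
   proof (rule partial_cong[OF _ open_img[OF c] y])
    show "(\<lambda>y. if j = i then \<psi> y else 0) differentiable at (snd c x)"
     using smooth_on_differentiable[OF \<psi>, of "snd c x"] by (cases "j = i") simp_all
   qed (use e in simp)
   then show ?thesis using partial_eq[OF has_derivative_const[of 0 "at (snd c x)"]] by auto
  qed
  then show ?thesis unfolding divergence_eq[OF X c x] chart_div_def by simp
 qed
 have div0: "divergence A g X x = 0" if "x \<notin> fst c" for x by (rule divergence_zero[OF X compact_imp_closed[OF K] X0 K0[OF that]])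
 have "(LINT x|m. f x * divergence A g X x) =
   (LINT y|lborel. indicat_real ?O y * (?V y * (f (chart_inv c y) * divergence A g X (chart_inv c y))))"
  by (rule chart_integral(2)[OF c]) (use div0 f smooth_fun_measurable[OF divergence_smooth[OF X]] in auto)
 also have "... = (LINT y|lborel. (indicat_real ?O y * f (chart_inv c y)) * partial i \<psi> y)"
 proof (rule Bochner_Integration.integral_cong[OF refl])
  fix y
  show "indicat_real ?O y * (?V y * (f (chart_inv c y) * divergence A g X (chart_inv c y))) = (indicat_real ?O y * f (chart_inv c y)) * partial i \<psi> y"
  proof (cases "y \<in> ?O")
   case True
   then show ?thesis using div[OF chart_inv_in[OF c True]] vol_pos[OF c True] c by simp
  qed simp
 qed
 finally have l: "(LINT x|m. f x * divergence A g X x) = (LINT y|lborel. (indicat_real ?O y * f (chart_inv c y)) * partial i \<psi> y)" .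
 have "(LINT x|m. g x (Z x) (X x)) = (LINT y|lborel. indicat_real ?O y * (?V y * g (chart_inv c y) (Z (chart_inv c y)) (X (chart_inv c y))))"
 proof (rule chart_integral(2)[OF c measurable_gradient_pairing[OF Z X]])
  fix x assume "x \<notin> fst c"
  then have "X x = (\<lambda>_. 0)" unfolding X_def by auto
  then show "g x (Z x) (X x) = 0" using g_zero[OF weak_gradientD(2)[OF Z]] g_sym[OF weak_gradientD(2)[OF Z] tangent_0] by simp
 qed
 also have "... = (LINT y|lborel. comp c Z i y * \<psi> y)"
 proof (rule Bochner_Integration.integral_cong[OF refl])
  fix y
  show "indicat_real ?O y * (?V y * g (chart_inv c y) (Z (chart_inv c y)) (X (chart_inv c y))) = comp c Z i y * \<psi> y"
  proof (cases "y \<in> ?O")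
   case True
   note x = chart_inv_in[OF c True]
   have "X (chart_inv c y) = (\<lambda>d. ?a y *\<^sub>R coord_field A c i (chart_inv c y) d)" unfolding X_def using x c True by simp
   then show ?thesis using g_scale_right[OF weak_gradientD(2)[OF Z] coord_field_in[OF c x], of "?a y"] vol_pos[OF c True] True
    by (simp add: comp_def)
  qed (simp add: comp_def)
 qed
 finally show ?thesis using weak_gradientD(5)[OF Z Xv] l by simp
qed

text \<open>On the manifold the integrand is \<open>k\<close> times \<open>b\<close> divided by the
  volume density, a factor bounded on the compact set; passing to coordinates multiplies by the
  density again.\<close>

lemma chart_locally_integrable:
 assumes c: "c \<in> A" and k: "k \<in> borel_measurable borel" "locally_integrable m k"
  and b: "continuous_on (snd c ` fst c) b" and L: "compact L" "L \<subseteq> snd c ` fst c"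
 shows "integrable lborel (\<lambda>y. indicat_real L y * (k (chart_inv c y) * b y))"
proof -
 let ?K = "chart_inv c ` L" and ?V = "vol_density A g c"
 have K: "compact ?K" "?K \<subseteq> fst c" using compact_inv_image[OF c L] chart_inv_in[OF c] L(2) by auto
 have Km: "?K \<in> sets borel" using K(1) by (simp add: compact_imp_closed)
 define w where "w x = indicat_real ?K x * (b (snd c x) * (1 / ?V (snd c x)))" for x
 have wc: "continuous_on (fst c) (\<lambda>x. b (snd c x) * (1 / ?V (snd c x)))" by (intro continuous_on_mult continuous_on_chart_compose[OF c b]
   continuous_on_chart_compose[OF c smooth_on_continuous_on[OF smooth_inverse_vol[OF c]]])
 have wm: "w \<in> borel_measurable borel" using borel_measurable_continuous_on_indicator[OF Km continuous_on_subset[OF wc K(2)]]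
  unfolding w_def by simp
 have "compact ((\<lambda>x. b (snd c x) * (1 / ?V (snd c x))) ` ?K)" by (rule compact_continuous_image[OF continuous_on_subset[OF wc K(2)] K(1)])
 then obtain B where B0: "\<forall>t\<in>(\<lambda>x. b (snd c x) * (1 / ?V (snd c x))) ` ?K. norm t <= B" using compact_imp_bounded bounded_iff by blast
 have B: "\<bar>w x\<bar> <= max 0 B" for x
 proof (cases "x \<in> ?K")
  case True
  have le: "\<bar>b (snd c x) * (1 / ?V (snd c x))\<bar> <= B" using bspec[OF B0 imageI[OF True]] unfolding real_norm_def .
  show ?thesis unfolding w_def indicator_simps(1)[OF True] mult_1 by (rule max.coboundedI2[OF le])
 next
  case False
  show ?thesis unfolding w_def indicator_simps(2)[OF False] mult_zero_left abs_zero by (rule max.cobounded1)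
 qed
 have ki: "integrable m (\<lambda>x. indicat_real ?K x * k x)" using k(2) K(1) unfolding locally_integrable_def set_integrable_def by simp
 have i: "integrable m (\<lambda>x. (indicat_real ?K x * k x) * w x)"
 proof (rule Bochner_Integration.integrable_bound[OF integrable_mult_left[of "max 0 B", OF ki]])
  show "(\<lambda>x. (indicat_real ?K x * k x) * w x) \<in> borel_measurable m" using k(1) wm Km by (simp add: measurable_cong_sets[OF sets_m refl])
  show "AE x in m. norm (indicat_real ?K x * k x * w x) <= norm (indicat_real ?K x * k x * max 0 B)"
   by (rule AE_I2) (use B in \<open>auto simp: abs_mult intro!: mult_left_mono\<close>)
 qed
 have "integrable lborel (\<lambda>y. indicat_real (snd c ` fst c) y * (?V y * ((indicat_real ?K (chart_inv c y) * k (chart_inv c y)) * w (chart_inv c y))))"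
  using chart_integral(1)[OF c, of "\<lambda>x. (indicat_real ?K x * k x) * w x"] i k(1) wm Km K(2) by (auto simp: indicator_def)
 moreover have "indicat_real (snd c ` fst c) y * (?V y * ((indicat_real ?K (chart_inv c y) * k (chart_inv c y)) * w (chart_inv c y))) =
   indicat_real L y * (k (chart_inv c y) * b y)" for y
 proof (cases "y \<in> snd c ` fst c")
  case True
  have "chart_inv c y \<in> ?K \<longleftrightarrow> y \<in> L"
  proof
   assume "chart_inv c y \<in> ?K"
   then obtain y' where y': "y' \<in> L" "chart_inv c y = chart_inv c y'" by blast
   then have "y = y'" using chart_inv[OF c True] chart_inv[OF c, of y'] L(2) by (metis subsetD)
   then show "y \<in> L" using y' by simp
  qed simp
  then show ?thesis using True vol_pos[OF c True] chart_inv[OF c True] by (simp add: w_def indicator_def)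
 next
  case False
  then show ?thesis using L(2) by (auto simp: indicator_def)
 qed
 ultimately show ?thesis by simp
qed

lemma g_abs_le:
 assumes "u \<in> tangent_space A x" "w \<in> tangent_space A x"
 shows "\<bar>g x u w\<bar> <= sqrt (g x u u) * sqrt (g x w w)" using real_sqrt_le_mono[OF g_Cauchy_Schwarz[OF assms]] by (simp add: real_sqrt_mult)

text \<open>By Cauchy-Schwarz the square of the component is at most g(Z, Z) times a diagonal entry
  of the Gram matrix, which is continuous.\<close>

lemma comp_square_integrable:
 assumes Z: "weak_gradient A g m f Z" and Z2: "locally_integrable m (\<lambda>x. g x (Z x) (Z x))"
  and ZZ: "(\<lambda>x. g x (Z x) (Z x)) \<in> borel_measurable borel"
  and c: "c \<in> A" and L: "compact L" "L \<subseteq> snd c ` fst c"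
 shows "integrable lborel (\<lambda>y. indicat_real L y * (comp c Z i y)\<^sup>2)"
proof (rule Bochner_Integration.integrable_bound[OF chart_locally_integrable[OF c ZZ Z2 _ L]])
 show "continuous_on (snd c ` fst c) (\<lambda>y. gram A g c (chart_inv c y) $ i $ i)" by (rule smooth_on_continuous_on[OF smooth_gram[OF c]])
 have [measurable]: "L \<in> sets borel" using L(1) by (simp add: compact_imp_closed)
 have [measurable]: "comp c Z i \<in> borel_measurable borel" by (rule measurable_comp[OF weak_gradientD(2)[OF Z] weak_gradientD(3)[OF Z c] c])
 show "(\<lambda>y. indicat_real L y * (comp c Z i y)\<^sup>2) \<in> borel_measurable lborel" by measurable
 show "AE y in lborel. norm (indicat_real L y * (comp c Z i y)\<^sup>2) <=
   norm (indicat_real L y * (g (chart_inv c y) (Z (chart_inv c y)) (Z (chart_inv c y)) * gram A g c (chart_inv c y) $ i $ i))"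
 proof (rule AE_I2)
  fix y
  show "norm (indicat_real L y * (comp c Z i y)\<^sup>2) <=
   norm (indicat_real L y * (g (chart_inv c y) (Z (chart_inv c y)) (Z (chart_inv c y)) * gram A g c (chart_inv c y) $ i $ i))"
  proof (cases "y \<in> L")
   case True
   then have "y \<in> snd c ` fst c" using L(2) by blast
   then show ?thesis using g_Cauchy_Schwarz[OF weak_gradientD(2)[OF Z] coord_field_in[OF c chart_inv_in[OF c]], of y i] True
    by (simp add: comp_def gram_def)
  qed simp
 qed
qed

lemma comp_integrable:
 assumes Z: "weak_gradient A g m f Z" and ZZ: "(\<lambda>x. g x (Z x) (Z x)) \<in> borel_measurable borel"
  and c: "c \<in> A" and L: "compact L" "L \<subseteq> snd c ` fst c"
 shows "integrable lborel (\<lambda>y. indicat_real L y * comp c Z i y)"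
proof (rule Bochner_Integration.integrable_bound[OF chart_locally_integrable[OF c _ weak_gradientD(4)[OF Z] _ L]])
 show "(\<lambda>x. sqrt (g x (Z x) (Z x))) \<in> borel_measurable borel" using ZZ by measurable
 show "continuous_on (snd c ` fst c) (\<lambda>y. sqrt (gram A g c (chart_inv c y) $ i $ i))"
  by (intro continuous_on_real_sqrt smooth_on_continuous_on[OF smooth_gram[OF c]])
 have [measurable]: "L \<in> sets borel" using L(1) by (simp add: compact_imp_closed)
 have [measurable]: "comp c Z i \<in> borel_measurable borel" by (rule measurable_comp[OF weak_gradientD(2)[OF Z] weak_gradientD(3)[OF Z c] c])
 show "(\<lambda>y. indicat_real L y * comp c Z i y) \<in> borel_measurable lborel" by measurable
 show "AE y in lborel. norm (indicat_real L y * comp c Z i y) <=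
   norm (indicat_real L y * (sqrt (g (chart_inv c y) (Z (chart_inv c y)) (Z (chart_inv c y))) * sqrt (gram A g c (chart_inv c y) $ i $ i)))"
 proof (rule AE_I2)
  fix y
  show "norm (indicat_real L y * comp c Z i y) <=
   norm (indicat_real L y * (sqrt (g (chart_inv c y) (Z (chart_inv c y)) (Z (chart_inv c y))) * sqrt (gram A g c (chart_inv c y) $ i $ i)))"
  proof (cases "y \<in> L")
   case True
   then have "y \<in> snd c ` fst c" using L(2) by blast
   then show ?thesis using g_abs_le[OF weak_gradientD(2)[OF Z] coord_field_in[OF c chart_inv_in[OF c]], of y i] True
    by (simp add: comp_def gram_def)
  qed simp
 qed
qed

text \<open>The functions \<open>W i\<close> are contravariant components of \<open>v\<close> with
  \<open>f\<close> and the volume density absorbed; against covariant components of \<open>Z\<close>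
  they pair without the metric. The factor \<open>k\<close> lets one statement serve both for
  \<open>R\<close> and for \<open>2 * u x\<close> times another gradient.\<close>

lemma gradient_pairing_chart:
 assumes Z: "weak_gradient A g m f0 Z" and c: "c \<in> A" and f: "smooth_fun f"
  and v: "smooth_field v" and K: "K \<subseteq> fst c" "{x. f x ~= 0} \<subseteq> K"
  and k: "k \<in> borel_measurable borel"
 defines "W \<equiv> \<lambda>i y. if y \<in> snd c ` fst c then f (chart_inv c y) * (vol_density A g c y * v (chart_inv c y) c $ i) else 0"
 shows "(LINT x|m. f x * (k x * g x (Z x) (v x))) = (LINT y|lborel. (\<Sum>i\<in>UNIV. (k (chart_inv c y) * comp c Z i y) * W i y))"
proof -
 let ?O = "snd c ` fst c" and ?V = "vol_density A g c"
 have "(\<lambda>x. f x * (k x * g x (Z x) (v x))) \<in> borel_measurable borel"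
  using smooth_fun_measurable[OF f] k measurable_gradient_pairing[OF Z v] by (intro borel_measurable_times)
 then have "(LINT x|m. f x * (k x * g x (Z x) (v x))) =
   (LINT y|lborel. indicat_real ?O y * (?V y * (f (chart_inv c y) * (k (chart_inv c y) * g (chart_inv c y) (Z (chart_inv c y)) (v (chart_inv c y))))))"
  by (rule chart_integral(2)[OF c]) (use K in auto)
 also have "... = (LINT y|lborel. (\<Sum>i\<in>UNIV. (k (chart_inv c y) * comp c Z i y) * W i y))"
 proof (rule Bochner_Integration.integral_cong[OF refl])
  fix y
  show "indicat_real ?O y * (?V y * (f (chart_inv c y) * (k (chart_inv c y) * g (chart_inv c y) (Z (chart_inv c y)) (v (chart_inv c y))))) =
   (\<Sum>i\<in>UNIV. (k (chart_inv c y) * comp c Z i y) * W i y)"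
  proof (cases "y \<in> ?O")
   case True
   show ?thesis unfolding g_expand_right[OF weak_gradientD(2)[OF Z] smooth_fieldD(1)[OF v] c chart_inv_in[OF c True]]
    using True by (simp add: W_def comp_def sum_distrib_left mult_ac)
  qed (simp add: comp_def)
 qed
 finally show ?thesis .
qed

text \<open>The two sides are compared through covariant components in one chart. There
  \<open>key\<close> identifies them, by the Euclidean product rule for the coordinate expression of
  \<open>u\<close> and the weak derivatives of its square.\<close>

lemma gradient_of_square_weak:
 assumes Z: "weak_gradient A g m u Z" and u: "u \<in> borel_measurable borel"
  and u2: "locally_integrable m (\<lambda>x. (u x)\<^sup>2)" and Z2: "locally_integrable m (\<lambda>x. g x (Z x) (Z x))"
  and R: "weak_gradient A g m (\<lambda>x. (u x)\<^sup>2) R"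
  and ZZ: "(\<lambda>x. g x (Z x) (Z x)) \<in> borel_measurable borel" and RR: "(\<lambda>x. g x (R x) (R x)) \<in> borel_measurable borel"
  and c: "c \<in> A" and f: "smooth_fun f" and v: "smooth_field v" and K: "compact K" "K \<subseteq> fst c" "{x. f x ~= 0} \<subseteq> K"
 shows "(LINT x|m. f x * g x (R x) (v x)) = (LINT x|m. f x * (2 * u x * g x (Z x) (v x)))"
proof -
 let ?O = "snd c ` fst c" and ?V = "vol_density A g c"
 define uc where "uc y = indicat_real ?O y * u (chart_inv c y)" for y
 have O: "open ?O" by (rule open_img[OF c])
 have [measurable]: "?O \<in> sets borel" using O by simp
 have uc: "uc \<in> borel_measurable borel" unfolding uc_def by (rule measurable_in_chart[OF c measurable_restrict_space1[OF u]])
 have zm: "comp c Z i \<in> borel_measurable borel" "comp c R i \<in> borel_measurable borel" for i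
  using measurable_comp[OF weak_gradientD(2)[OF Z] weak_gradientD(3)[OF Z c] c]
   measurable_comp[OF weak_gradientD(2)[OF R] weak_gradientD(3)[OF R c] c] by auto
 have usq: "integrable lborel (\<lambda>y. indicat_real L y * (uc y)\<^sup>2)" if L: "compact L" "L \<subseteq> ?O" for L
 proof -
  have u2m: "(\<lambda>x. (u x)\<^sup>2) \<in> borel_measurable borel" using u by measurable
  have "integrable lborel (\<lambda>y. indicat_real L y * ((u (chart_inv c y))\<^sup>2 * 1))"
   by (rule chart_locally_integrable[OF c u2m u2 continuous_on_const L])
  moreover have e: "indicat_real L y * ((u (chart_inv c y))\<^sup>2 * 1) = indicat_real L y * (uc y)\<^sup>2" for y
   using L(2) by (auto simp: uc_def indicator_def)
  ultimately show ?thesis unfolding e by simp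
 qed
 have key: "(LINT y|lborel. comp c R i y * \<psi> y) = (LINT y|lborel. 2 * (uc y * comp c Z i y) * \<psi> y)"
  if \<psi>: "smooth_on UNIV \<psi>" "compact L" "L \<subseteq> ?O" "{y. \<psi> y ~= 0} \<subseteq> L" for i \<psi> L
 proof -
  have "(LINT y|lborel. (uc y)\<^sup>2 * partial i \<psi> y) = - (LINT y|lborel. 2 * (uc y * comp c Z i y) * \<psi> y)"
  proof (rule weak_product_rule[OF O uc zm(1) _ _ \<psi>])
   show "integrable lborel (\<lambda>x. indicat_real K x * (uc x)\<^sup>2) & integrable lborel (\<lambda>x. indicat_real K x * (comp c Z i x)\<^sup>2)"
    if "compact K" "K \<subseteq> ?O" for K using usq[OF that] comp_square_integrable[OF Z Z2 ZZ c that] by blast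
   show "(LINT x|lborel. uc x * partial i \<psi> x) = - (LINT x|lborel. comp c Z i x * \<psi> x)"
    if "smooth_on UNIV \<psi>" "compact K" "K \<subseteq> ?O" "{x. \<psi> x ~= 0} \<subseteq> K" for \<psi> K unfolding uc_def by (rule weak_gradient_chart[OF Z u c that])
  qed
  moreover have "(LINT y|lborel. (indicat_real ?O y * (u (chart_inv c y))\<^sup>2) * partial i \<psi> y) = - (LINT y|lborel. comp c R i y * \<psi> y)"
   by (rule weak_gradient_chart[OF R _ c \<psi>]) (use u in measurable)
  moreover have "indicat_real ?O y * (u (chart_inv c y))\<^sup>2 = (uc y)\<^sup>2" for y by (simp add: uc_def indicator_def)
  ultimately show ?thesis by simp
 qed
 define W where "W i y = (if y \<in> ?O then f (chart_inv c y) * (?V y * v (chart_inv c y) c $ i) else 0)" for i y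
 have cK: "compact (snd c ` K)" "snd c ` K \<subseteq> ?O" using compact_chart_image[OF c K(1,2)] K(2) by auto
 have fz: "f (chart_inv c y) = 0" if "y \<in> ?O" "y \<notin> snd c ` K" for y using that K(3) c by auto
 have Ws: "smooth_on UNIV (W i)" for i unfolding W_def by (rule smooth_on_extend_zero[OF O _ compact_imp_closed[OF cK(1)] cK(2)])
   (use fz in \<open>auto intro!: smooth_on_mult open_img c smooth_funD[OF f c] smooth_vol smooth_fieldD_nth[OF v c] simp del: inv_chart\<close>)
 have Wz: "{y. W i y ~= 0} \<subseteq> snd c ` K" for i using fz unfolding W_def by (auto split: if_splits)
 have Wc: "continuous_on UNIV (W i)" for i by (rule smooth_on_continuous_on[OF Ws])
 have Wm: "W i \<in> borel_measurable borel" for i by (rule borel_measurable_continuous_onI[OF Wc])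
 have cKm: "snd c ` K \<in> sets borel" using cK(1) by (simp add: compact_imp_closed)
 let ?I = "\<lambda>y. indicat_real (snd c ` K) y"
 have Wint: "integrable lborel (\<lambda>y. h y * W i y)" if h: "h \<in> borel_measurable borel" "integrable lborel (\<lambda>y. ?I y * h y)" for h i
 proof -
  obtain B where B: "!!y. \<bar>W i y\<bar> <= B" "0 <= B" using bounded_of_compact_support[OF cK(1) Wz Wc] by blast
  show ?thesis
  proof (rule Bochner_Integration.integrable_bound[OF integrable_mult_left[of B, OF h(2)]])
   show "(\<lambda>y. h y * W i y) \<in> borel_measurable lborel" using h(1) Wm by simp
   show "AE y in lborel. norm (h y * W i y) <= norm (?I y * h y * B)"
   proof (rule AE_I2)
    fix y show "norm (h y * W i y) <= norm (?I y * h y * B)"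
    proof (cases "W i y = 0")
     case False
     then have "y \<in> snd c ` K" using Wz by blast
     then show ?thesis using B by (simp add: abs_mult mult_left_mono)
    qed simp
   qed
  qed
 qed
 have Ri: "integrable lborel (\<lambda>y. comp c R i y * W i y)" for i by (rule Wint[OF zm(2) comp_integrable[OF R RR c cK]])
 have uz: "integrable lborel (\<lambda>y. ?I y * (2 * (uc y * comp c Z i y)))" for i
 proof -
  have "integrable lborel (\<lambda>y. (?I y * uc y) * (?I y * comp c Z i y))"
  proof (rule integrable_mult_squares)
   show "(\<lambda>y. ?I y * uc y) \<in> borel_measurable lborel" "(\<lambda>y. ?I y * comp c Z i y) \<in> borel_measurable lborel"
    using cKm uc zm(1) by simp_all
   have "(?I y * t)\<^sup>2 = ?I y * t\<^sup>2" for y t by (simp add: indicator_def)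
   then show "integrable lborel (\<lambda>y. (?I y * uc y)\<^sup>2)" "integrable lborel (\<lambda>y. (?I y * comp c Z i y)\<^sup>2)"
    using usq[OF cK] comp_square_integrable[OF Z Z2 ZZ c cK] by simp_all
  qed
  then have "integrable lborel (\<lambda>y. 2 * ((?I y * uc y) * (?I y * comp c Z i y)))" by (rule integrable_mult_right)
  moreover have "2 * ((?I y * uc y) * (?I y * comp c Z i y)) =
   ?I y * (2 * (uc y * comp c Z i y))" for y by (simp add: indicator_def)
  ultimately show ?thesis by simp
 qed
 have Zi: "integrable lborel (\<lambda>y. 2 * (uc y * comp c Z i y) * W i y)" for i by (rule Wint[OF _ uz]) (use uc zm(1) in simp)
 have "(LINT x|m. f x * (1 * g x (R x) (v x))) = (LINT y|lborel. (\<Sum>i\<in>UNIV. (1 * comp c R i y) * W i y))"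
  unfolding W_def by (rule gradient_pairing_chart[OF R c f v K(2,3) borel_measurable_const])
 then have "(LINT x|m. f x * g x (R x) (v x)) = (\<Sum>i\<in>UNIV. LINT y|lborel. comp c R i y * W i y)"
  by (simp add: Bochner_Integration.integral_sum[OF Ri])
 also have "... = (\<Sum>i\<in>UNIV. LINT y|lborel. 2 * (uc y * comp c Z i y) * W i y)" by (rule sum.cong[OF refl]) (rule key[OF Ws cK Wz])
 also have "... = (LINT y|lborel. (\<Sum>i\<in>UNIV. 2 * (uc y * comp c Z i y) * W i y))" by (rule Bochner_Integration.integral_sum[OF Zi, symmetric])
 also have "... = (LINT y|lborel. (\<Sum>i\<in>UNIV. ((2 * u (chart_inv c y)) * comp c Z i y) * W i y))"
  by (intro Bochner_Integration.integral_cong refl sum.cong) (auto simp: uc_def W_def)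
 also have "... = (LINT x|m. f x * ((2 * u x) * g x (Z x) (v x)))"
  unfolding W_def by (rule gradient_pairing_chart[OF Z c f v K(2,3), symmetric]) (use u in simp)
 finally show ?thesis by simp
qed

text \<open>The fundamental lemma of the calculus of variations. If \<open>e\<close> in
  \<open>base\<close> is supported in a compact part of a chart, then \<open>e x * q x\<close> is
  integrable and orthogonal to a multiplicative generating class, hence zero almost everywhere. The
  positivity sets of countably many such \<open>e\<close> cover the manifold.\<close>

lemma AE_zero_of_weak_zero:
 assumes q: "q \<in> borel_measurable borel" "locally_integrable m q"
  and weak: "!!c f K. c \<in> A ==> smooth_fun f ==> compact K ==> K \<subseteq> fst c ==> {x. f x ~= 0} \<subseteq> K ==> (LINT x|m. f x * q x) = 0"
 shows "AE x in m. q x = 0"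
proof -
 interpret test_cone pos_tests by (rule test_cone_pos_tests)
 define G where "G = {e \<in> base. \<exists>c\<in>A. \<exists>K. compact K & K \<subseteq> fst c & {x. e x ~= 0} \<subseteq> K}"
 have qm: "q \<in> borel_measurable m" using q(1) by (simp add: measurable_cong_sets[OF sets_m refl])
 have "AE x in m. 0 < e x --> q x = 0" if eG: "e \<in> G" for e
 proof -
  obtain c K where c: "c \<in> A" "compact K" "K \<subseteq> fst c" "{x. e x ~= 0} \<subseteq> K" using eG unfolding G_def by blast
  have eD: "e \<in> pos_tests" using eG base_subset unfolding G_def by blast
  have e1: "e x <= 1" for x using eG base_le_1 unfolding G_def by blast
  have em: "e \<in> borel_measurable m" using measurable_test[OF eD] by (simp add: measurable_cong_sets[OF sets_m refl])
  have e0: "0 <= e x" for x by (rule nonneg[OF eD])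
  have iK: "integrable m (\<lambda>x. indicat_real K x * q x)" using q(2) c(2) unfolding locally_integrable_def set_integrable_def by simp
  have ez: "e x = 0" if "x \<notin> K" for x using c(4) that by blast
  let ?C = "{f \<in> pos_tests. \<forall>x. f x <= 1} \<union> {\<lambda>_. 1}"
  have "AE x in m. e x * q x = 0"
  proof (rule AE_zero_multiplicative[where C="?C"])
   show "integrable m (\<lambda>x. e x * q x)"
   proof (rule Bochner_Integration.integrable_bound[OF iK])
    show "AE x in m. norm (e x * q x) <= norm (indicat_real K x * q x)"
     using e0 e1 ez by (intro AE_I2) (auto simp: abs_mult mult_left_le_one_le split: split_indicator)
   qed (use em qm in simp)
   show "(\<lambda>x. x) \<in> measurable S m" if S: "space S = space m" "!!c. c \<in> ?C ==> c \<in> borel_measurable S" for S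
   proof (rule measurable_sigma_sets[where \<Omega>=UNIV and A="{{y. 0 < f y} | f. f \<in> pos_tests & (\<forall>y. f y <= 1)}"])
    show "sets m = sigma_sets UNIV {{y. 0 < f y} | f. f \<in> pos_tests & (\<forall>y. f y <= 1)}" by (simp add: sets_m sets_borel_eq)
    fix X assume "X \<in> {{y. 0 < f y} | f. f \<in> pos_tests & (\<forall>y. f y <= 1)}"
    then obtain f where f: "f \<in> pos_tests" "\<forall>y. f y <= 1" "X = {y. 0 < f y}" by auto
    then have "f \<in> borel_measurable S" by (intro S(2)) simp
    then show "(\<lambda>x. x) -` X \<inter> space S \<in> sets S" unfolding borel_measurable_iff_greater f(3) by (simp add: vimage_def S(1))
   qed auto
   show "f \<in> borel_measurable m" if "f \<in> ?C" for f
   proof -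
    have "f \<in> borel_measurable borel" using that measurable_test by auto
    then show ?thesis by (simp add: measurable_cong_sets[OF sets_m refl])
   qed
   show "\<exists>k\<in>?C. \<forall>x\<in>space m. k x = f x * h x" if "f \<in> ?C" "h \<in> ?C" for f h
    by (rule bexI[of _ "\<lambda>x. f x * h x"]) (use that mult nonneg in \<open>auto intro!: mult_le_one\<close>)
   show "(LINT x|m. f x * (e x * q x)) = 0" if f: "f \<in> ?C" for f
   proof -
    have "smooth_fun f" using f by (auto simp: pos_tests_iff smooth_fun_const)
    from weak[OF c(1) smooth_fun_mult[OF this, of e] c(2,3)] show ?thesis using c(4) eD by (auto simp: pos_tests_iff mult.assoc)
   qed
  qed (use nonneg in auto)
  then show ?thesis by eventually_elim auto
 qed
 moreover have "countable G" unfolding G_def using countable_base by (auto intro: countable_subset)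
 ultimately have "AE x in m. \<forall>e\<in>G. 0 < e x --> q x = 0" by (subst AE_ball_countable) auto
 then show ?thesis
 proof eventually_elim
  fix x assume all: "\<forall>e\<in>G. 0 < e x --> q x = 0"
  obtain c where c: "c \<in> A" "x \<in> fst c" using ex_chart by blast
  obtain f K where f: "smooth_fun f" "\<forall>y. 0 <= f y & f y <= 1" "0 < f x" "compact K" "K \<subseteq> fst c" "{y. f y ~= 0} \<subseteq> K"
   using bump_exists[OF open_dom[OF c(1)] c(2)] by blast
  have "open {y. 0 < f y}" by (intro open_Collect_less smooth_fun_continuous[OF f(1)] continuous_on_const)
  then obtain e where e: "e \<in> base" "0 < e x" "{y. e y ~= 0} \<subseteq> {y. 0 < f y}" using base_ex[of _ x] f(3) by blast
  have "{y. 0 < f y} \<subseteq> {y. f y ~= 0}" by auto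
  then have "{y. e y ~= 0} \<subseteq> K" using e(3) f(6) by blast
  then have "e \<in> G" unfolding G_def using e(1) c(1) f(4,5) by blast
  then show "q x = 0" using all e(2) by blast
 qed
qed

end

section \<open>The logarithmic derivative\<close>

locale weighted_manifold = riemannian_volume A g m
 for A :: "('a::{second_countable_topology,t2_space}, 'n::finite) chart set" and g :: "('a, 'n) metric"
  and m :: "'a measure" +
 fixes \<rho> :: "'a => real" and R :: "'a => ('a, 'n) tangent" and v :: "'a => ('a, 'n) tangent"
 assumes \<rho>_pos: "AE x in m. 0 < \<rho> x"
  and \<rho>_sobolev: "(\<lambda>x. sqrt (\<rho> x)) \<in> local_sobolev_1_2 A g m"
  and \<rho>_grad: "weak_gradient A g m \<rho> R"
  and v_field: "v \<in> compact_vector_fields A"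
begin

definition u where "u x = sqrt (\<rho> x)"

definition K where "K = closure {x. v x ~= (\<lambda>_. 0)}"

lemma compact_K: "compact K" using v_field unfolding K_def compact_vector_fields_def by simp

lemma v_smooth: "smooth_field v" using v_field field_iff by blast

lemma v_supp: "{x. v x ~= (\<lambda>_. 0)} \<subseteq> K" unfolding K_def by (rule closure_subset)

lemma v_zero: "x \<notin> K ==> v x = (\<lambda>_. 0)"
proof (rule ccontr)
 assume "x \<notin> K" "v x ~= (\<lambda>_. 0)"
 then show False using subsetD[OF v_supp, of x] by simp
qed

lemma measurable_u: "u \<in> borel_measurable borel" using \<rho>_sobolev unfolding local_sobolev_1_2_def u_def[abs_def] by simp

text \<open>The real square root is odd, so this form also holds where \<open>\<rho>\<close> is
  negative. Measurability of \<open>\<rho>\<close> thus follows from that of its root without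
  discarding a null set.\<close>

lemma rho_eq: "\<rho> x = u x * \<bar>u x\<bar>"
proof (cases "0 <= \<rho> x")
 case False
 have "u x = - sqrt (- \<rho> x)" by (simp add: u_def real_sqrt_minus)
 moreover have "sqrt (- \<rho> x) * sqrt (- \<rho> x) = - \<rho> x" using False by simp
 ultimately show ?thesis using False by simp
qed (simp add: u_def)

lemma measurable_rho: "\<rho> \<in> borel_measurable borel"
proof -
 have "(\<lambda>x. u x * \<bar>u x\<bar>) \<in> borel_measurable borel" using measurable_u by measurable
 then show ?thesis by (rule measurable_cong[THEN iffD1, rotated]) (simp add: rho_eq[symmetric])
qed

lemma AE_rho_square: "AE x in m. \<rho> x = (u x)\<^sup>2" using \<rho>_pos by eventually_elim (simp add: u_def)

lemma measurable_m: "f \<in> borel_measurable borel ==> f \<in> borel_measurable m" for f :: "'a => real"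
 by (simp add: measurable_cong_sets[OF sets_m refl])

text \<open>\<open>\<rho>\<close> equals the square of \<open>u\<close> only almost everywhere, but
  the weak gradient relation involves the function through integrals alone and passes over.\<close>

lemma square_gradient: "weak_gradient A g m (\<lambda>x. (u x)\<^sup>2) R"
proof -
 have l: "locally_integrable m (\<lambda>x. (u x)\<^sup>2)" using \<rho>_sobolev unfolding local_sobolev_1_2_def u_def by simp
 have "(LINT x|m. (u x)\<^sup>2 * divergence A g w x) = - (LINT x|m. g x (R x) (w x))" if w: "w \<in> compact_vector_fields A" for w
 proof -
  have dm: "divergence A g w \<in> borel_measurable borel" using w field_iff smooth_fun_measurable[OF divergence_smooth] by blast
  have "(LINT x|m. (u x)\<^sup>2 * divergence A g w x) = (LINT x|m. \<rho> x * divergence A g w x)" by (rule integral_cong_AE)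
    (use AE_rho_square measurable_m[OF dm] measurable_m[OF measurable_u] measurable_m[OF measurable_rho] in \<open>auto elim!: eventually_mono\<close>)
  then show ?thesis using weak_gradientD(5)[OF \<rho>_grad w] by simp
 qed
 then show ?thesis using \<rho>_grad l unfolding weak_gradient_def by blast
qed

lemma measurable_gradient_norm:
 assumes "weak_gradient A g m f Z"
 shows "(\<lambda>x. g x (Z x) (Z x)) \<in> borel_measurable borel"
 by (rule measurable_g) (use weak_gradientD(2,3)[OF assms] measurable_restrict_space1 in blast)+

lemma continuous_g_field: "smooth_field w ==> continuous_on UNIV (\<lambda>x. g x (w x) (w x))"
proof (rule continuous_on_charts)
 fix c assume w: "smooth_field w" and c: "c \<in> A"
 have "continuous_on (snd c ` fst c) (\<lambda>y. \<Sum>i\<in>UNIV. \<Sum>j\<in>UNIV. w (chart_inv c y) c $ i * (w (chart_inv c y) c $ j * gram A g c (chart_inv c y) $ i $ j))"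
  by (intro continuous_on_sum continuous_on_mult smooth_on_continuous_on[OF smooth_fieldD_nth[OF w c]] smooth_on_continuous_on[OF smooth_gram[OF c]])
 then show "continuous_on (snd c ` fst c) (\<lambda>y. g (chart_inv c y) (w (chart_inv c y)) (w (chart_inv c y)))" by (rule continuous_on_eq)
   (use g_expand[OF smooth_fieldD(1)[OF w] smooth_fieldD(1)[OF w] c chart_inv_in[OF c]] in simp)
qed

lemma bounded_on_compact:
 fixes h :: "'a => real"
 assumes "continuous_on UNIV h" "compact L"
 shows "\<exists>B\<ge>0. \<forall>x\<in>L. \<bar>h x\<bar> <= B"
proof -
 have "compact (h ` L)" by (rule compact_continuous_image[OF continuous_on_subset[OF assms(1)] assms(2)]) simp
 then obtain B where "\<forall>y\<in>h ` L. norm y <= B" using compact_imp_bounded bounded_iff by blast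
 then have "\<forall>x\<in>L. \<bar>h x\<bar> <= max 0 B" by (auto intro: max.coboundedI2)
 then show ?thesis by (intro exI[of _ "max 0 B"]) simp
qed

lemma integrable_on_compact:
 assumes k: "locally_integrable m k" and L: "compact L" and h: "h \<in> borel_measurable borel" and B: "0 <= B"
  and le: "!!x. x \<in> L ==> \<bar>h x\<bar> <= B * \<bar>k x\<bar>" and z: "!!x. x \<notin> L ==> h x = 0"
 shows "integrable m h"
proof -
 have "integrable m (\<lambda>x. indicat_real L x * k x)" using k L unfolding locally_integrable_def set_integrable_def by simp
 then show ?thesis
 proof (rule Bochner_Integration.integrable_bound[OF integrable_mult_right[of B]])
  show "AE x in m. norm (h x) <= norm (B * (indicat_real L x * k x))"
  proof (rule AE_I2)
   fix x show "norm (h x) <= norm (B * (indicat_real L x * k x))" using le[of x] z[of x] B by (cases "x \<in> L") (simp_all add: abs_mult)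
  qed
 qed (rule measurable_m[OF h])
qed

lemma integrable_gradient_pairing:
 assumes w: "smooth_field w" and f: "f \<in> borel_measurable borel" and L: "compact L"
  and B: "0 <= B" "!!x. x \<in> L ==> \<bar>f x\<bar> <= B" and z: "!!x. x \<notin> L ==> f x * g x (R x) (w x) = 0"
 shows "integrable m (\<lambda>x. f x * g x (R x) (w x))"
proof -
 note RT = weak_gradientD(2)[OF \<rho>_grad]
 obtain C where C: "0 <= C" "!!x. x \<in> L ==> \<bar>g x (w x) (w x)\<bar> <= C" using bounded_on_compact[OF continuous_g_field[OF w] L] by blast
 show ?thesis
 proof (rule integrable_on_compact[OF weak_gradientD(4)[OF \<rho>_grad] L])
  show "(\<lambda>x. f x * g x (R x) (w x)) \<in> borel_measurable borel" using f measurable_gradient_pairing[OF \<rho>_grad w] by measurable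
  show "0 <= B * sqrt C" using B C by simp
  show "\<bar>f x * g x (R x) (w x)\<bar> <= B * sqrt C * \<bar>sqrt (g x (R x) (R x))\<bar>" if "x \<in> L" for x
  proof -
   have "\<bar>g x (R x) (w x)\<bar> <= sqrt (g x (R x) (R x)) * sqrt (g x (w x) (w x))" by (rule g_abs_le[OF RT smooth_fieldD(1)[OF w]])
   also have "... <= sqrt (g x (R x) (R x)) * sqrt C" using C(2)[OF that] g_nonneg[OF RT] by (intro mult_left_mono real_sqrt_le_mono) auto
   finally have "\<bar>f x\<bar> * \<bar>g x (R x) (w x)\<bar> <= B * (sqrt (g x (R x) (R x)) * sqrt C)" using B(2)[OF that] B(1) by (intro mult_mono) auto
   then show ?thesis using g_nonneg[OF RT, of x] by (simp add: abs_mult mult_ac)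
  qed
 qed (rule z)
qed

text \<open>The identity holds weakly inside charts, and \<open>AE_zero_of_weak_zero\<close> makes
  it pointwise. Integrability rests on 2 |u g(Z, w)| <= u^2 + g(Z, Z) g(w, w).\<close>

lemma gradient_of_square:
 assumes Z: "weak_gradient A g m u Z" and Z2: "locally_integrable m (\<lambda>x. g x (Z x) (Z x))" and w: "smooth_field w"
 shows "AE x in m. g x (R x) (w x) = 2 * u x * g x (Z x) (w x)"
proof -
 have u2: "locally_integrable m (\<lambda>x. (u x)\<^sup>2)" using \<rho>_sobolev unfolding local_sobolev_1_2_def u_def by simp
 note mu = measurable_u
 have mR: "(\<lambda>x. g x (R x) (w x)) \<in> borel_measurable borel" by (rule measurable_gradient_pairing[OF \<rho>_grad w])
 have mZ: "(\<lambda>x. g x (Z x) (w x)) \<in> borel_measurable borel" by (rule measurable_gradient_pairing[OF Z w])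
 have ZZ: "(\<lambda>x. g x (Z x) (Z x)) \<in> borel_measurable borel" and RR: "(\<lambda>x. g x (R x) (R x)) \<in> borel_measurable borel"
  by (rule measurable_gradient_norm[OF Z], rule measurable_gradient_norm[OF \<rho>_grad])
 have tw: "w x \<in> tangent_space A x" for x by (rule smooth_fieldD(1)[OF w])
 have iR: "integrable m (\<lambda>x. f x * g x (R x) (w x))"
  and iZ: "integrable m (\<lambda>x. f x * (2 * u x * g x (Z x) (w x)))"
  if f: "f \<in> borel_measurable borel" "!!x. \<bar>f x\<bar> <= B" "!!x. x \<notin> L ==> f x = 0" "compact L" for f B L
 proof -
  have B: "0 <= B" using f(2)[of undefined] by linarith
  obtain C where C: "0 <= C" "!!x. x \<in> L ==> \<bar>g x (w x) (w x)\<bar> <= C" using bounded_on_compact[OF continuous_g_field[OF w] f(4)] by blast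
  show "integrable m (\<lambda>x. f x * g x (R x) (w x))" by (rule integrable_gradient_pairing[OF w f(1,4) B f(2)]) (simp add: f(3))
  have "locally_integrable m (\<lambda>x. (u x)\<^sup>2 + g x (Z x) (Z x))"
   using u2 Z2 unfolding locally_integrable_def by (auto intro: set_integral_add)
  then show "integrable m (\<lambda>x. f x * (2 * u x * g x (Z x) (w x)))"
  proof (rule integrable_on_compact[OF _ f(4)])
   show "(\<lambda>x. f x * (2 * u x * g x (Z x) (w x))) \<in> borel_measurable borel" using f(1) mu mZ by measurable
   show "0 <= B * (1 + C)" using B C by simp
   show "\<bar>f x * (2 * u x * g x (Z x) (w x))\<bar> <= B * (1 + C) * \<bar>(u x)\<^sup>2 + g x (Z x) (Z x)\<bar>" if x: "x \<in> L" for x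
   proof -
    have z0: "0 <= g x (Z x) (Z x)" by (rule g_nonneg[OF weak_gradientD(2)[OF Z]])
    have "2 * (\<bar>u x\<bar> * \<bar>g x (Z x) (w x)\<bar>) <= (u x)\<^sup>2 + (g x (Z x) (w x))\<^sup>2"
     using zero_le_power2[of "\<bar>u x\<bar> - \<bar>g x (Z x) (w x)\<bar>"] by (simp add: power2_eq_square algebra_simps)
    also have "(g x (Z x) (w x))\<^sup>2 <= g x (Z x) (Z x) * g x (w x) (w x)" by (rule g_Cauchy_Schwarz[OF weak_gradientD(2)[OF Z] tw])
    also have "... <= g x (Z x) (Z x) * C" using C(2)[OF x] z0 by (intro mult_left_mono) auto
    also have "(u x)\<^sup>2 + g x (Z x) (Z x) * C <= (1 + C) * ((u x)\<^sup>2 + g x (Z x) (Z x))"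
    proof -
     have "0 <= C * (u x)\<^sup>2" using C(1) by simp
     then show ?thesis using z0 by (simp add: algebra_simps)
    qed
    finally have "\<bar>2 * u x * g x (Z x) (w x)\<bar> <= (1 + C) * ((u x)\<^sup>2 + g x (Z x) (Z x))" by (simp add: abs_mult)
    then have "\<bar>f x\<bar> * \<bar>2 * u x * g x (Z x) (w x)\<bar> <= B * ((1 + C) * ((u x)\<^sup>2 + g x (Z x) (Z x)))"
     using f(2)[of x] B by (intro mult_mono) auto
    then show ?thesis using z0 by (simp add: abs_mult mult.assoc)
   qed
  qed (simp add: f(3))
 qed
 let ?q = "\<lambda>x. g x (R x) (w x) - 2 * u x * g x (Z x) (w x)"
 have "AE x in m. ?q x = 0"
 proof (rule AE_zero_of_weak_zero)
  show "?q \<in> borel_measurable borel" using mR mZ mu by measurable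
  show "locally_integrable m ?q" unfolding locally_integrable_def set_integrable_def
  proof (intro allI impI)
   fix L :: "'a set" assume L: "compact L"
   then have Lm: "indicat_real L \<in> borel_measurable borel" by (simp add: compact_imp_closed)
   have "integrable m (\<lambda>x. indicat_real L x * g x (R x) (w x) - indicat_real L x * (2 * u x * g x (Z x) (w x)))"
    by (intro Bochner_Integration.integrable_diff iR[OF Lm, of 1 L] iZ[OF Lm, of 1 L] L) (auto simp: indicator_def)
   then show "integrable m (\<lambda>x. indicat_real L x *\<^sub>R ?q x)" by (simp add: right_diff_distrib)
  qed
  fix c f L assume c: "c \<in> A" and f: "smooth_fun f" and L: "compact L" "L \<subseteq> fst c" "{x. f x ~= 0} \<subseteq> L"
  obtain B where B: "!!x. \<bar>f x\<bar> <= B" using bounded_of_compact_support[OF L(1,3) smooth_fun_continuous[OF f]] by blast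
  have fz: "f x = 0" if "x \<notin> L" for x using L(3) that by blast
  have "(LINT x|m. f x * ?q x) = (LINT x|m. f x * g x (R x) (w x) - f x * (2 * u x * g x (Z x) (w x)))" by (simp add: right_diff_distrib)
  also have "... = (LINT x|m. f x * g x (R x) (w x)) - (LINT x|m. f x * (2 * u x * g x (Z x) (w x)))"
   by (rule Bochner_Integration.integral_diff)
    (use iR[OF smooth_fun_measurable[OF f] B fz L(1)] iZ[OF smooth_fun_measurable[OF f] B fz L(1)] in blast)+
  also have "... = 0" using gradient_of_square_weak[OF Z mu u2 Z2 square_gradient ZZ RR c f w L] by simp
  finally show "(LINT x|m. f x * ?q x) = 0" .
 qed
 then show ?thesis by eventually_elim simp
qed

definition \<sigma> where "\<sigma> = density m (\<lambda>x. ennreal (\<rho> x))"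

definition \<beta> where "\<beta> = log_derivative A g \<rho> R v"

text \<open>Division by zero yields 0, in agreement with the convention in
  \<open>log_gradient\<close>, so the formula holds without a case distinction.\<close>

lemma beta_eq: "\<beta> x = g x (R x) (v x) / \<rho> x + divergence A g v x"
proof -
 have R: "R x \<in> tangent_space A x" by (rule weak_gradientD(2)[OF \<rho>_grad])
 have v: "v x \<in> tangent_space A x" by (rule smooth_fieldD(1)[OF v_smooth])
 show ?thesis unfolding \<beta>_def log_derivative_def log_gradient_def
  using g_scale[OF R v, of "1 / \<rho> x"] g_zero[OF v] by (simp add: inverse_eq_divide)
qed

lemma measurable_div: "divergence A g v \<in> borel_measurable borel" by (rule smooth_fun_measurable[OF divergence_smooth[OF v_smooth]])

lemma measurable_beta: "\<beta> \<in> borel_measurable borel"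
proof -
 have "(\<lambda>x. g x (R x) (v x) / \<rho> x + divergence A g v x) \<in> borel_measurable borel"
  using measurable_gradient_pairing[OF \<rho>_grad v_smooth] measurable_rho measurable_div by measurable
 then show ?thesis by (rule measurable_cong[THEN iffD1, rotated]) (simp add: beta_eq)
qed

lemma div_zero: "x \<notin> K ==> divergence A g v x = 0" by (rule divergence_zero[OF v_smooth compact_imp_closed[OF compact_K] v_supp])

lemma gR_zero: "x \<notin> K ==> g x (R x) (v x) = 0"
 using v_zero[of x] g_sym[OF weak_gradientD(2)[OF \<rho>_grad] tangent_0, of x] g_zero[OF weak_gradientD(2)[OF \<rho>_grad], of x] by simp

lemma beta_zero: "x \<notin> K ==> \<beta> x = 0" unfolding beta_eq by (simp add: div_zero gR_zero)

lemma sets_sigma: "sets \<sigma> = sets borel" unfolding \<sigma>_def by (simp add: sets_m)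

lemma integral_sigma:
 assumes "f \<in> borel_measurable borel"
 shows "integrable \<sigma> f \<longleftrightarrow> integrable m (\<lambda>x. \<rho> x * f x)" "(LINT x|\<sigma>. f x) = (LINT x|m. \<rho> x * f x)"
proof -
 have p: "AE x in m. 0 <= \<rho> x" using \<rho>_pos by eventually_elim simp
 show "integrable \<sigma> f \<longleftrightarrow> integrable m (\<lambda>x. \<rho> x * f x)" "(LINT x|\<sigma>. f x) = (LINT x|m. \<rho> x * f x)"
  unfolding \<sigma>_def using integrable_density[OF measurable_m[OF assms] measurable_m[OF measurable_rho] p]
   integral_density[OF measurable_m[OF assms] measurable_m[OF measurable_rho] p] by simp_all
qed

lemma sigma_finite_compact: "compact L ==> emeasure \<sigma> L < \<infinity>"
proof -
 assume L: "compact L"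
 then have Lm: "L \<in> sets borel" by (simp add: compact_imp_closed)
 have "integrable m (\<lambda>x. \<rho> x * indicat_real L x)" by (rule integrable_on_compact[OF weak_gradientD(1)[OF \<rho>_grad] L, of _ 1])
   (use measurable_rho Lm in \<open>auto intro!: borel_measurable_times\<close>)
 then have "integrable \<sigma> (indicat_real L)" using integral_sigma(1)[of "indicat_real L"] Lm by simp
 then have "(\<integral>\<^sup>+x. ennreal (norm (indicat_real L x)) \<partial>\<sigma>) < \<infinity>" by (simp add: integrable_iff_bounded)
 then show ?thesis using Lm by (simp add: ennreal_indicator sets_sigma)
qed

lemma sigma_nonatomic: "emeasure \<sigma> {x} = 0"
proof -
 have "emeasure \<sigma> {x} = (\<integral>\<^sup>+y. ennreal (\<rho> y) * indicator {x} y \<partial>m)"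
  unfolding \<sigma>_def using measurable_m[OF measurable_rho] by (intro emeasure_density) (auto simp: sets_m)
 also have "... = 0" by (rule nn_integral_null_set) (simp add: null_sets_def nonatomic sets_m)
 finally show ?thesis .
qed

text \<open>Almost everywhere g(R, v) = 2 u g(Z, v) and \<open>\<rho>\<close> is the square of
  \<open>u\<close>, so \<open>\<rho>\<close> times the square of the quotient of g(R, v) by
  \<open>\<rho>\<close> equals 4 g(Z, v)^2. The singular denominator disappears; this is where the
  Sobolev regularity of the square root enters.\<close>

lemma beta_square_integrable: "integrable \<sigma> (\<lambda>x. (\<beta> x)\<^sup>2)"
proof -
 obtain Z where Z: "weak_gradient A g m u Z" and Z2: "locally_integrable m (\<lambda>x. g x (Z x) (Z x))"
  using \<rho>_sobolev unfolding local_sobolev_1_2_def u_def[abs_def] by auto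
 obtain C where C: "0 <= C" "!!x. x \<in> K ==> \<bar>g x (v x) (v x)\<bar> <= C"
  using bounded_on_compact[OF continuous_g_field[OF v_smooth] compact_K] by blast
 obtain E where E: "0 <= E" "!!x. x \<in> K ==> \<bar>divergence A g v x\<bar> <= E"
  using bounded_on_compact[OF smooth_fun_continuous[OF divergence_smooth[OF v_smooth]] compact_K] by blast
 have i1: "integrable m (\<lambda>x. indicat_real K x * g x (Z x) (Z x))" "integrable m (\<lambda>x. indicat_real K x * \<rho> x)"
  using Z2 weak_gradientD(1)[OF \<rho>_grad] compact_K unfolding locally_integrable_def set_integrable_def by auto
 have bm: "(\<lambda>x. (\<beta> x)\<^sup>2) \<in> borel_measurable borel" using measurable_beta by measurable
 \<comment> \<open>From (a + b)^2 <= 2 a^2 + 2 b^2: the gradient part contributes 2 times 4 times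
   the bound \<open>C\<close> for g(v, v), and the divergence part 2 times its squared
   bound.\<close>
 let ?D = "\<lambda>x. (8 * C) * (indicat_real K x * g x (Z x) (Z x)) + (2 * E\<^sup>2) * (indicat_real K x * \<rho> x)"
 have "integrable m (\<lambda>x. \<rho> x * (\<beta> x)\<^sup>2)"
 proof (rule Bochner_Integration.integrable_bound)
  show "integrable m (\<lambda>x. ?D x)" by (intro Bochner_Integration.integrable_add integrable_mult_right i1)
  show "(\<lambda>x. \<rho> x * (\<beta> x)\<^sup>2) \<in> borel_measurable m" using measurable_m[OF measurable_rho] measurable_m[OF bm] by simp
  show "AE x in m. norm (\<rho> x * (\<beta> x)\<^sup>2) <= norm (?D x)" using \<rho>_pos gradient_of_square[OF Z Z2 v_smooth]
  proof eventually_elim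
   fix x assume p: "0 < \<rho> x" and e: "g x (R x) (v x) = 2 * u x * g x (Z x) (v x)"
   show "norm (\<rho> x * (\<beta> x)\<^sup>2) <= norm (?D x)"
   proof (cases "x \<in> K")
    case True
    have z0: "0 <= g x (Z x) (Z x)" by (rule g_nonneg[OF weak_gradientD(2)[OF Z]])
    have ru: "\<rho> x = (u x)\<^sup>2" "0 < u x" using p by (auto simp: u_def)
    have "(\<beta> x)\<^sup>2 <= 2 * (g x (R x) (v x) / \<rho> x)\<^sup>2 + 2 * (divergence A g v x)\<^sup>2"
     unfolding beta_eq using zero_le_power2[of "g x (R x) (v x) / \<rho> x - divergence A g v x"]
     by (simp add: power2_eq_square algebra_simps)
    then have "\<rho> x * (\<beta> x)\<^sup>2 <= \<rho> x * (2 * (g x (R x) (v x) / \<rho> x)\<^sup>2 + 2 * (divergence A g v x)\<^sup>2)"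
     using p by (intro mult_left_mono) auto
    also have "... = 8 * (g x (Z x) (v x))\<^sup>2 + 2 * (\<rho> x * (divergence A g v x)\<^sup>2)"
     unfolding e ru(1) using ru(2) by (simp add: power2_eq_square field_simps)
    also have "... <= 8 * (g x (Z x) (Z x) * C) + 2 * (\<rho> x * E\<^sup>2)"
    proof (intro add_mono mult_left_mono)
     have "(g x (Z x) (v x))\<^sup>2 <= g x (Z x) (Z x) * g x (v x) (v x)"
      by (rule g_Cauchy_Schwarz[OF weak_gradientD(2)[OF Z] smooth_fieldD(1)[OF v_smooth]])
     also have "... <= g x (Z x) (Z x) * C" using C(2)[OF True] z0 by (intro mult_left_mono) auto
     finally show "(g x (Z x) (v x))\<^sup>2 <= g x (Z x) (Z x) * C" .
     show "(divergence A g v x)\<^sup>2 <= E\<^sup>2" using E True by (simp add: abs_le_square_iff[symmetric])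
    qed (use p in auto)
    finally have le: "\<rho> x * (\<beta> x)\<^sup>2 <= ?D x" using True by (simp add: mult_ac)
    have "0 <= \<rho> x * (\<beta> x)\<^sup>2" using p by simp
    then show ?thesis using le by simp
   next
    case False
    then show ?thesis by (simp add: beta_zero)
   qed
  qed
 qed
 then show ?thesis using integral_sigma(1)[OF bm] by simp
qed

lemma beta_integrable: "integrable \<sigma> \<beta>"
proof (rule Bochner_Integration.integrable_bound)
 have Km: "K \<in> sets \<sigma>" using compact_K by (simp add: sets_sigma compact_imp_closed)
 have "integrable \<sigma> (indicat_real K)" using sigma_finite_compact[OF compact_K] Km by (intro integrable_real_indicator)
 then show "integrable \<sigma> (\<lambda>x. indicat_real K x + (\<beta> x)\<^sup>2)" by (intro Bochner_Integration.integrable_add beta_square_integrable)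
 show "\<beta> \<in> borel_measurable \<sigma>" using measurable_beta by (simp add: measurable_cong_sets[OF sets_sigma refl])
 show "AE x in \<sigma>. norm (\<beta> x) <= norm (indicat_real K x + (\<beta> x)\<^sup>2)"
 proof (rule AE_I2)
  fix x
  have "2 * \<bar>\<beta> x\<bar> <= 1 + (\<beta> x)\<^sup>2" using zero_le_power2[of "\<bar>\<beta> x\<bar> - 1"] by (simp add: power2_eq_square algebra_simps)
  then show "norm (\<beta> x) <= norm (indicat_real K x + (\<beta> x)\<^sup>2)" by (cases "x \<in> K") (simp_all add: beta_zero)
 qed
qed

text \<open>The defining relation of the weak gradient is applied to the field \<open>w\<close>
  times \<open>v\<close>, which has compact support because \<open>v\<close> has. The Leibniz rule
  for the divergence splits off \<open>vderiv w v\<close>, and the remaining terms make up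
  \<open>w x * \<beta> x\<close> times the density.\<close>

lemma integration_by_parts:
 assumes w: "smooth_fun w"
 shows "integrable \<sigma> (vderiv w v)" "(LINT x|\<sigma>. vderiv w v x) = - (LINT x|\<sigma>. w x * \<beta> x)"
proof -
 have wv: "(\<lambda>x d. w x *\<^sub>R v x d) \<in> compact_vector_fields A"
  unfolding field_iff using smooth_field_scale[OF w v_smooth] compact_K v_zero by (auto intro!: exI[of _ K])
 note wm = smooth_fun_measurable[OF w] and wc = smooth_fun_continuous[OF w]
 have vc: "continuous_on UNIV (vderiv w v)" by (rule smooth_fun_continuous[OF vderiv_smooth[OF w v_smooth]])
 have vm: "vderiv w v \<in> borel_measurable borel" by (rule borel_measurable_continuous_onI[OF vc])
 have vz: "vderiv w v x = 0" if "x \<notin> K" for x by (rule vderiv_zero[OF w v_smooth v_zero[OF that]])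
 have rint: "integrable m (\<lambda>x. \<rho> x * h x)" if h: "continuous_on UNIV h" "!!x. x \<notin> K ==> h x = 0" for h
 proof -
  obtain B where B: "0 <= B" "!!x. x \<in> K ==> \<bar>h x\<bar> <= B" using bounded_on_compact[OF h(1) compact_K] by blast
  show ?thesis
  proof (rule integrable_on_compact[OF weak_gradientD(1)[OF \<rho>_grad] compact_K _ B(1)])
   show "(\<lambda>x. \<rho> x * h x) \<in> borel_measurable borel" using measurable_rho borel_measurable_continuous_onI[OF h(1)] by simp
   show "\<bar>\<rho> x * h x\<bar> <= B * \<bar>\<rho> x\<bar>" if "x \<in> K" for x
    using mult_right_mono[OF B(2)[OF that], of "\<bar>\<rho> x\<bar>"] by (simp add: abs_mult mult.commute)
  qed (simp add: h(2))
 qed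
 have i1: "integrable m (\<lambda>x. \<rho> x * vderiv w v x)" by (rule rint[OF vc vz])
 then show "integrable \<sigma> (vderiv w v)" using integral_sigma(1)[OF vm] by simp
 have i2: "integrable m (\<lambda>x. \<rho> x * (w x * divergence A g v x))"
  by (rule rint) (auto intro!: continuous_on_mult wc smooth_fun_continuous[OF divergence_smooth[OF v_smooth]] simp: div_zero)
 have gw: "g x (R x) (\<lambda>d. w x *\<^sub>R v x d) = w x * g x (R x) (v x)" for x
  by (rule g_scale_right[OF weak_gradientD(2)[OF \<rho>_grad] smooth_fieldD(1)[OF v_smooth]])
 have "(LINT x|m. \<rho> x * (w x * divergence A g v x) + \<rho> x * vderiv w v x) = - (LINT x|m. w x * g x (R x) (v x))"
  using weak_gradientD(5)[OF \<rho>_grad wv] unfolding divergence_mult[OF w v_smooth] gw distrib_left .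
 then have l: "(LINT x|m. \<rho> x * vderiv w v x) = - (LINT x|m. w x * g x (R x) (v x)) - (LINT x|m. \<rho> x * (w x * divergence A g v x))"
  using Bochner_Integration.integral_add[OF i2 i1] by simp
 have i3: "integrable m (\<lambda>x. w x * g x (R x) (v x))"
 proof -
  obtain B where B: "0 <= B" "!!x. x \<in> K ==> \<bar>w x\<bar> <= B" using bounded_on_compact[OF wc compact_K] by blast
  show ?thesis by (rule integrable_gradient_pairing[OF v_smooth wm compact_K B]) (simp_all add: gR_zero)
 qed
 have wb: "(\<lambda>x. w x * \<beta> x) \<in> borel_measurable borel" using wm measurable_beta by simp
 have "(LINT x|\<sigma>. w x * \<beta> x) = (LINT x|m. \<rho> x * (w x * \<beta> x))" by (rule integral_sigma(2)[OF wb])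
 also have "... = (LINT x|m. w x * g x (R x) (v x) + \<rho> x * (w x * divergence A g v x))"
 proof (rule integral_cong_AE)
  show "AE x in m. \<rho> x * (w x * \<beta> x) = w x * g x (R x) (v x) + \<rho> x * (w x * divergence A g v x)"
   using \<rho>_pos by eventually_elim (simp add: beta_eq field_simps)
  show "(\<lambda>x. \<rho> x * (w x * \<beta> x)) \<in> borel_measurable m" using measurable_m[OF measurable_rho] measurable_m[OF wb] by simp
  show "(\<lambda>x. w x * g x (R x) (v x) + \<rho> x * (w x * divergence A g v x)) \<in> borel_measurable m"
   using borel_measurable_integrable[OF i3] borel_measurable_integrable[OF i2] by simp
 qed
 also have "... = (LINT x|m. w x * g x (R x) (v x)) + (LINT x|m. \<rho> x * (w x * divergence A g v x))"
  by (rule Bochner_Integration.integral_add[OF i3 i2])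
 finally show "(LINT x|\<sigma>. vderiv w v x) = - (LINT x|\<sigma>. w x * \<beta> x)" unfolding integral_sigma(2)[OF vm] l by simp
qed

end

section \<open>Integration by parts\<close>

context riemannian_atlas begin

lemma vderiv_eqI:
 assumes w: "smooth_field w" and c: "c \<in> A" "x \<in> fst c"
  and f: "smooth_fun f" "((\<lambda>y. f (chart_inv c y)) has_derivative D) (at (snd c x))"
 shows "vderiv f w x = D (w x c)" unfolding vderiv_frechet[OF f(1) w c] frechet_derivative_at[OF f(2), symmetric] ..

lemma smooth_fun_has_derivative:
 assumes f: "smooth_fun f" and c: "c \<in> A" "x \<in> fst c"
 shows "((\<lambda>y. f (chart_inv c y)) has_derivative frechet_derivative (\<lambda>y. f (chart_inv c y)) (at (snd c x))) (at (snd c x))"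
 by (rule differentiable_has_derivative, rule smooth_on_differentiable[OF smooth_funD[OF f c(1)]]) (use c in auto)

lemma vderiv_mult:
 assumes f: "smooth_fun f" and e: "smooth_fun e" and w: "smooth_field w"
 shows "vderiv (\<lambda>x. f x * e x) w x = vderiv f w x * e x + f x * vderiv e w x"
proof -
 obtain c where c: "c \<in> A" "x \<in> fst c" using ex_chart by blast
 show ?thesis using vderiv_eqI[OF w c smooth_fun_mult[OF f e]
    has_derivative_mult[OF smooth_fun_has_derivative[OF f c] smooth_fun_has_derivative[OF e c]]]
  by (simp add: vderiv_frechet[OF f w c] vderiv_frechet[OF e w c] c)
qed

lemma vderiv_affine:
 assumes f: "smooth_fun f" and w: "smooth_field w"
 shows "vderiv (\<lambda>x. a + b * f x) w x = b * vderiv f w x"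
proof -
 obtain c where c: "c \<in> A" "x \<in> fst c" using ex_chart by blast
 have "((\<lambda>y. a + b * f (chart_inv c y)) has_derivative
   (\<lambda>y. b * frechet_derivative (\<lambda>y. f (chart_inv c y)) (at (snd c x)) y)) (at (snd c x))"
  using has_derivative_add[OF has_derivative_const has_derivative_mult_right[OF smooth_fun_has_derivative[OF f c]]] by simp
 from vderiv_eqI[OF w c smooth_fun_add[OF smooth_fun_const smooth_fun_cmult[OF f]] this]
 show ?thesis by (simp add: vderiv_frechet[OF f w c])
qed

lemma vderiv_bounded_smooth:
 assumes h: "h \<in> bounded_smooth N" and a: "!!i. i < N ==> smooth_fun (a i)" and w: "smooth_field w"
 shows "vderiv (\<lambda>x. h (\<lambda>i. a i x)) w x = (\<Sum>i<N. seq_partial i h (\<lambda>i. a i x) * vderiv (a i) w x)"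
proof -
 obtain c where c: "c \<in> A" "x \<in> fst c" using ex_chart by blast
 note * = has_derivative_bounded_smooth[where a="\<lambda>i y. a i (chart_inv c y)", OF h smooth_fun_has_derivative[OF a c]]
 show ?thesis using vderiv_eqI[OF w c smooth_fun_bounded_smooth[OF h a] *] c by (simp add: vderiv_frechet[OF a w c])
qed

end

section \<open>Integration by parts for mark functions\<close>

locale poisson_manifold = weighted_manifold A g m \<rho> R v +
  M: compound_poisson_marks "riemannian_atlas.pos_tests A" P \<tau> "weighted_manifold.\<sigma> m \<rho>"
 for A :: "('a::{second_countable_topology,t2_space}, 'n::finite) chart set" and g :: "('a, 'n) metric"
  and m :: "'a measure" and \<rho> :: "'a => real" and R :: "'a => ('a, 'n) tangent" and v :: "'a => ('a, 'n) tangent"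
  and P :: "('a => real) measure" and \<tau> :: "real measure" +
 assumes tau_second_moment: "(\<integral>\<^sup>+s. ennreal (s\<^sup>2) \<partial>\<tau>) < \<infinity>"
begin

text \<open>A reference function for the Mecke formula. It is positive on \<open>K\<close>, so the
  atoms it sees include all those at which \<open>v\<close> is nonzero.\<close>

definition cutoff where "cutoff = (SOME f. f \<in> pos_tests & (\<forall>x\<in>K. 0 < f x))"

lemma cutoff: "cutoff \<in> pos_tests" "x \<in> K ==> 0 < cutoff x"
 using someI_ex[of "\<lambda>f. f \<in> pos_tests & (\<forall>x\<in>K. 0 < f x)"] ex_cutoff[OF compact_K] unfolding cutoff_def by blast+

lemma cutoff_zero: "cutoff x = 0 ==> x \<notin> K" using cutoff(2)[of x] by auto

text \<open>All atoms move simultaneously; to first order their effects add up, each weighted by its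
  mass.\<close>

definition gradient :: "('a => ('a => real) => real) => ('a => real) => real" where
 "gradient D w = (\<Sum>x\<in>atoms w cutoff. w x * D x w)"

definition beta_sum :: "('a => real) => real" where
 "beta_sum w = (\<Sum>x\<in>atoms w cutoff. \<beta> x)"

text \<open>\<open>D x w\<close> is the derivative along \<open>v\<close> of \<open>\<Phi>\<close> with respect to the position of a point of unit mass at \<open>x\<close>.\<close>

definition point_derivative :: "(('a => real) => real) => ('a => ('a => real) => real) => bool" where
 "point_derivative \<Phi> D \<longleftrightarrow>
  \<Phi> \<in> borel_measurable M.mark_space & (\<exists>C. \<forall>w\<in>marks. \<bar>\<Phi> w\<bar> <= C) &
  (\<lambda>(x, w). D x w) \<in> borel_measurable M.pair_space & (\<exists>C. \<forall>x. \<forall>w\<in>marks. \<bar>D x w\<bar> <= C) & (\<forall>x w. x \<notin> K --> D x w = 0) &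
  (\<forall>w\<in>marks. \<forall>s>0. smooth_fun (\<lambda>x. \<Phi> (shift x s w)) & (\<forall>x. vderiv (\<lambda>x. \<Phi> (shift x s w)) v x = s * D x (shift x s w)))"

lemma point_derivativeD:
 assumes "point_derivative \<Phi> D"
 shows "\<Phi> \<in> borel_measurable M.mark_space" "\<exists>C. \<forall>w\<in>marks. \<bar>\<Phi> w\<bar> <= C"
  "(\<lambda>(x, w). D x w) \<in> borel_measurable M.pair_space" "\<exists>C. \<forall>x. \<forall>w\<in>marks. \<bar>D x w\<bar> <= C"
  "x \<notin> K ==> D x w = 0"
  "w \<in> marks ==> 0 < s ==> smooth_fun (\<lambda>x. \<Phi> (shift x s w))"
  "w \<in> marks ==> 0 < s ==> vderiv (\<lambda>x. \<Phi> (shift x s w)) v x = s * D x (shift x s w)" using assms unfolding point_derivative_def by simp_all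

text \<open>Closing the class under products reduces the formula for two functions to that for a
  single one, applied to their product.\<close>

lemma point_derivative_mult:
 assumes "point_derivative \<Phi> D" "point_derivative \<Psi> E"
 shows "point_derivative (\<lambda>w. \<Phi> w * \<Psi> w) (\<lambda>x w. D x w * \<Psi> w + \<Phi> w * E x w)"
proof -
 note 1 = point_derivativeD[OF assms(1)] and 2 = point_derivativeD[OF assms(2)]
 have [measurable]: "\<Phi> \<in> borel_measurable M.mark_space" "\<Psi> \<in> borel_measurable M.mark_space" by (fact 1(1) 2(1))+
 have m: "(\<lambda>(x, w). D x w * \<Psi> w + \<Phi> w * E x w) \<in> borel_measurable M.pair_space"
 proof -
  have "(\<lambda>p. (\<lambda>(x, w). D x w) p * \<Psi> (snd p) + \<Phi> (snd p) * (\<lambda>(x, w). E x w) p) \<in> borel_measurable M.pair_space"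
   by (intro borel_measurable_add borel_measurable_times 1(3) 2(3)) measurable
  then show ?thesis by (simp add: split_beta')
 qed
 obtain a where a: "!!w. w \<in> marks ==> \<bar>\<Phi> w\<bar> <= a" using 1(2) by auto
 obtain b where b: "!!w. w \<in> marks ==> \<bar>\<Psi> w\<bar> <= b" using 2(2) by auto
 obtain a' where a': "!!x w. w \<in> marks ==> \<bar>D x w\<bar> <= a'" using 1(4) by auto
 obtain b' where b': "!!x w. w \<in> marks ==> \<bar>E x w\<bar> <= b'" using 2(4) by auto
 have "\<bar>\<Phi> w * \<Psi> w\<bar> <= a * b" if w: "w \<in> marks" for w unfolding abs_mult by (rule mult_mono[OF a[OF w] b[OF w]]) (use a[OF w] in simp_all)
 moreover have "\<bar>D x w * \<Psi> w + \<Phi> w * E x w\<bar> <= a' * b + a * b'" if w: "w \<in> marks" for x w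
 proof (rule order_trans[OF abs_triangle_ineq add_mono])
  show "\<bar>D x w * \<Psi> w\<bar> <= a' * b" unfolding abs_mult by (rule mult_mono[OF a'[OF w] b[OF w]]) (use a'[OF w, of x] in simp_all)
  show "\<bar>\<Phi> w * E x w\<bar> <= a * b'" unfolding abs_mult by (rule mult_mono[OF a[OF w] b'[OF w]]) (use a[OF w] in simp_all)
 qed
 moreover have "vderiv (\<lambda>x. \<Phi> (shift x s w) * \<Psi> (shift x s w)) v x =
   s * (D x (shift x s w) * \<Psi> (shift x s w) + \<Phi> (shift x s w) * E x (shift x s w))"
  if w: "w \<in> marks" and s: "0 < s" for w s x
  unfolding vderiv_mult[OF 1(6)[OF w s] 2(6)[OF w s] v_smooth] 1(7)[OF w s] 2(7)[OF w s] by (simp add: algebra_simps)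
 ultimately show ?thesis unfolding point_derivative_def
  by (intro conjI allI ballI impI exI[of _ "a * b"] exI[of _ "a' * b + a * b'"] m smooth_fun_mult 1(6) 2(6)) (simp_all add: 1(5) 2(5))
qed

text \<open>The mass carried by the atoms in \<open>K\<close> has a second moment since jumps have
  two moments and \<open>K\<close> has finite measure. Up to a constant it dominates every
  \<open>gradient\<close>.\<close>

lemma second_moment_mass:
 "(\<integral>\<^sup>+w. ennreal ((\<Sum>x\<in>atoms w cutoff. max 0 (w x) * indicator K x)\<^sup>2) \<partial>P) < \<infinity>"
proof (rule M.second_moment_finite[OF cutoff(1), of "\<lambda>x s. max 0 s * indicator K x"])
 have [measurable]: "K \<in> sets borel" using compact_K by (simp add: compact_imp_closed)
 have K: "K \<in> sets \<sigma>" by (simp add: sets_sigma)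
 show "(\<lambda>(x, s). max 0 s * indicator K x :: real) \<in> borel_measurable (borel \<Otimes>\<^sub>M borel)" by measurable
 show "max 0 s * indicator K x = (0::real)" if "cutoff x = 0" for x s using cutoff_zero[OF that] by simp
 have "(\<integral>\<^sup>+x. \<integral>\<^sup>+s. ennreal ((max 0 s * indicator K x) ^ n) \<partial>\<tau> \<partial>\<sigma>) < \<infinity>"
  if n: "0 < n" and fin: "(\<integral>\<^sup>+s. ennreal (s ^ n) \<partial>\<tau>) < \<infinity>" for n
 proof -
  have "(\<integral>\<^sup>+s. ennreal ((max 0 s * indicator K x) ^ n) \<partial>\<tau>) = (\<integral>\<^sup>+s. ennreal (s ^ n) \<partial>\<tau>) * indicator K x" for x
  proof -
   have "(\<integral>\<^sup>+s. ennreal ((max 0 s * indicator K x) ^ n) \<partial>\<tau>) = (\<integral>\<^sup>+s. ennreal (s ^ n) * indicator K x \<partial>\<tau>)"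
    by (rule nn_integral_cong_AE, rule AE_mp[OF M.tau_pos], rule AE_I2) (use n in \<open>auto simp: max_def split: split_indicator\<close>)
   also have "... = (\<integral>\<^sup>+s. ennreal (s ^ n) \<partial>\<tau>) * indicator K x"
    by (rule nn_integral_multc) (simp add: measurable_cong_sets[OF M.sets_tau refl])
   finally show ?thesis .
  qed
  then have "(\<integral>\<^sup>+x. \<integral>\<^sup>+s. ennreal ((max 0 s * indicator K x) ^ n) \<partial>\<tau> \<partial>\<sigma>) = (\<integral>\<^sup>+s. ennreal (s ^ n) \<partial>\<tau>) * emeasure \<sigma> K"
   using K by (simp add: nn_integral_cmult_indicator)
  then show ?thesis using fin sigma_finite_compact[OF compact_K] by (simp add: ennreal_mult_less_top)
 qed
 from this[of 1] this[of 2] show "(\<integral>\<^sup>+x. \<integral>\<^sup>+s. ennreal (max 0 s * indicator K x) \<partial>\<tau> \<partial>\<sigma>) < \<infinity>"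
  "(\<integral>\<^sup>+x. \<integral>\<^sup>+s. ennreal ((max 0 s * indicator K x)\<^sup>2) \<partial>\<tau> \<partial>\<sigma>) < \<infinity>" using M.tau_moment tau_second_moment by simp_all
qed (simp_all add: zero_le_mult_iff)

lemma mass_sum_measurable: "k \<in> borel_measurable M.pair_space ==> (!!x w. cutoff x = 0 ==> k (x, w) = 0) ==>
  (\<lambda>w. \<Sum>x\<in>atoms w cutoff. k (x, w) :: real) \<in> borel_measurable P"
 using M.measurable_sum_marks_real[OF cutoff(1), of "\<lambda>x w. k (x, w)"] by (simp add: measurable_cong_sets[OF M.sets_P refl])

lemma gradient_kernel_measurable:
 assumes "point_derivative \<Phi> D"
 shows "(\<lambda>(x, w). w x * D x w) \<in> borel_measurable M.pair_space"
 using borel_measurable_times[OF M.measurable_mass point_derivativeD(3)[OF assms]] by (simp add: split_beta')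

lemma gradient_measurable: "point_derivative \<Phi> D ==> gradient D \<in> borel_measurable P" unfolding gradient_def[abs_def]
 using mass_sum_measurable[OF gradient_kernel_measurable] point_derivativeD(5) cutoff_zero by simp

lemma gradient_square_integrable:
 assumes D: "point_derivative \<Phi> D"
 shows "integrable P (\<lambda>w. (gradient D w)\<^sup>2)"
proof -
 obtain C where C: "!!x w. w \<in> marks ==> \<bar>D x w\<bar> <= C" using point_derivativeD(4)[OF D] by auto
 let ?N = "\<lambda>w. \<Sum>x\<in>atoms w cutoff. max 0 (w x) * indicator K x"
 have le: "(gradient D w)\<^sup>2 <= C\<^sup>2 * (?N w)\<^sup>2" if w: "w \<in> marks" for w
 proof -
  have "\<bar>gradient D w\<bar> <= (\<Sum>x\<in>atoms w cutoff. C * (max 0 (w x) * indicator K x))" unfolding gradient_def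
  proof (rule order_trans[OF sum_abs sum_mono])
   fix x
   show "\<bar>w x * D x w\<bar> <= C * (max 0 (w x) * indicator K x)"
    using C[OF w, of x] marks_nonneg[OF w, of x] point_derivativeD(5)[OF D, of x w] mult_left_mono[of "\<bar>D x w\<bar>" C "w x"]
    by (cases "x \<in> K") (auto simp: abs_mult ac_simps)
  qed
  then have "\<bar>gradient D w\<bar> <= C * ?N w" by (simp add: sum_distrib_left)
  from power_mono[OF this abs_ge_zero, of 2] show ?thesis by (simp add: power_mult_distrib)
 qed
 show ?thesis
 proof (rule integrableI_bounded)
  have "(\<integral>\<^sup>+w. ennreal (norm ((gradient D w)\<^sup>2)) \<partial>P) <= (\<integral>\<^sup>+w. ennreal (C\<^sup>2) * ennreal ((?N w)\<^sup>2) \<partial>P)"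
   by (rule nn_integral_mono) (use le in \<open>simp add: ennreal_mult'[symmetric] ennreal_leI\<close>)
  also have "... = ennreal (C\<^sup>2) * (\<integral>\<^sup>+w. ennreal ((?N w)\<^sup>2) \<partial>P)"
  proof (rule nn_integral_cmult)
   have [measurable]: "K \<in> sets borel" using compact_K by (simp add: compact_imp_closed)
   have "(\<lambda>p. max 0 ((\<lambda>(x, w). w x) p) * indicator K (fst p) :: real) \<in> borel_measurable M.pair_space"
    by (intro borel_measurable_times borel_measurable_max M.measurable_mass) measurable
   from mass_sum_measurable[OF this] cutoff_zero have "?N \<in> borel_measurable P" by simp
   then show "(\<lambda>w. ennreal ((?N w)\<^sup>2)) \<in> borel_measurable P" by measurable
  qed
  also have "... < \<infinity>" using second_moment_mass by (simp add: ennreal_mult_less_top)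
  finally show "(\<integral>\<^sup>+w. ennreal (norm ((gradient D w)\<^sup>2)) \<partial>P) < \<infinity>" .
 qed (use gradient_measurable[OF D] in measurable)
qed

lemma beta_sum_measurable: "beta_sum \<in> borel_measurable P" unfolding beta_sum_def[abs_def]
 using mass_sum_measurable[of "\<lambda>p. \<beta> (fst p)"] measurable_beta beta_zero cutoff_zero by simp

text \<open>An atom contributes \<open>\<beta> x\<close> whatever its mark, so \<open>\<tau>\<close>
  enters only through its total mass, next to the first two moments of \<open>\<beta>\<close> under
  \<open>\<sigma>\<close>.\<close>

lemma beta_sum_square_integrable: "integrable P (\<lambda>w. (beta_sum w)\<^sup>2)"
proof (rule integrableI_bounded)
 have [measurable]: "\<beta> \<in> borel_measurable borel" by (rule measurable_beta)
 have le: "(beta_sum w)\<^sup>2 <= (\<Sum>x\<in>atoms w cutoff. \<bar>\<beta> x\<bar>)\<^sup>2" for w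
  unfolding beta_sum_def using power_mono[OF sum_abs[of \<beta> "atoms w cutoff"] abs_ge_zero, of 2] by simp
 have fin: "(\<integral>\<^sup>+x. \<integral>\<^sup>+s. ennreal (b x) \<partial>\<tau> \<partial>\<sigma>) < \<infinity>" if "integrable \<sigma> b" "!!x. 0 <= b x" for b
  using that M.tau.emeasure_finite[of UNIV, unfolded infinity_ennreal_def less_top]
  by (simp add: integrable_iff_bounded nn_integral_multc ennreal_mult_less_top)
 have "(\<integral>\<^sup>+w. ennreal (norm ((beta_sum w)\<^sup>2)) \<partial>P) <=
   (\<integral>\<^sup>+w. ennreal ((\<Sum>x\<in>atoms w cutoff. \<bar>\<beta> x\<bar>)\<^sup>2) \<partial>P)"
  by (rule nn_integral_mono) (use le in \<open>simp add: ennreal_leI\<close>)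
 also have "... < \<infinity>" by (rule M.second_moment_finite[OF cutoff(1), of "\<lambda>x s. \<bar>\<beta> x\<bar>"])
   (use fin[OF integrable_abs[OF beta_integrable]] fin[OF beta_square_integrable] beta_zero cutoff_zero in simp_all)
 finally show "(\<integral>\<^sup>+w. ennreal (norm ((beta_sum w)\<^sup>2)) \<partial>P) < \<infinity>" .
qed (use beta_sum_measurable in measurable)

text \<open>The Mecke formula turns the sum over atoms into an integral over a new point x, its mark
  s and a mark function w. For fixed s and w the integrand is the derivative along \<open>v\<close>
  of x -> \<open>\<Phi> (shift x s w)\<close>, to which integration by parts with respect to
  \<open>\<sigma>\<close> applies. The formula read backwards returns a sum over atoms, now of
  \<open>\<beta>\<close>.\<close>

lemma integration_by_parts_marks:
 assumes D: "point_derivative \<Phi> D"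
 shows "(LINT w|P. gradient D w) = - (LINT w|P. \<Phi> w * beta_sum w)"
proof -
 note 1 = point_derivativeD[OF D]
 interpret TP: sigma_finite_measure "\<tau> \<Otimes>\<^sub>M P" using finite_measure_pair_measure[OF M.P.finite_measure_axioms M.tau.finite_measure_axioms]
  by (rule finite_measure.axioms)
 interpret T: pair_sigma_finite \<sigma> "\<tau> \<Otimes>\<^sub>M P" ..
 interpret S: pair_sigma_finite \<tau> P ..
 obtain C where C: "!!w. w \<in> marks ==> \<bar>\<Phi> w\<bar> <= C" using 1(2) by auto
 obtain C' where C': "!!x w. w \<in> marks ==> \<bar>D x w\<bar> <= C'" using 1(4) by auto
 have [measurable]: "\<beta> \<in> borel_measurable borel" "K \<in> sets borel" using measurable_beta compact_K by (simp_all add: compact_imp_closed)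
 have m2: "(\<lambda>(x, w). \<beta> x * \<Phi> w) \<in> borel_measurable M.pair_space" using 1(1) by measurable
 note m1 = gradient_kernel_measurable[OF D]
 let ?mass = "\<lambda>(x, s, w). max 0 s * indicator K x :: real"
 let ?b = "\<lambda>(x, s, w). \<beta> x * \<Phi> (shift x s w)"
 let ?d = "\<lambda>(x, s, w). w x * D x w"
 let ?e = "\<lambda>(x, s, w). max 0 s * D x (shift x s w)"
 let ?f = "\<lambda>(x, s, w). shift x s w x * D x (shift x s w)"
 note sh = M.measurable_shifted
 have msh: "(\<lambda>(x, s, w). D x (shift x s w)) \<in> borel_measurable M.triple"
  using sh[OF 1(3)] by (simp add: measurable_cong_sets[OF M.sets_triple refl])
 have me: "?e \<in> borel_measurable M.triple"
  using borel_measurable_times[OF _ msh, of "\<lambda>p. max 0 (fst (snd p))"] M.sets_tau by (simp add: split_beta')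
 have mf: "?f \<in> borel_measurable M.triple" using sh[OF m1] by (simp add: measurable_cong_sets[OF M.sets_triple refl])
 have mb: "?b \<in> borel_measurable M.triple" using sh[OF m2] by (simp add: measurable_cong_sets[OF M.sets_triple refl])
 have sp: "space M.triple = UNIV \<times> UNIV \<times> marks" by (simp add: space_pair_measure)
 have ib: "integrable M.triple ?b"
 proof (rule integrableI_bounded[OF mb])
  have "(\<integral>\<^sup>+p. ennreal (norm (?b p)) \<partial>M.triple) <= (\<integral>\<^sup>+p. ennreal C * ennreal \<bar>\<beta> (fst p)\<bar> \<partial>M.triple)"
  proof (rule nn_integral_mono)
   fix p assume "p \<in> space M.triple"
   then obtain x s w where p: "p = (x, s, w)" "w \<in> marks" unfolding sp by auto
   show "ennreal (norm (?b p)) <= ennreal C * ennreal \<bar>\<beta> (fst p)\<bar>"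
    using C[OF shift_marks[OF p(2)], of x s] p(1) mult_left_mono[of "\<bar>\<Phi> (shift x s w)\<bar>" C "\<bar>\<beta> x\<bar>"]
    by (simp add: ennreal_mult''[symmetric] abs_mult ac_simps ennreal_leI)
  qed
  also have "... = ennreal C * (\<integral>\<^sup>+x. ennreal \<bar>\<beta> x\<bar> * emeasure (\<tau> \<Otimes>\<^sub>M P) (space (\<tau> \<Otimes>\<^sub>M P)) \<partial>\<sigma>)"
   by (subst nn_integral_cmult, measurable, subst TP.nn_integral_fst[symmetric]) simp_all
  also have "... < \<infinity>"
   using beta_integrable finite_measure.emeasure_finite[OF finite_measure_pair_measure[OF M.P.finite_measure_axioms M.tau.finite_measure_axioms], unfolded infinity_ennreal_def less_top]
   by (simp add: nn_integral_multc ennreal_mult_less_top integrable_iff_bounded)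
  finally show "(\<integral>\<^sup>+p. ennreal (norm (?b p)) \<partial>M.triple) < \<infinity>" .
 qed
 have ie: "integrable M.triple ?e"
 proof (rule integrableI_bounded[OF me])
  have "(\<integral>\<^sup>+p. ennreal (norm (?e p)) \<partial>M.triple) <= (\<integral>\<^sup>+p. ennreal C' * ennreal (?mass p) \<partial>M.triple)"
  proof (rule nn_integral_mono)
   fix p assume "p \<in> space M.triple"
   then obtain x s w where p: "p = (x, s, w)" "w \<in> marks" unfolding sp by auto
   show "ennreal (norm (?e p)) <= ennreal C' * ennreal (?mass p)" using C'[OF shift_marks[OF p(2)], of x x s] p(1) 1(5)[of x]
     mult_left_mono[of "\<bar>D x (shift x s w)\<bar>" C' "max 0 s"]
    by (auto simp: ennreal_mult''[symmetric] abs_mult ac_simps ennreal_leI split: split_indicator)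
  qed
  also have "... = ennreal C' * (\<integral>\<^sup>+x. \<integral>\<^sup>+s. ennreal (max 0 s * indicator K x) \<partial>\<tau> \<partial>\<sigma>)"
   by (subst nn_integral_cmult, measurable, subst M.nn_integral_triple) (simp_all add: M.P.emeasure_space_1[unfolded M.space_P])
  also have "... < \<infinity>"
  proof -
   have "(\<integral>\<^sup>+s. ennreal (max 0 s * indicator K x) \<partial>\<tau>) = (\<integral>\<^sup>+s. ennreal s \<partial>\<tau>) * indicator K x" for x
    by (subst nn_integral_multc[symmetric], measurable) (auto intro!: nn_integral_cong simp: max_def ennreal_neg split: split_indicator)
   then show ?thesis using M.tau_moment sigma_finite_compact[OF compact_K]
    by (simp add: nn_integral_cmult_indicator sets_sigma ennreal_mult_less_top)
  qed
  finally show "(\<integral>\<^sup>+p. ennreal (norm (?e p)) \<partial>M.triple) < \<infinity>" .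
 qed
 \<comment> \<open>The Mecke formula produces the mass at \<open>x\<close> after the shift, which is
   \<open>w x + max 0 s\<close>, whereas integration by parts needs the factor \<open>s\<close>
   alone. They agree almost everywhere because the new point is not an atom of
   \<open>w\<close>.\<close>
 have "AE x in \<sigma>. AE q in \<tau> \<Otimes>\<^sub>M P. ?f (x, q) = ?e (x, q)"
 proof (rule AE_mp[OF M.AE_no_mass[OF cutoff(1)]], rule AE_I2, rule impI)
  fix x assume *: "AE w in P. cutoff x ~= 0 --> w x = 0"
  have "AE s in \<tau>. AE w in P. ?f (x, s, w) = ?e (x, s, w)"
   by (rule AE_I2, rule AE_mp[OF *], rule AE_I2) (use 1(5)[of x] cutoff_zero[of x] in \<open>auto simp: shift_def\<close>)
  moreover have "{q \<in> space (\<tau> \<Otimes>\<^sub>M P). ?f (x, q) = ?e (x, q)} \<in> sets (\<tau> \<Otimes>\<^sub>M P)"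
  proof -
   have "Pair x \<in> measurable (\<tau> \<Otimes>\<^sub>M P) M.triple" by simp
   from measurable_compose[OF this mf] measurable_compose[OF this me] show ?thesis by measurable
  qed
  ultimately show "AE q in \<tau> \<Otimes>\<^sub>M P. ?f (x, q) = ?e (x, q)" by (intro S.AE_pair_measure) auto
 qed
 then have ae: "AE p in M.triple. ?f p = ?e p" by (intro T.AE_pair_measure) (use me mf in measurable)
 then have if': "integrable M.triple ?f" using integrable_cong_AE[OF mf me] ie by blast
 have inner: "(LINT x|\<sigma>. ?e (x, q)) = - (LINT x|\<sigma>. ?b (x, q))" if q: "0 < fst q" "snd q \<in> marks" for q
 proof -
  obtain s w where "q = (s, w)" by (cases q)
  then show ?thesis using integration_by_parts(2)[OF 1(6)[of w s]] 1(7)[of w s] q by (simp add: ac_simps)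
 qed
 have aeq: "AE q in \<tau> \<Otimes>\<^sub>M P. 0 < fst q & snd q \<in> marks"
 proof (rule S.AE_pair_measure)
  show "AE s in \<tau>. AE w in P. 0 < fst (s, w) & snd (s, w) \<in> marks" using M.tau_pos by eventually_elim auto
  have "{q \<in> space (\<tau> \<Otimes>\<^sub>M P). 0 < fst q & snd q \<in> marks} = {q \<in> space (\<tau> \<Otimes>\<^sub>M P). 0 < fst q}" by (auto simp: space_pair_measure)
  then show "{q \<in> space (\<tau> \<Otimes>\<^sub>M P). 0 < fst q & snd q \<in> marks} \<in> sets (\<tau> \<Otimes>\<^sub>M P)" by simp
 qed
 have "(LINT w|P. gradient D w) = (LINT p|M.triple. ?f p)" unfolding gradient_def
  by (rule M.mecke_integral(2)[OF cutoff(1) m1]) (use 1(5) cutoff_zero if' in auto)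
 also have "... = (LINT p|M.triple. ?e p)" by (rule integral_cong_AE[OF mf me ae])
 also have "... = (LINT q|(\<tau> \<Otimes>\<^sub>M P). LINT x|\<sigma>. ?e (x, q))" using T.integral_snd[of "\<lambda>x q. ?e (x, q)"] ie by (simp add: split_beta')
 also have "... = (LINT q|(\<tau> \<Otimes>\<^sub>M P). - (LINT x|\<sigma>. ?b (x, q)))"
 proof (rule integral_cong_AE)
  show "(\<lambda>q. LINT x|\<sigma>. ?e (x, q)) \<in> borel_measurable (\<tau> \<Otimes>\<^sub>M P)" using T.integrable_snd[of "\<lambda>x q. ?e (x, q)"] ie by (simp add: split_beta')
  show "(\<lambda>q. - (LINT x|\<sigma>. ?b (x, q))) \<in> borel_measurable (\<tau> \<Otimes>\<^sub>M P)"
   using T.integrable_snd[of "\<lambda>x q. ?b (x, q)"] ib by (simp add: split_beta')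
  show "AE q in \<tau> \<Otimes>\<^sub>M P. (LINT x|\<sigma>. ?e (x, q)) = - (LINT x|\<sigma>. ?b (x, q))" using aeq by eventually_elim (rule inner, simp_all)
 qed
 also have "... = - (LINT p|M.triple. ?b p)" using T.integral_snd[of "\<lambda>x q. ?b (x, q)"] ib by (simp add: split_beta')
 also have "(LINT p|M.triple. ?b p) = (LINT w|P. \<Phi> w * beta_sum w)" unfolding beta_sum_def sum_distrib_left
  using M.mecke_integral(2)[OF cutoff(1) m2 _ ib] beta_zero cutoff_zero by (simp add: ac_simps)
 finally show ?thesis .
qed

text \<open>The generating pairings involve nonnegative functions only, and positive and negative
  parts would not be smooth. Instead a multiple of a cutoff \<open>k\<close> is added, with a factor
  that bounds the quotient of |f| by \<open>k\<close> on the support of \<open>f\<close>.\<close>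

lemma test_measurable_pairing:
 assumes f: "f \<in> test_functions A"
 shows "(\<lambda>w. pairing w f) \<in> borel_measurable M.mark_space"
proof -
 obtain L where L: "compact L" "{x. f x ~= 0} \<subseteq> L" using f unfolding test_iff csupp_def by auto
 obtain k where k: "k \<in> pos_tests" "!!x. x \<in> L ==> 0 < k x" using ex_cutoff[OF L(1)] by auto
 note fs = f[unfolded test_iff] and ks = k(1)[unfolded pos_tests_iff]
 obtain b where b: "!!x. x \<in> L ==> 0 <= f x + b * k x"
 proof -
  have "continuous_on L (\<lambda>x. \<bar>f x\<bar> / k x)"
   by (intro continuous_intros continuous_on_subset[OF smooth_fun_continuous] fs[THEN conjunct1] ks[THEN conjunct1]) (use k(2) in force)+
  from compact_imp_bounded[OF compact_continuous_image[OF this L(1)]]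
  obtain b where "\<forall>y\<in>(\<lambda>x. \<bar>f x\<bar> / k x) ` L. norm y <= b" unfolding bounded_iff by blast
  then have b: "\<bar>f x\<bar> / k x <= b" if "x \<in> L" for x using that abs_le_D1[of "\<bar>f x\<bar> / k x" b] by simp
  have "0 <= f x + b * k x" if "x \<in> L" for x using b[OF that] k(2)[OF that] by (simp add: pos_divide_le_eq)
  with that show ?thesis by blast
 qed
 have 1: "(\<lambda>x. f x + max 0 b * k x) \<in> pos_tests" unfolding pos_tests_iff
 proof (intro conjI allI smooth_fun_add smooth_fun_cmult csupp_add)
  show "0 <= f x + max 0 b * k x" for x
   using b[of x] L(2) ks mult_right_mono[of b "max 0 b" "k x"] by (cases "x \<in> L") (force, metis (mono_tags, lifting) add_0 max.cobounded1 mem_Collect_eq mult_nonneg_nonneg subsetD)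
  show "csupp (\<lambda>x. max 0 b * k x)" by (rule csupp_subset[of k]) (use ks in auto)
 qed (use fs ks in auto)
 have "pairing w f = pairing w (\<lambda>x. f x + max 0 b * k x) - max 0 b * pairing w k" if "w \<in> marks" for w
  using pairing_lin[OF that, of f k 1 "max 0 b"] fs ks by simp
 then show ?thesis using M.measurable_pairing[OF 1] M.measurable_pairing[OF k(1)]
  by (subst measurable_cong[where g="\<lambda>w. pairing w (\<lambda>x. f x + max 0 b * k x) - max 0 b * pairing w k"]) simp_all
qed

definition cylinder_derivative :: "nat => ((nat => real) => real) => (nat => 'a => real) => 'a => ('a => real) => real" where
 "cylinder_derivative N h f x w = (\<Sum>i<N. seq_partial i h (\<lambda>i. pairing w (f i)) * vderiv (f i) v x)"

text \<open>Adding a point changes each pairing by \<open>s * f i x\<close>, so along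
  \<open>x\<close> a cylinder function is a smooth function of finitely many smooth functions, and
  the chain rule yields the factor \<open>s\<close>.\<close>

lemma point_derivative_cylinder:
 assumes h: "h \<in> bounded_smooth N" and f: "!!i. f i \<in> test_functions A"
 shows "point_derivative (\<lambda>w. h (\<lambda>i. pairing w (f i))) (cylinder_derivative N h f)"
proof -
 have fs: "smooth_fun (f i)" "csupp (f i)" for i using f[of i] unfolding test_iff by simp_all
 have seq: "(\<lambda>w i. pairing w (f i)) \<in> borel_measurable M.mark_space"
  unfolding sets_PiM_equal_borel[symmetric] measurable_cong_sets[OF refl sets_PiM_equal_borel[symmetric]]
  by (rule measurable_PiM_single') (use test_measurable_pairing[OF f] in simp_all)
 have mh: "k \<in> bounded_smooth N ==> (\<lambda>w. k (\<lambda>i. pairing w (f i))) \<in> borel_measurable M.mark_space" for k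
  by (rule measurable_compose[OF seq borel_measurable_continuous_onI[OF bounded_smoothD(3)]])
 have mv: "vderiv (f i) v \<in> borel_measurable borel" for i by (rule smooth_fun_measurable[OF vderiv_smooth[OF fs(1) v_smooth]])
 have z: "x \<notin> K ==> vderiv (f i) v x = 0" for i x by (rule vderiv_zero[OF fs(1) v_smooth v_zero])
 obtain a where a: "!!i y. i < N ==> \<bar>seq_partial i h y\<bar> <= a i" using bounded_smoothD(4)[OF bounded_smooth_partial[OF h]] by metis
 have "\<exists>B. \<forall>x\<in>K. \<bar>vderiv (f i) v x\<bar> <= B" for i
  using bounded_on_compact[OF smooth_fun_continuous[OF vderiv_smooth[OF fs(1) v_smooth]] compact_K] by blast
 then obtain b where b: "!!i x. x \<in> K ==> \<bar>vderiv (f i) v x\<bar> <= b i" by metis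
 have b': "\<bar>vderiv (f i) v x\<bar> <= \<bar>b i\<bar>" for i x using b[of x i] z[of x i] by (cases "x \<in> K") auto
 have le: "\<bar>cylinder_derivative N h f x w\<bar> <= (\<Sum>i<N. a i * \<bar>b i\<bar>)" for x w unfolding cylinder_derivative_def
 proof (rule order_trans[OF sum_abs sum_mono])
  fix i assume "i \<in> {..<N}"
  then have i: "i < N" by simp
  show "\<bar>seq_partial i h (\<lambda>i. pairing w (f i)) * vderiv (f i) v x\<bar> <= a i * \<bar>b i\<bar>"
   unfolding abs_mult by (rule mult_mono[OF a[OF i] b']) (use order_trans[OF abs_ge_zero a[OF i]] in auto)
 qed
 have m: "(\<lambda>(x, w). cylinder_derivative N h f x w) \<in> borel_measurable M.pair_space" unfolding cylinder_derivative_def split_beta'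
  by (intro borel_measurable_sum borel_measurable_times measurable_compose[OF measurable_snd mh]
    measurable_compose[OF measurable_fst mv] bounded_smooth_partial[OF h]) simp
 have sh: "(\<lambda>i. pairing (shift x s w) (f i)) = (\<lambda>i. pairing w (f i) + s * f i x)" if "w \<in> marks" "0 < s" for w s x
  using pairing_shift[OF that(1) fs(2)] that(2) by (simp add: fun_eq_iff)
 have sm: "smooth_fun (\<lambda>x. pairing w (f i) + s * f i x)" for w s i by (intro smooth_fun_add smooth_fun_const smooth_fun_cmult fs)
 have "vderiv (\<lambda>x. h (\<lambda>i. pairing (shift x s w) (f i))) v x = s * cylinder_derivative N h f x (shift x s w)"
  if "w \<in> marks" "0 < s" for w s x
  unfolding cylinder_derivative_def sh[OF that] vderiv_bounded_smooth[OF h sm v_smooth] vderiv_affine[OF fs(1) v_smooth]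
  by (simp add: sum_distrib_left ac_simps)
 moreover have "smooth_fun (\<lambda>x. h (\<lambda>i. pairing (shift x s w) (f i)))" if "w \<in> marks" "0 < s" for w s
  unfolding sh[OF that] by (rule smooth_fun_bounded_smooth[OF h sm])
 moreover have "x \<notin> K ==> cylinder_derivative N h f x w = 0" for x w unfolding cylinder_derivative_def by (simp add: z)
 ultimately show ?thesis unfolding point_derivative_def using mh[OF h] m le bounded_smoothD(4)[OF h] by blast
qed

text \<open>Exchanging the two finite sums collects, for each argument of \<open>h\<close>, the
  pairing of \<open>w\<close> with \<open>vderiv (f i) v\<close>; atoms not seen by
  \<open>cutoff\<close> lie off \<open>K\<close> and contribute 0.\<close>

lemma gradient_cylinder:
 assumes f: "!!i. f i \<in> test_functions A" and w: "w \<in> marks"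
 shows "gradient (cylinder_derivative N h f) w =
  (\<Sum>i<N. seq_partial i h (\<lambda>i. pairing w (f i)) * pairing w (vderiv (f i) v))"
proof -
 let ?S = "atoms w cutoff"
 have fs: "smooth_fun (f i)" "csupp (f i)" for i using f[of i] unfolding test_iff by simp_all
 have "csupp cutoff" using cutoff(1) by (simp add: pos_tests_iff)
 from finite_marks[OF w this] have S: "finite ?S" .
 have "pairing w (vderiv (f i) v) = (\<Sum>x\<in>?S. w x * vderiv (f i) v x)" for i
 proof (rule pairing_eq_sum[OF S], rule subsetI)
  fix x assume x: "x \<in> {x. w x ~= 0 & vderiv (f i) v x ~= 0}"
  then have "x \<in> K" using vderiv_zero[OF fs(1) v_smooth v_zero] by blast
  then show "x \<in> ?S" using x cutoff_zero by blast
 qed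
 then show ?thesis unfolding gradient_def cylinder_derivative_def by (simp add: sum_distrib_left sum.swap[of _ _ ?S] ac_simps)
qed

end

section \<open>Transport along a flow\<close>

lemma measure_support_pos:
 assumes "sets \<tau> = sets (restrict_space borel {0<..})" "s \<in> measure_support \<tau>" shows "0 < s"
 using assms(2) sets_eq_imp_space_eq[OF assms(1)] unfolding measure_support_def by (simp add: space_restrict_space)

text \<open>Only finitely many atoms of \<open>w\<close> and \<open>w'\<close> are seen by
  \<open>e\<close>. A bump at \<open>x\<close> that avoids the others, multiplied by
  \<open>e\<close>, sees the mass at \<open>x\<close> alone.\<close>

lemma (in test_cone) marks_eqI:
 assumes w: "w \<in> marks" "w' \<in> marks" and eq: "!!f. f \<in> D ==> pairing w f = pairing w' f"
 shows "w = w'"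
proof
 fix x
 obtain e where e: "e \<in> D" "0 < e x" using bump[of UNIV x] by auto
 let ?T = "{y. w y ~= 0 & e y ~= 0} \<union> {y. w' y ~= 0 & e y ~= 0} - {x}"
 have T: "finite ?T" using finite_marks[OF w(1) csupp[OF e(1)]] finite_marks[OF w(2) csupp[OF e(1)]] by simp
 then have "open (- ?T)" by (intro open_Compl finite_imp_closed)
 then obtain f where f: "f \<in> D" "0 < f x" "{y. f y ~= 0} \<subseteq> - ?T" using bump[of "- ?T" x] by auto
 have z: "f y * e y = 0" if "y ~= x" "w y ~= 0 \<or> w' y ~= 0" for y using subsetD[OF f(3), of y] that by auto
 have "pairing w (\<lambda>y. f y * e y) = w x * (f x * e x)" by (subst pairing_eq_sum[of "{x}"]) (use z in auto)
 moreover have "pairing w' (\<lambda>y. f y * e y) = w' x * (f x * e x)" by (subst pairing_eq_sum[of "{x}"]) (use z in auto)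
 ultimately show "w x = w' x" using eq[OF mult[OF f(1) e(1)]] e(2) f(2) by simp
qed

section \<open>Mark functions as distributions\<close>

context riemannian_atlas begin

lemma csupp_test: "f \<in> test_functions A ==> csupp f" by (simp add: test_iff)

lemma test_lin: "f \<in> test_functions A ==> h \<in> test_functions A ==> (\<lambda>x. a * f x + b * h x) \<in> test_functions A" unfolding test_iff
 by (intro conjI smooth_fun_add smooth_fun_cmult csupp_add) (auto intro: csupp_subset)

definition distribution_of :: "('a => real) => ('a => real) => real" where
 "distribution_of w = restrict (pairing w) (test_functions A)"

lemma weighted_diracs_eq:
 "(!!x. x \<in> \<gamma> ==> s x ~= 0) ==> weighted_diracs A \<gamma> s id = distribution_of (\<lambda>x. if x \<in> \<gamma> then s x else 0)"
 unfolding weighted_diracs_def distribution_of_def pairing_def by (intro restrict_ext sum.cong) auto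

text \<open>The seminorm given by pairing \<open>w\<close> with the absolute value of
  \<open>f\<close> dominates the functional. Its balls are absolutely convex, and on functions
  supported in a fixed compact set it involves finitely many point values only.\<close>

lemma distribution_of_in:
 assumes w: "w \<in> marks" shows "distribution_of w \<in> distributions A" unfolding distributions_def
proof (intro CollectI conjI ballI allI impI)
 show "distribution_of w \<in> extensional (test_functions A)" by (simp add: distribution_of_def)
 show "distribution_of w (\<lambda>x. a * f x + b * h x) = a * distribution_of w f + b * distribution_of w h"
  if "f \<in> test_functions A" "h \<in> test_functions A" for f h a b
  using that test_lin[OF that] pairing_lin[OF w csupp_test csupp_test] by (simp add: distribution_of_def)
 fix e :: real assume e: "0 < e"
 let ?V = "{f \<in> test_functions A. pairing w (\<lambda>x. \<bar>f x\<bar>) < e}"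
 have ab: "csupp (\<lambda>x. \<bar>f x\<bar>)" if "f \<in> test_functions A" for f by (rule csupp_subset[OF csupp_test[OF that]]) simp
 have "test_nhd A ?V" unfolding test_nhd_def
 proof (intro conjI ballI allI impI)
  fix f h and a b :: real assume f: "f \<in> ?V" and h: "h \<in> ?V" and c: "\<bar>a\<bar> + \<bar>b\<bar> <= 1"
  let ?S = "atoms w f \<union> atoms w h"
  have S: "finite ?S" using finite_marks[OF w csupp_test] f h by simp
  have "pairing w (\<lambda>x. \<bar>a * f x + b * h x\<bar>) = (\<Sum>x\<in>?S. w x * \<bar>a * f x + b * h x\<bar>)" by (rule pairing_eq_sum[OF S]) auto
  also have "... <= (\<Sum>x\<in>?S. w x * (\<bar>a\<bar> * \<bar>f x\<bar> + \<bar>b\<bar> * \<bar>h x\<bar>))" by (intro sum_mono mult_left_mono marks_nonneg[OF w])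
    (simp add: abs_mult[symmetric] abs_triangle_ineq)
  also have "... = \<bar>a\<bar> * (\<Sum>x\<in>?S. w x * \<bar>f x\<bar>) + \<bar>b\<bar> * (\<Sum>x\<in>?S. w x * \<bar>h x\<bar>)"
   by (simp only: sum_distrib_left sum.distrib distrib_left ac_simps)
  also have "... = \<bar>a\<bar> * pairing w (\<lambda>x. \<bar>f x\<bar>) + \<bar>b\<bar> * pairing w (\<lambda>x. \<bar>h x\<bar>)"
   by (intro arg_cong2[where f="(+)"] arg_cong2[where f="(*)"] refl; rule pairing_eq_sum[OF S, symmetric]) auto
  also have "... <= \<bar>a\<bar> * max (pairing w (\<lambda>x. \<bar>f x\<bar>)) (pairing w (\<lambda>x. \<bar>h x\<bar>)) + \<bar>b\<bar> * max (pairing w (\<lambda>x. \<bar>f x\<bar>)) (pairing w (\<lambda>x. \<bar>h x\<bar>))"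
   by (intro add_mono mult_left_mono) auto
  also have "... <= 1 * max (pairing w (\<lambda>x. \<bar>f x\<bar>)) (pairing w (\<lambda>x. \<bar>h x\<bar>))" unfolding distrib_right[symmetric]
   by (rule mult_right_mono[OF c]) (simp add: le_max_iff_disj pairing_nonneg[OF w])
  also have "... < e" using f h by simp
  finally show "(\<lambda>x. a * f x + b * h x) \<in> ?V" using test_lin f h by simp
 next
  fix L :: "'a set" assume L: "compact L"
  let ?T = "{x. w x ~= 0} \<inter> L"
  have T: "finite ?T" using w L unfolding marks_def by simp
  obtain c where c: "!!x. c x \<in> A & x \<in> fst (c x)" using ex_chart by metis
  \<comment> \<open>For each atom in \<open>L\<close> a singleton with the empty list of
    derivatives, so that only values of \<open>f\<close> are controlled. The 1 in the denominator of
    \<open>?d\<close> covers the case without atoms and makes the final bound strict.\<close>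
  let ?S = "(\<lambda>x. (c x, {x}, [])) ` ?T" and ?d = "e / (1 + sum w ?T)"
  have pos: "0 <= sum w ?T" using marks_nonneg[OF w] by (intro sum_nonneg)
  have "{f \<in> test_functions A. closure {x. f x ~= 0} \<subseteq> L &
    (\<forall>(c, L, is)\<in>?S. \<forall>x\<in>L. \<bar>partials is (f \<circ> chart_inv c) (snd c x)\<bar> < ?d)} \<subseteq> ?V"
  proof safe
   fix f assume f: "f \<in> test_functions A" "closure {x. f x ~= 0} \<subseteq> L"
    and s: "\<forall>(c, L, is)\<in>?S. \<forall>x\<in>L. \<bar>partials is (f \<circ> chart_inv c) (snd c x)\<bar> < ?d"
   have le: "\<bar>f x\<bar> <= ?d" if x: "x \<in> ?T" for x
   proof -
    have "(c x, {x}, []) \<in> ?S" using x by (rule imageI)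
    from bspec[OF s this] have "\<bar>(f \<circ> chart_inv (c x)) (snd (c x) x)\<bar> < ?d" by simp
    then show ?thesis using inv_chart[of "c x" x] c[of x] by simp
   qed
   have "{x. f x ~= 0} \<subseteq> L" by (rule order_trans[OF closure_subset f(2)])
   then have "pairing w (\<lambda>x. \<bar>f x\<bar>) = (\<Sum>x\<in>?T. w x * \<bar>f x\<bar>)" by (intro pairing_eq_sum[OF T]) auto
   also have "... <= (\<Sum>x\<in>?T. w x * ?d)" by (intro sum_mono mult_left_mono le marks_nonneg[OF w])
   also have "... = sum w ?T * ?d" by (rule sum_distrib_right[symmetric])
   also have "... < e" using e pos by (simp add: field_simps)
   finally show "pairing w (\<lambda>x. \<bar>f x\<bar>) < e" .
  qed
  moreover have "finite ?S" "0 < ?d" "\<forall>(c, L, is)\<in>?S. c \<in> A & compact L & L \<subseteq> fst c" using T e pos c by auto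
  ultimately show "\<exists>S d. finite S & 0 < d & (\<forall>(c, L, is)\<in>S. c \<in> A & compact L & L \<subseteq> fst c) &
    {f \<in> test_functions A. closure {x. f x ~= 0} \<subseteq> L & (\<forall>(c, L, is)\<in>S. \<forall>x\<in>L. \<bar>partials is (f \<circ> chart_inv c) (snd c x)\<bar> < d)} \<subseteq> ?V"
   by (intro exI[of _ ?S] exI[of _ ?d] conjI)
 qed auto
 moreover have "\<bar>distribution_of w f\<bar> < e" if f: "f \<in> ?V" for f
 proof -
  have S: "finite (atoms w f)" using finite_marks[OF w csupp_test] f by simp
  have "\<bar>pairing w f\<bar> <= (\<Sum>x\<in>atoms w f. \<bar>w x * f x\<bar>)" unfolding pairing_def by (rule sum_abs)
  also have "... = pairing w (\<lambda>x. \<bar>f x\<bar>)" unfolding pairing_def by (intro sum.cong) (auto simp: abs_mult marks_nonneg[OF w])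
  finally show ?thesis using f by (simp add: distribution_of_def)
 qed
 ultimately show "\<exists>V. test_nhd A V & (\<forall>f\<in>V. \<bar>distribution_of w f\<bar> < e)" by blast
qed

lemma distribution_of_inject:
 assumes w: "w \<in> marks" "w' \<in> marks" and "distribution_of w = distribution_of w'"
 shows "w = w'"
proof -
 interpret test_cone pos_tests by (rule test_cone_pos_tests)
 have "pairing w f = pairing w' f" if "f \<in> pos_tests" for f
  using fun_cong[OF assms(3), of f] that by (simp add: distribution_of_def pos_tests_def)
 then show ?thesis by (rule marks_eqI[OF w])
qed

context
 fixes \<tau> :: "real measure"
 assumes sets_tau: "sets \<tau> = sets (restrict_space borel {0<..})"
begin

lemma extend_marks:
 assumes "\<gamma> \<in> configurations" "\<forall>x\<in>\<gamma>. s x \<in> measure_support \<tau>"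
 shows "(\<lambda>x. if x \<in> \<gamma> then s x else 0) \<in> marks" "weighted_diracs A \<gamma> s id = distribution_of (\<lambda>x. if x \<in> \<gamma> then s x else 0)"
  "{x. (if x \<in> \<gamma> then s x else 0) ~= 0} = \<gamma>"
proof -
 have p: "0 < s x" if "x \<in> \<gamma>" for x using measure_support_pos[OF sets_tau bspec[OF assms(2) that]] .
 show *: "{x. (if x \<in> \<gamma> then s x else 0) ~= 0} = \<gamma>" using p by force
 show "(\<lambda>x. if x \<in> \<gamma> then s x else 0) \<in> marks" unfolding marks_def mem_Collect_eq *
  using assms(1) p unfolding configurations_def by (auto intro: less_imp_le)
 show "weighted_diracs A \<gamma> s id = distribution_of (\<lambda>x. if x \<in> \<gamma> then s x else 0)" by (rule weighted_diracs_eq) (use p in force)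
qed

lemma marks_configuration: "w \<in> marks ==> {x. w x ~= 0} \<in> configurations" unfolding marks_def configurations_def by simp

text \<open>\<open>config_of\<close> and \<open>marks_of\<close> are definite descriptions. Marks in
  the support of \<open>\<tau>\<close> are positive, so a representation of the distribution amounts
  to a mark function, and injectivity of \<open>distribution_of\<close> gives uniqueness.\<close>

lemma distribution_of_compound:
 assumes w: "w \<in> marks" and s: "\<forall>x. w x ~= 0 --> w x \<in> measure_support \<tau>"
 shows "distribution_of w \<in> compound_configurations A \<tau>"
  and "config_of A \<tau> (distribution_of w) = {x. w x ~= 0}"
  and "marks_of A \<tau> (distribution_of w) = w"
proof -
 have eq: "distribution_of w = weighted_diracs A {x. w x ~= 0} w id"
  by (subst weighted_diracs_eq) (simp, rule arg_cong[where f=distribution_of], simp add: fun_eq_iff)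
 show "distribution_of w \<in> compound_configurations A \<tau>" unfolding compound_configurations_def
  by (intro CollectI conjI distribution_of_in[OF w] bexI[OF _ marks_configuration[OF w]] exI[of _ w] eq) (use s in simp)
 have uniq: "w = (\<lambda>x. if x \<in> \<gamma> then s x else 0) & \<gamma> = {x. w x ~= 0}"
  if a: "\<gamma> \<in> configurations" "\<forall>x\<in>\<gamma>. s x \<in> measure_support \<tau>" "distribution_of w = weighted_diracs A \<gamma> s id" for \<gamma> s
 proof -
  note e = extend_marks[OF a(1,2)]
  have "w = (\<lambda>x. if x \<in> \<gamma> then s x else 0)" by (rule distribution_of_inject[OF w e(1) trans[OF a(3) e(2)]])
  with e(3) show ?thesis by simp
 qed
 show c: "config_of A \<tau> (distribution_of w) = {x. w x ~= 0}" unfolding config_of_def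
 proof (rule the_equality)
  show "{x. w x ~= 0} \<in> configurations & (\<exists>s. (\<forall>x\<in>{x. w x ~= 0}. s x \<in> measure_support \<tau>) &
    distribution_of w = weighted_diracs A {x. w x ~= 0} s id)"
   by (intro conjI exI[of _ w] eq marks_configuration[OF w]) (use s in simp)
 qed (use uniq in blast)
 show "marks_of A \<tau> (distribution_of w) = w" unfolding marks_of_def c
 proof (rule the_equality)
  fix s' assume a: "(\<forall>x\<in>{x. w x ~= 0}. s' x \<in> measure_support \<tau>) & (\<forall>x. x \<notin> {x. w x ~= 0} --> s' x = 0) &
   distribution_of w = weighted_diracs A {x. w x ~= 0} s' id"
  then have "w = (\<lambda>x. if x \<in> {x. w x ~= 0} then s' x else 0)" using uniq[OF marks_configuration[OF w]] by blast
  then have "s' x = w x" for x using a fun_cong[of w "\<lambda>x. if x \<in> {x. w x ~= 0} then s' x else 0" x] by (cases "w x = 0") auto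
  then show "s' = w" by blast
 qed (use eq s in auto)
qed

lemma compound_configurationE:
 assumes "\<omega> \<in> compound_configurations A \<tau>"
 obtains w where "w \<in> marks" "\<forall>x. w x ~= 0 --> w x \<in> measure_support \<tau>" "\<omega> = distribution_of w"
proof -
 obtain \<gamma> s where a: "\<gamma> \<in> configurations" "\<forall>x\<in>\<gamma>. s x \<in> measure_support \<tau>" "\<omega> = weighted_diracs A \<gamma> s id"
  using assms unfolding compound_configurations_def by blast
 note e = extend_marks[OF a(1,2)]
 show ?thesis by (rule that[OF e(1)]) (use a e(2) in \<open>auto split: if_splits\<close>)
qed

lemma transport_distribution_of:
 assumes w: "w \<in> marks" and s: "\<forall>x. w x ~= 0 --> w x \<in> measure_support \<tau>"
 shows "transport A \<tau> p (distribution_of w) = (\<lambda>f\<in>test_functions A. pairing w (\<lambda>x. f (p x)))"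
 unfolding transport_def distribution_of_compound[OF w s] weighted_diracs_def pairing_def by simp

text \<open>The image is locally finite because \<open>p\<close> moves only points of the compact
  set \<open>L\<close>. Injectivity on the atoms matters: if two points met, their marks would add
  up, and the sum might leave the support of \<open>\<tau>\<close>.\<close>

lemma transport_compound:
 assumes w: "w \<in> marks" and s: "\<forall>x. w x ~= 0 --> w x \<in> measure_support \<tau>"
  and L: "compact L" "!!x. x \<notin> L ==> p x = x" and inj: "inj_on p {x. w x ~= 0}"
 shows "transport A \<tau> p (distribution_of w) \<in> compound_configurations A \<tau>"
proof -
 let ?\<gamma> = "{x. w x ~= 0}"
 let ?s = "\<lambda>y. w (inv_into ?\<gamma> p y)"
 let ?w = "\<lambda>y. if y \<in> p ` ?\<gamma> then ?s y else 0"
 have sp: "?s (p x) = w x" if "w x ~= 0" for x using inv_into_f_f[OF inj, of x] that by simp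
 have "p ` ?\<gamma> \<in> configurations" unfolding configurations_def
 proof (intro CollectI allI impI)
  fix M :: "'a set" assume M: "compact M"
  have "p ` ?\<gamma> \<inter> M \<subseteq> (?\<gamma> \<inter> M) \<union> p ` (?\<gamma> \<inter> L)" using L(2) by auto (metis (mono_tags) IntI image_eqI mem_Collect_eq)
  moreover have "finite ((?\<gamma> \<inter> M) \<union> p ` (?\<gamma> \<inter> L))" using w M L(1) unfolding marks_def by simp
  ultimately show "finite (p ` ?\<gamma> \<inter> M)" by (rule finite_subset)
 qed
 note e = extend_marks[OF this, of ?s]
 have ss: "?s y \<in> measure_support \<tau>" if "y \<in> p ` ?\<gamma>" for y using that sp s by auto
 have "(\<lambda>f\<in>test_functions A. pairing w (\<lambda>x. f (p x))) = distribution_of ?w" unfolding distribution_of_def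
 proof (rule restrict_ext)
  fix f :: "'a => real"
  have S: "{y. ?w y ~= 0 & f y ~= 0} = p ` {x. w x ~= 0 & f (p x) ~= 0}" using sp by auto
  show "pairing w (\<lambda>x. f (p x)) = pairing ?w f" unfolding pairing_def S by (subst sum.reindex[OF inj_on_subset[OF inj]]) (use sp in auto)
 qed
 moreover have "distribution_of ?w \<in> compound_configurations A \<tau>"
  by (rule distribution_of_compound(1)[OF e(1)]) (use ss in \<open>auto split: if_splits\<close>)
 ultimately show ?thesis unfolding transport_distribution_of[OF w s] by simp
qed

end

end

section \<open>Derivatives along the flow\<close>

context weighted_manifold begin

context
 fixes \<phi> assumes flow: "flow_of A v \<phi>"
begin

lemma flow_0: "\<phi> 0 x = x" and flow_continuous: "continuous_on UNIV (\<lambda>t. \<phi> t x)"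
 and flow_derivative: "c \<in> A ==> \<phi> t x \<in> fst c ==> ((\<lambda>s. snd c (\<phi> s x)) has_vector_derivative v (\<phi> t x) c) (at t)"
 using flow unfolding flow_of_def by blast+

lemma flow_open: "open U ==> open {t. \<phi> t x \<in> U}" using open_vimage[OF _ flow_continuous] unfolding vimage_def by simp

lemma flow_near: "open U ==> x \<in> U ==> \<forall>\<^sub>F t in nhds 0. \<phi> t x \<in> U"
 using eventually_nhds_in_open[OF flow_open[of U x], of 0] by (simp add: flow_0)

text \<open>The set of times at which the curve is at \<open>x\<close> is closed by continuity. It
  is open because, while the curve stays in a chart and off \<open>K\<close>, the field vanishes
  along it and its coordinates are constant. Connectedness of the real line does the rest.\<close>

lemma flow_fixed:
 assumes x: "x \<notin> K" shows "\<phi> t x = x"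
proof -
 let ?Z = "{t. \<phi> t x = x}"
 have "closed ?Z" using closed_vimage[OF closed_singleton[of x] flow_continuous] unfolding vimage_def by simp
 moreover have "open ?Z" unfolding open_contains_ball
 proof
  fix t0 assume t0: "t0 \<in> ?Z"
  obtain c where c: "c \<in> A" "x \<in> fst c" using ex_chart by blast
  have "open (fst c - K)" by (intro open_Diff open_dom[OF c(1)] compact_imp_closed compact_K)
  from flow_open[OF this, of x] have "open {t. \<phi> t x \<in> fst c - K}" .
  moreover have "t0 \<in> {t. \<phi> t x \<in> fst c - K}" using t0 c x by simp
  ultimately obtain e where e: "0 < e" "ball t0 e \<subseteq> {t. \<phi> t x \<in> fst c - K}" by (rule openE)
  have "\<exists>k. \<forall>s\<in>ball t0 e. snd c (\<phi> s x) = k"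
  proof (rule has_vector_derivative_zero_constant[OF convex_ball])
   fix s assume "s \<in> ball t0 e"
   then have "\<phi> s x \<in> fst c - K" using e(2) by blast
   then show "((\<lambda>s. snd c (\<phi> s x)) has_vector_derivative 0) (at s within ball t0 e)"
    using has_vector_derivative_at_within[OF flow_derivative[OF c(1), of s x]] v_zero[of "\<phi> s x"] by simp
  qed blast
  then obtain k where k: "!!s. s \<in> ball t0 e ==> snd c (\<phi> s x) = k" by blast
  have "ball t0 e \<subseteq> ?Z"
  proof
   fix s assume s: "s \<in> ball t0 e"
   then have 1: "\<phi> s x \<in> fst c" using e(2) by blast
   have "snd c (\<phi> s x) = snd c x" using k[OF s] k[of t0] e(1) t0 by simp
   then show "s \<in> ?Z" using inv_chart[OF c(1) 1] inv_chart[OF c] by simp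
  qed
  then show "\<exists>e>0. ball t0 e \<subseteq> ?Z" using e(1) by blast
 qed
 moreover have "0 \<in> ?Z" using flow_0 by simp
 ultimately have "?Z = UNIV" using connected_clopen[of "UNIV :: real set"] by auto
 then show ?thesis by blast
qed

lemma flow_vderiv:
 assumes f: "smooth_fun f"
 shows "((\<lambda>t. f (\<phi> t x)) has_real_derivative vderiv f v x) (at 0)"
proof -
 obtain c where c: "c \<in> A" "x \<in> fst c" using ex_chart by blast
 note d = flow_derivative[OF c(1), of 0 x, unfolded flow_0, OF c(2)]
 have f': "((\<lambda>y. f (chart_inv c y)) has_derivative frechet_derivative (\<lambda>y. f (chart_inv c y)) (at (snd c x))) (at (snd c (\<phi> 0 x)))"
  using smooth_fun_has_derivative[OF f c] by (simp add: flow_0)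
 have lin: "linear (frechet_derivative (\<lambda>y. f (chart_inv c y)) (at (snd c x)))"
  using smooth_fun_has_derivative[OF f c] by (rule has_derivative_linear)
 have "((\<lambda>t. f (chart_inv c (snd c (\<phi> t x)))) has_derivative (\<lambda>t. t * vderiv f v x)) (at 0)"
  using has_derivative_compose[OF d[unfolded has_vector_derivative_def] f']
  by (simp add: linear_cmul[OF lin] vderiv_frechet[OF f v_smooth c])
 then have "((\<lambda>t. f (\<phi> t x)) has_derivative (\<lambda>t. t * vderiv f v x)) (at 0)"
  by (rule has_derivative_transform_within_open[OF _ flow_open[OF open_dom[OF c(1)]]]) (use c flow_0 inv_chart[OF c(1)] in auto)
 then show ?thesis by (rule has_derivative_imp_has_field_derivative) simp
qed

text \<open>Atoms off \<open>K\<close> stay fixed, so for all times the pairing is a sum over one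
  finite set, the atoms in \<open>K\<close> or in the support of \<open>f\<close>, and it can be
  differentiated term by term.\<close>

lemma pairing_flow:
 assumes w: "w \<in> marks" and f: "f \<in> test_functions A"
 shows "((\<lambda>t. pairing w (\<lambda>x. f (\<phi> t x))) has_real_derivative pairing w (vderiv f v)) (at 0)"
proof -
 have fs: "smooth_fun f" using f by (simp add: test_iff)
 obtain L where L: "compact L" "{x. f x ~= 0} \<subseteq> L" using csupp_test[OF f] unfolding csupp_def by blast
 let ?S = "{x. w x ~= 0} \<inter> (K \<union> L)"
 have S: "finite ?S" using w compact_Un[OF compact_K L(1)] unfolding marks_def by blast
 have 1: "pairing w (\<lambda>x. f (\<phi> t x)) = (\<Sum>x\<in>?S. w x * f (\<phi> t x))" for t
 proof (rule pairing_eq_sum[OF S], rule subsetI)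
  fix x assume x: "x \<in> {x. w x ~= 0 & f (\<phi> t x) ~= 0}"
  then have "x \<in> K \<or> x \<in> L" using flow_fixed[of x t] L(2) by (cases "x \<in> K") auto
  then show "x \<in> ?S" using x by blast
 qed
 have 2: "pairing w (vderiv f v) = (\<Sum>x\<in>?S. w x * vderiv f v x)"
 proof (rule pairing_eq_sum[OF S], rule subsetI)
  fix x assume x: "x \<in> {x. w x ~= 0 & vderiv f v x ~= 0}"
  then have "x \<in> K" using vderiv_zero[OF fs v_smooth v_zero] by blast
  then show "x \<in> ?S" using x by blast
 qed
 show ?thesis unfolding 1 2 by (intro DERIV_sum DERIV_cmult flow_vderiv[OF fs])
qed

text \<open>Only the finitely many atoms in \<open>K\<close> can move. For small times they keep
  apart by the Hausdorff property and reach no fixed atom, because the atoms are discrete. The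
  length of the time interval depends on \<open>w\<close>, which is good enough for a derivative at
  0.\<close>

lemma flow_injective_near:
 assumes w: "w \<in> marks"
 shows "\<forall>\<^sub>F t in nhds 0. inj_on (\<phi> t) {x. w x ~= 0}"
proof -
 let ?\<gamma> = "{x. w x ~= 0}"
 let ?T = "?\<gamma> \<inter> K"
 have T: "finite ?T" using w compact_K unfolding marks_def by blast
 have 1: "\<forall>\<^sub>F t in nhds 0. \<phi> t x \<notin> ?\<gamma> - K" if x: "x \<in> ?T" for x
 proof -
  obtain e L where e: "0 < e x" "compact L" "{y. e y ~= 0} \<subseteq> L" "smooth_fun e" using bump_exists[of UNIV x] by auto
  let ?U = "{y. 0 < e y} - (?\<gamma> \<inter> L - {x})"
  have "finite (?\<gamma> \<inter> L - {x})" using w e(2) unfolding marks_def by simp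
  then have "open ?U" by (intro open_Diff finite_imp_closed open_Collect_less smooth_fun_continuous continuous_on_const e(4))
  then have "\<forall>\<^sub>F t in nhds 0. \<phi> t x \<in> ?U" by (rule flow_near) (use e(1) in simp)
  then show ?thesis
  proof eventually_elim
   case (elim t)
   then have "\<phi> t x \<in> L" using subsetD[OF e(3), of "\<phi> t x"] by simp
   then have "\<phi> t x \<notin> ?\<gamma> \<or> \<phi> t x = x" using elim by blast
   then show ?case using x by auto
  qed
 qed
 have 2: "\<forall>\<^sub>F t in nhds 0. x ~= y --> \<phi> t x ~= \<phi> t y" for x y
 proof (cases "x = y")
  case False
  obtain U V where U: "open U" "open V" "x \<in> U" "y \<in> V" "U \<inter> V = {}" using hausdorff[OF False] by metis
  show ?thesis using flow_near[OF U(1,3)] flow_near[OF U(2,4)] by eventually_elim (use U(5) in auto)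
 qed simp
 have "\<forall>\<^sub>F t in nhds 0. \<forall>x\<in>?T. \<phi> t x \<notin> ?\<gamma> - K" by (rule eventually_ball_finite[OF T], rule ballI, rule 1)
 moreover have "\<forall>\<^sub>F t in nhds 0. \<forall>x\<in>?T. \<forall>y\<in>?T. x ~= y --> \<phi> t x ~= \<phi> t y"
  by (rule eventually_ball_finite[OF T], rule ballI, rule eventually_ball_finite[OF T], rule ballI, rule 2)
 ultimately show ?thesis
 proof eventually_elim
  case (elim t)
  show ?case
  proof (rule inj_onI)
   fix x y assume a: "x \<in> ?\<gamma>" "y \<in> ?\<gamma>" "\<phi> t x = \<phi> t y"
   show "x = y"
   proof (cases "x \<in> K"; cases "y \<in> K")
    assume "x \<in> K" "y \<in> K" then show ?thesis using a elim(2) by blast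
   next
    assume *: "x \<in> K" "y \<notin> K"
    then have "\<phi> t x = y" using a(3) flow_fixed[OF *(2)] by simp
    moreover have "\<phi> t x \<notin> ?\<gamma> - K" using elim(1) a(1) *(1) by blast
    ultimately show ?thesis using a(2) *(2) by blast
   next
    assume *: "x \<notin> K" "y \<in> K"
    then have "\<phi> t y = x" using a(3) flow_fixed[OF *(1)] by simp
    moreover have "\<phi> t y \<notin> ?\<gamma> - K" using elim(1) a(2) *(2) by blast
    ultimately show ?thesis using a(1) *(1) by blast
   next
    assume "x \<notin> K" "y \<notin> K" then show ?thesis using a(3) flow_fixed by simp
   qed
  qed
 qed
qed

text \<open>\<open>F\<close> is described by \<open>h\<close> on compound configurations only, so
  the transported configuration has to remain one for small times before the chain rule and
  \<open>pairing_flow\<close> can be used.\<close>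

lemma directional_derivative_cylinder:
 assumes tau: "sets \<tau> = sets (restrict_space borel {0<..})"
  and w: "w \<in> marks" "\<forall>x. w x ~= 0 --> w x \<in> measure_support \<tau>"
  and h: "h \<in> bounded_smooth N" and f: "!!i. f i \<in> test_functions A"
  and F: "\<forall>\<omega>\<in>compound_configurations A \<tau>. F \<omega> = h (\<lambda>i. \<omega> (f i))"
 shows "((\<lambda>t. F (transport A \<tau> (\<phi> t) (distribution_of w))) has_real_derivative
  (\<Sum>i<N. seq_partial i h (\<lambda>i. pairing w (f i)) * pairing w (vderiv (f i) v))) (at 0)"
proof -
 have "((\<lambda>t. h (\<lambda>i. pairing w (\<lambda>x. f i (\<phi> t x)))) has_derivative
   (\<lambda>t. \<Sum>i<N. seq_partial i h (\<lambda>i. pairing w (\<lambda>x. f i (\<phi> 0 x))) * (pairing w (vderiv (f i) v) * t))) (at 0)"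
  by (rule has_derivative_bounded_smooth[OF h]) (use pairing_flow[OF w(1) f] in \<open>simp add: has_field_derivative_def\<close>)
 then have *: "((\<lambda>t. h (\<lambda>i. pairing w (\<lambda>x. f i (\<phi> t x)))) has_real_derivative
   (\<Sum>i<N. seq_partial i h (\<lambda>i. pairing w (f i)) * pairing w (vderiv (f i) v))) (at 0)"
  by (rule has_derivative_imp_has_field_derivative) (simp add: flow_0 sum_distrib_left ac_simps)
 have ev: "\<forall>\<^sub>F t in nhds 0. F (transport A \<tau> (\<phi> t) (distribution_of w)) = h (\<lambda>i. pairing w (\<lambda>x. f i (\<phi> t x)))"
  using flow_injective_near[OF w(1)]
 proof eventually_elim
  case (elim t)
  have "transport A \<tau> (\<phi> t) (distribution_of w) \<in> compound_configurations A \<tau>"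
   by (rule transport_compound[OF tau w compact_K flow_fixed elim])
  then show ?case using F f by (simp add: transport_distribution_of[OF tau w])
 qed
 show ?thesis using * DERIV_cong_ev[OF refl ev refl] by blast
qed

end

end

section \<open>The compound Poisson measure on distributions\<close>

locale compound_poisson_manifold = weighted_manifold A g m \<rho> R v
 for A :: "('a::{second_countable_topology,t2_space}, 'n::finite) chart set" and g :: "('a, 'n) metric"
  and m :: "'a measure" and \<rho> :: "'a => real" and R :: "'a => ('a, 'n) tangent" and v :: "'a => ('a, 'n) tangent" +
 fixes \<tau> :: "real measure" and P :: "(('a => real) => real) measure" and \<phi> :: "real => 'a => 'a"
 assumes tau_finite: "finite_measure \<tau>" "sets \<tau> = sets (restrict_space borel {0<..})"
  and tau_moments: "\<exists>C>0. \<forall>n\<ge>1. (\<integral>\<^sup>+ s. ennreal (s ^ n) \<partial>\<tau>) < ennreal (C ^ n * fact n)"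
  and poisson: "compound_poisson A \<sigma> \<tau> P"
  and poisson_support: "emeasure P (compound_configurations A \<tau>) = 1"
  and flow: "flow_of A v \<phi>"
begin

abbreviation "\<Omega> \<equiv> compound_configurations A \<tau>"

abbreviation "P\<Omega> \<equiv> restrict_space P \<Omega>"

abbreviation "mark_sigma \<equiv> test_cone.mark_space pos_tests"

sublocale P: prob_space P using poisson unfolding compound_poisson_def by blast

lemma sets_P: "sets P = sets (distribution_space A)" using poisson unfolding compound_poisson_def by blast

lemma Omega_sets: "\<Omega> \<in> sets P" using poisson_support emeasure_notin_sets[of \<Omega> P] by force

lemma space_POmega: "space P\<Omega> = \<Omega>" using Omega_sets by simp

lemma AE_Omega: "AE \<omega> in P. \<omega> \<in> \<Omega>" using P.AE_in_set_eq_1[OF Omega_sets] poisson_support by (simp add: measure_def)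

sublocale PO: prob_space P\<Omega> by (rule prob_spaceI) (simp add: emeasure_restrict_space Omega_sets poisson_support)

lemma measurable_evaluation: "f \<in> test_functions A ==> (\<lambda>\<omega>. \<omega> f) \<in> borel_measurable P"
 unfolding measurable_cong_sets[OF sets_P refl] distribution_space_def by (intro measurable_restrict_space1 measurable_component_singleton)

lemma measurable_evaluation_Omega: "f \<in> test_functions A ==> (\<lambda>\<omega>. \<omega> f) \<in> borel_measurable P\<Omega>"
 by (rule measurable_restrict_space1[OF measurable_evaluation])

lemma marks_of_Omega:
 assumes "\<omega> \<in> \<Omega>"
 shows "marks_of A \<tau> \<omega> \<in> marks" "\<omega> = distribution_of (marks_of A \<tau> \<omega>)"
  "\<forall>x. marks_of A \<tau> \<omega> x ~= 0 --> marks_of A \<tau> \<omega> x \<in> measure_support \<tau>"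
  "config_of A \<tau> \<omega> = {x. marks_of A \<tau> \<omega> x ~= 0}"
  "f \<in> test_functions A ==> \<omega> f = pairing (marks_of A \<tau> \<omega>) f"
proof -
 obtain w where w: "w \<in> marks" "\<forall>x. w x ~= 0 --> w x \<in> measure_support \<tau>" "\<omega> = distribution_of w"
  using assms by (rule compound_configurationE[OF tau_finite(2)])
 note c = distribution_of_compound[OF tau_finite(2) w(1,2), folded w(3)]
 show "marks_of A \<tau> \<omega> \<in> marks" "\<omega> = distribution_of (marks_of A \<tau> \<omega>)"
  "\<forall>x. marks_of A \<tau> \<omega> x ~= 0 --> marks_of A \<tau> \<omega> x \<in> measure_support \<tau>"
  "config_of A \<tau> \<omega> = {x. marks_of A \<tau> \<omega> x ~= 0}"
  "f \<in> test_functions A ==> \<omega> f = pairing (marks_of A \<tau> \<omega>) f" using c w by (simp_all add: distribution_of_def)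
qed

lemma measurable_marks_of: "marks_of A \<tau> \<in> measurable P\<Omega> mark_sigma"
proof -
 interpret test_cone pos_tests by (rule test_cone_pos_tests)
 show ?thesis
 proof (rule measurable_mark_spaceI)
  fix f assume "f \<in> pos_tests"
  then have f: "f \<in> test_functions A" by (simp add: pos_tests_def)
  show "(\<lambda>\<omega>. pairing (marks_of A \<tau> \<omega>) f) \<in> borel_measurable P\<Omega>" using measurable_evaluation_Omega[OF f] marks_of_Omega(5)[OF _ f]
   by (subst measurable_cong[where g="\<lambda>\<omega>. \<omega> f"]) (simp_all add: space_POmega)
 qed (use marks_of_Omega(1) space_POmega in simp)
qed

definition "mark_law = distr P\<Omega> mark_sigma (marks_of A \<tau>)"

text \<open>\<open>\<tau>\<close> is a measure on the open half line as a space of its own; its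
  image on the real line has the sigma-algebra that \<open>compound_poisson_marks\<close> asks
  for.\<close>

definition "jump_law = distr \<tau> borel (\<lambda>s. s)"

lemma space_tau: "space \<tau> = {0<..}" using sets_eq_imp_space_eq[OF tau_finite(2)] by (simp add: space_restrict_space)

lemma measurable_tau: "(\<lambda>s. s) \<in> borel_measurable \<tau>"
 unfolding measurable_cong_sets[OF tau_finite(2) refl] by (rule measurable_restrict_space1) simp

lemma nn_integral_jump_law: "f \<in> borel_measurable borel ==> (\<integral>\<^sup>+s. f s \<partial>jump_law) = (\<integral>\<^sup>+s. f s \<partial>\<tau>)"
 unfolding jump_law_def by (rule nn_integral_distr[OF measurable_tau]) simp

lemma moment_finite: "1 <= n ==> (\<integral>\<^sup>+s. ennreal (s ^ n) \<partial>jump_law) < \<infinity>"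
 using tau_moments nn_integral_jump_law[of "\<lambda>s. ennreal (s ^ n)"] order_less_trans[OF _ ennreal_less_top] by force

text \<open>The prescribed transform is used at \<open>- f\<close>. For positive \<open>s\<close>
  the integrand there lies between -1 and 0 and vanishes outside the compact support of
  \<open>f\<close>, so it is integrable, as \<open>\<tau>\<close> is finite, and the finite branch
  of \<open>compound_poisson\<close> applies.\<close>

lemma mark_law_laplace:
 assumes f: "f \<in> pos_tests"
 shows "(\<integral>\<^sup>+w. ennreal (exp (- pairing w f)) \<partial>mark_law) =
  ennreal (exp (- enn2real (\<integral>\<^sup>+x. \<integral>\<^sup>+s. ennreal (1 - exp (- (s * f x))) \<partial>jump_law \<partial>\<sigma>)))"
proof -
 interpret C: test_cone pos_tests by (rule test_cone_pos_tests)
 interpret T: finite_measure \<tau> by (rule tau_finite(1))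
 have ft: "f \<in> test_functions A" "!!x. 0 <= f x" using f by (simp_all add: pos_tests_def)
 have fm[measurable]: "f \<in> borel_measurable borel" using f by (rule C.measurable_test)
 have nft: "(\<lambda>x. - f x) \<in> test_functions A" using test_lin[OF ft(1) ft(1), of "-1" 0] by simp
 obtain L where L: "compact L" "{x. f x ~= 0} \<subseteq> L" using csupp_test[OF ft(1)] unfolding csupp_def by blast
 have Ls: "L \<in> sets \<sigma>" using L(1) by (simp add: sets_sigma compact_imp_closed)
 note [measurable] = measurable_tau
 have sm[measurable_cong]: "sets \<sigma> = sets borel" by (rule sets_sigma)
 let ?G = "\<lambda>(x, s). exp (s * - f x) - 1"
 have Gm: "?G \<in> borel_measurable (\<sigma> \<Otimes>\<^sub>M \<tau>)" unfolding split_beta'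
  by (intro borel_measurable_diff borel_measurable_exp borel_measurable_times borel_measurable_uminus borel_measurable_const
    measurable_compose[OF measurable_snd measurable_tau] measurable_compose[OF measurable_fst]) simp
 have le1: "0 <= 1 - exp (- (s * f x)) & 1 - exp (- (s * f x)) <= indicator L x" if "0 < s" for s x
  using ft(2)[of x] that subsetD[OF L(2), of x] by (cases "f x = 0") (auto split: split_indicator)
 have le2: "\<bar>1 - exp (- (s * f x))\<bar> <= 1" if "0 < s" for s x
  using ft(2)[of x] that by (simp add: abs_le_iff mult_nonneg_nonneg add_increasing)
 have fin: "(\<integral>\<^sup>+x. \<integral>\<^sup>+s. ennreal (1 - exp (- (s * f x))) \<partial>\<tau> \<partial>\<sigma>) < \<infinity>"
 proof -
  have "(\<integral>\<^sup>+x. \<integral>\<^sup>+s. ennreal (1 - exp (- (s * f x))) \<partial>\<tau> \<partial>\<sigma>) <= (\<integral>\<^sup>+x. \<integral>\<^sup>+s. indicator L x \<partial>\<tau> \<partial>\<sigma>)"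
   by (intro nn_integral_mono) (use le1 in \<open>auto simp: space_tau ennreal_indicator[symmetric] intro!: ennreal_leI simp del: ennreal_indicator\<close>)
  also have "... = emeasure \<tau> (space \<tau>) * emeasure \<sigma> L" using Ls by (simp add: nn_integral_multc mult.commute)
  also have "... < \<infinity>" using T.emeasure_finite[of "space \<tau>", unfolded infinity_ennreal_def less_top] sigma_finite_compact[OF L(1)]
   by (simp add: ennreal_mult_less_top)
  finally show ?thesis .
 qed
 have absG: "ennreal (norm (?G (x, s))) = ennreal (1 - exp (- (s * f x)))" if "0 < s" for s x
 proof -
  have "\<bar>- (1 - exp (- (s * f x)))\<bar> = 1 - exp (- (s * f x))"
   unfolding abs_minus_cancel by (rule abs_of_nonneg) (use le1[OF that] in blast)
  then show ?thesis by simp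
 qed
 have int: "integrable (\<sigma> \<Otimes>\<^sub>M \<tau>) ?G"
 proof (rule integrableI_bounded[OF Gm])
  have "(\<integral>\<^sup>+p. ennreal (norm (?G p)) \<partial>(\<sigma> \<Otimes>\<^sub>M \<tau>)) = (\<integral>\<^sup>+x. \<integral>\<^sup>+s. ennreal (norm (?G (x, s))) \<partial>\<tau> \<partial>\<sigma>)"
   by (rule T.nn_integral_fst[symmetric]) (use Gm in measurable)
  also have "... = (\<integral>\<^sup>+x. \<integral>\<^sup>+s. ennreal (1 - exp (- (s * f x))) \<partial>\<tau> \<partial>\<sigma>)" by (intro nn_integral_cong absG) (simp add: space_tau)
  finally show "(\<integral>\<^sup>+p. ennreal (norm (?G p)) \<partial>(\<sigma> \<Otimes>\<^sub>M \<tau>)) < \<infinity>" using fin by simp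
 qed
 \<comment> \<open>The inner integral as a nonnegative real function, which links the Bochner
   integrals in \<open>compound_poisson\<close> to the nonnegative integrals in the claim.\<close>
 define q where "q x = (LINT s|\<tau>. 1 - exp (- (s * f x)))" for x
 have q: "(\<integral>\<^sup>+s. ennreal (1 - exp (- (s * f x))) \<partial>\<tau>) = ennreal (q x)" for x unfolding q_def
  by (intro nn_integral_eq_integral T.integrable_const_bound[where B=1] AE_I2) (use le1 le2 in \<open>auto simp: space_tau\<close>)
 have q0: "0 <= q x" for x unfolding q_def by (intro integral_nonneg_AE AE_I2) (use le1 in \<open>auto simp: space_tau\<close>)
 have qm: "q \<in> borel_measurable \<sigma>"
 proof -
  have "(\<lambda>(x, s). 1 - exp (- (s * f x))) \<in> borel_measurable (\<sigma> \<Otimes>\<^sub>M \<tau>)" using borel_measurable_uminus[OF Gm] by (simp add: split_beta')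
  from T.borel_measurable_lebesgue_integral[OF this] show ?thesis unfolding q_def[abs_def] .
 qed
 have "(LINT x|\<sigma>. LINT s|\<tau>. exp (s * - f x) - 1) = (LINT x|\<sigma>. - q x)" unfolding q_def by (simp flip: integral_minus)
 also have "... = - enn2real (\<integral>\<^sup>+x. ennreal (q x) \<partial>\<sigma>)" using qm q0 by (simp add: integral_eq_nn_integral)
 finally have I: "(LINT x|\<sigma>. LINT s|\<tau>. exp (s * - f x) - 1) = - enn2real (\<integral>\<^sup>+x. \<integral>\<^sup>+s. ennreal (1 - exp (- (s * f x))) \<partial>jump_law \<partial>\<sigma>)"
  using q by (simp add: nn_integral_jump_law)
 have "(\<integral>\<^sup>+w. ennreal (exp (- pairing w f)) \<partial>mark_law) = (\<integral>\<^sup>+\<omega>. ennreal (exp (- pairing (marks_of A \<tau> \<omega>) f)) \<partial>P\<Omega>)" unfolding mark_law_def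
  by (rule nn_integral_distr[OF measurable_marks_of]) (use C.measurable_pairing[OF f] in measurable)
 also have "... = (\<integral>\<^sup>+\<omega>. ennreal (exp (- pairing (marks_of A \<tau> \<omega>) f)) * indicator \<Omega> \<omega> \<partial>P)"
  by (rule nn_integral_restrict_space) (simp add: Omega_sets)
 also have "... = (\<integral>\<^sup>+\<omega>. ennreal (exp (\<omega> (\<lambda>x. - f x))) \<partial>P)"
 proof (rule nn_integral_cong_AE, rule AE_mp[OF AE_Omega], rule AE_I2, rule impI)
  fix \<omega> assume \<omega>: "\<omega> \<in> \<Omega>"
  have "\<omega> (\<lambda>x. - f x) = - pairing (marks_of A \<tau> \<omega>) f" unfolding marks_of_Omega(5)[OF \<omega> nft]
   using pairing_scale[OF marks_of_Omega(1)[OF \<omega>] csupp_test[OF ft(1)], of "-1"] by simp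
  then show "ennreal (exp (- pairing (marks_of A \<tau> \<omega>) f)) * indicator \<Omega> \<omega> = ennreal (exp (\<omega> (\<lambda>x. - f x)))" using \<omega> by simp
 qed
 also have "... = ennreal (exp (LINT x|\<sigma>. LINT s|\<tau>. exp (s * - f x) - 1))" using poisson nft int unfolding compound_poisson_def by simp
 finally show ?thesis unfolding I .
qed

sublocale poisson_manifold A g m \<rho> R v mark_law jump_law
proof -
 interpret T: finite_measure \<tau> by (rule tau_finite(1))
 interpret C: test_cone pos_tests by (rule test_cone_pos_tests)
 interpret L: prob_space mark_law unfolding mark_law_def by (rule PO.prob_space_distr[OF measurable_marks_of])
 interpret J: finite_measure jump_law unfolding jump_law_def by (rule T.finite_measure_distr[OF measurable_tau])
 show "poisson_manifold A g m \<rho> R v mark_law jump_law"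
 proof unfold_locales
  show "AE s in jump_law. 0 < s" unfolding jump_law_def using measurable_tau by (subst AE_distr_iff) (auto simp: space_tau)
  show "(\<integral>\<^sup>+s. ennreal s \<partial>jump_law) < \<infinity>" "(\<integral>\<^sup>+s. ennreal (s\<^sup>2) \<partial>jump_law) < \<infinity>" using moment_finite[of 1] moment_finite[of 2] by simp_all
 qed (simp_all add: mark_law_def[THEN arg_cong[where f=sets]] jump_law_def[THEN arg_cong[where f=sets]]
   sets_sigma sigma_finite_compact[unfolded infinity_ennreal_def] sigma_nonatomic mark_law_laplace)
qed

section \<open>Cylinder functions under the compound Poisson law\<close>

abbreviation "nabla \<equiv> directional_derivative A \<tau> \<phi>"

text \<open>Read through \<open>marks_of\<close>, a cylinder function becomes a function of the mark
  function with a point derivative, and \<open>nabla\<close> becomes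
  \<open>gradient\<close>.\<close>

lemma cylinderE:
 assumes "F \<in> cylinder_functions A \<tau>"
 obtains \<Phi> D where "point_derivative \<Phi> D" "\<forall>\<omega>\<in>\<Omega>. F \<omega> = \<Phi> (marks_of A \<tau> \<omega>)"
  "\<forall>\<omega>\<in>\<Omega>. ((\<lambda>t. F (transport A \<tau> (\<phi> t) \<omega>)) has_real_derivative gradient D (marks_of A \<tau> \<omega>)) (at 0)"
  "\<forall>\<omega>\<in>\<Omega>. nabla F \<omega> = gradient D (marks_of A \<tau> \<omega>)"
proof -
 obtain N f' h where h: "h \<in> bounded_smooth N" and f': "\<forall>i<N. f' i \<in> test_functions A"
  and F': "\<forall>\<omega>\<in>\<Omega>. F \<omega> = h (\<lambda>i. \<omega> (f' i))" using assms unfolding cylinder_functions_def mem_Collect_eq by (elim exE bexE conjE)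
 \<comment> \<open>The arguments from index \<open>N\<close> on are arbitrary. Since
   \<open>h\<close> depends only on the first \<open>N\<close> entries they may be replaced by 0,
   after which every member of the family is a test function.\<close>
 define f where "f i = (if i < N then f' i else (\<lambda>_. 0))" for i
 have "(\<lambda>_. 0) \<in> test_functions A" unfolding test_iff using smooth_fun_const by (simp add: csupp_def) blast
 then have f: "f i \<in> test_functions A" for i by (simp add: f_def f')
 have F: "\<forall>\<omega>\<in>\<Omega>. F \<omega> = h (\<lambda>i. \<omega> (f i))"
 proof
  fix \<omega> assume "\<omega> \<in> \<Omega>"
  then have "F \<omega> = h (\<lambda>i. \<omega> (f' i))" using F' by blast
  also have "... = h (\<lambda>i. \<omega> (f i))" by (rule bounded_smoothD(1)[OF h]) (simp add: f_def)
  finally show "F \<omega> = h (\<lambda>i. \<omega> (f i))" .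
 qed
 have d: "((\<lambda>t. F (transport A \<tau> (\<phi> t) \<omega>)) has_real_derivative
   gradient (cylinder_derivative N h f) (marks_of A \<tau> \<omega>)) (at 0)" if "\<omega> \<in> \<Omega>" for \<omega>
 proof -
  note mk = marks_of_Omega[OF that]
  show ?thesis unfolding gradient_cylinder[OF f mk(1)]
   using directional_derivative_cylinder[OF flow tau_finite(2) mk(1,3) h f F] mk(2) by simp
 qed
 show ?thesis
 proof (rule that[OF point_derivative_cylinder[OF h f]])
  show "\<forall>\<omega>\<in>\<Omega>. F \<omega> = h (\<lambda>i. pairing (marks_of A \<tau> \<omega>) (f i))" using F marks_of_Omega(5)[OF _ f] by simp
  show "\<forall>\<omega>\<in>\<Omega>. ((\<lambda>t. F (transport A \<tau> (\<phi> t) \<omega>)) has_real_derivative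
    gradient (cylinder_derivative N h f) (marks_of A \<tau> \<omega>)) (at 0)" using d by blast
  then show "\<forall>\<omega>\<in>\<Omega>. nabla F \<omega> = gradient (cylinder_derivative N h f) (marks_of A \<tau> \<omega>)"
   by (simp add: directional_derivative_def DERIV_imp_deriv)
 qed
qed

abbreviation "B \<equiv> poisson_log_derivative A g \<tau> \<rho> R v"

lemma B_eq:
 assumes "\<omega> \<in> \<Omega>" shows "B \<omega> = beta_sum (marks_of A \<tau> \<omega>)"
proof -
 note w = marks_of_Omega[OF assms]
 have "csupp cutoff" using cutoff(1) by (simp add: pos_tests_iff)
 from finite_marks[OF w(1) this] show ?thesis unfolding poisson_log_derivative_def config_pairing_def beta_sum_def w(4) \<beta>_def[symmetric]
  by (rule sum.mono_neutral_left) (use beta_zero cutoff_zero in auto)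
qed

text \<open>Integrals over \<open>\<Omega>\<close> pass to the image measure on mark functions.
  Agreement is asked for on \<open>\<Omega>\<close> only, because elsewhere the values of a cylinder
  function are arbitrary.\<close>

lemma transfer:
 fixes F :: "(('a => real) => real) => real"
 assumes F: "!!\<omega>. \<omega> \<in> \<Omega> ==> F \<omega> = \<Phi> (marks_of A \<tau> \<omega>)" and \<Phi>: "\<Phi> \<in> borel_measurable mark_law"
 shows "F \<in> borel_measurable P\<Omega>" "integrable mark_law \<Phi> ==> integrable P\<Omega> F"
  "(LINT \<omega>|P\<Omega>. F \<omega>) = (LINT w|mark_law. \<Phi> w)"
proof -
 have \<Phi>': "\<Phi> \<in> borel_measurable mark_sigma" using \<Phi> by (simp add: mark_law_def)
 have *: "(\<lambda>\<omega>. \<Phi> (marks_of A \<tau> \<omega>)) \<in> borel_measurable P\<Omega>" by (rule measurable_compose[OF measurable_marks_of \<Phi>'])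
 show "F \<in> borel_measurable P\<Omega>" by (subst measurable_cong[OF F]) (simp_all add: space_POmega *)
 show "integrable P\<Omega> F" if "integrable mark_law \<Phi>" using integrable_distr[OF measurable_marks_of that[unfolded mark_law_def]]
  by (subst Bochner_Integration.integrable_cong[OF refl F]) (simp_all add: space_POmega)
 show "(LINT \<omega>|P\<Omega>. F \<omega>) = (LINT w|mark_law. \<Phi> w)" unfolding mark_law_def integral_distr[OF measurable_marks_of \<Phi>']
  by (rule Bochner_Integration.integral_cong) (simp_all add: space_POmega F)
qed

lemma mark_measurable: "f \<in> borel_measurable mark_sigma ==> f \<in> borel_measurable mark_law" for f :: "_ => real" by (simp add: mark_law_def)

lemma square_integrable_bounded:
 assumes "point_derivative \<Phi> D" shows "integrable mark_law (\<lambda>w. (\<Phi> w)\<^sup>2)"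
proof -
 obtain C where C: "!!w. w \<in> marks ==> \<bar>\<Phi> w\<bar> <= C" using point_derivativeD(2)[OF assms] by auto
 show ?thesis
 proof (rule M.P.integrable_const_bound[where B="C\<^sup>2"])
  show "(\<lambda>w. (\<Phi> w)\<^sup>2) \<in> borel_measurable mark_law" using mark_measurable[OF point_derivativeD(1)[OF assms]] by measurable
  show "AE w in mark_law. norm ((\<Phi> w)\<^sup>2) <= C\<^sup>2" by (rule AE_I2) (use power_mono[OF C abs_ge_zero, of _ 2] in simp)
 qed
qed

lemma cylinder_square_integrable:
 assumes F: "F \<in> cylinder_functions A \<tau>"
 shows "square_integrable P\<Omega> F" "square_integrable P\<Omega> (nabla F)"
proof -
 obtain \<Phi> D where D: "point_derivative \<Phi> D" and e: "\<forall>\<omega>\<in>\<Omega>. F \<omega> = \<Phi> (marks_of A \<tau> \<omega>)"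
  and n: "\<forall>\<omega>\<in>\<Omega>. nabla F \<omega> = gradient D (marks_of A \<tau> \<omega>)" by (rule cylinderE[OF F])
 note m1 = mark_measurable[OF point_derivativeD(1)[OF D]] and m2 = gradient_measurable[OF D]
 show "square_integrable P\<Omega> F" unfolding square_integrable_def
  by (intro conjI transfer(1)[OF bspec[OF e] m1] transfer(2)[OF _ _ square_integrable_bounded[OF D]]) (use m1 e in auto)
 show "square_integrable P\<Omega> (nabla F)" unfolding square_integrable_def
  by (intro conjI transfer(1)[OF bspec[OF n] m2] transfer(2)[OF _ _ gradient_square_integrable[OF D]]) (use m2 n in auto)
qed

lemma B_square_integrable: "square_integrable P\<Omega> B" unfolding square_integrable_def
 by (intro conjI transfer(1)[OF B_eq beta_sum_measurable] transfer(2)[OF _ _ beta_sum_square_integrable])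
  (use B_eq beta_sum_measurable in auto)

lemma integrable_product: "square_integrable M f ==> square_integrable M h ==> integrable M (\<lambda>x. f x * h x)"
 unfolding square_integrable_def by (rule integrable_mult_squares) auto

lemma cylinder_bounded_mult:
 assumes F: "F \<in> cylinder_functions A \<tau>" and H: "square_integrable P\<Omega> H"
 shows "square_integrable P\<Omega> (\<lambda>\<omega>. F \<omega> * H \<omega>)"
proof -
 obtain \<Phi> D where D: "point_derivative \<Phi> D" and e: "\<forall>\<omega>\<in>\<Omega>. F \<omega> = \<Phi> (marks_of A \<tau> \<omega>)" by (rule cylinderE[OF F])
 obtain C where "!!w. w \<in> marks ==> \<bar>\<Phi> w\<bar> <= C" using point_derivativeD(2)[OF D] by auto
 then have C: "\<bar>F \<omega>\<bar> <= C" if "\<omega> \<in> \<Omega>" for \<omega> using bspec[OF e that] marks_of_Omega(1)[OF that] by simp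
 have m: "(\<lambda>\<omega>. F \<omega> * H \<omega>) \<in> borel_measurable P\<Omega>" using cylinder_square_integrable(1)[OF F] H unfolding square_integrable_def by auto
 have "integrable P\<Omega> (\<lambda>\<omega>. (F \<omega> * H \<omega>)\<^sup>2)"
 proof (rule Bochner_Integration.integrable_bound)
  show "integrable P\<Omega> (\<lambda>\<omega>. C\<^sup>2 * (H \<omega>)\<^sup>2)" using H unfolding square_integrable_def by simp
  show "AE \<omega> in P\<Omega>. norm ((F \<omega> * H \<omega>)\<^sup>2) <= norm (C\<^sup>2 * (H \<omega>)\<^sup>2)" using power_mono[OF C abs_ge_zero, of _ 2]
   by (intro AE_I2) (simp add: space_POmega power_mult_distrib mult_right_mono)
 qed (use m in measurable)
 with m show ?thesis unfolding square_integrable_def by blast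
qed

text \<open>\<open>integration_by_parts_marks\<close> is applied once, to the product of the two
  functions; its gradient splits by the product rule into the two terms with \<open>nabla\<close>.
  Square integrability permits separating the integrals.\<close>

lemma cylinder_integration_by_parts:
 assumes F: "F \<in> cylinder_functions A \<tau>" and G: "G \<in> cylinder_functions A \<tau>"
 shows "integrable P\<Omega> (\<lambda>\<omega>. nabla F \<omega> * G \<omega>)" "integrable P\<Omega> (\<lambda>\<omega>. F \<omega> * nabla G \<omega>)" "integrable P\<Omega> (\<lambda>\<omega>. F \<omega> * G \<omega> * B \<omega>)"
  "(LINT \<omega>|P\<Omega>. nabla F \<omega> * G \<omega>) = - (LINT \<omega>|P\<Omega>. F \<omega> * nabla G \<omega>) - (LINT \<omega>|P\<Omega>. F \<omega> * G \<omega> * B \<omega>)"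
proof -
 note sF = cylinder_square_integrable[OF F] and sG = cylinder_square_integrable[OF G]
 show i: "integrable P\<Omega> (\<lambda>\<omega>. nabla F \<omega> * G \<omega>)" "integrable P\<Omega> (\<lambda>\<omega>. F \<omega> * nabla G \<omega>)" by (intro integrable_product sF sG)+
 show "integrable P\<Omega> (\<lambda>\<omega>. F \<omega> * G \<omega> * B \<omega>)" by (intro integrable_product cylinder_bounded_mult[OF F sG(1)] B_square_integrable)
 obtain \<Phi> D where D: "point_derivative \<Phi> D" and e: "\<forall>\<omega>\<in>\<Omega>. F \<omega> = \<Phi> (marks_of A \<tau> \<omega>)"
  and n: "\<forall>\<omega>\<in>\<Omega>. nabla F \<omega> = gradient D (marks_of A \<tau> \<omega>)" by (rule cylinderE[OF F])
 obtain \<Psi> E where E: "point_derivative \<Psi> E" and e': "\<forall>\<omega>\<in>\<Omega>. G \<omega> = \<Psi> (marks_of A \<tau> \<omega>)"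
  and n': "\<forall>\<omega>\<in>\<Omega>. nabla G \<omega> = gradient E (marks_of A \<tau> \<omega>)" by (rule cylinderE[OF G])
 note DE = point_derivative_mult[OF D E]
 have grad: "gradient (\<lambda>x w. D x w * \<Psi> w + \<Phi> w * E x w) w = gradient D w * \<Psi> w + \<Phi> w * gradient E w" for w
  unfolding gradient_def by (simp add: sum_distrib_left sum_distrib_right distrib_left sum.distrib ac_simps)
 have "(LINT \<omega>|P\<Omega>. nabla F \<omega> * G \<omega> + F \<omega> * nabla G \<omega>) = (LINT w|mark_law. gradient (\<lambda>x w. D x w * \<Psi> w + \<Phi> w * E x w) w)"
  by (rule transfer(3)[OF _ gradient_measurable[OF DE]]) (simp add: n n' e e' grad)
 also have "... = - (LINT w|mark_law. \<Phi> w * \<Psi> w * beta_sum w)" by (rule integration_by_parts_marks[OF DE])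
 also have "(LINT w|mark_law. \<Phi> w * \<Psi> w * beta_sum w) = (LINT \<omega>|P\<Omega>. F \<omega> * G \<omega> * B \<omega>)" by (rule transfer(3)[symmetric])
   (use mark_measurable[OF point_derivativeD(1)[OF DE]] beta_sum_measurable in \<open>simp_all add: e e' B_eq\<close>)
 finally show "(LINT \<omega>|P\<Omega>. nabla F \<omega> * G \<omega>) = - (LINT \<omega>|P\<Omega>. F \<omega> * nabla G \<omega>) - (LINT \<omega>|P\<Omega>. F \<omega> * G \<omega> * B \<omega>)" using i by simp
qed

end

section \<open>The adjoint and its uniqueness\<close>

lemma trig_prod_mult:
 "trig_prod N a b c y * trig_prod N' a' b' c' y' =
 trig_prod (N + N') (\<lambda>i. if i < N then a i else a' (i - N)) (\<lambda>i. if i < N then b i else b' (i - N))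
  (\<lambda>i. if i < N then c i else c' (i - N)) (\<lambda>i. if i < N then y i else y' (i - N))"
proof -
 let ?t = "\<lambda>i. (if i < N then a i else a' (i - N)) + (if i < N then b i else b' (i - N)) *
  sin ((if i < N then y i else y' (i - N)) + (if i < N then c i else c' (i - N)))"
 have e: "{..<N + N'} = {..<N} \<union> {N..<N + N'}" by auto
 have "(\<Prod>i<N + N'. ?t i) = (\<Prod>i<N. ?t i) * (\<Prod>i\<in>{N..<N + N'}. ?t i)" unfolding e by (rule prod.union_disjoint) auto
 also have "(\<Prod>i<N. ?t i) = (\<Prod>i<N. a i + b i * sin (y i + c i))" by (rule prod.cong) auto
 also have "(\<Prod>i\<in>{N..<N + N'}. ?t i) = (\<Prod>i<N'. a' i + b' i * sin (y' i + c' i))"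
  by (rule prod.reindex_bij_witness[of _ "\<lambda>i. i + N" "\<lambda>i. i - N"]) auto
 finally show ?thesis unfolding trig_prod_def ..
qed

lemma trig_prod_le_1:
 assumes "!!i. \<bar>a i\<bar> + \<bar>b i\<bar> <= 1" shows "\<bar>trig_prod N a b c y\<bar> <= 1" unfolding trig_prod_def abs_prod
proof (rule prod_le_1, intro conjI)
 fix i
 have "\<bar>a i + b i * sin (y i + c i)\<bar> <= \<bar>a i\<bar> + \<bar>b i\<bar> * \<bar>sin (y i + c i)\<bar>" unfolding abs_mult[symmetric] by (rule abs_triangle_ineq)
 also have "... <= \<bar>a i\<bar> + \<bar>b i\<bar> * 1" by (intro add_left_mono mult_left_mono) auto
 finally show "\<bar>a i + b i * sin (y i + c i)\<bar> <= 1" using assms[of i] by simp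
qed simp

text \<open>Recovers an unbounded value from bounded functions of its multiples, so that bounded
  trigonometric functions determine all evaluations.\<close>

lemma tendsto_sin_quotient: "(\<lambda>n. real (Suc n) * sin (a / real (Suc n))) \<longlonglongrightarrow> a"
proof -
 have "((\<lambda>x. x * sin (a / x)) \<longlongrightarrow> a) at_top" by real_asymp
 moreover have "filterlim (\<lambda>n. real (Suc n)) at_top sequentially" by real_asymp
 ultimately show ?thesis by (rule filterlim_compose)
qed

lemma square_integrable_uminus_diff:
 assumes f: "square_integrable M f" and h: "square_integrable M h"
 shows "square_integrable M (\<lambda>x. - f x - h x)" "square_integrable M (\<lambda>x. f x - h x)"
proof -
 have i: "integrable M (\<lambda>x. f x * h x)" using f h unfolding square_integrable_def by (intro integrable_mult_squares) auto
 have "(\<lambda>x. (- f x - h x)\<^sup>2) = (\<lambda>x. (f x)\<^sup>2 + 2 * (f x * h x) + (h x)\<^sup>2)"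
  "(\<lambda>x. (f x - h x)\<^sup>2) = (\<lambda>x. (f x)\<^sup>2 - 2 * (f x * h x) + (h x)\<^sup>2)" by (simp_all add: fun_eq_iff power2_eq_square algebra_simps)
 then show "square_integrable M (\<lambda>x. - f x - h x)" "square_integrable M (\<lambda>x. f x - h x)"
  using f h i unfolding square_integrable_def by auto
qed

context compound_poisson_manifold begin

abbreviation "FC \<equiv> cylinder_functions A \<tau>"

definition trig_cylinders :: "((('a => real) => real) => real) set" where
 "trig_cylinders = {\<lambda>\<omega>. trig_prod N a b c (\<lambda>i. \<omega> (f i)) | N a b c f.
  (\<forall>i. f i \<in> test_functions A) & (\<forall>i. \<bar>a i\<bar> + \<bar>b i\<bar> <= 1)}"

lemma trig_cylindersI:
 assumes "!!\<omega>. G \<omega> = trig_prod N a b c (\<lambda>i. \<omega> (f i))" "!!i. f i \<in> test_functions A" "!!i. \<bar>a i\<bar> + \<bar>b i\<bar> <= 1"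
 shows "G \<in> trig_cylinders"
proof -
 have "G = (\<lambda>\<omega>. trig_prod N a b c (\<lambda>i. \<omega> (f i)))" using assms(1) by (rule ext)
 then show ?thesis unfolding trig_cylinders_def using assms(2,3) by blast
qed

lemma trig_cylindersE:
 assumes "G \<in> trig_cylinders"
 obtains N a b c f where "G = (\<lambda>\<omega>. trig_prod N a b c (\<lambda>i. \<omega> (f i)))"
  "\<forall>i. f i \<in> test_functions A" "\<forall>i. \<bar>a i\<bar> + \<bar>b i\<bar> <= 1" using assms unfolding trig_cylinders_def mem_Collect_eq by (elim exE conjE)

lemma trig_cylinders_subset: "G \<in> trig_cylinders ==> G \<in> FC"
proof (erule trig_cylindersE)
 fix N a b c f
 assume G: "G = (\<lambda>\<omega>. trig_prod N a b c (\<lambda>i. \<omega> (f i)))" and f: "\<forall>i. f i \<in> test_functions A"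
 show "G \<in> FC" unfolding cylinder_functions_def G
  by (intro CollectI exI[of _ N] exI[of _ f] bexI[OF _ trig_prod_bounded_smooth[of N a b c]]) (use f in simp)
qed

lemma trig_cylinders_measurable: "G \<in> trig_cylinders ==> G \<in> borel_measurable P\<Omega>"
 using cylinder_square_integrable(1)[OF trig_cylinders_subset] unfolding square_integrable_def by blast

lemma test_zero: "(\<lambda>_. 0) \<in> test_functions A" unfolding test_iff using smooth_fun_const by (simp add: csupp_def) blast

lemma trig_cylinders_one: "(\<lambda>_. 1) \<in> trig_cylinders"
 by (rule trig_cylindersI[where N=0 and a="\<lambda>_. 0" and b="\<lambda>_. 0" and f="\<lambda>_ _. 0"]) (simp_all add: trig_prod_def test_zero)

lemma trig_cylinders_le_1: "\<forall>G\<in>trig_cylinders. \<forall>\<omega>. \<bar>G \<omega>\<bar> <= 1"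
proof
 fix G assume "G \<in> trig_cylinders"
 then obtain N a b c f where "G = (\<lambda>\<omega>. trig_prod N a b c (\<lambda>i. \<omega> (f i)))" "\<forall>i. \<bar>a i\<bar> + \<bar>b i\<bar> <= 1" by (rule trig_cylindersE)
 then show "\<forall>\<omega>. \<bar>G \<omega>\<bar> <= 1" using trig_prod_le_1 by simp
qed

lemma trig_cylinders_mult:
 assumes "G \<in> trig_cylinders" "H \<in> trig_cylinders"
 shows "(\<lambda>\<omega>. G \<omega> * H \<omega>) \<in> trig_cylinders"
proof -
 obtain N a b k f where 1: "G = (\<lambda>\<omega>. trig_prod N a b k (\<lambda>i. \<omega> (f i)))"
  "\<forall>i. f i \<in> test_functions A" "\<forall>i. \<bar>a i\<bar> + \<bar>b i\<bar> <= 1" using assms(1) by (rule trig_cylindersE)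
 obtain N' a' b' k' f' where 2: "H = (\<lambda>\<omega>. trig_prod N' a' b' k' (\<lambda>i. \<omega> (f' i)))"
  "\<forall>i. f' i \<in> test_functions A" "\<forall>i. \<bar>a' i\<bar> + \<bar>b' i\<bar> <= 1" using assms(2) by (rule trig_cylindersE)
 have "(\<lambda>i. if i < N then \<omega> (f i) else \<omega> (f' (i - N))) = (\<lambda>i. \<omega> (if i < N then f i else f' (i - N)))" for \<omega> :: "('a => real) => real" by auto
 then show ?thesis by (intro trig_cylindersI[where f="\<lambda>i. if i < N then f i else f' (i - N)" and N="N + N'"
    and a="\<lambda>i. if i < N then a i else a' (i - N)" and b="\<lambda>i. if i < N then b i else b' (i - N)"
    and c="\<lambda>i. if i < N then k i else k' (i - N)"]) (use 1 2 in \<open>simp_all add: trig_prod_mult\<close>)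
qed

text \<open>The sine of the evaluation at a multiple of \<open>f\<close> is in the trigonometric
  class. Elements of \<open>\<Omega>\<close> are linear, so \<open>tendsto_sin_quotient\<close>
  recovers the evaluation at \<open>f\<close> as a limit, and the evaluations generate the
  sigma-algebra.\<close>

lemma measurable_id_Omega:
 assumes sp: "space S = \<Omega>" and meas: "!!G. G \<in> trig_cylinders ==> G \<in> borel_measurable S"
 shows "(\<lambda>\<omega>. \<omega>) \<in> measurable S P\<Omega>"
proof -
 have ev: "(\<lambda>\<omega>. \<omega> f) \<in> borel_measurable S" if f: "f \<in> test_functions A" for f
 proof (rule borel_measurable_LIMSEQ_real)
  \<comment> \<open>The summand with factor 0 puts the scaled function into the form of
    \<open>test_lin\<close> and \<open>pairing_lin\<close>.\<close>
  let ?f = "\<lambda>n x. 1 / real (Suc n) * f x + 0 * f x"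
  have fn: "?f n \<in> test_functions A" for n by (rule test_lin[OF f f])
  show "(\<lambda>n. real (Suc n) * sin (\<omega> (?f n))) \<longlonglongrightarrow> \<omega> f" if "\<omega> \<in> space S" for \<omega>
  proof -
   have \<omega>: "\<omega> \<in> \<Omega>" using that sp by simp
   have "\<omega> (?f n) = \<omega> f / real (Suc n)" for n unfolding marks_of_Omega(5)[OF \<omega> fn] marks_of_Omega(5)[OF \<omega> f]
     pairing_lin[OF marks_of_Omega(1)[OF \<omega>] csupp_test[OF f] csupp_test[OF f]] by simp
   then show ?thesis using tendsto_sin_quotient[of "\<omega> f"] by simp
  qed
  have "(\<lambda>\<omega>. sin (\<omega> (?f n))) \<in> trig_cylinders" for n
   by (rule trig_cylindersI[where N=1 and a="\<lambda>_. 0" and b="\<lambda>_. 1" and c="\<lambda>_. 0" and f="\<lambda>_. ?f n"])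
    (use fn in \<open>simp_all add: trig_prod_def\<close>)
  from borel_measurable_times[OF borel_measurable_const meas[OF this]]
  show "(\<lambda>\<omega>. real (Suc n) * sin (\<omega> (?f n))) \<in> borel_measurable S" for n .
 qed
 have dist: "\<Omega> \<subseteq> distributions A" unfolding compound_configurations_def by blast
 have "(\<lambda>\<omega> f. \<omega> f) \<in> measurable S (\<Pi>\<^sub>M f\<in>test_functions A. borel :: real measure)"
  by (rule measurable_PiM_single'[OF ev]) (use dist in \<open>auto simp: sp distributions_def PiE_def\<close>)
 then have "(\<lambda>\<omega>. \<omega>) \<in> measurable S (restrict_space (distribution_space A) \<Omega>)"
  unfolding distribution_space_def by (intro measurable_restrict_space2) (use dist sp in auto)
 then show ?thesis by (subst measurable_cong_sets[OF refl sets_restrict_space_cong[OF sets_P]])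
qed

text \<open>In particular \<open>d\<close> is orthogonal to the trigonometric class, which is
  multiplicative, bounded by 1 and generating, so it vanishes. This is density in L^2 in the form
  that uniqueness of the adjoint requires.\<close>

lemma cylinder_functions_total:
 assumes d: "square_integrable P\<Omega> d" and 0: "!!G. G \<in> FC ==> (LINT \<omega>|P\<Omega>. G \<omega> * d \<omega>) = 0"
 shows "AE \<omega> in P\<Omega>. d \<omega> = 0"
proof (rule AE_zero_multiplicative[where C=trig_cylinders])
 have "square_integrable P\<Omega> (\<lambda>_. 1)" unfolding square_integrable_def by simp
 from integrable_product[OF this d] show "integrable P\<Omega> d" by simp
 show "(\<lambda>\<omega>. \<omega>) \<in> measurable S P\<Omega>" if "space S = space P\<Omega>" "!!c. c \<in> trig_cylinders ==> c \<in> borel_measurable S" for S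
  by (rule measurable_id_Omega) (use that space_POmega in auto)
 show "\<exists>e\<in>trig_cylinders. \<forall>x\<in>space P\<Omega>. e x = c x * k x" if "c \<in> trig_cylinders" "k \<in> trig_cylinders" for c k
  by (rule bexI[OF _ trig_cylinders_mult[OF that]]) simp
 show "c \<in> borel_measurable P\<Omega>" if "c \<in> trig_cylinders" for c by (rule trig_cylinders_measurable[OF that])
 show "(LINT \<omega>|P\<Omega>. c \<omega> * d \<omega>) = 0" if "c \<in> trig_cylinders" for c by (rule 0[OF trig_cylinders_subset[OF that]])
 show "\<forall>c\<in>trig_cylinders. \<forall>x\<in>space P\<Omega>. \<bar>c x\<bar> <= 1" by (simp add: trig_cylinders_le_1)
qed (rule trig_cylinders_one)

text \<open>Integration by parts with the test element \<open>G\<close> in the differentiated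
  position moves \<open>nabla\<close> onto \<open>F\<close>.\<close>

lemma adjoint_formula:
 assumes F: "F \<in> FC"
 shows "(F, \<lambda>\<omega>. - nabla F \<omega> - B \<omega> * F \<omega>) \<in> adjoint_graph P\<Omega> nabla FC"
proof -
 note sF = cylinder_square_integrable[OF F]
 have s: "square_integrable P\<Omega> (\<lambda>\<omega>. - nabla F \<omega> - B \<omega> * F \<omega>)"
  using square_integrable_uminus_diff(1)[OF sF(2) cylinder_bounded_mult[OF F B_square_integrable]] by (simp add: mult.commute)
 have "(LINT \<omega>|P\<Omega>. nabla G \<omega> * F \<omega>) = (LINT \<omega>|P\<Omega>. G \<omega> * (- nabla F \<omega> - B \<omega> * F \<omega>))" if G: "G \<in> FC" for G
 proof -
  note i = cylinder_integration_by_parts[OF G F]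
  have "(LINT \<omega>|P\<Omega>. G \<omega> * (- nabla F \<omega> - B \<omega> * F \<omega>)) = (LINT \<omega>|P\<Omega>. - (G \<omega> * nabla F \<omega>) - G \<omega> * F \<omega> * B \<omega>)"
   by (rule Bochner_Integration.integral_cong) (auto simp: algebra_simps)
  also have "... = - (LINT \<omega>|P\<Omega>. G \<omega> * nabla F \<omega>) - (LINT \<omega>|P\<Omega>. G \<omega> * F \<omega> * B \<omega>)" using i(2,3) by simp
  finally show ?thesis using i(4) by simp
 qed
 then show ?thesis unfolding adjoint_graph_def using s sF(1) by blast
qed

lemma adjoint_unique:
 assumes H: "(F, H) \<in> adjoint_graph P\<Omega> nabla FC" "(F, H') \<in> adjoint_graph P\<Omega> nabla FC"
 shows "AE \<omega> in P\<Omega>. H \<omega> = H' \<omega>"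
proof -
 have s: "square_integrable P\<Omega> H" "square_integrable P\<Omega> H'" and
  eq: "!!G. G \<in> FC ==> (LINT \<omega>|P\<Omega>. G \<omega> * H \<omega>) = (LINT \<omega>|P\<Omega>. G \<omega> * H' \<omega>)" using H unfolding adjoint_graph_def by simp_all
 have "AE \<omega> in P\<Omega>. H \<omega> - H' \<omega> = 0"
 proof (rule cylinder_functions_total[OF square_integrable_uminus_diff(2)[OF s]])
  fix G assume G: "G \<in> FC"
  note i = integrable_product[OF cylinder_square_integrable(1)[OF G] s(1)] integrable_product[OF cylinder_square_integrable(1)[OF G] s(2)]
  show "(LINT \<omega>|P\<Omega>. G \<omega> * (H \<omega> - H' \<omega>)) = 0" unfolding right_diff_distrib using i eq[OF G] by simp
 qed
 then show ?thesis by simp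
qed

end

theorem theorem3p5:
  fixes A :: "('a::{second_countable_topology,t2_space}, 'n::finite) chart set"
    and g :: "('a, 'n) metric"
    and m \<sigma> :: "'a measure"
    and \<rho> :: "'a \<Rightarrow> real"
    and R :: "'a \<Rightarrow> ('a, 'n) tangent"
    and \<tau> :: "real measure"
    and P P\<Omega> :: "(('a \<Rightarrow> real) \<Rightarrow> real) measure"
    and v :: "'a \<Rightarrow> ('a, 'n) tangent"
    and \<phi> :: "real \<Rightarrow> 'a \<Rightarrow> 'a"
    and nabla :: "((('a \<Rightarrow> real) \<Rightarrow> real) \<Rightarrow> real) \<Rightarrow> (('a \<Rightarrow> real) \<Rightarrow> real) \<Rightarrow> real"
    and B :: "(('a \<Rightarrow> real) \<Rightarrow> real) \<Rightarrow> real"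
    and FC :: "((('a \<Rightarrow> real) \<Rightarrow> real) \<Rightarrow> real) set"
  assumes manifold: "oriented_atlas A" "connected (UNIV :: 'a set)" "\<not> compact (UNIV :: 'a set)"
    and metric: "riemannian_metric A g"
    and volume: "volume_measure A g m"
    and \<rho>_pos: "AE x in m. 0 < \<rho> x"
    and \<rho>_sobolev: "(\<lambda>x. sqrt (\<rho> x)) \<in> local_sobolev_1_2 A g m"
    and \<rho>_grad: "weak_gradient A g m \<rho> R"
    and \<sigma>_def: "\<sigma> = density m (\<lambda>x. ennreal (\<rho> x))"
    and \<tau>_finite: "finite_measure \<tau>" "sets \<tau> = sets (restrict_space borel {0<..})"
    and \<tau>_moments: "\<exists>C>0. \<forall>n\<ge>1. (\<integral>\<^sup>+ s. ennreal (s ^ n) \<partial>\<tau>) < ennreal (C ^ n * fact n)"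
    and poisson: "compound_poisson A \<sigma> \<tau> P"
    and poisson_support: "emeasure P (compound_configurations A \<tau>) = 1"
    and P\<Omega>_def: "P\<Omega> = restrict_space P (compound_configurations A \<tau>)"
    and v: "v \<in> compact_vector_fields A"
    and flow: "flow_of A v \<phi>"
    and nabla_def: "nabla = directional_derivative A \<tau> \<phi>"
    and B_def: "B = poisson_log_derivative A g \<tau> \<rho> R v"
    and FC_def: "FC = cylinder_functions A \<tau>"
  shows
    "(\<forall>F\<in>FC. \<forall>\<omega>\<in>compound_configurations A \<tau>.
        (\<lambda>t. F (transport A \<tau> (\<phi> t) \<omega>)) differentiable (at 0)) \<and>
     (\<forall>F\<in>FC. square_integrable P\<Omega> F \<and> square_integrable P\<Omega> (nabla F)) \<and>
     (\<forall>F\<in>FC. \<forall>G\<in>FC.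
        integrable P\<Omega> (\<lambda>\<omega>. nabla F \<omega> * G \<omega>) \<and>
        integrable P\<Omega> (\<lambda>\<omega>. F \<omega> * nabla G \<omega>) \<and>
        integrable P\<Omega> (\<lambda>\<omega>. F \<omega> * G \<omega> * B \<omega>) \<and>
        (LINT \<omega>|P\<Omega>. nabla F \<omega> * G \<omega>) =
          - (LINT \<omega>|P\<Omega>. F \<omega> * nabla G \<omega>) - (LINT \<omega>|P\<Omega>. F \<omega> * G \<omega> * B \<omega>)) \<and>
     (\<forall>F\<in>FC.
        (F, \<lambda>\<omega>. - nabla F \<omega> - B \<omega> * F \<omega>) \<in> adjoint_graph P\<Omega> nabla FC \<and>
        (\<forall>H. (F, H) \<in> adjoint_graph P\<Omega> nabla FC \<longrightarrow>
           (AE \<omega> in P\<Omega>. H \<omega> = - nabla F \<omega> - B \<omega> * F \<omega>)))"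
proof -
 note \<sigma>_eq = \<sigma>_def
 interpret riemannian_volume A g m by unfold_locales (fact manifold(1) metric volume)+
 interpret weighted_manifold A g m \<rho> R v by unfold_locales (fact \<rho>_pos \<rho>_sobolev \<rho>_grad v)+
 have \<sigma>: "\<sigma> = weighted_manifold.\<sigma> m \<rho>" by (simp only: \<sigma>_eq weighted_manifold.\<sigma>_def[OF weighted_manifold_axioms])
 interpret compound_poisson_manifold A g m \<rho> R v \<tau> P \<phi>
  by (intro compound_poisson_manifold.intro compound_poisson_manifold_axioms.intro weighted_manifold_axioms)
   (fact \<tau>_finite \<tau>_moments poisson[unfolded \<sigma>] poisson_support flow)+
 have diff: "\<forall>F\<in>cylinder_functions A \<tau>. \<forall>\<omega>\<in>compound_configurations A \<tau>.
   (\<lambda>t. F (transport A \<tau> (\<phi> t) \<omega>)) differentiable (at 0)"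
 proof (intro ballI)
  fix F \<omega> assume F: "F \<in> cylinder_functions A \<tau>" and \<omega>: "\<omega> \<in> compound_configurations A \<tau>"
  obtain \<Phi> D where "\<forall>\<omega>\<in>compound_configurations A \<tau>.
    ((\<lambda>t. F (transport A \<tau> (\<phi> t) \<omega>)) has_real_derivative gradient D (marks_of A \<tau> \<omega>)) (at 0)"
   by (rule cylinderE[OF F])
  from bspec[OF this \<omega>] show "(\<lambda>t. F (transport A \<tau> (\<phi> t) \<omega>)) differentiable (at 0)" unfolding real_differentiable_def by (rule exI)
 qed
 have adj: "\<forall>F\<in>cylinder_functions A \<tau>. (F, \<lambda>\<omega>. - nabla F \<omega> - B \<omega> * F \<omega>) \<in> adjoint_graph P\<Omega> nabla FC &
   (\<forall>H. (F, H) \<in> adjoint_graph P\<Omega> nabla FC --> (AE \<omega> in P\<Omega>. H \<omega> = - nabla F \<omega> - B \<omega> * F \<omega>))"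
  unfolding FC_def nabla_def B_def P\<Omega>_def using adjoint_formula adjoint_unique[OF _ adjoint_formula] by simp
 show ?thesis using diff adj cylinder_square_integrable cylinder_integration_by_parts unfolding FC_def nabla_def B_def P\<Omega>_def by simp
qed

end
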